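(* Let $X$ be a Banach space, $1<p<\infty$, $I=(0,2\pi)$, $\Pi=I\times(0,\infty)$, and let $f\in W^2_p(I;X)$. If the nonlocal boundary value problem $$\begin{cases}\Delta u(x,y)=0, & (x,y)\in\Pi,\\ \Gamma_I u=f(x), & x\in(0,2\pi),\\ \Gamma_{J_0}u=\Gamma_{J_{2\pi}}u, & y\in(0,\infty),\\ \Gamma_{J_0}(\partial_xu)=0, & y\in(0,\infty),\end{cases}$$ admits a solution $u\in W^2_{p,1}(\Pi;X)$, then this solution is unique (in $W^2_{p,1}(\Pi;X)$).
   Context: $W^2_p(I;X)$ is the space of $f\in L^p(I;X)$ (Bochner space) whose weak derivatives $f',f''$ belong to $L^p(I;X)$. $L^{p,1}(\Pi;X)$ is the mixed-norm Bochner space of strongly measurable $u:\Pi\to X$ with finite norm $$\|u\|_{L^{p,1}(\Pi;X)}=\int_0^\infty\left(\int_0^{2\pi}\|u(x,y)\|_X^p\,dx\right)^{1/p}dy,$$ and $W^m_{p,1}(\Pi;X)$ is the space of $u\in L^{p,1}(\Pi;X)$ whose weak derivatives $\partial^\alpha u$, $|\alpha|\le m$, all belong to $L^{p,1}(\Pi;X)$, with norm $\sum_{|\alpha|\le m}\|\partial^\alpha u\|_{L^{p,1}(\Pi;X)}$. Let $J_0=\{(0,y):y>0\}$ and $J_{2\pi}=\{(2\pi,y):y>0\}$, both identified with $(0,\infty)$ via $y$. $\Gamma_{J_0},\Gamma_{J_{2\pi}}$ denote the linear trace operators $W^1_{p,1}(\Pi;X)\to L^1_{\mathrm{loc}}(J;X)$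 ($J=J_0$, resp. $J_{2\pi}$) that agree with pointwise restriction to $J$ for $u\in W^1_{p,1}(\Pi;X)\cap C(\overline{\Pi};X)$ and are bounded into $L^1$ of $\{(0,y):0<y<\xi\}$ (resp. $\{(2\pi,y):0<y<\xi\}$) for every $\xi>0$. $\Gamma_I$ is the trace operator on the bottom side $I\times\{0\}$ (identified with $I$), i.e. the bounded linear operator into $L^p(I;X)$ agreeing with restriction $u\mapsto u(\cdot,0)$ for functions continuous on $\overline\Pi$. A solution of the problem is a function $u\in W^2_{p,1}(\Pi;X)$ such that $\Delta u=\partial_x^2u+\partial_y^2u=0$ almost everywhere in $\Pi$ and the boundary conditions hold in the sense of these traces (as equalities almost everywhere). *)

theory Defs
  imports "HOL-Analysis.Analysis"
begin

section \<open>Bochner integration in an arbitrary Banach space\<close>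

text \<open>
  The Bochner integral of HOL-Analysis is restricted to second countable (hence separable) target
  spaces. The definitions below are the same ones, with Borel measurability replaced by strong
  measurability, so that the Banach space need not be separable.
\<close>

definition strongly_measurable :: "'b measure \<Rightarrow> ('b \<Rightarrow> 'a::real_normed_vector) \<Rightarrow> bool" where
  "strongly_measurable M f \<longleftrightarrow>
     (\<exists>s :: nat \<Rightarrow> 'b \<Rightarrow> 'a. (\<forall>i. simple_function M (s i)) \<and>
        (AE x in M. (\<lambda>i. s i x) \<longlonglongrightarrow> f x))"

definition has_strong_integral ::
    "'b measure \<Rightarrow> ('b \<Rightarrow> 'a::real_normed_vector) \<Rightarrow> 'a \<Rightarrow> bool" where
  "has_strong_integral M f J \<longleftrightarrow>
     strongly_measurable M f \<and>
     (\<exists>s :: nat \<Rightarrow> 'b \<Rightarrow> 'a. (\<forall>i. Bochner_Integration.simple_bochner_integrable M (s i)) \<and>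
        (\<lambda>i. \<integral>\<^sup>+x. ennreal (norm (f x - s i x)) \<partial>M) \<longlonglongrightarrow> 0 \<and>
        (\<lambda>i. Bochner_Integration.simple_bochner_integral M (s i)) \<longlonglongrightarrow> J)"

definition strong_integral :: "'b measure \<Rightarrow> ('b \<Rightarrow> 'a::real_normed_vector) \<Rightarrow> 'a" where
  "strong_integral M f = (THE J. has_strong_integral M f J)"

definition locally_integrable ::
    "'b::euclidean_space set \<Rightarrow> ('b \<Rightarrow> 'a::real_normed_vector) \<Rightarrow> bool" where
  "locally_integrable \<Omega> f \<longleftrightarrow>
     (\<forall>K. compact K \<and> K \<subseteq> \<Omega> \<longrightarrow> (\<exists>J. has_strong_integral (lebesgue_on K) f J))"

section \<open>Weak derivatives\<close>

text \<open>
  A partial derivative of order k is given by a list of k basis vectors.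
\<close>

definition partials :: "'b list \<Rightarrow> ('b::euclidean_space \<Rightarrow> real) \<Rightarrow> 'b \<Rightarrow> real" where
  "partials bs \<phi> = fold (\<lambda>b \<psi> z. frechet_derivative \<psi> (at z) b) bs \<phi>"

text \<open>
  Real-valued smooth functions with compact support in \<open>\<Omega>\<close>: every iterated partial derivative
  exists and is (totally) differentiable on the whole space.
\<close>

definition test_function :: "'b::euclidean_space set \<Rightarrow> ('b \<Rightarrow> real) \<Rightarrow> bool" where
  "test_function \<Omega> \<phi> \<longleftrightarrow>
     (\<forall>bs. set bs \<subseteq> Basis \<longrightarrow> partials bs \<phi> differentiable_on UNIV) \<and>
     (\<exists>K. compact K \<and> K \<subseteq> \<Omega> \<and> (\<forall>z. z \<notin> K \<longrightarrow> \<phi> z = 0))"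

definition is_weak_derivative ::
    "'b::euclidean_space set \<Rightarrow> 'b list \<Rightarrow> ('b \<Rightarrow> 'a::banach) \<Rightarrow> ('b \<Rightarrow> 'a) \<Rightarrow> bool" where
  "is_weak_derivative \<Omega> bs u v \<longleftrightarrow>
     locally_integrable \<Omega> u \<and> locally_integrable \<Omega> v \<and>
     (\<forall>\<phi>. test_function \<Omega> \<phi> \<longrightarrow>
        strong_integral (lebesgue_on \<Omega>) (\<lambda>z. partials bs \<phi> z *\<^sub>R u z)
          = (-1) ^ length bs *\<^sub>R strong_integral (lebesgue_on \<Omega>) (\<lambda>z. \<phi> z *\<^sub>R v z))"

definition has_weak_derivative ::
    "'b::euclidean_space set \<Rightarrow> 'b list \<Rightarrow> ('b \<Rightarrow> 'a::banach) \<Rightarrow> bool" where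
  "has_weak_derivative \<Omega> bs u \<longleftrightarrow> (\<exists>v. is_weak_derivative \<Omega> bs u v)"

text \<open>
  Weak derivatives are determined only up to null sets; this picks a representative. All uses
  below depend only on its class modulo null sets.
\<close>

definition weak_derivative ::
    "'b::euclidean_space set \<Rightarrow> 'b list \<Rightarrow> ('b \<Rightarrow> 'a::banach) \<Rightarrow> 'b \<Rightarrow> 'a" where
  "weak_derivative \<Omega> bs u = (SOME v. is_weak_derivative \<Omega> bs u v)"

section \<open>Function spaces on the interval and the half-strip\<close>

text \<open>Elements of all spaces are functions; equality of classes is equality almost everywhere.\<close>

text \<open>Powers of extended nonnegative reals, for exponents \<open>r > 0\<close> only.\<close>

definition ennreal_powr :: "ennreal \<Rightarrow> real \<Rightarrow> ennreal" where
  "ennreal_powr x r = (if x = \<infinity> then \<infinity> else ennreal (enn2real x powr r))"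

definition II :: "real set" where
  "II = {0<..<2 * pi}"

definition strip :: "(real \<times> real) set" where
  "strip = II \<times> {0<..}"

definition Lp_norm :: "real \<Rightarrow> 'b::euclidean_space set \<Rightarrow> ('b \<Rightarrow> 'a::banach) \<Rightarrow> ennreal" where
  "Lp_norm p \<Omega> f =
     ennreal_powr (\<integral>\<^sup>+x. ennreal (norm (f x) powr p) \<partial>lebesgue_on \<Omega>) (1 / p)"

definition Lp_space :: "real \<Rightarrow> 'b::euclidean_space set \<Rightarrow> ('b \<Rightarrow> 'a::banach) set" where
  "Lp_space p \<Omega> = {f. strongly_measurable (lebesgue_on \<Omega>) f \<and> Lp_norm p \<Omega> f < \<infinity>}"

text \<open>\<open>Wp m p\<close> is the Sobolev space of order \<open>m\<close> on the interval; the only basis vector of the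
  real line is \<open>1\<close>.\<close>

definition Wp :: "nat \<Rightarrow> real \<Rightarrow> (real \<Rightarrow> 'a::banach) set" where
  "Wp m p =
     {f. f \<in> Lp_space p II \<and>
         (\<forall>k \<le> m. has_weak_derivative II (replicate k 1) f \<and>
                  weak_derivative II (replicate k 1) f \<in> Lp_space p II)}"

definition Lp1_norm :: "real \<Rightarrow> (real \<times> real \<Rightarrow> 'a::banach) \<Rightarrow> ennreal" where
  "Lp1_norm p u = (\<integral>\<^sup>+y. Lp_norm p II (\<lambda>x. u (x, y)) \<partial>lebesgue_on {0<..})"

definition Lp1_space :: "real \<Rightarrow> (real \<times> real \<Rightarrow> 'a::banach) set" where
  "Lp1_space p = {u. strongly_measurable (lebesgue_on strip) u \<and> Lp1_norm p u < \<infinity>}"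

text \<open>The multi-index \<open>(i, j)\<close> on the plane: \<open>i\<close> derivatives in \<open>x\<close> and \<open>j\<close> in \<open>y\<close>.\<close>

definition midx :: "nat \<Rightarrow> nat \<Rightarrow> (real \<times> real) list" where
  "midx i j = replicate i (1, 0) @ replicate j (0, 1)"

abbreviation wD :: "nat \<Rightarrow> nat \<Rightarrow> (real \<times> real \<Rightarrow> 'a::banach) \<Rightarrow> real \<times> real \<Rightarrow> 'a" where
  "wD i j u \<equiv> weak_derivative strip (midx i j) u"

definition Wp1 :: "nat \<Rightarrow> real \<Rightarrow> (real \<times> real \<Rightarrow> 'a::banach) set" where
  "Wp1 m p =
     {u. u \<in> Lp1_space p \<and>
         (\<forall>i j. i + j \<le> m \<longrightarrow>
            has_weak_derivative strip (midx i j) u \<and> wD i j u \<in> Lp1_space p)}"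

definition Wp1_norm :: "nat \<Rightarrow> real \<Rightarrow> (real \<times> real \<Rightarrow> 'a::banach) \<Rightarrow> ennreal" where
  "Wp1_norm m p u = (\<Sum>(i, j)\<in>{(i, j). i + j \<le> m}. Lp1_norm p (wD i j u))"

section \<open>Traces\<close>

text \<open>
  A trace operator acts on representatives, so linearity is required modulo null sets. That it
  respects equality almost everywhere follows from linearity and boundedness.
\<close>

definition trace_linear ::
    "real \<Rightarrow> real set \<Rightarrow> ((real \<times> real \<Rightarrow> 'a::banach) \<Rightarrow> real \<Rightarrow> 'a) \<Rightarrow> bool" where
  "trace_linear p S \<Gamma> \<longleftrightarrow>
     (\<forall>u\<in>Wp1 1 p. \<forall>v\<in>Wp1 1 p.
        AE t in lebesgue_on S. \<Gamma> (\<lambda>z. u z + v z) t = \<Gamma> u t + \<Gamma> v t) \<and>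
     (\<forall>c. \<forall>u\<in>Wp1 1 p. AE t in lebesgue_on S. \<Gamma> (\<lambda>z. c *\<^sub>R u z) t = c *\<^sub>R \<Gamma> u t)"

text \<open>Trace on the vertical side \<open>{(a, y). y > 0}\<close> (for \<open>a = 0\<close> or \<open>a = 2 * pi\<close>).\<close>

definition side_trace ::
    "real \<Rightarrow> real \<Rightarrow> ((real \<times> real \<Rightarrow> 'a::banach) \<Rightarrow> real \<Rightarrow> 'a) \<Rightarrow> bool" where
  "side_trace p a \<Gamma> \<longleftrightarrow>
     trace_linear p {0<..} \<Gamma> \<and>
     (\<forall>u\<in>Wp1 1 p. locally_integrable {0<..} (\<Gamma> u)) \<and>
     (\<forall>u\<in>Wp1 1 p. continuous_on (closure strip) u \<longrightarrow>
        (AE y in lebesgue_on {0<..}. \<Gamma> u y = u (a, y))) \<and>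
     (\<forall>\<xi>>0. \<exists>C::real. \<forall>u\<in>Wp1 1 p.
        (\<integral>\<^sup>+y. ennreal (norm (\<Gamma> u y)) \<partial>lebesgue_on {0<..<\<xi>}) \<le> ennreal C * Wp1_norm 1 p u)"

definition bottom_trace ::
    "real \<Rightarrow> ((real \<times> real \<Rightarrow> 'a::banach) \<Rightarrow> real \<Rightarrow> 'a) \<Rightarrow> bool" where
  "bottom_trace p \<Gamma> \<longleftrightarrow>
     trace_linear p II \<Gamma> \<and>
     (\<forall>u\<in>Wp1 1 p. \<Gamma> u \<in> Lp_space p II) \<and>
     (\<forall>u\<in>Wp1 1 p. continuous_on (closure strip) u \<longrightarrow>
        (AE x in lebesgue_on II. \<Gamma> u x = u (x, 0))) \<and>
     (\<exists>C::real. \<forall>u\<in>Wp1 1 p. Lp_norm p II (\<Gamma> u) \<le> ennreal C * Wp1_norm 1 p u)"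

section \<open>The nonlocal problem\<close>

definition is_solution ::
    "real \<Rightarrow> ((real \<times> real \<Rightarrow> 'a::banach) \<Rightarrow> real \<Rightarrow> 'a) \<Rightarrow>
     ((real \<times> real \<Rightarrow> 'a) \<Rightarrow> real \<Rightarrow> 'a) \<Rightarrow> ((real \<times> real \<Rightarrow> 'a) \<Rightarrow> real \<Rightarrow> 'a) \<Rightarrow>
     (real \<Rightarrow> 'a) \<Rightarrow> (real \<times> real \<Rightarrow> 'a) \<Rightarrow> bool" where
  "is_solution p \<Gamma>I \<Gamma>0 \<Gamma>2\<pi> f u \<longleftrightarrow>
     u \<in> Wp1 2 p \<and>
     (AE z in lebesgue_on strip. wD 2 0 u z + wD 0 2 u z = 0) \<and>
     (AE x in lebesgue_on II. \<Gamma>I u x = f x) \<and>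
     (AE y in lebesgue_on {0<..}. \<Gamma>0 u y = \<Gamma>2\<pi> u y) \<and>
     (AE y in lebesgue_on {0<..}. \<Gamma>0 (wD 1 0 u) y = 0)"

end

theory Submission imports Defs begin

text \<open>
The difference \<open>w\<close> of two solutions is harmonic in the half-strip, vanishes on the bottom side, takes equal
values on the two vertical sides and has vanishing \<open>x\<close>-derivative on the left one; it has to be shown that
\<open>w = 0\<close>. Separation of variables would pair \<open>w\<close> with the products \<open>sin (n x) b(y)\<close> and \<open>cos (n x) b(y)\<close>. For the
sine no boundary terms at \<open>x = 0, 2 \<pi>\<close> survive, because they involve only \<open>w(0, y) - w(2 \<pi>, y)\<close>. For the
cosine they involve \<open>w\<^sub>x(0, y) - w\<^sub>x(2 \<pi>, y)\<close>, about which nothing is known at \<open>2 \<pi>\<close>. But once all sine pairings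
vanish, \<open>w\<close> is symmetric about \<open>x = \<pi>\<close>, and then the condition at \<open>x = 0\<close> alone suffices. In both
cases \<open>g(y) = \<integral> w(x, y) \<psi>\<^sub>n(x) dx\<close> satisfies \<open>g'' = n\<^sup>2 g\<close>, \<open>g(0) = 0\<close> and is integrable, so \<open>g = 0\<close>. Here this is
done by duality: pairing with \<open>\<eta>(y) = exp (- n y) - exp (- m y)\<close>, which vanishes at \<open>0\<close>, leaves the pairing
with \<open>exp (- m y)\<close> equal to zero for every \<open>m > n\<close>, and the Weierstrass theorem in the variable \<open>exp (- y)\<close> gives
all \<open>b\<close> (\<open>mode_equation\<close>, \<open>exponential_mode\<close>, \<open>product_mode\<close>). A second use of that theorem, in the variable
\<open>cos x\<close>, recovers the symmetric and antisymmetric parts of \<open>w\<close> (\<open>vanishing_parity_part\<close>, \<open>symmetric\<close>, \<open>vanishes\<close>).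

The boundary conditions are given for traces, and these are only known on functions continuous up to the
boundary. Therefore \<open>w\<close> is replaced by a bounded continuous representative \<open>W\<close> on the whole plane, which exists because
\<open>w, w\<^sub>x, w\<^sub>y, w\<^sub>x\<^sub>y\<close> are integrable (\<open>continuous_representative\<close>). The trace of \<open>w\<^sub>x\<close> is accessible only as a limit:
the difference quotients \<open>(W((1 - h) x + 2 \<pi> h, y) - W((1 - h) x, y)) / (2 \<pi> h)\<close> are continuous up to the
boundary, do not leave the strip, converge to \<open>w\<^sub>x\<close> in the first order Sobolev norm, and at \<open>x = 0\<close> equal
\<open>(W(2 \<pi> h, y) - W(0, y)) / (2 \<pi> h)\<close>. So \<open>\<integral> \<parallel>W(x, y) - W(0, y)\<parallel> dy = o(x)\<close> on bounded \<open>y\<close>-intervals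
(\<open>dilated_quotient_tendsto\<close>, \<open>difference_of_solutions\<close>), and this is exactly what the cosine layers need.

The target space need not be separable. Vector-valued integrals are only ever taken
against scalar test functions; all estimates are Lebesgue integrals of norms, and vector-valued identities are proved
either on simple functions and extended by density (\<open>density_principle\<close>) or tested weakly and turned into
pointwise bounds (\<open>fundamental_lemma_rect\<close>).
\<close>

section \<open>Notation\<close>

(* Short input notation: integrals of nonnegative functions with respect to lborel are written NN z. f z,
   and sequences converge as in X ---> l. *)
type_synonym plane = "real \<times> real"

abbreviation (input) nn_lborel :: "('b::euclidean_space => ennreal) => ennreal" (binder "NN " 10) where
 "nn_lborel f \<equiv> nn_integral lborel f"

abbreviation (input) enorm :: "'a::real_normed_vector => ennreal" where
 "enorm x \<equiv> ennreal (norm x)"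

notation (input) LIMSEQ ("(_)/ ---> (_)" [60, 60] 60)

abbreviation (input) "Borel \<equiv> borel_measurable borel"
abbreviation (input) "bochner_simple \<equiv> Bochner_Integration.simple_bochner_integrable"
abbreviation (input) "bochner_sum \<equiv> Bochner_Integration.simple_bochner_integral"

section \<open>Strong integrability\<close>

text \<open>Limits of simple functions at every point rather than almost everywhere: unlike \<open>strongly_measurable\<close> this is
preserved by arbitrary measurable substitutions.\<close>

definition simple_limit :: "'b measure => ('b => 'a::real_normed_vector) => bool" where
 "simple_limit M f \<longleftrightarrow>
   (\<exists>s :: nat => 'b => 'a. (\<forall>i. simple_function M (s i)) & (\<forall>x\<in>space M. (%i. s i x) ---> f x))"

definition abs_integrable :: "'b measure => ('b => 'a::real_normed_vector) => bool" where
 "abs_integrable M f \<longleftrightarrow> simple_limit M f & (\<integral>\<^sup>+x. enorm (f x) \<partial>M) < \<infinity>"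

abbreviation (input) "L1 \<equiv> abs_integrable lborel"

lemma simple_limitI:
 assumes "!!i. simple_function M (s i)" "!!x. x \<in> space M ==> (%i. s i x) ---> f x"
 shows "simple_limit M f"
 using assms unfolding simple_limit_def by blast

lemma simple_limitE:
 assumes "simple_limit M f"
 obtains s where "!!i. simple_function M (s i)" "!!x. x \<in> space M ==> (%i. s i x) ---> f x"
 using assms unfolding simple_limit_def by blast

lemma simple_limit_simple: "simple_function M f ==> simple_limit M f"
 by (rule simple_limitI[where s="%_. f"]) auto

lemma simple_limit_const [simp]: "simple_limit M (%x. c)"
 by (rule simple_limit_simple) auto

lemma simple_limit_norm_measurable:
 assumes "simple_limit M f" shows "(%x. norm (f x)) \<in> borel_measurable M"
proof -
 obtain s where s: "!!i. simple_function M (s i)" "!!x. x \<in> space M ==> (%i. s i x) ---> f x"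
  using simple_limitE[OF assms] by blast
 show ?thesis
 proof (rule borel_measurable_LIMSEQ_real)
  show "(%x. norm (s i x)) \<in> borel_measurable M" for i by (rule borel_measurable_simple_function[OF simple_function_compose1[OF s(1)]])
  show "(%i. norm (s i x)) ---> norm (f x)" if "x \<in> space M" for x by (intro tendsto_norm s that)
 qed
qed

lemma simple_limit_add:
 assumes "simple_limit M f" "simple_limit M g" shows "simple_limit M (%x. f x + g x)"
proof -
 obtain s where s: "!!i. simple_function M (s i)" "!!x. x \<in> space M ==> (%i. s i x) ---> f x"
  using simple_limitE[OF assms(1)] by blast
 obtain t where t: "!!i. simple_function M (t i)" "!!x. x \<in> space M ==> (%i. t i x) ---> g x"
  using simple_limitE[OF assms(2)] by blast
 show ?thesis by (rule simple_limitI[where s="%i x. s i x + t i x"])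
    (auto intro!: simple_function_compose2[where h="(+)"] tendsto_add s t)
qed

lemma simple_limit_scaleR:
 assumes "\<phi> \<in> borel_measurable M" "simple_limit M f" shows "simple_limit M (%x. \<phi> x *\<^sub>R f x)"
proof -
 obtain s where s: "!!i. simple_function M (s i)" "!!x. x \<in> space M ==> (%i. s i x) ---> f x"
  using simple_limitE[OF assms(2)] by blast
 obtain t where t: "!!i. simple_function M (t i)" "!!x. x \<in> space M ==> (%i. t i x) ---> \<phi> x"
  using borel_measurable_implies_sequence_metric[OF assms(1), of 0] by blast
 show ?thesis by (rule simple_limitI[where s="%i x. t i x *\<^sub>R s i x"])
    (auto intro!: simple_function_compose2[where h="(*\<^sub>R)"] tendsto_scaleR s t)
qed

lemma simple_limit_minus: "simple_limit M f ==> simple_limit M (%x. - f x)"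
 using simple_limit_scaleR[of "%_. -1" M f] by simp

lemma simple_limit_diff:
 "simple_limit M f ==> simple_limit M g ==> simple_limit M (%x. f x - g x)"
 using simple_limit_add[of M f "%x. - g x"] simple_limit_minus[of M g] by simp

lemma simple_limit_compose:
 assumes "simple_limit N f" "T \<in> measurable M N" shows "simple_limit M (%x. f (T x))"
proof -
 obtain s where s: "!!i. simple_function N (s i)" "!!x. x \<in> space N ==> (%i. s i x) ---> f x"
  using simple_limitE[OF assms(1)] by blast
 show ?thesis
 proof (rule simple_limitI[where s="%i x. s i (T x)"])
  show "simple_function M (%x. s i (T x))" for i
   using simple_function_comp[OF assms(2) s(1)[of i]] by (simp add: comp_def)
  show "(%i. s i (T x)) ---> f (T x)" if "x \<in> space M" for x by (intro s measurable_space[OF assms(2) that])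
 qed
qed

lemma simple_limit_continuous:
 fixes f :: "'b::euclidean_space => 'a::real_normed_vector"
 assumes "continuous_on UNIV f" shows "simple_limit lborel f"
proof -
 have "(%x::'b. x) \<in> borel_measurable lborel" by simp
 then obtain F :: "nat => 'b => 'b" where F: "!!i. simple_function lborel (F i)" "!!x. (%i. F i x) ---> x"
  using borel_measurable_implies_sequence_metric[of "%x::'b. x" lborel 0] by auto
 show ?thesis
 proof (rule simple_limitI[where s="%i x. f (F i x)"])
  show "simple_function lborel (%x. f (F i x))" for i by (rule simple_function_compose1[OF F(1)])
  have "isCont f x" for x using assms continuous_on_eq_continuous_at[of UNIV f] by auto
  then show "(%i. f (F i x)) ---> f x" for x
   using isCont_tendsto_compose F(2) by blast
 qed
qed

lemma simple_limit_measurable_real: "simple_limit M f ==> (f :: _ => real) \<in> borel_measurable M"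
proof (erule simple_limitE)
 fix s assume "!!i::nat. simple_function M (s i)" "!!x. x \<in> space M ==> (%i. s i x) ---> f x"
 then show "f \<in> borel_measurable M"
  using borel_measurable_LIMSEQ_real[of M s f] borel_measurable_simple_function by blast
qed

lemma measurable_real_simple_limit: "(f :: _ => real) \<in> borel_measurable M ==> simple_limit M f"
 using simple_limit_scaleR[of f M "%_. 1::real"] by (simp add: real_scaleR_def)

text \<open>On the null set where the approximating simple functions may diverge they are replaced by \<open>0\<close>.\<close>

lemma strongly_measurable_iff_simple_limit:
 "strongly_measurable M f \<longleftrightarrow> (\<exists>f'. simple_limit M f' & (AE x in M. f x = f' x))"
proof
 assume "strongly_measurable M f"
 then obtain s where s: "!!i. simple_function M (s i)" and ae: "AE x in M. (%i. s i x) ---> f x"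
  unfolding strongly_measurable_def by blast
 obtain N where N0: "{x\<in>space M. \<not> (%i. s i x) ---> f x} \<subseteq> N" "emeasure M N = 0" "N \<in> sets M"
  using AE_E[OF ae] by blast
 then have N: "{x\<in>space M. \<not> (%i. s i x) ---> f x} \<subseteq> N" "N \<in> null_sets M" by auto
 have Ns: "N \<in> sets M" using N by auto
 define f' where "f' x = (if x \<in> N then 0 else f x)" for x
 have "simple_limit M f'"
 proof (rule simple_limitI[where s="%i x. if x \<in> N then 0 else s i x"])
  show "simple_function M (%x. if x \<in> N then 0 else s i x)" for i by (intro simple_function_If_set s simple_function_const) (use Ns in auto)
  show "(%i. if x \<in> N then 0 else s i x) ---> f' x" if "x \<in> space M" for x
   using N that by (auto simp: f'_def)
 qed
 moreover have "AE x in M. f x = f' x"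
  using AE_not_in[OF N(2)] by eventually_elim (auto simp: f'_def)
 ultimately show "\<exists>f'. simple_limit M f' & (AE x in M. f x = f' x)" by blast
next
 assume "\<exists>f'. simple_limit M f' & (AE x in M. f x = f' x)"
 then obtain f' where f': "simple_limit M f'" and ae: "AE x in M. f x = f' x" by blast
 obtain s where s: "!!i. simple_function M (s i)" "!!x. x \<in> space M ==> (%i. s i x) ---> f' x"
  using simple_limitE[OF f'] by blast
 have "AE x in M. (%i. s i x) ---> f x"
  using ae AE_space by eventually_elim (use s in auto)
 then show "strongly_measurable M f" unfolding strongly_measurable_def using s by blast
qed

text \<open>Simple functions that are too large are cut to \<open>0\<close>: keeping \<open>s i x\<close> only where its norm is at most
\<open>2 * norm (f x)\<close> costs nothing in the limit and makes \<open>2 * norm (f x)\<close> an integrable majorant.\<close>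

lemma abs_integrable_simple_approx:
 assumes "abs_integrable M f"
 obtains s where "!!i::nat. bochner_simple M (s i)"
  "!!x. x \<in> space M ==> (%i. s i x) ---> f x"
  "!!i x. norm (s i x) <= 2 * norm (f x)"
  "(%i. \<integral>\<^sup>+x. enorm (f x - s i x) \<partial>M) ---> 0"
proof -
 have f: "simple_limit M f" and fin: "(\<integral>\<^sup>+x. enorm (f x) \<partial>M) < \<infinity>"
  using assms unfolding abs_integrable_def by auto
 obtain t where t: "!!i. simple_function M (t i)" "!!x. x \<in> space M ==> (%i. t i x) ---> f x"
  using simple_limitE[OF f] by blast
 note [measurable] = simple_limit_norm_measurable[OF f]
 have [measurable]: "(%x. norm (t i x)) \<in> borel_measurable M" for i by (rule borel_measurable_simple_function[OF simple_function_compose1[OF t(1)]])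
 define s where "s i x = (if norm (t i x) <= 2 * norm (f x) then t i x else 0)" for i x
 have sf: "simple_function M (s i)" for i
 proof -
  have "{x \<in> space M. norm (t i x) <= 2 * norm (f x)} \<in> sets M" by measurable
  then show ?thesis unfolding s_def by (rule simple_function_If[OF t(1) simple_function_const])
 qed
 have lim: "(%i. s i x) ---> f x" if x: "x \<in> space M" for x
 proof (cases "f x = 0")
  case True then have "s i x = 0" for i by (auto simp: s_def)
  then show ?thesis using True by simp
 next
  case False
  have "(%i. norm (t i x)) ---> norm (f x)" by (intro tendsto_norm t x)
  moreover have "norm (f x) < 2 * norm (f x)" using False by simp
  ultimately have "eventually (%i. norm (t i x) < 2 * norm (f x)) sequentially" by (rule order_tendstoD)
  then have "eventually (%i. t i x = s i x) sequentially" by eventually_elim (auto simp: s_def)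
  then show ?thesis using t(2)[OF x] tendsto_cong by fastforce
 qed
 have bnd: "norm (s i x) <= 2 * norm (f x)" for i x by (auto simp: s_def)
 have sbi: "bochner_simple M (s i)" for i
 proof (rule Bochner_Integration.simple_bochner_integrableI_bounded[OF sf])
  have "(\<integral>\<^sup>+x. enorm (s i x) \<partial>M) <= (\<integral>\<^sup>+x. 2 * enorm (f x) \<partial>M)"
  proof (intro nn_integral_mono)
   fix x
   have "enorm (s i x) <= ennreal (2 * norm (f x))" by (intro ennreal_leI bnd)
   then show "enorm (s i x) <= 2 * enorm (f x)" by (simp add: ennreal_mult)
  qed
  also have "\<dots> < \<infinity>" using fin by (subst nn_integral_cmult) (auto simp: ennreal_mult_less_top)
  finally show "(\<integral>\<^sup>+x. enorm (s i x) \<partial>M) < \<infinity>" .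
 qed
 have "(%i. \<integral>\<^sup>+x. enorm (f x - s i x) \<partial>M) ---> (\<integral>\<^sup>+x. 0 \<partial>M)"
 proof (rule nn_integral_dominated_convergence[where w="%x. ennreal (3 * norm (f x))"])
  show "(%x. enorm (f x - s i x)) \<in> borel_measurable M" for i
   using simple_limit_norm_measurable[OF simple_limit_diff[OF f simple_limit_simple[OF sf[of i]]]] by measurable
  have "(\<integral>\<^sup>+x. ennreal (3 * norm (f x)) \<partial>M) = 3 * (\<integral>\<^sup>+x. enorm (f x) \<partial>M)"
   by (subst nn_integral_cmult[symmetric]) (auto simp: ennreal_mult)
  then show "(\<integral>\<^sup>+x. ennreal (3 * norm (f x)) \<partial>M) < \<infinity>" using fin by (auto simp: ennreal_mult_less_top)
  show "AE x in M. enorm (f x - s j x) <= ennreal (3 * norm (f x))" for j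
  proof (intro AE_I2 ennreal_leI)
   fix x show "norm (f x - s j x) <= 3 * norm (f x)"
    using norm_triangle_ineq4[of "f x" "s j x"] bnd[of j x] by linarith
  qed
  have "(%i. enorm (f x - s i x)) ---> enorm (f x - f x)" if "x \<in> space M" for x
   by (intro tendsto_ennrealI tendsto_norm tendsto_diff lim that tendsto_const)
  then show "AE x in M. (%i. enorm (f x - s i x)) ---> 0" by (intro AE_I2) auto
 qed auto
 then show thesis using that[OF sbi lim bnd] by simp
qed

lemma ennreal_tendsto_0_D:
 assumes "(%i. enorm (x i)) ---> 0" shows "x ---> (0::'a::real_normed_vector)"
 using assms tendsto_ennreal_iff[of "%i. norm (x i)" sequentially 0] by (simp add: tendsto_norm_zero_iff)

lemma nn_integral_norm_add:
 assumes "simple_limit M f" "simple_limit M g"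
 shows "(\<integral>\<^sup>+x. enorm (f x + g x) \<partial>M) <= (\<integral>\<^sup>+x. enorm (f x) \<partial>M) + (\<integral>\<^sup>+x. enorm (g x) \<partial>M)"
proof -
 note [measurable] = assms[THEN simple_limit_norm_measurable]
 have "(\<integral>\<^sup>+x. enorm (f x + g x) \<partial>M) <= (\<integral>\<^sup>+x. enorm (f x) + enorm (g x) \<partial>M)"
  by (intro nn_integral_mono) (simp add: norm_triangle_ineq flip: ennreal_plus)
 also have "\<dots> = (\<integral>\<^sup>+x. enorm (f x) \<partial>M) + (\<integral>\<^sup>+x. enorm (g x) \<partial>M)" by (intro nn_integral_add) auto
 finally show ?thesis .
qed

lemma abs_integrable_add: "abs_integrable M f ==> abs_integrable M g ==> abs_integrable M (%x. f x + g x)"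
 unfolding abs_integrable_def
 using nn_integral_norm_add[of M f g] by (auto intro: simple_limit_add le_less_trans)

lemma abs_integrable_bounded_scaleR:
 assumes "abs_integrable M f" "\<phi> \<in> borel_measurable M" "!!x. \<bar>\<phi> x\<bar> <= C"
 shows "abs_integrable M (%x. \<phi> x *\<^sub>R f x)"
 unfolding abs_integrable_def
proof
 have f: "simple_limit M f" and fin: "(\<integral>\<^sup>+x. enorm (f x) \<partial>M) < \<infinity>"
  using assms(1) unfolding abs_integrable_def by auto
 show "simple_limit M (%x. \<phi> x *\<^sub>R f x)" by (intro simple_limit_scaleR assms f)
 note [measurable] = simple_limit_norm_measurable[OF f]
 have C: "0 <= C" using assms(3)[of undefined] by linarith
 have "(\<integral>\<^sup>+x. enorm (\<phi> x *\<^sub>R f x) \<partial>M) <= (\<integral>\<^sup>+x. ennreal C * enorm (f x) \<partial>M)"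
 proof (intro nn_integral_mono)
  fix x
  have "norm (\<phi> x *\<^sub>R f x) <= C * norm (f x)" using assms(3)[of x] by (simp add: mult_right_mono)
  then have "enorm (\<phi> x *\<^sub>R f x) <= ennreal (C * norm (f x))" by (rule ennreal_leI)
  then show "enorm (\<phi> x *\<^sub>R f x) <= ennreal C * enorm (f x)" using C by (simp add: ennreal_mult)
 qed
 also have "\<dots> = ennreal C * (\<integral>\<^sup>+x. enorm (f x) \<partial>M)" by (intro nn_integral_cmult) auto
 also have "\<dots> < \<infinity>" using fin by (auto simp: ennreal_mult_less_top)
 finally show "(\<integral>\<^sup>+x. enorm (\<phi> x *\<^sub>R f x) \<partial>M) < \<infinity>" .
qed

lemma abs_integrable_scaleR: "abs_integrable M f ==> abs_integrable M (%x. c *\<^sub>R f x)"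
 by (rule abs_integrable_bounded_scaleR[where C="\<bar>c\<bar>"]) auto

lemma abs_integrable_diff: "abs_integrable M f ==> abs_integrable M g ==> abs_integrable M (%x. f x - g x)"
 using abs_integrable_add[of M f "%x. - g x"] abs_integrable_scaleR[of M g "-1"] by simp

lemma abs_integrable_mono:
 assumes "simple_limit M f" "AE x in M. enorm (f x) <= g x" "(\<integral>\<^sup>+x. g x \<partial>M) < \<infinity>"
 shows "abs_integrable M f"
 unfolding abs_integrable_def using assms nn_integral_mono_AE[OF assms(2)] by auto

lemma has_strong_integral_cong_AE:
 assumes "has_strong_integral M f J" "AE x in M. f x = g x"
 shows "has_strong_integral M g J"
proof -
 have "strongly_measurable M g"
 proof -
  obtain f' where f': "simple_limit M f'" "AE x in M. f x = f' x"
   using assms(1) unfolding has_strong_integral_def strongly_measurable_iff_simple_limit by blast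
  have "AE x in M. g x = f' x" using assms(2) f'(2) by eventually_elim simp
  then show ?thesis using f'(1) unfolding strongly_measurable_iff_simple_limit by blast
 qed
 moreover have "(\<integral>\<^sup>+x. enorm (g x - s x) \<partial>M) = (\<integral>\<^sup>+x. enorm (f x - s x) \<partial>M)" for s
  by (rule nn_integral_cong_AE) (use assms(2) in auto)
 ultimately show ?thesis using assms(1) unfolding has_strong_integral_def by simp
qed

lemma simple_bochner_imp_simple_limit:
 "bochner_simple M s ==> simple_limit M s"
 by (auto elim: simple_bochner_integrable.cases intro: simple_limit_simple)

lemma simple_bochner_imp_abs_integrable:
 assumes "bochner_simple M s" shows "abs_integrable M s"
proof -
 have "simple_function M (%x. norm (s x))"
  using assms by (auto elim!: simple_bochner_integrable.cases intro: simple_function_compose1)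
 have *: "bochner_simple M (%x. norm (s x))"
  using simple_bochner_integrable_compose2[of "%x y. norm x" M s s] assms by auto
 have "(\<integral>\<^sup>+x. enorm (s x) \<partial>M) < \<infinity>"
  using simple_bochner_integral_eq_nn_integral[OF *, symmetric] by simp
 then show ?thesis unfolding abs_integrable_def using simple_bochner_imp_simple_limit[OF assms] by blast
qed

lemma simple_bochner_norm_le:
 assumes "bochner_simple M s"
 shows "enorm (bochner_sum M s) <= (\<integral>\<^sup>+x. enorm (s x) \<partial>M)"
proof -
 have *: "bochner_simple M (%x. norm (s x))"
  using simple_bochner_integrable_compose2[of "%x y. norm x" M s s] assms by auto
 show ?thesis
  using simple_bochner_integral_eq_nn_integral[OF *, symmetric] simple_bochner_integral_norm_bound[OF assms] by (simp add: ennreal_leI)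
qed

lemma simple_bochner_dist_le:
 assumes "simple_limit M f" "bochner_simple M s" "bochner_simple M t"
 shows "enorm (bochner_sum M s - bochner_sum M t)
   <= (\<integral>\<^sup>+x. enorm (f x - s x) \<partial>M) + (\<integral>\<^sup>+x. enorm (f x - t x) \<partial>M)"
proof -
 have d: "bochner_simple M (%x. s x - t x)"
  using simple_bochner_integrable_compose2[of "(-)" M s t] assms by auto
 have "enorm (bochner_sum M s - bochner_sum M t)
  <= (\<integral>\<^sup>+x. enorm (s x - t x) \<partial>M)"
  using simple_bochner_norm_le[OF d] simple_bochner_integral_diff[OF assms(2,3)] by simp
 also have "\<dots> = (\<integral>\<^sup>+x. enorm (- (f x - s x) + (f x - t x)) \<partial>M)" by simp
 also have "\<dots> <= (\<integral>\<^sup>+x. enorm (- (f x - s x)) \<partial>M) + (\<integral>\<^sup>+x. enorm (f x - t x) \<partial>M)"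
  by (intro nn_integral_norm_add simple_limit_minus simple_limit_diff assms simple_bochner_imp_simple_limit)
 finally show ?thesis by (simp add: norm_minus_commute)
qed

lemma has_strong_integral_unique:
 assumes "has_strong_integral M f J" "has_strong_integral M f J'"
 shows "J = J'"
proof -
 obtain f' where f': "simple_limit M f'" "AE x in M. f x = f' x"
  using assms unfolding has_strong_integral_def strongly_measurable_iff_simple_limit by blast
 note 1 = has_strong_integral_cong_AE[OF assms(1) f'(2)] has_strong_integral_cong_AE[OF assms(2) f'(2)]
 obtain s where s: "!!i. bochner_simple M (s i)"
  "(%i::nat. \<integral>\<^sup>+x. enorm (f' x - s i x) \<partial>M) ---> 0"
  "(%i. bochner_sum M (s i)) ---> J"
  using 1(1) unfolding has_strong_integral_def by blast
 obtain t where t: "!!i. bochner_simple M (t i)"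
  "(%i::nat. \<integral>\<^sup>+x. enorm (f' x - t i x) \<partial>M) ---> 0"
  "(%i. bochner_sum M (t i)) ---> J'"
  using 1(2) unfolding has_strong_integral_def by blast
 have "(%i. enorm (bochner_sum M (s i) - bochner_sum M (t i))) ---> 0"
 proof (rule tendsto_sandwich[OF _ _ tendsto_const])
  show "(%i. (\<integral>\<^sup>+x. enorm (f' x - s i x) \<partial>M) + (\<integral>\<^sup>+x. enorm (f' x - t i x) \<partial>M)) ---> 0"
   using tendsto_add[OF s(2) t(2)] by simp
 qed (auto intro!: always_eventually simple_bochner_dist_le f' s t)
 then have "(%i. bochner_sum M (s i) - bochner_sum M (t i)) ---> 0" by (rule ennreal_tendsto_0_D)
 moreover have "(%i. bochner_sum M (s i) - bochner_sum M (t i)) ---> J - J'" by (intro tendsto_diff s t)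
 ultimately have "J - J' = 0" using LIMSEQ_unique by blast
 then show ?thesis by simp
qed

lemma strong_integral_eq: "has_strong_integral M f J ==> strong_integral M f = J"
 unfolding strong_integral_def using has_strong_integral_unique by blast

lemma simple_limit_imp_strongly_measurable: "simple_limit M f ==> strongly_measurable M f"
 unfolding strongly_measurable_iff_simple_limit by blast

lemma strong_integral_limit:
 fixes f :: "'b => 'a::banach"
 assumes f: "abs_integrable M f" and s: "!!i::nat. bochner_simple M (s i)"
  and lim: "(%i. \<integral>\<^sup>+x. enorm (f x - s i x) \<partial>M) ---> 0"
 shows "(%i. bochner_sum M (s i)) ---> strong_integral M f"
  and "has_strong_integral M f (strong_integral M f)"
proof -
 let ?I = "%i. bochner_sum M (s i)"
 have sl: "simple_limit M f" using f by (auto simp: abs_integrable_def)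
 have "Cauchy ?I"
 proof (rule metric_CauchyI)
  fix e :: real assume "0 < e"
  then have "eventually (%i. (\<integral>\<^sup>+x. enorm (f x - s i x) \<partial>M) < ennreal (e/2)) sequentially" by (intro order_tendstoD[OF lim]) auto
  then obtain N where N: "!!i. i \<ge> N ==> (\<integral>\<^sup>+x. enorm (f x - s i x) \<partial>M) < ennreal (e/2)"
   unfolding eventually_sequentially by blast
  have "dist (?I m) (?I n) < e" if "m \<ge> N" "n \<ge> N" for m n
  proof -
   have "enorm (?I m - ?I n) <= (\<integral>\<^sup>+x. enorm (f x - s m x) \<partial>M) + (\<integral>\<^sup>+x. enorm (f x - s n x) \<partial>M)"
    by (intro simple_bochner_dist_le s sl)
   also have "\<dots> < ennreal (e/2) + ennreal (e/2)" using N that by (intro add_strict_mono) auto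
   also have "\<dots> = ennreal e" using \<open>0 < e\<close> by (simp flip: ennreal_plus)
   finally show ?thesis using \<open>0 < e\<close> by (simp add: dist_norm ennreal_less_iff)
  qed
  then show "\<exists>N. \<forall>m\<ge>N. \<forall>n\<ge>N. dist (?I m) (?I n) < e" by blast
 qed
 then obtain J where J: "?I ---> J" using Cauchy_convergent_iff convergent_def by blast
 then have "has_strong_integral M f J"
  unfolding has_strong_integral_def using s lim simple_limit_imp_strongly_measurable[OF sl] by blast
 then show "?I ---> strong_integral M f" "has_strong_integral M f (strong_integral M f)"
  using J strong_integral_eq by blast+
qed

lemma strong_integral_cong_AE:
 assumes "AE x in M. f x = g x" shows "strong_integral M f = strong_integral M g"
proof -
 have "AE x in M. g x = f x" using assms by auto
 then have "has_strong_integral M f = has_strong_integral M g"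
  using has_strong_integral_cong_AE assms by blast
 then show ?thesis unfolding strong_integral_def by simp
qed

lemma strong_integral_norm_le:
 fixes f :: "'b => 'a::banach"
 assumes f: "abs_integrable M f"
 shows "enorm (strong_integral M f) <= (\<integral>\<^sup>+x. enorm (f x) \<partial>M)"
proof -
 obtain s where s: "!!i::nat. bochner_simple M (s i)"
  "(%i. \<integral>\<^sup>+x. enorm (f x - s i x) \<partial>M) ---> 0"
  using abs_integrable_simple_approx[OF f] by metis
 have sl: "simple_limit M f" using f by (auto simp: abs_integrable_def)
 note L = strong_integral_limit(1)[OF f s]
 have 1: "enorm (bochner_sum M (s i))
  <= (\<integral>\<^sup>+x. enorm (f x) \<partial>M) + (\<integral>\<^sup>+x. enorm (f x - s i x) \<partial>M)" for i
 proof -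
  have "enorm (bochner_sum M (s i)) <= (\<integral>\<^sup>+x. enorm (s i x) \<partial>M)" by (rule simple_bochner_norm_le[OF s(1)])
  also have "\<dots> = (\<integral>\<^sup>+x. enorm (f x + - (f x - s i x)) \<partial>M)" by simp
  also have "\<dots> <= (\<integral>\<^sup>+x. enorm (f x) \<partial>M) + (\<integral>\<^sup>+x. enorm (- (f x - s i x)) \<partial>M)"
   by (intro nn_integral_norm_add simple_limit_minus simple_limit_diff sl simple_bochner_imp_simple_limit s)
  finally show ?thesis by (simp add: norm_minus_commute)
 qed
 show ?thesis
 proof (rule LIMSEQ_le[OF tendsto_ennrealI[OF tendsto_norm[OF L]]])
  show "(%i. (\<integral>\<^sup>+x. enorm (f x) \<partial>M) + (\<integral>\<^sup>+x. enorm (f x - s i x) \<partial>M)) ---> (\<integral>\<^sup>+x. enorm (f x) \<partial>M)"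
   using tendsto_add[OF tendsto_const s(2), of "\<integral>\<^sup>+x. enorm (f x) \<partial>M"] by simp
 qed (use 1 in auto)
qed

lemma strong_integral_add:
 fixes f :: "'b => 'a::banach"
 assumes f: "abs_integrable M f" and g: "abs_integrable M g"
 shows "strong_integral M (%x. f x + g x) = strong_integral M f + strong_integral M g"
proof -
 obtain s where s: "!!i::nat. bochner_simple M (s i)"
  "(%i. \<integral>\<^sup>+x. enorm (f x - s i x) \<partial>M) ---> 0"
  using abs_integrable_simple_approx[OF f] by metis
 obtain t where t: "!!i::nat. bochner_simple M (t i)"
  "(%i. \<integral>\<^sup>+x. enorm (g x - t i x) \<partial>M) ---> 0"
  using abs_integrable_simple_approx[OF g] by metis
 have st: "bochner_simple M (%x. s i x + t i x)" for i
  using simple_bochner_integrable_compose2[of "(+)" M "s i" "t i"] s t by auto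
 have lim: "(%i. \<integral>\<^sup>+x. enorm (f x + g x - (s i x + t i x)) \<partial>M) ---> 0"
 proof (rule tendsto_sandwich[OF _ _ tendsto_const])
  show "(%i. (\<integral>\<^sup>+x. enorm (f x - s i x) \<partial>M) + (\<integral>\<^sup>+x. enorm (g x - t i x) \<partial>M)) ---> 0"
   using tendsto_add[OF s(2) t(2)] by simp
  have "(\<integral>\<^sup>+x. enorm ((f x - s i x) + (g x - t i x)) \<partial>M) <= (\<integral>\<^sup>+x. enorm (f x - s i x) \<partial>M) + (\<integral>\<^sup>+x. enorm (g x - t i x) \<partial>M)" for i
   using f g by (intro nn_integral_norm_add simple_limit_diff[OF _ simple_bochner_imp_simple_limit[OF s(1)]]
     simple_limit_diff[OF _ simple_bochner_imp_simple_limit[OF t(1)]]) (auto simp: abs_integrable_def)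
  then show "\<forall>\<^sub>F i in sequentially. (\<integral>\<^sup>+x. enorm (f x + g x - (s i x + t i x)) \<partial>M) <= (\<integral>\<^sup>+x. enorm (f x - s i x) \<partial>M) + (\<integral>\<^sup>+x. enorm (g x - t i x) \<partial>M)"
   by (simp add: algebra_simps)
 qed auto
 note L = strong_integral_limit(1)[OF abs_integrable_add[OF f g] st lim]
 have "(%i. bochner_sum M (%x. s i x + t i x)) ---> strong_integral M f + strong_integral M g" by (subst simple_bochner_integral_add[OF s(1) t(1)])
    (intro tendsto_add strong_integral_limit(1) f g s t)
 then show ?thesis using LIMSEQ_unique[OF L] by blast
qed

lemma strong_integral_scaleR:
 fixes f :: "'b => 'a::banach"
 assumes f: "abs_integrable M f"
 shows "strong_integral M (%x. c *\<^sub>R f x) = c *\<^sub>R strong_integral M f"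
proof -
 obtain s where s: "!!i::nat. bochner_simple M (s i)"
  "(%i. \<integral>\<^sup>+x. enorm (f x - s i x) \<partial>M) ---> 0"
  using abs_integrable_simple_approx[OF f] by metis
 have sl: "simple_limit M f" using f by (auto simp: abs_integrable_def)
 have st: "bochner_simple M (%x. c *\<^sub>R s i x)" for i
  using simple_bochner_integrable_compose2[of "%x y. c *\<^sub>R x" M "s i" "s i"] s by auto
 have "(\<integral>\<^sup>+x. enorm (c *\<^sub>R f x - c *\<^sub>R s i x) \<partial>M) = ennreal \<bar>c\<bar> * (\<integral>\<^sup>+x. enorm (f x - s i x) \<partial>M)" for i
  using simple_limit_norm_measurable[OF simple_limit_diff[OF sl simple_bochner_imp_simple_limit[OF s(1)]]]
  by (subst nn_integral_cmult[symmetric]) (auto simp: ennreal_mult simp flip: scaleR_diff_right)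
 then have lim: "(%i. \<integral>\<^sup>+x. enorm (c *\<^sub>R f x - c *\<^sub>R s i x) \<partial>M) ---> 0"
  using ennreal_tendsto_cmult[OF _ s(2), of "ennreal \<bar>c\<bar>"] by simp
 note L = strong_integral_limit(1)[OF abs_integrable_scaleR[OF f] st lim]
 have "(%i. bochner_sum M (%x. c *\<^sub>R s i x)) ---> c *\<^sub>R strong_integral M f" by (subst simple_bochner_integral_linear[OF linear_scaleR s(1)])
    (intro tendsto_scaleR tendsto_const strong_integral_limit(1) f s)
 then show ?thesis using LIMSEQ_unique[OF L] by blast
qed

lemma strong_integral_diff:
 fixes f :: "'b => 'a::banach"
 assumes f: "abs_integrable M f" and g: "abs_integrable M g"
 shows "strong_integral M (%x. f x - g x) = strong_integral M f - strong_integral M g"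
 using strong_integral_add[OF f abs_integrable_scaleR[OF g, of "-1"]] strong_integral_scaleR[OF g, of "-1"] by simp

lemma abs_integrable_indicator:
 assumes "A \<in> sets M" "emeasure M A < \<infinity>" shows "abs_integrable M (%z. indicator A z *\<^sub>R x)"
proof -
 have "(\<integral>\<^sup>+z. enorm (indicator A z *\<^sub>R x) \<partial>M) = enorm x * emeasure M A"
  using assms by (subst nn_integral_cmult_indicator[symmetric]) (auto intro!: nn_integral_cong split: split_indicator)
 moreover have "simple_limit M (%z. indicator A z *\<^sub>R x)" by (intro simple_limit_scaleR simple_limit_const borel_measurable_indicator assms)
 ultimately show ?thesis unfolding abs_integrable_def using assms by (auto simp: ennreal_mult_less_top)
qed

lemma abs_integrable_0 [simp]: "abs_integrable M (%x. 0)"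
 unfolding abs_integrable_def by simp

lemma strong_integral_0 [simp]: "strong_integral M (%x. 0 :: 'a::banach) = 0"
 using strong_integral_norm_le[of M "%x. 0 :: 'a"] by simp

text \<open>This replaces all vector-valued Fubini arguments: the difference of the two sides of an identity is a bounded
additive map \<open>T\<close>, so it is enough to check indicators times a vector, where the identity is a real one.\<close>

lemma density_principle:
 fixes T :: "('b => 'a::banach) => 'c::real_normed_vector"
 assumes sp: "space M = UNIV"
  and add: "!!g h. abs_integrable M g ==> abs_integrable M h ==> T (%z. g z + h z) = T g + T h"
  and bnd: "!!g. abs_integrable M g ==> enorm (T g) <= C * (\<integral>\<^sup>+z. enorm (g z) \<partial>M)"
  and C: "C < \<infinity>"
  and ind: "!!A x. A \<in> sets M ==> emeasure M A < \<infinity> ==> T (%z. indicator A z *\<^sub>R x) = 0"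
  and f: "abs_integrable M f"
 shows "T f = 0"
proof -
 have T0: "T (%z. 0) = 0" using bnd[of "%z. 0"] by simp
 have fs: "T (%z. \<Sum>y\<in>F. g y z) = (\<Sum>y\<in>F. T (g y)) & abs_integrable M (%z. \<Sum>y\<in>F. g y z)"
  if "finite F" "!!y. y \<in> F ==> abs_integrable M (g y)" for F :: "'a set" and g
  using that by (induction F) (auto simp: T0 add abs_integrable_add)
 have simple: "T s = 0" if s: "bochner_simple M s" for s
 proof -
  have sf: "simple_function M s" and sn: "emeasure M {x \<in> space M. s x ~= 0} ~= \<infinity>"
   using s by (auto elim: simple_bochner_integrable.cases)
  define F where "F = s ` UNIV - {0}"
  have finF: "finite F" using simple_functionD(1)[OF sf] sp by (auto simp: F_def)
  define A where "A y = s -` {y}" for y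
  have A: "A y \<in> sets M" for y using simple_functionD(2)[OF sf, of "{y}"] sp by (auto simp: A_def)
  have A': "emeasure M (A y) < \<infinity>" if "y \<in> F" for y
  proof -
   have "emeasure M (A y) <= emeasure M {x \<in> space M. s x ~= 0}"
   proof (intro emeasure_mono)
    show "A y \<subseteq> {x \<in> space M. s x ~= 0}" using that sp by (auto simp: A_def F_def)
    show "{x \<in> space M. s x ~= 0} \<in> sets M" using simple_functionD(2)[OF sf, of "- {0}"] sp by (simp add: vimage_def)
   qed
   then show ?thesis using sn by (auto simp: less_top top_unique)
  qed
  have "s z = (\<Sum>y\<in>F. indicator (A y) z *\<^sub>R y)" for z
  proof (cases "s z = 0")
   case True then show ?thesis by (auto simp: A_def F_def intro!: sum.neutral[symmetric] split: split_indicator)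
  next
   case False
   have "(\<Sum>y\<in>F. indicator (A y) z *\<^sub>R y) = (\<Sum>y\<in>F. if y = s z then s z else 0)"
    by (intro sum.cong) (auto simp: A_def split: split_indicator)
   then show ?thesis using False finF by (auto simp: F_def)
  qed
  then have "s = (%z. \<Sum>y\<in>F. indicator (A y) z *\<^sub>R y)" by auto
  then have "T s = (\<Sum>y\<in>F. T (%z. indicator (A y) z *\<^sub>R y))"
   using conjunct1[OF fs[OF finF, of "%y z. indicator (A y) z *\<^sub>R y", OF abs_integrable_indicator[OF A A']]] by metis
  also have "\<dots> = 0" using ind[OF A A'] by simp
  finally show ?thesis .
 qed
 obtain s where s: "!!i::nat. bochner_simple M (s i)"
  "(%i. \<integral>\<^sup>+x. enorm (f x - s i x) \<partial>M) ---> 0"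
  using abs_integrable_simple_approx[OF f] by metis
 have "enorm (T f) <= C * (\<integral>\<^sup>+x. enorm (f x - s i x) \<partial>M)" for i
 proof -
  have d: "abs_integrable M (%z. f z - s i z)" by (intro abs_integrable_diff f simple_bochner_imp_abs_integrable s)
  have "T f = T (%z. (f z - s i z) + s i z)" by simp
  also have "\<dots> = T (%z. f z - s i z)"
   unfolding add[OF d simple_bochner_imp_abs_integrable[OF s(1)]] simple[OF s(1)] by simp
  finally show ?thesis using bnd[OF d] by simp
 qed
 moreover have "(%i. C * (\<integral>\<^sup>+x. enorm (f x - s i x) \<partial>M)) ---> C * 0"
  by (intro ennreal_tendsto_cmult s C[unfolded infinity_ennreal_def])
 ultimately have "enorm (T f) <= C * 0" by (intro LIMSEQ_le_const) auto
 then show ?thesis by simp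
qed

section \<open>Smooth functions of one variable\<close>

primrec diff_times :: "nat => (real => real) => bool" where
 "diff_times 0 f = True"
| "diff_times (Suc n) f = (\<exists>f'. (\<forall>x. (f has_real_derivative f' x) (at x)) & diff_times n f')"

definition smooth :: "(real => real) => bool" where
 "smooth f \<longleftrightarrow> (\<forall>n. diff_times n f)"

lemma diff_times_SucI: "(!!x. (f has_real_derivative f' x) (at x)) ==> diff_times n f' ==> diff_times (Suc n) f"
 by auto

lemma diff_times_Suc_D: "diff_times (Suc n) f ==> diff_times n f"
 by (induction n arbitrary: f) auto

lemma diff_times_const: "diff_times n (%x. c)"
proof (induction n arbitrary: c)
 case (Suc n) show ?case by (rule diff_times_SucI[OF _ Suc[of 0]]) auto
qed simp

lemma diff_times_add: "diff_times n f ==> diff_times n g ==> diff_times n (%x. f x + g x)"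
proof (induction n arbitrary: f g)
 case (Suc n)
 then obtain f' g' where *: "!!x. (f has_real_derivative f' x) (at x)" "diff_times n f'"
  "!!x. (g has_real_derivative g' x) (at x)" "diff_times n g'" by auto
 show ?case by (rule diff_times_SucI[OF _ Suc.IH[OF *(2,4)]]) (intro DERIV_add *)
qed simp

lemma diff_times_mult: "diff_times n f ==> diff_times n g ==> diff_times n (%x. f x * g x)"
proof (induction n arbitrary: f g)
 case (Suc n)
 then obtain f' g' where *: "!!x. (f has_real_derivative f' x) (at x)" "diff_times n f'"
  "!!x. (g has_real_derivative g' x) (at x)" "diff_times n g'" by auto
 have **: "diff_times n f" "diff_times n g" using Suc.prems diff_times_Suc_D by blast+
 show ?case by (rule diff_times_SucI[OF _ diff_times_add[OF Suc.IH[OF *(2) **(2)] Suc.IH[OF *(4) **(1)]]])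
    (intro DERIV_mult *)
qed simp

lemma diff_times_cmult: "diff_times n f ==> diff_times n (%x. c * f x)"
 using diff_times_mult[OF diff_times_const] .

lemma diff_times_affine: "diff_times n f ==> diff_times n (%x. f (c * x + d))"
proof (induction n arbitrary: f)
 case (Suc n)
 then obtain f' where *: "!!x. (f has_real_derivative f' x) (at x)" "diff_times n f'" by auto
 have "((%x. f (c * x + d)) has_real_derivative c * f' (c * x + d)) (at x)" for x
 proof -
  have "((%x. c * x + d) has_real_derivative c) (at x)" by (auto intro!: derivative_eq_intros)
  from DERIV_chain2[OF *(1) this] show ?thesis by (simp add: mult.commute)
 qed
 then show ?case by (rule diff_times_SucI[OF _ diff_times_cmult[OF Suc.IH[OF *(2)]]])
qed simp

lemma diff_times_inverse:
 assumes "!!x. g x ~= 0" shows "diff_times n g ==> diff_times n (%x. inverse (g x))"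
proof (induction n)
 case (Suc n)
 then obtain g' where *: "!!x. (g has_real_derivative g' x) (at x)" "diff_times n g'" by auto
 have IH: "diff_times n (%x. inverse (g x))" using Suc diff_times_Suc_D by blast
 have "((%x. inverse (g x)) has_real_derivative (-1) * (g' x * (inverse (g x) * inverse (g x)))) (at x)" for x
  using DERIV_inverse'[OF *(1)[of x] assms] by (simp add: mult_ac)
 then show ?case by (rule diff_times_SucI[OF _ diff_times_cmult[OF diff_times_mult[OF *(2) diff_times_mult[OF IH IH]]]])
qed simp

text \<open>The derivatives in \<open>diff_times\<close> are unique, so the existentially chosen ones are \<open>deriv f\<close>.\<close>

lemma smooth_deriv:
 assumes "smooth f"
 shows "(f has_real_derivative deriv f x) (at x)" "smooth (deriv f)"
proof -
 have d: "(f has_real_derivative deriv f x) (at x)" for x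
 proof -
  have "diff_times (Suc 0) f" using assms smooth_def by blast
  then obtain f' where "!!x. (f has_real_derivative f' x) (at x)" by auto
  then show ?thesis using DERIV_imp_deriv by metis
 qed
 then show "(f has_real_derivative deriv f x) (at x)" .
 show "smooth (deriv f)" unfolding smooth_def
 proof
  fix n
  have "diff_times (Suc n) f" using assms smooth_def by blast
  then obtain f' where f': "!!x. (f has_real_derivative f' x) (at x)" "diff_times n f'" by auto
  have "f' = deriv f" using DERIV_unique[OF f'(1) d] by auto
  then show "diff_times n (deriv f)" using f' by simp
 qed
qed

lemma smoothI_deriv:
 assumes "!!x. (f has_real_derivative f' x) (at x)" "smooth f'" shows "smooth f"
 unfolding smooth_def
proof
 fix n show "diff_times n f" using assms by (cases n) (auto simp: smooth_def)
qed

lemma smooth_const [simp]: "smooth (%x. c)" by (simp add: smooth_def diff_times_const)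
lemma smooth_add: "smooth f ==> smooth g ==> smooth (%x. f x + g x)" by (simp add: smooth_def diff_times_add)
lemma smooth_mult: "smooth f ==> smooth g ==> smooth (%x. f x * g x)" by (simp add: smooth_def diff_times_mult)
lemma smooth_affine: "smooth f ==> smooth (%x. f (c * x + d))" by (simp add: smooth_def diff_times_affine)
lemma smooth_diff: "smooth f ==> smooth g ==> smooth (%x. f x - g x)"
 using smooth_add[of f "%x. -1 * g x"] smooth_mult[OF smooth_const, of g "-1"] by simp
lemma smooth_inverse: "smooth g ==> (!!x. g x ~= 0) ==> smooth (%x. inverse (g x))"
 by (simp add: smooth_def diff_times_inverse)

lemma smooth_continuous: assumes "smooth f" shows "continuous_on S f"
 by (meson DERIV_isCont assms continuous_at_imp_continuous_on smooth_deriv(1))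

lemma smooth_measurable: "smooth f ==> f \<in> Borel"
 by (intro borel_measurable_continuous_onI smooth_continuous)

lemma smooth_exp: "smooth (%x. exp (c * x))"
proof -
 have "diff_times n (%x. a * exp (c * x))" for n a
 proof (induction n arbitrary: a)
  case (Suc n)
  have "((%x. a * exp (c * x)) has_real_derivative (a * c) * exp (c * x)) (at x)" for x by (auto intro!: derivative_eq_intros)
  then show ?case by (rule diff_times_SucI[OF _ Suc])
 qed simp
 from this[of _ 1] show ?thesis by (simp add: smooth_def)
qed

lemma smooth_sin_cos: "smooth (%x. a * sin (c * x) + b * cos (c * x))"
proof -
 have "diff_times n (%x. a * sin (c * x) + b * cos (c * x))" for n
 proof (induction n arbitrary: a b)
  case (Suc n)
  have "((%x. a * sin (c * x) + b * cos (c * x)) has_real_derivative (- (b * c)) * sin (c * x) + (a * c) * cos (c * x)) (at x)" for x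
   by (auto intro!: derivative_eq_intros)
  then show ?case by (rule diff_times_SucI[OF _ Suc])
 qed simp
 then show ?thesis by (simp add: smooth_def)
qed

lemma smooth_sin: "smooth (%x. sin (c * x))" using smooth_sin_cos[of 1 c 0] by simp
lemma smooth_cos: "smooth (%x. cos (c * x))" using smooth_sin_cos[of 0 c 1] by simp

text \<open>The standard flat functions; the family over \<open>k\<close> is closed under differentiation, which gives smoothness at \<open>0\<close>
without computing higher derivatives.\<close>

definition flat :: "nat => real => real" where
 "flat k t = (if t <= 0 then 0 else exp (- 1 / t) / t ^ k)"

lemma flat_deriv: "(flat k has_real_derivative flat (k + 2) t + (- real k) * flat (k + 1) t) (at t)"
proof -
 consider "t < 0" | "t = 0" | "t > 0" by linarith
 then show ?thesis
 proof cases
  case 1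
  have "(flat k has_real_derivative 0) (at t)"
   by (rule has_field_derivative_transform_within_open[of "%_. 0" _ _ "{..<0}"]) (use 1 in \<open>auto simp: flat_def\<close>)
  then show ?thesis using 1 by (simp add: flat_def)
 next
  case 3
  have "((%t. exp (- 1 / t) / t ^ k) has_real_derivative flat (k + 2) t + (- real k) * flat (k + 1) t) (at t)"
  proof -
   have p: "((%t. inverse t ^ k) has_real_derivative (- real k) * inverse t ^ (k + 1)) (at t)"
   proof -
    have "(inverse has_real_derivative - (inverse t ^ 2)) (at t)"
     using DERIV_inverse[of t UNIV] 3 by (simp add: numeral_2_eq_2)
    show ?thesis by (rule DERIV_cong[OF DERIV_power[OF \<open>(inverse has_real_derivative - (inverse t ^ 2)) (at t)\<close>, of k]])
       (cases k, simp_all add: power2_eq_square algebra_simps)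
   qed
   have q: "((%t. exp (- 1 / t)) has_real_derivative exp (- 1 / t) * inverse t ^ 2) (at t)"
    using 3 by (auto intro!: derivative_eq_intros simp: power2_eq_square field_simps)
   from DERIV_mult[OF q p] show ?thesis using 3 by (simp add: flat_def field_simps power_inverse power_add power2_eq_square)
  qed
  then show ?thesis by (rule has_field_derivative_transform_within_open[of _ _ _ "{0<..}"]) (use 3 in \<open>auto simp: flat_def\<close>)
 next
  case 2
  have "((%x::real. x ^ (k+1) / exp x) \<longlongrightarrow> 0) at_top" by (rule tendsto_power_div_exp_0)
  then have "((%x. inverse x ^ (k+1) / exp (inverse x)) \<longlongrightarrow> 0) (at_right (0::real))"
   by (rule filterlim_compose[OF _ filterlim_inverse_at_top_right])
  then have "((%h. flat k h / h) \<longlongrightarrow> 0) (at_right (0::real))" by (rule Lim_transform_eventually)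
     (auto simp: eventually_at_right_field flat_def field_simps exp_minus intro!: exI[of _ 1])
  moreover have "((%h. flat k h / h) \<longlongrightarrow> 0) (at_left (0::real))" by (rule Lim_transform_eventually[OF tendsto_const])
     (auto simp: eventually_at_left_field flat_def intro!: exI[of _ "-1"])
  ultimately have "((%h. flat k h / h) \<longlongrightarrow> 0) (at 0)" by (simp add: filterlim_split_at)
  then show ?thesis using 2 by (simp add: DERIV_def flat_def)
 qed
qed

lemma smooth_flat: "smooth (flat k)"
proof -
 have "diff_times n (flat k)" for n
 proof (induction n arbitrary: k)
  case (Suc n)
  show ?case by (rule diff_times_SucI[OF flat_deriv diff_times_add[OF Suc diff_times_cmult[OF Suc]]])
 qed simp
 then show ?thesis by (simp add: smooth_def)
qed

text \<open>A smooth step from \<open>0\<close> to \<open>1\<close> on \<open>[1, 2]\<close>. The quotient form makes its graph symmetric about the point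
\<open>(3/2, 1/2)\<close>; \<open>cosine_layers_vanish\<close> depends on this symmetry.\<close>

definition step :: "real => real" where
 "step t = flat 0 (t - 1) * inverse (flat 0 (t - 1) + flat 0 (2 - t))"

lemma flat0_nonneg: "0 <= flat 0 t" by (simp add: flat_def)
lemma flat0_pos: "t > 0 ==> 0 < flat 0 t" by (simp add: flat_def)

lemma step_denom_pos: "0 < flat 0 (t - 1) + flat 0 (2 - t)"
proof (cases "t > 1")
 case True then show ?thesis using flat0_pos[of "t-1"] flat0_nonneg[of "2-t"] by linarith
next
 case False then show ?thesis using flat0_pos[of "2-t"] flat0_nonneg[of "t-1"] by linarith
qed

lemma smooth_step: "smooth step"
proof -
 have 1: "smooth (%t. flat 0 (t - 1))" using smooth_affine[OF smooth_flat, of 0 1 "-1"] by simp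
 have 2: "smooth (%t. flat 0 (2 - t))" using smooth_affine[OF smooth_flat, of 0 "-1" 2] by simp
 show ?thesis unfolding step_def by (intro smooth_mult smooth_inverse smooth_add 1 2) (use step_denom_pos in \<open>auto simp: less_le\<close>)
qed

lemma step_0: "t <= 1 ==> step t = 0" by (simp add: step_def flat_def)
lemma step_1: "t \<ge> 2 ==> step t = 1" by (simp add: step_def flat_def)
lemma step_nonneg: "0 <= step t" using step_denom_pos[of t] flat0_nonneg[of "t-1"] by (simp add: step_def)
lemma step_le_1: "step t <= 1"
 using step_denom_pos[of t] flat0_nonneg[of "t-1"] flat0_nonneg[of "2-t"] by (simp add: step_def field_simps)
lemma step_reflect: "step (3 - t) = 1 - step t"
 using step_denom_pos[of t] by (simp add: step_def field_simps)

lemma smooth_antiderivative: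
 assumes f: "smooth f" and z: "!!x. x <= c ==> f x = 0"
 shows "\<exists>F. smooth F & (\<forall>x. (F has_real_derivative f x) (at x)) & (\<forall>x\<le>c. F x = 0)"
proof -
 define F where "F x = integral {c..x} f" for x
 have F0: "F x = 0" if "x <= c" for x
  using that by (cases "x = c") (auto simp: F_def)
 have d: "(F has_real_derivative f x) (at x)" for x
 proof -
  define G where "G y = integral {min x c - 1..y} f" for y
  have "(G has_real_derivative f x) (at x within {min x c - 1..x+1})"
   unfolding G_def by (rule integral_has_real_derivative) (auto intro: smooth_continuous[OF f])
  moreover have "at x within {min x c - 1..x+1} = at x" by (rule at_within_interior) auto
  ultimately have G: "(G has_real_derivative f x) (at x)" by simp
  have "G y = F y" if "y \<in> {min x c - 1<..}" for y
  proof -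
   have f0: "integral {a..b} f = 0" if "b <= c" for a b
    using integral_cong[of "{a..b}" f "%_. 0"] that z by simp
   show ?thesis
   proof (cases "y <= c")
    case True then show ?thesis using F0 f0 by (simp add: G_def)
   next
    case False
    have "integral {min x c - 1..c} f + integral {c..y} f = integral {min x c - 1..y} f"
     by (intro Henstock_Kurzweil_Integration.integral_combine integrable_continuous_interval smooth_continuous[OF f])
       (use False in auto)
    then show ?thesis using f0[of c] by (simp add: G_def F_def)
   qed
  qed
  then show ?thesis by (intro has_field_derivative_transform_within_open[OF G, of "{min x c - 1<..}"]) auto
 qed
 show ?thesis by (intro exI[of _ F]) (use d F0 smoothI_deriv[OF d f] in auto)
qed

text \<open>Compact support in the open interval \<open>(c, d)\<close>.\<close>

definition supported_in :: "real => real => (real => real) => bool" where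
 "supported_in c d a \<longleftrightarrow> (\<exists>c' d'. c < c' & d' < d & (\<forall>x. a x ~= 0 --> c' <= x & x <= d'))"

lemma supported_in_outside: "supported_in c d a ==> x <= c \<or> x \<ge> d ==> a x = 0"
 unfolding supported_in_def by force

lemma supported_in_mono: "supported_in c d a ==> c' <= c ==> d <= d' ==> supported_in c' d' a"
 unfolding supported_in_def by (meson le_less_trans less_le_trans)

lemma supported_in_mult': "supported_in c d b ==> supported_in c d (%x. a x * b x)"
 unfolding supported_in_def by force

lemma supported_in_add:
 assumes "supported_in c d a" "supported_in c d b" shows "supported_in c d (%x. a x + b x)"
proof -
 obtain p q p' q' where *: "c < p" "q < d" "c < p'" "q' < d" "!!x. a x ~= 0 ==> p <= x & x <= q" "!!x. b x ~= 0 ==> p' <= x & x <= q'"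
  using assms unfolding supported_in_def by metis
 show ?thesis unfolding supported_in_def
 proof (rule exI[of _ "min p p'"], rule exI[of _ "max q q'"], intro conjI allI impI)
  fix x assume "a x + b x ~= 0"
  then have "a x ~= 0 \<or> b x ~= 0" by auto
  then show "min p p' <= x" "x <= max q q'" using *(5,6) by fastforce+
 qed (use * in auto)
qed

lemma supported_in_deriv:
 assumes "supported_in c d a" shows "supported_in c d (deriv a)"
proof -
 obtain p q where *: "c < p" "q < d" "!!x. a x ~= 0 ==> p <= x & x <= q"
  using assms unfolding supported_in_def by metis
 have "deriv a x = 0" if "\<not> (p <= x & x <= q)" for x
 proof -
  have "(a has_real_derivative 0) (at x)"
  proof (rule has_field_derivative_transform_within_open[of "%_. 0" _ _ "- {p..q}"])
   show "x \<in> - {p..q}" using that by auto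
   show "0 = a x" if "x \<in> - {p..q}" for x using that *(3) by fastforce
  qed (auto simp: open_Compl)
  then show ?thesis by (rule DERIV_imp_deriv)
 qed
 then show ?thesis unfolding supported_in_def using * by metis
qed

lemma supported_in_bounded:
 assumes "smooth a" "supported_in c d a" obtains C where "C \<ge> 0" "!!x. \<bar>a x\<bar> <= C"
proof -
 have "compact (a ` {c..d})" by (intro compact_continuous_image smooth_continuous assms compact_Icc)
 then obtain C where C: "!!x. x \<in> {c..d} ==> \<bar>a x\<bar> <= C"
  unfolding bounded_iff by (metis bounded_iff compact_imp_bounded image_eqI real_norm_def)
 have "\<bar>a x\<bar> <= max C 0" for x
  using C[of x] supported_in_outside[OF assms(2), of x] by (cases "x \<in> {c..d}") auto
 then show thesis using that[of "max C 0"] by auto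
qed

section \<open>Lebesgue measure, product integrals and affine substitutions\<close>

lemma simple_function_completion: "simple_function M t ==> simple_function (completion M) t"
 unfolding simple_function_def by auto

text \<open>Passage from the completed measure restricted to \<open>S\<close> to Borel measure on the whole space: the
representative vanishes outside \<open>S\<close>.\<close>

lemma strongly_measurable_lebesgue_on_rep:
 fixes f :: "'b::euclidean_space => 'a::real_normed_vector"
 assumes S: "S \<in> sets borel" and f: "strongly_measurable (lebesgue_on S) f"
 obtains g where "simple_limit lborel g" "!!x. x \<notin> S ==> g x = 0" "AE x in lborel. x \<in> S --> f x = g x"
proof -
 have S': "S \<inter> space lebesgue \<in> sets lebesgue" using S by simp
 obtain s where s: "!!i::nat. simple_function (lebesgue_on S) (s i)" and ae: "AE x in lebesgue_on S. (%i. s i x) ---> f x"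
  using f unfolding strongly_measurable_def by blast
 have "simple_function lebesgue (%x. indicator S x *\<^sub>R s i x)" for i
  using s[of i] simple_function_restrict_space[OF S', of "s i"] by simp
 then have "\<forall>i. \<exists>t. simple_function lborel t & (AE x in lborel. indicator S x *\<^sub>R s i x = t x)"
  using completion_ex_simple_function by blast
 then obtain t where t: "!!i. simple_function lborel (t i)" "!!i. AE x in lborel. indicator S x *\<^sub>R s i x = t i x" by metis
 have "AE x in lborel. \<forall>i. indicator S x *\<^sub>R s i x = t i x" using t(2) by (simp add: AE_all_countable)
 moreover have "AE x in lborel. x \<in> S --> (%i. s i x) ---> f x"
  using ae S' by (simp add: AE_restrict_space_iff AE_completion_iff)
 ultimately have "AE x in lborel. (%i. t i x) ---> indicator S x *\<^sub>R f x"
 proof eventually_elim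
  case (elim x)
  then have "(%i. t i x) = (%i. indicator S x *\<^sub>R s i x)" by auto
  then show ?case using elim by (auto simp: indicator_def)
 qed
 then have "strongly_measurable lborel (%x. indicator S x *\<^sub>R f x)"
  unfolding strongly_measurable_def using t(1) by blast
 then obtain h where h: "simple_limit lborel h" "AE x in lborel. indicator S x *\<^sub>R f x = h x"
  unfolding strongly_measurable_iff_simple_limit by blast
 show thesis
 proof (rule that[of "%x. indicator S x *\<^sub>R h x"])
  show "simple_limit lborel (%x. indicator S x *\<^sub>R h x)" by (intro simple_limit_scaleR h) (use S in simp)
  show "AE x in lborel. x \<in> S --> f x = indicator S x *\<^sub>R h x" using h(2) by eventually_elim auto
 qed auto
qed

lemma nn_integral_lebesgue_on:
 assumes "S \<in> sets borel"
 shows "(\<integral>\<^sup>+x. f x \<partial>lebesgue_on S) = (NN x. f x * indicator S x)"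
 using assms by (subst nn_integral_restrict_space) (auto simp: nn_integral_completion)

lemma AE_lebesgue_on:
 assumes "S \<in> sets borel"
 shows "(AE x in lebesgue_on S. P x) \<longleftrightarrow> (AE x in lborel. x \<in> S --> P x)"
 using assms by (subst AE_restrict_space_iff) (auto simp: AE_completion_iff)

lemma has_strong_integral_lebesgue_on:
 fixes g :: "'b::euclidean_space => 'a::banach"
 assumes S: "S \<in> sets borel" and g: "L1 g" and z: "!!x. x \<notin> S ==> g x = 0"
  and ae: "AE x in lborel. x \<in> S --> f x = g x"
 shows "has_strong_integral (lebesgue_on S) f (strong_integral lborel g)"
proof -
 have S': "S \<inter> space lebesgue \<in> sets lebesgue" using S by simp
 obtain s where s: "!!i::nat. bochner_simple lborel (s i)"
  "!!x. (%i. s i x) ---> g x"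
  "!!i x. norm (s i x) <= 2 * norm (g x)"
  "(%i. NN x. enorm (g x - s i x)) ---> 0"
 proof (rule abs_integrable_simple_approx[OF g])
 qed (use that in auto)
 have sz: "s i x = 0" if "x \<notin> S" for i x using s(3)[of i x] z[OF that] by simp
 have ind: "(%x. indicator S x *\<^sub>R s i x) = s i" for i using sz by (auto simp: indicator_def)
 have sfl: "simple_function lborel (s i)" for i using s(1) by (auto elim: simple_bochner_integrable.cases)
 have sbl: "bochner_simple lebesgue (s i)" for i
 proof -
  have "{y. s i y ~= 0} \<in> sets lborel" using simple_functionD(2)[OF sfl[of i], of "- {0}"] by (simp add: vimage_def)
  then show ?thesis using s(1)[of i] by (auto simp: simple_bochner_integrable.simps simple_function_completion emeasure_completion)
 qed
 have eqint: "bochner_sum lebesgue (s i) = bochner_sum lborel (s i)" for i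
  unfolding simple_bochner_integral_def
 proof (intro sum.cong arg_cong2[where f=scaleR])
  fix y
  have "{x. s i x = y} \<in> sets lborel" using simple_functionD(2)[OF sfl[of i], of "{y}"] by (simp add: vimage_def)
  then show "measure lebesgue {x \<in> space lebesgue. s i x = y} = measure lborel {x \<in> space lborel. s i x = y}" by (simp add: measure_completion)
 qed auto
 have sbS: "bochner_simple (lebesgue_on S) (s i)" for i
  using simple_bochner_integrable_restrict_space[OF S', of "s i"] sbl ind by simp
 have eqS: "bochner_sum (lebesgue_on S) (s i) = bochner_sum lborel (s i)" for i
  using simple_bochner_integral_restrict_space[OF S' sbS[of i]] ind eqint by simp
 have dist: "(\<integral>\<^sup>+x. enorm (f x - s i x) \<partial>lebesgue_on S) = (NN x. enorm (g x - s i x))" for i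
  unfolding nn_integral_lebesgue_on[OF S] by (rule nn_integral_cong_AE) (use ae in eventually_elim, auto simp: indicator_def z sz)
 have "strongly_measurable (lebesgue_on S) f"
  unfolding strongly_measurable_def
 proof (intro exI[of _ s] conjI allI)
  show "simple_function (lebesgue_on S) (s i)" for i using sbS by (auto elim: simple_bochner_integrable.cases)
  show "AE x in lebesgue_on S. (%i. s i x) ---> f x"
   unfolding AE_lebesgue_on[OF S] using ae by eventually_elim (use s(2) in auto)
 qed
 moreover have "(%i. bochner_sum (lebesgue_on S) (s i)) ---> strong_integral lborel g"
  unfolding eqS by (rule strong_integral_limit(1)[OF g s(1) s(4)])
 ultimately show ?thesis
  unfolding has_strong_integral_def using sbS s(4) dist by (intro conjI exI[of _ s]) auto
qed

lemma has_strong_integral_finite: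
 assumes "has_strong_integral M f J" shows "(\<integral>\<^sup>+x. enorm (f x) \<partial>M) < \<infinity>"
proof -
 obtain f' where f': "simple_limit M f'" "AE x in M. f x = f' x"
  using assms unfolding has_strong_integral_def strongly_measurable_iff_simple_limit by blast
 obtain s where s: "!!i::nat. bochner_simple M (s i)"
  "(%i. \<integral>\<^sup>+x. enorm (f' x - s i x) \<partial>M) ---> 0"
  using has_strong_integral_cong_AE[OF assms f'(2)] unfolding has_strong_integral_def by blast
 have "eventually (%i. (\<integral>\<^sup>+x. enorm (f' x - s i x) \<partial>M) < 1) sequentially" by (rule order_tendstoD[OF s(2)]) simp
 then obtain i where i: "(\<integral>\<^sup>+x. enorm (f' x - s i x) \<partial>M) < 1"
  unfolding eventually_sequentially by blast
 have "(\<integral>\<^sup>+x. enorm (f x) \<partial>M) = (\<integral>\<^sup>+x. enorm ((f' x - s i x) + s i x) \<partial>M)"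
  by (rule nn_integral_cong_AE) (use f'(2) in auto)
 also have "\<dots> <= (\<integral>\<^sup>+x. enorm (f' x - s i x) \<partial>M) + (\<integral>\<^sup>+x. enorm (s i x) \<partial>M)"
  by (intro nn_integral_norm_add simple_limit_diff f' simple_bochner_imp_simple_limit s)
 also have "\<dots> < \<infinity>"
 proof -
  have "(\<integral>\<^sup>+x. enorm (f' x - s i x) \<partial>M) < \<infinity>" using order.strict_trans[OF i] by simp
  moreover have "(\<integral>\<^sup>+x. enorm (s i x) \<partial>M) < \<infinity>"
   using simple_bochner_imp_abs_integrable[OF s(1)[of i]] unfolding abs_integrable_def by blast
  ultimately show ?thesis by simp
 qed
 finally show ?thesis .
qed

lemma has_strong_integral_lebesgue_on_rep:
 fixes f :: "'b::euclidean_space => 'a::banach"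
 assumes S: "S \<in> sets borel" and f: "has_strong_integral (lebesgue_on S) f J"
 obtains g where "L1 g" "!!x. x \<notin> S ==> g x = 0" "AE x in lborel. x \<in> S --> f x = g x"
proof -
 have "strongly_measurable (lebesgue_on S) f" using f unfolding has_strong_integral_def by blast
 then obtain g where g: "simple_limit lborel g" "!!x. x \<notin> S ==> g x = 0" "AE x in lborel. x \<in> S --> f x = g x"
  using strongly_measurable_lebesgue_on_rep[OF S] by blast
 have "(NN x. enorm (g x)) = (\<integral>\<^sup>+x. enorm (f x) \<partial>lebesgue_on S)"
  unfolding nn_integral_lebesgue_on[OF S] by (rule nn_integral_cong_AE) (use g(3) in eventually_elim, auto simp: indicator_def g(2))
 then have "L1 g"
  unfolding abs_integrable_def using g has_strong_integral_finite[OF f] by simp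
 then show thesis using that g by blast
qed

lemma strong_integral_simple:
 fixes s :: "'b => 'a::banach"
 assumes "bochner_simple M s"
 shows "strong_integral M s = bochner_sum M s"
 using LIMSEQ_unique[OF strong_integral_limit(1)[OF simple_bochner_imp_abs_integrable[OF assms], of "%_. s"] tendsto_const] assms by simp

lemma strong_integral_indicator:
 fixes x :: "'a::banach"
 assumes A: "A \<in> sets M" "emeasure M A < \<infinity>"
 shows "strong_integral M (%z. indicator A z *\<^sub>R x) = measure M A *\<^sub>R x"
proof -
 have 1: "bochner_simple M (%z. indicator A z :: real)"
  using assms sets.sets_into_space[OF A(1)] by (auto simp: simple_bochner_integrable.simps Int_absorb1 indicator_eq_0_iff Collect_conj_eq Int_def[symmetric])
 have 2: "ennreal (bochner_sum M (%z. indicator A z :: real)) = emeasure M A"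
  by (subst simple_bochner_integral_eq_nn_integral[OF 1]) (use A in \<open>auto simp: ennreal_indicator\<close>)
 have 3: "bochner_sum M (%z. indicator A z :: real) = measure M A"
  using 2 simple_bochner_integral_nonneg[of "%z. indicator A z :: real" M] by (simp add: measure_def flip: 2)
 have l: "linear (%r::real. r *\<^sub>R x)" by (rule linearI) (auto simp: scaleR_add_left)
 have 4: "bochner_simple M (%z. indicator A z *\<^sub>R x)"
  using simple_bochner_integrable_compose2[of "%r q. r *\<^sub>R x" M "%z. indicator A z" "%z. indicator A z"] 1 by auto
 show ?thesis unfolding strong_integral_simple[OF 4] simple_bochner_integral_linear[OF l 1] 3 ..
qed

lemma abs_integrable_real_iff: "abs_integrable M (\<phi> :: 'b => real) \<longleftrightarrow> integrable M \<phi>"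
 unfolding abs_integrable_def integrable_iff_bounded
 using simple_limit_measurable_real measurable_real_simple_limit by auto

lemma nn_integral_norm_scaleR_const:
 assumes "(\<phi> :: 'b => real) \<in> borel_measurable M"
 shows "(\<integral>\<^sup>+z. enorm (\<phi> z *\<^sub>R x) \<partial>M) = enorm x * (\<integral>\<^sup>+z. enorm (\<phi> z) \<partial>M)"
 using assms by (subst nn_integral_cmult[symmetric]) (auto simp: ennreal_mult mult.commute)

lemma abs_integrable_scaleR_const:
 assumes "integrable M (\<phi> :: 'b => real)" shows "abs_integrable M (%z. \<phi> z *\<^sub>R x)"
 using assms nn_integral_norm_scaleR_const[of \<phi> M x]
 by (auto simp: abs_integrable_def integrable_iff_bounded ennreal_mult_less_top intro: simple_limit_scaleR)

lemma strong_integral_scaleR_const: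
 fixes x :: "'a::banach"
 assumes sp: "space M = UNIV" and \<phi>: "integrable M (\<phi> :: 'b => real)"
 shows "strong_integral M (%z. \<phi> z *\<^sub>R x) = (\<integral>z. \<phi> z \<partial>M) *\<^sub>R x"
proof -
 define T where "T g = strong_integral M (%z. g z *\<^sub>R x) - (\<integral>z. g z \<partial>M) *\<^sub>R x" for g :: "'b => real"
 have "T \<phi> = 0"
 proof (rule density_principle[OF sp, where T=T and C="2 * enorm x"])
  fix g h :: "'b => real" assume gh: "abs_integrable M g" "abs_integrable M h"
  then show "T (%z. g z + h z) = T g + T h"
   unfolding T_def by (simp add: scaleR_add_left strong_integral_add abs_integrable_scaleR_const abs_integrable_real_iff)
 next
  fix g :: "'b => real" assume g: "abs_integrable M g"
  then have gi: "integrable M g" by (simp add: abs_integrable_real_iff)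
  let ?n = "\<integral>\<^sup>+z. enorm (g z) \<partial>M"
  have "enorm (strong_integral M (%z. g z *\<^sub>R x)) <= enorm x * ?n"
   using strong_integral_norm_le[OF abs_integrable_scaleR_const[OF gi, of x]] nn_integral_norm_scaleR_const[of g M x] gi by auto
  moreover have "enorm ((\<integral>z. g z \<partial>M) *\<^sub>R x) <= enorm x * ?n"
   using integral_norm_bound_ennreal[OF gi] by (simp add: ennreal_mult mult.commute mult_left_mono)
  moreover have "enorm (T g) <= enorm (strong_integral M (%z. g z *\<^sub>R x)) + enorm ((\<integral>z. g z \<partial>M) *\<^sub>R x)"
   unfolding T_def by (simp add: norm_triangle_ineq4 del: norm_scaleR flip: ennreal_plus)
  ultimately show "enorm (T g) <= 2 * enorm x * ?n" by (smt (verit, best) add_mono distrib_right mult_2 order_trans)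
 next
  fix A and r :: real assume A: "A \<in> sets M" "emeasure M A < \<infinity>"
  have "strong_integral M (%z. (indicator A z *\<^sub>R r) *\<^sub>R x) = measure M A *\<^sub>R (r *\<^sub>R x)"
   using strong_integral_indicator[OF A, of "r *\<^sub>R x"] by simp
  moreover have "(\<integral>z. indicator A z *\<^sub>R r \<partial>M) = measure M A * r" using A sp by simp
  ultimately show "T (%z. indicator A z *\<^sub>R r) = 0" unfolding T_def using sp by simp
 next
  show "abs_integrable M \<phi>" using \<phi> by (simp add: abs_integrable_real_iff)
 qed (auto simp: ennreal_mult_less_top)
 then show ?thesis by (simp add: T_def)
qed

text \<open>The substitution formula for nonnegative functions implies the one for vector-valued functions, because
both sides can be computed by the same simple approximations.\<close>

lemma change_of_variables:
 fixes g :: "'b => 'a::banach"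
 assumes sp: "space M = UNIV" and T: "T \<in> measurable M M" and c: "0 <= c"
  and nn: "!!f :: 'b => ennreal. f \<in> borel_measurable M ==> (\<integral>\<^sup>+z. f (T z) \<partial>M) = ennreal c * (\<integral>\<^sup>+z. f z \<partial>M)"
  and g: "abs_integrable M g"
 shows "abs_integrable M (%z. g (T z))" "strong_integral M (%z. g (T z)) = c *\<^sub>R strong_integral M g"
proof -
 have norm_eq: "(\<integral>\<^sup>+z. enorm (h (T z)) \<partial>M) = ennreal c * (\<integral>\<^sup>+z. enorm (h z) \<partial>M)"
  if "abs_integrable M h" for h :: "'b => 'a"
  using nn[of "%z. enorm (h z)"] simple_limit_norm_measurable[of M h] that by (auto simp: abs_integrable_def)
 have ai: "abs_integrable M (%z. h (T z))" if "abs_integrable M h" for h :: "'b => 'a"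
  using that norm_eq[OF that] simple_limit_compose[of M h T M] T by (auto simp: abs_integrable_def ennreal_mult_less_top)
 show "abs_integrable M (%z. g (T z))" using ai[OF g] .
 define D where "D h = strong_integral M (%z. h (T z)) - c *\<^sub>R strong_integral M h" for h :: "'b => 'a"
 have "D g = 0"
 proof (rule density_principle[OF sp, where T=D and C="2 * ennreal c"])
  fix h k :: "'b => 'a" assume "abs_integrable M h" "abs_integrable M k"
  then show "D (%z. h z + k z) = D h + D k"
   unfolding D_def by (simp add: scaleR_add_right strong_integral_add ai)
 next
  fix h :: "'b => 'a" assume h: "abs_integrable M h"
  let ?n = "\<integral>\<^sup>+z. enorm (h z) \<partial>M"
  have "enorm (strong_integral M (%z. h (T z))) <= ennreal c * ?n"
   using strong_integral_norm_le[OF ai[OF h]] norm_eq[OF h] by simp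
  moreover have "enorm (c *\<^sub>R strong_integral M h) <= ennreal c * ?n"
   using strong_integral_norm_le[OF h] c by (simp add: ennreal_mult mult_left_mono)
  moreover have "enorm (D h) <= enorm (strong_integral M (%z. h (T z))) + enorm (c *\<^sub>R strong_integral M h)"
   unfolding D_def by (simp add: norm_triangle_ineq4 del: norm_scaleR flip: ennreal_plus)
  ultimately show "enorm (D h) <= 2 * ennreal c * ?n" by (smt (verit, best) add_mono distrib_right mult_2 order_trans)
 next
  fix A and x :: 'a assume A: "A \<in> sets M" "emeasure M A < \<infinity>"
  have TA: "T -` A \<in> sets M" using measurable_sets[OF T A(1)] sp by simp
  have "emeasure M (T -` A) = (\<integral>\<^sup>+z. indicator A (T z) \<partial>M)"
   using nn_integral_indicator[OF TA] by (simp add: indicator_vimage[symmetric] indicator_def)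
  also have "\<dots> = ennreal c * emeasure M A" using nn[of "indicator A"] A by simp
  finally have e: "emeasure M (T -` A) = ennreal c * emeasure M A" .
  then have m: "measure M (T -` A) = c * measure M A" using c by (simp add: measure_def enn2real_mult)
  have "strong_integral M (%z. indicator A (T z) *\<^sub>R x) = strong_integral M (%z. indicator (T -` A) z *\<^sub>R x)" by (simp add: indicator_def)
  also have "\<dots> = (c * measure M A) *\<^sub>R x"
   using strong_integral_indicator[OF TA, of x] e A(2) m by (simp add: ennreal_mult_less_top)
  finally show "D (%z. indicator A z *\<^sub>R x) = 0"
   unfolding D_def strong_integral_indicator[OF A] by simp
 qed (use g in \<open>auto simp: ennreal_mult_less_top\<close>)
 then show "strong_integral M (%z. g (T z)) = c *\<^sub>R strong_integral M g" by (simp add: D_def)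
qed

lemma nn_integral_plane:
 assumes "f \<in> borel_measurable (borel :: plane measure)"
 shows "(NN z. f z) = (NN y. NN x. f (x, y))"
  and "(NN z. f z) = (NN x. NN y. f (x, y))"
proof -
 have "f \<in> borel_measurable (lborel \<Otimes>\<^sub>M lborel)" using assms by (simp add: lborel_prod)
 then show "(NN z. f z) = (NN y. NN x. f (x, y))"
  "(NN z. f z) = (NN x. NN y. f (x, y))"
  by (simp_all add: lborel_pair.nn_integral_snd lborel.nn_integral_fst flip: lborel_prod)
qed

lemma measurable_section_integral:
 assumes "f \<in> borel_measurable (borel :: plane measure)"
 shows "(%y. NN x. f (x, y)) \<in> Borel"
  and "(%x. f (x, y)) \<in> Borel"
proof -
 have [measurable]: "f \<in> borel_measurable (borel \<Otimes>\<^sub>M borel)" using assms by (simp add: borel_prod)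
 show "(%y. NN x. f (x, y)) \<in> Borel" by measurable
 show "(%x. f (x, y)) \<in> Borel" by measurable
qed

lemma AE_plane:
 assumes "AE z in (lborel :: plane measure). P z"
 shows "AE y in lborel. AE x in lborel. P (x, y)"
proof -
 obtain N where N: "{z. \<not> P z} \<subseteq> N" "emeasure lborel N = 0" "N \<in> sets (borel :: plane measure)"
  using AE_E[OF assms] by auto
 have "(NN y. NN x. indicator N (x, y)) = 0"
  using nn_integral_plane(1)[of "indicator N"] N by simp
 moreover have N': "(indicator N :: plane => ennreal) \<in> Borel" using N(3) by simp
 ultimately have "AE y in lborel. (NN x. indicator N (x, y)) = 0" by (subst (asm) nn_integral_0_iff_AE) (use measurable_section_integral(1)[OF N'] in simp_all)
 then show ?thesis
 proof eventually_elim
  case (elim y)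
  have "(%x. indicator N (x, y) :: ennreal) \<in> borel_measurable lborel" using measurable_section_integral(2)[OF N'] by simp
  then have "AE x in lborel. indicator N (x, y) = (0::ennreal)" using elim nn_integral_0_iff_AE by blast
  then show ?case by eventually_elim (use N(1) in \<open>auto simp: indicator_def split: if_splits\<close>)
 qed
qed

text \<open>Affine maps in \<open>x\<close> with \<open>y\<close> fixed: they produce the translations, the dilations of the strip and the
reflections \<open>x \<mapsto> c - x\<close>.\<close>

definition shear :: "real => real => plane => plane" where
 "shear c d z = (c * fst z + d, snd z)"

lemma measurable_shear [measurable]: "shear c d \<in> Borel"
 unfolding shear_def by (intro borel_measurable_continuous_onI continuous_intros)

lemma nn_integral_shear:
 assumes [measurable]: "f \<in> borel_measurable (borel :: plane measure)" and c: "c ~= 0"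
 shows "(NN z. f (shear c d z)) = ennreal (1 / \<bar>c\<bar>) * (NN z. f z)"
proof -
 note f2 = measurable_section_integral(2)[OF assms(1)]
 have m: "(%y. NN x. f (x, y)) \<in> borel_measurable lborel"
  using measurable_section_integral(1)[OF assms(1)] by simp
 have eq: "(NN x. f (c * x + d, y)) = ennreal (1 / \<bar>c\<bar>) * (NN x. f (x, y))" for y
 proof -
  have "ennreal (1 / \<bar>c\<bar>) * (NN x. f (x, y)) = ennreal (1 / \<bar>c\<bar>) * (ennreal \<bar>c\<bar> * (NN x. f (d + c * x, y)))"
   using nn_integral_real_affine[OF f2 c, of y d] by simp
  also have "\<dots> = (NN x. f (c * x + d, y))"
   using c by (simp add: add.commute mult.assoc[symmetric] flip: ennreal_mult)
  finally show ?thesis by simp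
 qed
 have "(NN z. f (shear c d z)) = (NN y. NN x. f (c * x + d, y))"
 proof -
  have "(%z. f (shear c d z)) \<in> Borel" by measurable
  from nn_integral_plane(1)[OF this] show ?thesis by (simp add: shear_def)
 qed
 also have "\<dots> = ennreal (1 / \<bar>c\<bar>) * (NN y. NN x. f (x, y))"
  unfolding eq by (rule nn_integral_cmult[OF m])
 finally show ?thesis using nn_integral_plane(1)[OF assms(1)] by simp
qed

lemma strong_integral_shear:
 fixes g :: "plane => 'a::banach"
 assumes "c ~= 0" "L1 g"
 shows "L1 (%z. g (shear c d z))"
  "strong_integral lborel (%z. g (shear c d z)) = (1 / \<bar>c\<bar>) *\<^sub>R strong_integral lborel g"
 using change_of_variables[of lborel "shear c d" "1 / \<bar>c\<bar>" g] nn_integral_shear[OF _ assms(1)] assms by auto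

lemma AE_shear:
 assumes "AE z in lborel. P z" and c: "c ~= 0" shows "AE z in lborel. P (shear c d z)"
proof -
 obtain N where N: "{z. \<not> P z} \<subseteq> N" "emeasure lborel N = 0" "N \<in> sets (borel :: plane measure)"
  using AE_E[OF assms(1)] by auto
 have "(NN z. indicator N (shear c d z)) = 0"
  using nn_integral_shear[OF _ c, of "indicator N" d] N by simp
 moreover have "(%z. indicator N (shear c d z) :: ennreal) \<in> borel_measurable lborel"
  using N(3) by measurable
 ultimately have "AE z in lborel. indicator N (shear c d z) = (0::ennreal)"
  using nn_integral_0_iff_AE by blast
 then show ?thesis by eventually_elim (use N(1) in \<open>auto simp: indicator_def split: if_splits\<close>)
qed

section \<open>Pairing with test functions; the fundamental lemma\<close>

definition pairing :: "(plane => 'a::banach) => (plane => real) => 'a" where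
 "pairing V \<phi> = strong_integral lborel (%z. \<phi> z *\<^sub>R V z)"

definition tensor :: "(real => real) => (real => real) => plane => real" where
 "tensor a b z = a (fst z) * b (snd z)"

definition bounded_measurable :: "(plane => real) => bool" where
 "bounded_measurable \<phi> \<longleftrightarrow> \<phi> \<in> Borel & (\<exists>C. \<forall>z. \<bar>\<phi> z\<bar> <= C)"

lemma bounded_measurableI: "\<phi> \<in> Borel ==> (!!z. \<bar>\<phi> z\<bar> <= C) ==> bounded_measurable \<phi>"
 unfolding bounded_measurable_def by blast

lemma bounded_measurable_abs_integrable:
 "L1 V ==> bounded_measurable \<phi> ==> L1 (%z. \<phi> z *\<^sub>R V z)"
 unfolding bounded_measurable_def using abs_integrable_bounded_scaleR[of lborel V \<phi>] by auto

lemma bounded_measurable_add: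
 assumes "bounded_measurable \<phi>" "bounded_measurable \<psi>" shows "bounded_measurable (%z. \<phi> z + \<psi> z)"
proof -
 obtain C D where "!!z. \<bar>\<phi> z\<bar> <= C" "!!z. \<bar>\<psi> z\<bar> <= D" using assms unfolding bounded_measurable_def by metis
 then have "\<bar>\<phi> z + \<psi> z\<bar> <= C + D" for z by (meson abs_triangle_ineq add_mono order_trans)
 then show ?thesis using assms by (intro bounded_measurableI[where C="C+D"]) (auto simp: bounded_measurable_def)
qed

lemma bounded_measurable_mult:
 assumes "bounded_measurable \<phi>" "bounded_measurable \<psi>" shows "bounded_measurable (%z. \<phi> z * \<psi> z)"
proof -
 obtain C D where *: "!!z. \<bar>\<phi> z\<bar> <= C" "!!z. \<bar>\<psi> z\<bar> <= D" using assms unfolding bounded_measurable_def by metis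
 have "\<bar>\<phi> z * \<psi> z\<bar> <= C * D" for z
  unfolding abs_mult by (intro mult_mono *) (use *(1)[of z] in linarith, auto)
 then show ?thesis using assms by (intro bounded_measurableI[where C="C*D"]) (auto simp: bounded_measurable_def)
qed

lemma bounded_measurable_const [simp]: "bounded_measurable (%z. c)"
 by (intro bounded_measurableI[where C="\<bar>c\<bar>"]) auto

lemma bounded_measurable_cmult: "bounded_measurable \<phi> ==> bounded_measurable (%z. c * \<phi> z)"
 using bounded_measurable_mult[of "%_. c" \<phi>] by simp

lemma bounded_measurable_diff: "bounded_measurable \<phi> ==> bounded_measurable \<psi> ==> bounded_measurable (%z. \<phi> z - \<psi> z)"
 using bounded_measurable_add[of \<phi> "%z. (-1) * \<psi> z"] bounded_measurable_cmult[of \<psi> "-1"] by simp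

lemma bounded_measurable_indicator: "A \<in> sets borel ==> bounded_measurable (indicator A)"
 by (intro bounded_measurableI[where C=1]) (auto simp: indicator_def)

lemma bounded_measurable_sum:
 "(!!i. i \<in> F ==> bounded_measurable (\<phi> i)) ==> bounded_measurable (%z. \<Sum>i\<in>F. \<phi> i z)"
 by (induction F rule: infinite_finite_induct) (auto intro: bounded_measurable_add)

lemma bounded_measurable_compose:
 "bounded_measurable \<phi> ==> T \<in> Borel ==> bounded_measurable (%z. \<phi> (T z))"
 unfolding bounded_measurable_def using measurable_compose[of T borel borel \<phi> borel] by metis

lemma measurable_tensor:
 assumes [measurable]: "a \<in> Borel" "b \<in> Borel"
 shows "tensor a b \<in> Borel"
 unfolding tensor_def by (simp add: borel_prod[symmetric])

lemma bounded_measurable_tensor: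
 assumes "a \<in> Borel" "b \<in> Borel" "!!x. \<bar>a x\<bar> <= C" "!!x. \<bar>b x\<bar> <= D"
 shows "bounded_measurable (tensor a b)"
proof (rule bounded_measurableI[OF measurable_tensor[OF assms(1,2)]])
 show "\<bar>tensor a b z\<bar> <= C * D" for z
  unfolding abs_mult tensor_def by (intro mult_mono assms) (use assms(3)[of "fst z"] in linarith, auto)
qed

lemma bounded_measurable_test:
 assumes "smooth a" "supported_in c d a" "smooth b" "supported_in c' d' b"
 shows "bounded_measurable (tensor a b)"
 using supported_in_bounded[OF assms(1,2)] supported_in_bounded[OF assms(3,4)] by (metis assms(1,3) bounded_measurable_tensor smooth_measurable)

lemma pairing_add:
 assumes "L1 V" "bounded_measurable \<phi>" "bounded_measurable \<psi>"
 shows "pairing V (%z. \<phi> z + \<psi> z) = pairing V \<phi> + pairing V \<psi>"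
 unfolding pairing_def scaleR_add_left by (intro strong_integral_add bounded_measurable_abs_integrable assms)

lemma pairing_cmult:
 assumes "L1 V" "bounded_measurable \<phi>"
 shows "pairing V (%z. c * \<phi> z) = c *\<^sub>R pairing V \<phi>"
 unfolding pairing_def scaleR_scaleR[symmetric] by (intro strong_integral_scaleR bounded_measurable_abs_integrable assms)

lemma pairing_diff:
 assumes "L1 V" "bounded_measurable \<phi>" "bounded_measurable \<psi>"
 shows "pairing V (%z. \<phi> z - \<psi> z) = pairing V \<phi> - pairing V \<psi>"
 unfolding pairing_def scaleR_diff_left by (intro strong_integral_diff bounded_measurable_abs_integrable assms)

lemma pairing_add_left:
 assumes "L1 V" "L1 W" "bounded_measurable \<phi>"
 shows "pairing (%z. V z + W z) \<phi> = pairing V \<phi> + pairing W \<phi>"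
 unfolding pairing_def scaleR_add_right by (intro strong_integral_add bounded_measurable_abs_integrable assms)

lemma pairing_diff_left:
 assumes "L1 V" "L1 W" "bounded_measurable \<phi>"
 shows "pairing (%z. V z - W z) \<phi> = pairing V \<phi> - pairing W \<phi>"
 unfolding pairing_def scaleR_diff_right by (intro strong_integral_diff bounded_measurable_abs_integrable assms)

lemma pairing_scaleR_left:
 assumes "L1 V" "bounded_measurable \<phi>"
 shows "pairing (%z. c *\<^sub>R V z) \<phi> = c *\<^sub>R pairing V \<phi>"
 using pairing_cmult[OF assms, of c] unfolding pairing_def by (simp add: mult.commute)

lemma pairing_sum:
 assumes "L1 V" "!!i. i \<in> F ==> bounded_measurable (\<phi> i)"
 shows "pairing V (%z. \<Sum>i\<in>F. \<phi> i z) = (\<Sum>i\<in>F. pairing V (\<phi> i))"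
 using assms(2)
proof (induction F rule: infinite_finite_induct)
 case (insert x F)
 then show ?case by (simp add: pairing_add[OF assms(1)] bounded_measurable_sum)
qed (simp_all add: pairing_def)

lemma pairing_cong_AE: "AE z in lborel. \<phi> z *\<^sub>R V z = \<psi> z *\<^sub>R W z ==> pairing V \<phi> = pairing W \<psi>"
 unfolding pairing_def by (rule strong_integral_cong_AE)

lemma pairing_norm_le:
 assumes "L1 V" "bounded_measurable \<phi>"
 shows "enorm (pairing V \<phi>) <= (NN z. ennreal \<bar>\<phi> z\<bar> * enorm (V z))"
 using strong_integral_norm_le[OF bounded_measurable_abs_integrable[OF assms]]
 unfolding pairing_def by (simp add: ennreal_mult)

lemma measurable_norm_abs_integrable:
 "L1 V ==> (%z. norm (V z)) \<in> Borel"
 using simple_limit_norm_measurable[of lborel V] unfolding abs_integrable_def by simp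

text \<open>Dominated convergence for the weights; convergence is needed only where \<open>V\<close> does not vanish.\<close>

lemma pairing_tendsto:
 assumes V: "L1 V" and m: "!!j. \<phi> j \<in> Borel" "\<psi> \<in> Borel"
  and C: "!!j z. \<bar>\<phi> j z\<bar> <= C" and lim: "AE z in lborel. V z ~= 0 --> (%j::nat. \<phi> j z) ---> \<psi> z"
  and b: "!!z. \<bar>\<psi> z\<bar> <= C"
 shows "(%j. pairing V (\<phi> j)) ---> pairing V \<psi>"
proof -
 note [measurable] = m measurable_norm_abs_integrable[OF V]
 have bm: "bounded_measurable (\<phi> j)" "bounded_measurable \<psi>" for j using bounded_measurableI[OF m(1) C] bounded_measurableI[OF m(2) b] by blast+
 have "(%j. NN z. ennreal \<bar>\<phi> j z - \<psi> z\<bar> * enorm (V z)) ---> nn_integral lborel (%z::plane. 0)"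
 proof (rule nn_integral_dominated_convergence[where w="%z. ennreal (2 * C) * enorm (V z)"])
  have "(NN z. ennreal (2 * C) * enorm (V z)) = ennreal (2 * C) * (NN z. enorm (V z))" by (rule nn_integral_cmult) auto
  then show "(NN z. ennreal (2 * C) * enorm (V z)) < \<infinity>"
   using V by (auto simp: abs_integrable_def ennreal_mult_less_top)
  show "AE z in lborel. ennreal \<bar>\<phi> j z - \<psi> z\<bar> * enorm (V z) <= ennreal (2 * C) * enorm (V z)" for j
  proof (intro AE_I2 mult_right_mono ennreal_leI)
   fix z show "\<bar>\<phi> j z - \<psi> z\<bar> <= 2 * C" using C[of j z] b[of z] by linarith
  qed auto
  show "AE z in lborel. (%j. ennreal \<bar>\<phi> j z - \<psi> z\<bar> * enorm (V z)) ---> 0"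
   using lim
  proof eventually_elim
   case (elim z)
   show ?case
   proof (cases "V z = 0")
    case False
    then have "(%j. ennreal (\<bar>\<phi> j z - \<psi> z\<bar> * norm (V z))) ---> ennreal (\<bar>\<psi> z - \<psi> z\<bar> * norm (V z))"
     using elim by (intro tendsto_ennrealI tendsto_intros) auto
    then show ?thesis by (simp add: ennreal_mult)
   qed simp
  qed
 qed auto
 then have l0: "(%j. NN z. ennreal \<bar>\<phi> j z - \<psi> z\<bar> * enorm (V z)) ---> 0" by simp
 have "(%j. enorm (pairing V (%z. \<phi> j z - \<psi> z))) ---> 0"
 proof (rule tendsto_sandwich[OF _ _ tendsto_const l0])
  show "\<forall>\<^sub>F j in sequentially. enorm (pairing V (%z. \<phi> j z - \<psi> z))
    <= (NN z. ennreal \<bar>\<phi> j z - \<psi> z\<bar> * enorm (V z))" by (intro always_eventually allI pairing_norm_le[OF V] bounded_measurable_diff bm)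
 qed simp
 then have "(%j. pairing V (%z. \<phi> j z - \<psi> z)) ---> 0" by (rule ennreal_tendsto_0_D)
 then show ?thesis unfolding pairing_diff[OF V bm] by (simp add: LIM_zero_iff)
qed

lemma pairing_shear:
 assumes V: "L1 V" and \<phi>: "bounded_measurable \<phi>" and c: "c ~= 0"
 shows "pairing (%z. V (shear c d z)) (%z. \<phi> (shear c d z)) = (1 / \<bar>c\<bar>) *\<^sub>R pairing V \<phi>"
 using strong_integral_shear(2)[OF c bounded_measurable_abs_integrable[OF V \<phi>], of d] unfolding pairing_def .

text \<open>The inequality of the fundamental lemma for a general weight. It is inherited by sums and bounded limits, so it
spreads from smooth tensors to rectangles, open sets and Borel sets. It is an inequality rather than a linear
identity and hence is not stable under differences; this is why no Dynkin class argument is used.\<close>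

definition dominated_pairing where
 "dominated_pairing H M \<phi> \<longleftrightarrow> bounded_measurable \<phi> & (\<forall>z. 0 <= \<phi> z) &
   enorm (pairing H \<phi>) <= (NN z. ennreal (\<phi> z) * M z)"

context
 fixes H :: "plane => 'a::banach" and M :: "plane => ennreal"
 assumes H: "L1 H" and M [measurable]: "M \<in> Borel"
  and Mfin: "(NN z. M z) < \<infinity>"
begin

lemma dominated_pairing_add:
 assumes "dominated_pairing H M \<phi>" "dominated_pairing H M \<psi>" shows "dominated_pairing H M (%z. \<phi> z + \<psi> z)"
proof -
 have bm: "bounded_measurable \<phi>" "bounded_measurable \<psi>" and nn: "!!z. 0 <= \<phi> z" "!!z. 0 <= \<psi> z"
  using assms by (auto simp: dominated_pairing_def)
 have [measurable]: "\<phi> \<in> Borel" "\<psi> \<in> Borel" using bm by (auto simp: bounded_measurable_def)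
 have "enorm (pairing H (%z. \<phi> z + \<psi> z)) <= enorm (pairing H \<phi>) + enorm (pairing H \<psi>)"
  unfolding pairing_add[OF H bm] by (simp add: norm_triangle_ineq flip: ennreal_plus)
 also have "\<dots> <= (NN z. ennreal (\<phi> z) * M z) + (NN z. ennreal (\<psi> z) * M z)"
  using assms by (intro add_mono) (auto simp: dominated_pairing_def)
 also have "\<dots> = (NN z. ennreal (\<phi> z + \<psi> z) * M z)" by (subst nn_integral_add[symmetric]) (auto simp: nn distrib_right intro!: nn_integral_cong)
 finally show ?thesis using bm nn by (auto simp: dominated_pairing_def bounded_measurable_add)
qed

lemma dominated_pairing_0: "dominated_pairing H M (%z. 0)"
 by (simp add: dominated_pairing_def pairing_def)

lemma dominated_pairing_sum:
 "(!!i. i \<in> F ==> dominated_pairing H M (\<phi> i)) ==> dominated_pairing H M (%z. \<Sum>i\<in>F. \<phi> i z)"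
 by (induction F rule: infinite_finite_induct) (auto intro: dominated_pairing_add dominated_pairing_0)

lemma dominated_pairing_limit:
 assumes d: "!!j::nat. dominated_pairing H M (\<phi> j)" and C: "!!j z. \<phi> j z <= C"
  and \<psi>: "\<psi> \<in> Borel" "!!z. 0 <= \<psi> z" "!!z. \<psi> z <= C"
  and lim: "AE z in lborel. (%j. \<phi> j z) ---> \<psi> z"
 shows "dominated_pairing H M \<psi>"
proof -
 have nn: "0 <= \<phi> j z" and m: "\<phi> j \<in> Borel" for j z
  using d[of j] unfolding dominated_pairing_def bounded_measurable_def by blast+
 note [measurable] = m \<psi>(1)
 have "(%j. pairing H (\<phi> j)) ---> pairing H \<psi>" by (rule pairing_tendsto[OF H m \<psi>(1), where C=C]) (use lim nn C \<psi> in auto)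
 then have 1: "(%j. enorm (pairing H (\<phi> j))) ---> enorm (pairing H \<psi>)" by (intro tendsto_ennrealI tendsto_norm)
 have "AE z in lborel. M z < \<infinity>" using nn_integral_PInf_AE[of M lborel] Mfin by (auto simp: less_top)
 have 2: "(%j. NN z. ennreal (\<phi> j z) * M z) ---> (NN z. ennreal (\<psi> z) * M z)"
 proof (rule nn_integral_dominated_convergence[where w="%z. ennreal C * M z"])
  show "(NN z. ennreal C * M z) < \<infinity>"
   using Mfin by (subst nn_integral_cmult) (auto simp: ennreal_mult_less_top)
  show "AE z in lborel. ennreal (\<phi> j z) * M z <= ennreal C * M z" for j by (intro AE_I2 mult_right_mono ennreal_leI C) auto
  show "AE z in lborel. (%j. ennreal (\<phi> j z) * M z) ---> ennreal (\<psi> z) * M z"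
   using lim \<open>AE z in lborel. M z < \<infinity>\<close>
  proof eventually_elim
   case (elim z)
   have "(%j. M z * ennreal (\<phi> j z)) ---> M z * ennreal (\<psi> z)"
    using elim by (intro ennreal_tendsto_cmult tendsto_ennrealI) auto
   then show ?case by (simp add: mult.commute)
  qed
 qed auto
 have "enorm (pairing H \<psi>) <= (NN z. ennreal (\<psi> z) * M z)" by (rule LIMSEQ_le[OF 1 2]) (use d in \<open>auto simp: dominated_pairing_def\<close>)
 then show ?thesis unfolding dominated_pairing_def using \<psi> by (auto intro: bounded_measurableI[where C=C])
qed

context
 fixes c1 d1 c2 d2 :: real
 assumes test: "!!a b. smooth a ==> smooth b ==> supported_in c1 d1 a ==> supported_in c2 d2 b ==>
   (!!x. 0 <= a x) ==> (!!x. 0 <= b x) ==>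
   enorm (pairing H (tensor a b)) <= (NN z. ennreal (tensor a b z) * M z)"
begin

text \<open>Indicators of open rectangles are pointwise limits of products of smooth cutoffs.\<close>

lemma dominated_open_rect:
 assumes "c1 <= \<alpha>" "\<beta> <= d1" "c2 <= \<gamma>" "\<delta> <= d2"
 shows "dominated_pairing H M (indicator ({\<alpha><..<\<beta>} \<times> {\<gamma><..<\<delta>}))"
proof -
 define w where "w p q j x = step (real (Suc j) * (x - p)) * step (real (Suc j) * (q - x))" for p q j x
 have ws: "smooth (w p q j)" for p q j
 proof -
  have "smooth (%x. step (real (Suc j) * x + (- real (Suc j) * p)))" by (rule smooth_affine[OF smooth_step])
  moreover have "smooth (%x. step ((- real (Suc j)) * x + real (Suc j) * q))" by (rule smooth_affine[OF smooth_step])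
  ultimately have "smooth (%x. step (real (Suc j) * x + (- real (Suc j) * p)) * step ((- real (Suc j)) * x + real (Suc j) * q))" by (rule smooth_mult)
  moreover have "w p q j = (%x. step (real (Suc j) * x + (- real (Suc j) * p)) * step ((- real (Suc j)) * x + real (Suc j) * q))"
   by (auto simp: w_def algebra_simps)
  ultimately show ?thesis by simp
 qed
 have wp: "supported_in p q (w p q j)" for p q j
  unfolding supported_in_def
 proof (intro exI conjI allI impI)
  fix x assume "w p q j x ~= 0"
  then have "\<not> real (Suc j) * (x - p) <= 1" "\<not> real (Suc j) * (q - x) <= 1" using step_0 by (auto simp: w_def)
  then show "p + 1 / real (Suc j) <= x" "x <= q - 1 / real (Suc j)" by (auto simp: field_simps)
 qed auto
 have w0: "0 <= w p q j x" and w1: "w p q j x <= 1" for p q j x by (auto simp: w_def step_nonneg step_le_1 mult_le_one)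
 have wl: "(%j. w p q j x) ---> indicator {p<..<q} x" for p q x
 proof (cases "x \<in> {p<..<q}")
  case True
  define e where "e = min (x - p) (q - x)"
  have e: "e > 0" using True by (auto simp: e_def)
  obtain J :: nat where J: "2 / e < real J" using reals_Archimedean2 by blast
  have "w p q j x = 1" if "j \<ge> J" for j
  proof -
   have "2 / e <= real (Suc j)" using J that by linarith
   then have "2 <= real (Suc j) * e" using e by (simp add: field_simps)
   moreover have "real (Suc j) * e <= real (Suc j) * (x - p)" "real (Suc j) * e <= real (Suc j) * (q - x)" by (intro mult_left_mono; simp add: e_def)+
   ultimately show ?thesis unfolding w_def by (subst (1 2) step_1) linarith+
  qed
  then have "eventually (%j. w p q j x = 1) sequentially" using eventually_sequentially by blast
  then show ?thesis using True by (simp add: tendsto_eventually)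
 next
  case False
  then have "w p q j x = 0" for j
  proof -
   have "real (Suc j) * (x - p) <= 0 \<or> real (Suc j) * (q - x) <= 0"
    using False by (auto intro!: mult_nonneg_nonpos simp: not_less)
   then show ?thesis unfolding w_def
    using step_0[of "real (Suc j) * (x - p)"] step_0[of "real (Suc j) * (q - x)"] by force
  qed
  then show ?thesis using False by simp
 qed
 show ?thesis
 proof (rule dominated_pairing_limit[where C=1 and \<phi>="%j. tensor (w \<alpha> \<beta> j) (w \<gamma> \<delta> j)"])
  show "dominated_pairing H M (tensor (w \<alpha> \<beta> j) (w \<gamma> \<delta> j))" for j
   unfolding dominated_pairing_def
  proof (intro conjI allI)
   show "bounded_measurable (tensor (w \<alpha> \<beta> j) (w \<gamma> \<delta> j))" by (rule bounded_measurable_test[OF ws wp ws wp])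
   show "0 <= tensor (w \<alpha> \<beta> j) (w \<gamma> \<delta> j) z" for z by (simp add: tensor_def w0)
   show "enorm (pairing H (tensor (w \<alpha> \<beta> j) (w \<gamma> \<delta> j))) <= (NN z. ennreal (tensor (w \<alpha> \<beta> j) (w \<gamma> \<delta> j) z) * M z)"
    by (intro test ws w0 supported_in_mono[OF wp] assms)
  qed
  show "tensor (w \<alpha> \<beta> j) (w \<gamma> \<delta> j) z <= 1" for j z by (simp add: tensor_def mult_le_one w0 w1)
  show "AE z in lborel. (%j. tensor (w \<alpha> \<beta> j) (w \<gamma> \<delta> j) z) ---> indicator ({\<alpha><..<\<beta>} \<times> {\<gamma><..<\<delta>}) z"
  proof (intro AE_I2)
   fix z :: "plane"
   have "(%j. tensor (w \<alpha> \<beta> j) (w \<gamma> \<delta> j) z) ---> indicator {\<alpha><..<\<beta>} (fst z) * indicator {\<gamma><..<\<delta>} (snd z)"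
    unfolding tensor_def by (intro tendsto_mult wl)
   then show "(%j. tensor (w \<alpha> \<beta> j) (w \<gamma> \<delta> j) z) ---> indicator ({\<alpha><..<\<beta>} \<times> {\<gamma><..<\<delta>}) z"
    by (cases z) (simp add: indicator_times)
  qed
  show "indicator ({\<alpha><..<\<beta>} \<times> {\<gamma><..<\<delta>}) \<in> Borel" by (intro borel_measurable_indicator borel_open open_Times) auto
 qed (auto simp: indicator_def)
qed

text \<open>A half-open rectangle is a decreasing limit of open ones.\<close>

lemma dominated_half_open_rect:
 assumes "c1 < \<alpha>" "\<beta> <= d1" "c2 < \<gamma>" "\<delta> <= d2"
 shows "dominated_pairing H M (indicator ({\<alpha>..<\<beta>} \<times> {\<gamma>..<\<delta>}))"
proof (rule dominated_pairing_limit[where C=1 and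
   \<phi>="%j. indicator ({\<alpha> - (\<alpha> - c1) / real (Suc j)<..<\<beta>} \<times> {\<gamma> - (\<gamma> - c2) / real (Suc j)<..<\<delta>})"])
 show "dominated_pairing H M (indicator ({\<alpha> - (\<alpha> - c1) / real (Suc j)<..<\<beta>} \<times> {\<gamma> - (\<gamma> - c2) / real (Suc j)<..<\<delta>}))" for j
 proof (rule dominated_open_rect)
  have "(\<alpha> - c1) / real (Suc j) <= \<alpha> - c1" using assms by (simp add: divide_le_eq mult_le_cancel_left1)
  then show "c1 <= \<alpha> - (\<alpha> - c1) / real (Suc j)" by simp
  have "(\<gamma> - c2) / real (Suc j) <= \<gamma> - c2" using assms by (simp add: divide_le_eq mult_le_cancel_left1)
  then show "c2 <= \<gamma> - (\<gamma> - c2) / real (Suc j)" by simp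
 qed (use assms in auto)
 have l: "(%j. indicator {p - (p - c) / real (Suc j)<..<q} x :: real) ---> indicator {p..<q} x" if "c < p" for p q c x
 proof (cases "x \<ge> p")
  case True
  have "p - (p - c) / real (Suc j) < x" for j
   using True that by (smt (verit) divide_pos_pos of_nat_0_less_iff zero_less_Suc)
  then have "(%j. indicator {p - (p - c) / real (Suc j)<..<q} x :: real) = (%j. indicator {p..<q} x)"
   using True by (auto simp: indicator_def)
  then show ?thesis by simp
 next
  case False
  have "(%j. p - (p - c) / real (Suc j)) ---> p - 0" by (intro tendsto_diff tendsto_const LIMSEQ_Suc[OF lim_const_over_n])
  then have "eventually (%j. x < p - (p - c) / real (Suc j)) sequentially"
   using False by (intro order_tendstoD(1)) auto
  then have "eventually (%j. indicator {p - (p - c) / real (Suc j)<..<q} x = (0::real)) sequentially" by eventually_elim (auto simp: indicator_def)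
  then show ?thesis using False by (simp add: tendsto_eventually)
 qed
 show "AE z in lborel. (%j. indicator ({\<alpha> - (\<alpha> - c1) / real (Suc j)<..<\<beta>} \<times> {\<gamma> - (\<gamma> - c2) / real (Suc j)<..<\<delta>}) z :: real)
   ---> indicator ({\<alpha>..<\<beta>} \<times> {\<gamma>..<\<delta>}) z"
 proof (intro AE_I2)
  fix z :: "plane"
  show "(%j. indicator ({\<alpha> - (\<alpha> - c1) / real (Suc j)<..<\<beta>} \<times> {\<gamma> - (\<gamma> - c2) / real (Suc j)<..<\<delta>}) z :: real)
   ---> indicator ({\<alpha>..<\<beta>} \<times> {\<gamma>..<\<delta>}) z"
   using tendsto_mult[OF l[OF assms(1), of \<beta> "fst z"] l[OF assms(3), of \<delta> "snd z"]] by (cases z) (simp add: indicator_times)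
 qed
 show "indicator ({\<alpha>..<\<beta>} \<times> {\<gamma>..<\<delta>}) \<in> Borel" by (intro borel_measurable_indicator) (simp add: borel_prod[symmetric])
qed (auto simp: indicator_def)

text \<open>An open set is the increasing union of the dyadic squares of side \<open>2\<^sup>-\<^sup>n\<close> contained in it, and squares
of one generation are disjoint.\<close>

lemma dominated_open:
 assumes U: "open U" "U \<subseteq> {c1<..<d1} \<times> {c2<..<d2}"
 shows "dominated_pairing H M (indicator U)"
proof -
 define Q where "Q n k = {x::real. \<lfloor>2 ^ n * x\<rfloor> = k}" for n :: nat and k :: int
 have Q: "Q n k = {real_of_int k / 2 ^ n..<(real_of_int k + 1) / 2 ^ n}" for n k
 proof -
  have "\<lfloor>2 ^ n * x\<rfloor> = k \<longleftrightarrow> real_of_int k / 2 ^ n <= x & x < (real_of_int k + 1) / 2 ^ n" for x :: real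
  proof -
   have p: "(0::real) < 2 ^ n" by simp
   show ?thesis unfolding floor_eq_iff pos_divide_le_eq[OF p] pos_less_divide_eq[OF p] by (simp only: mult.commute)
  qed
  then show ?thesis unfolding Q_def by (intro set_eqI) (simp only: mem_Collect_eq atLeastLessThan_iff)
 qed
 (* The generation n squares contained in U; they are indexed by the corner of the square. *)
 define K where "K n = {(k, l). Q n k \<times> Q n l \<subseteq> U}" for n
 have ne: "real_of_int k / 2 ^ n \<in> Q n k" for n k by (simp add: Q divide_strict_right_mono)
 have corner: "c < real_of_int k / 2 ^ n & (real_of_int k + 1) / 2 ^ n <= d" if "Q n k \<subseteq> {c<..<d}" for n k c d
 proof
  show "c < real_of_int k / 2 ^ n" using ne[of k n] that by auto
  show "(real_of_int k + 1) / 2 ^ n <= d"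
  proof (rule ccontr)
   assume *: "\<not> (real_of_int k + 1) / 2 ^ n <= d"
   have "real_of_int k / 2 ^ n < d" using ne[of k n] that by auto
   then have "d \<in> Q n k" using * by (auto simp: Q)
   then show False using that by auto
  qed
 qed
 have sub: "Q n k \<subseteq> {c1<..<d1}" "Q n l \<subseteq> {c2<..<d2}" if "(k, l) \<in> K n" for k l n
  using that U(2) ne[of k n] ne[of l n] by (auto simp: K_def)
 have Kfin: "finite (K n)" for n
 proof (rule finite_subset)
  show "K n \<subseteq> {\<lfloor>2 ^ n * c1\<rfloor>..\<lfloor>2 ^ n * d1\<rfloor>} \<times> {\<lfloor>2 ^ n * c2\<rfloor>..\<lfloor>2 ^ n * d2\<rfloor>}"
  proof clarify
   fix k l assume kl: "(k, l) \<in> K n"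
   have "\<lfloor>2 ^ n * c\<rfloor> <= k & k <= \<lfloor>2 ^ n * d\<rfloor>" if "Q n k \<subseteq> {c<..<d}" for k c d
   proof -
    have "2 ^ n * c < real_of_int k" "real_of_int k + 1 <= 2 ^ n * d"
     using corner[OF that] by (simp_all add: pos_less_divide_eq pos_divide_le_eq mult.commute)
    then show ?thesis by linarith
   qed
   then show "k \<in> {\<lfloor>2 ^ n * c1\<rfloor>..\<lfloor>2 ^ n * d1\<rfloor>} & l \<in> {\<lfloor>2 ^ n * c2\<rfloor>..\<lfloor>2 ^ n * d2\<rfloor>}"
    using sub[OF kl] by auto
  qed
 qed auto
 define \<phi> where "\<phi> n z = (\<Sum>(k, l)\<in>K n. indicator (Q n k \<times> Q n l) z :: real)" for n and z :: "plane"
 have \<phi>: "\<phi> n z = indicator (K n) (\<lfloor>2 ^ n * fst z\<rfloor>, \<lfloor>2 ^ n * snd z\<rfloor>)" for n z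
 proof -
  have "\<phi> n z = (\<Sum>kl\<in>K n. if kl = (\<lfloor>2 ^ n * fst z\<rfloor>, \<lfloor>2 ^ n * snd z\<rfloor>) then 1 else 0)"
   unfolding \<phi>_def by (intro sum.cong) (auto simp: Q_def indicator_def mem_Times_iff)
  then show ?thesis using Kfin[of n] by (auto simp: indicator_def)
 qed
 show ?thesis
 proof (rule dominated_pairing_limit[where C=1 and \<phi>=\<phi>])
  show "dominated_pairing H M (\<phi> n)" for n
   unfolding \<phi>_def split_def
  proof (rule dominated_pairing_sum)
   fix i assume "i \<in> K n"
   then have "(fst i, snd i) \<in> K n" by simp
   note s = sub[OF this]
   show "dominated_pairing H M (indicator (Q n (fst i) \<times> Q n (snd i)))"
    using dominated_half_open_rect corner[OF s(1)] corner[OF s(2)] by (simp add: Q)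
  qed
  show "indicator U \<in> Borel" using U by (intro borel_measurable_indicator borel_open)
  show "AE z in lborel. (%n. \<phi> n z) ---> indicator U z"
  proof (intro AE_I2)
   fix z :: "plane"
   show "(%n. \<phi> n z) ---> indicator U z"
   proof (cases "z \<in> U")
    case False
    have "\<phi> n z = 0" for n
    proof -
     have "z \<in> Q n \<lfloor>2 ^ n * fst z\<rfloor> \<times> Q n \<lfloor>2 ^ n * snd z\<rfloor>" by (cases z) (simp add: Q_def)
     then show ?thesis using False unfolding \<phi> K_def by (auto simp: indicator_def)
    qed
    then show ?thesis using False by simp
   next
    case True
    obtain e where e: "e > 0" "ball z e \<subseteq> U" using U(1) True open_contains_ball by blast
    have "(%n. (1/2) ^ n :: real) ---> 0" by (rule LIMSEQ_realpow_zero) auto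
    then have "eventually (%n. (1/2::real) ^ n < e / 2) sequentially" using e by (intro order_tendstoD(2)) auto
    then have "eventually (%n. \<phi> n z = 1) sequentially"
    proof eventually_elim
     case (elim n)
     have "Q n \<lfloor>2 ^ n * fst z\<rfloor> \<times> Q n \<lfloor>2 ^ n * snd z\<rfloor> \<subseteq> ball z e"
     proof clarify
      fix x y assume xy: "x \<in> Q n \<lfloor>2 ^ n * fst z\<rfloor>" "y \<in> Q n \<lfloor>2 ^ n * snd z\<rfloor>"
      have d: "\<bar>s - t\<bar> < e / 2" if "\<lfloor>2 ^ n * s\<rfloor> = \<lfloor>2 ^ n * t\<rfloor>" for s t :: real
      proof -
       have "\<bar>2 ^ n * s - 2 ^ n * t\<bar> < 1" using that by linarith
       then have "2 ^ n * \<bar>s - t\<bar> < 1" by (simp add: abs_mult flip: right_diff_distrib)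
       then have "\<bar>s - t\<bar> < (1/2) ^ n" by (simp add: power_one_over pos_less_divide_eq mult.commute)
       then show ?thesis using elim by linarith
      qed
      have "dist z (x, y) <= \<bar>fst z - x\<bar> + \<bar>snd z - y\<bar>" by (cases z) (simp add: dist_prod_def dist_real_def sqrt_sum_squares_le_sum_abs)
      also have "\<dots> < e" using d[of "fst z" x] d[of "snd z" y] xy by (simp add: Q_def)
      finally show "(x, y) \<in> ball z e" by simp
     qed
     then show ?case using e(2) unfolding \<phi> K_def by (auto simp: indicator_def)
    qed
    then show ?thesis using True by (simp add: tendsto_eventually)
   qed
  qed
 qed (auto simp: \<phi> indicator_def)
qed

text \<open>Outer regularity: up to a null set, a Borel set is a decreasing limit of open sets.\<close>

lemma dominated_borel:
 assumes A: "A \<in> sets borel" "A \<subseteq> {c1<..<d1} \<times> {c2<..<d2}"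
 shows "dominated_pairing H M (indicator A)"
proof -
 have "A \<in> sets lebesgue" using A by simp
 then have "\<exists>T. open T & A \<subseteq> T & emeasure lebesgue (T - A) < ennreal (1 / real (Suc n))" for n
  using sets_lebesgue_outer_open[of A "1 / real (Suc n)"] by (metis of_nat_0_less_iff zero_less_Suc zero_less_divide_1_iff)
 then obtain T where T: "!!n. open (T n)" "!!n. A \<subseteq> T n" "!!n. emeasure lebesgue (T n - A) < ennreal (1 / real (Suc n))" by metis
 define U where "U n = ({c1<..<d1} \<times> {c2<..<d2}) \<inter> (\<Inter>i\<le>n. T i)" for n
 have Uo: "open (U n)" for n
  unfolding U_def by (intro open_Int open_Times open_INT ballI T) auto
 define N where "N = (\<Inter>n. T n) - A"
 have Nb: "N \<in> sets borel" unfolding N_def using A T(1) by (intro sets.Diff sets.countable_INT') auto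
 have "emeasure lborel N <= ennreal (1 / real (Suc n))" for n
 proof -
  have "emeasure lborel N = emeasure lebesgue N" using Nb by simp
  also have "\<dots> <= emeasure lebesgue (T n - A)"
   using A T(1)[of n] by (intro emeasure_mono) (auto simp: N_def)
  finally show ?thesis using T(3)[of n] by simp
 qed
 moreover have "(%n. ennreal (1 / real (Suc n))) ---> ennreal 0" by (intro tendsto_ennrealI LIMSEQ_Suc[OF lim_1_over_n])
 ultimately have "emeasure lborel N <= ennreal 0" by (intro LIMSEQ_le_const) auto
 then have N0: "N \<in> null_sets lborel" using Nb by auto
 show ?thesis
 proof (rule dominated_pairing_limit[where C=1 and \<phi>="%n. indicator (U n)"])
  show "dominated_pairing H M (indicator (U n))" for n by (rule dominated_open[OF Uo]) (auto simp: U_def)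
  show "AE z in lborel. (%n. indicator (U n) z :: real) ---> indicator A z"
   using AE_not_in[OF N0]
  proof eventually_elim
   case (elim z)
   show ?case
   proof (cases "z \<in> A")
    case True
    then have "z \<in> U n" for n using A T(2) by (auto simp: U_def)
    then show ?thesis using True by simp
   next
    case False
    then obtain m where m: "z \<notin> T m" using elim by (auto simp: N_def)
    have "indicator (U n) z = (0::real)" if "n \<ge> m" for n using m that by (auto simp: U_def indicator_def)
    then have "eventually (%n. indicator (U n) z = (0::real)) sequentially" using eventually_sequentially by blast
    then show ?thesis using False by (simp add: tendsto_eventually)
   qed
  qed
 qed (use A in \<open>auto simp: indicator_def intro!: borel_measurable_indicator\<close>)
qed

text \<open>If \<open>s\<close> is simple and close to \<open>H\<close> in \<open>L\<^sup>1\<close>, then on each piece where \<open>s\<close> is constant its norm integral is the norm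
of its integral, which is controlled by the inequality for that piece.\<close>

lemma dominated_norm_integral:
 assumes A: "A \<in> sets borel" "A \<subseteq> {c1<..<d1} \<times> {c2<..<d2}"
 shows "(NN z. enorm (H z) * indicator A z) <= (NN z. M z * indicator A z)"
proof -
 note [measurable] = measurable_norm_abs_integrable[OF H] A(1)
 obtain s where s: "!!i::nat. bochner_simple lborel (s i)"
  "(%i. NN x. enorm (H x - s i x)) ---> 0"
 proof (rule abs_integrable_simple_approx[OF H])
 qed (use that in auto)
 have sa: "L1 (s i)" for i by (rule simple_bochner_imp_abs_integrable[OF s(1)])
 have da: "L1 (%z. H z - s i z)" for i by (rule abs_integrable_diff[OF H sa])
 let ?e = "%i. NN x. enorm (H x - s i x)"
 have Afin: "emeasure lborel B < \<infinity>" if "B \<subseteq> A" for B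
 proof -
  have "emeasure lborel B <= emeasure lborel (cbox (c1, c2) (d1, d2))"
  proof (rule emeasure_mono)
   show "B \<subseteq> cbox (c1, c2) (d1, d2)" using that A(2) by (auto simp: cbox_Pair_eq)
  qed simp
  also have "\<dots> < \<infinity>" by (rule emeasure_lborel_cbox_finite)
  finally show ?thesis .
 qed
 have "(NN z. enorm (H z) * indicator A z) <= (NN z. M z * indicator A z) + (?e i + ?e i)" for i
 proof -
  note [measurable] = measurable_norm_abs_integrable[OF sa[of i]] measurable_norm_abs_integrable[OF da[of i]]
  have sf: "simple_function lborel (s i)" using s(1)[of i] by (auto elim: simple_bochner_integrable.cases)
  define F where "F = range (s i)"
  have Ffin: "finite F" using simple_functionD(1)[OF sf] by (simp add: F_def)
  define B where "B y = A \<inter> s i -` {y}" for y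
  have Bm [measurable]: "B y \<in> sets borel" for y
   using simple_functionD(2)[OF sf, of "{y}"] A by (auto simp: B_def)
  have sumB: "(\<Sum>y\<in>F. g z * indicator (B y) z) = g z * indicator A z" for g :: "plane => ennreal" and z
  proof -
   have "(\<Sum>y\<in>F. g z * indicator (B y) z) = (\<Sum>y\<in>F. if y = s i z then g z * indicator A z else 0)"
    by (intro sum.cong) (auto simp: B_def indicator_def)
   then show ?thesis using Ffin by (simp add: F_def)
  qed
  have one: "(NN z. enorm (s i z) * indicator (B y) z)
    <= (NN z. M z * indicator (B y) z) + (NN z. enorm (H z - s i z) * indicator (B y) z)" for y
  proof -
   have bm: "bounded_measurable (indicator (B y))" by (rule bounded_measurable_indicator[OF Bm])
   have "(NN z. enorm (s i z) * indicator (B y) z) = (NN z. enorm y * indicator (B y) z)" by (intro nn_integral_cong) (auto simp: B_def indicator_def)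
   also have "\<dots> = enorm y * emeasure lborel (B y)"
    using Bm by (intro nn_integral_cmult_indicator) auto
   also have "\<dots> = enorm (measure lborel (B y) *\<^sub>R y)"
    using Afin[of "B y"] by (simp add: ennreal_mult emeasure_eq_ennreal_measure B_def less_top mult.commute)
   also have "measure lborel (B y) *\<^sub>R y = pairing (s i) (indicator (B y))"
   proof -
    have "pairing (s i) (indicator (B y)) = strong_integral lborel (%z. indicator (B y) z *\<^sub>R y)"
     unfolding pairing_def by (rule arg_cong[where f="strong_integral lborel"]) (auto simp: B_def indicator_def)
    also have "\<dots> = measure lborel (B y) *\<^sub>R y" by (rule strong_integral_indicator) (use Bm Afin[of "B y"] in \<open>auto simp: B_def\<close>)
    finally show ?thesis by simp
   qed
   also have "pairing (s i) (indicator (B y)) = pairing H (indicator (B y)) - pairing (%z. H z - s i z) (indicator (B y))"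
    by (simp add: pairing_diff_left[OF H sa bm])
   also have "enorm (pairing H (indicator (B y)) - pairing (%z. H z - s i z) (indicator (B y)))
    <= enorm (pairing H (indicator (B y))) + enorm (pairing (%z. H z - s i z) (indicator (B y)))" by (simp add: norm_triangle_ineq4 flip: ennreal_plus)
   also have "\<dots> <= (NN z. ennreal (indicator (B y) z) * M z) + (NN z. ennreal \<bar>indicator (B y) z\<bar> * enorm (H z - s i z))"
   proof (intro add_mono pairing_norm_le da bm)
    have "dominated_pairing H M (indicator (B y))" by (rule dominated_borel[OF Bm]) (use A(2) in \<open>auto simp: B_def\<close>)
    then show "enorm (pairing H (indicator (B y))) <= (NN z. ennreal (indicator (B y) z) * M z)" by (simp add: dominated_pairing_def)
   qed
   finally show ?thesis by (simp add: ennreal_indicator mult.commute)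
  qed
  have sumI: "(\<Sum>y\<in>F. NN z. g z * indicator (B y) z) = (NN z. g z * indicator A z)"
   if [measurable]: "g \<in> Borel" for g :: "plane => ennreal"
  proof -
   have "(\<Sum>y\<in>F. NN z. g z * indicator (B y) z) = (NN z. (\<Sum>y\<in>F. g z * indicator (B y) z))" by (rule nn_integral_sum[symmetric]) measurable
   then show ?thesis by (simp only: sumB)
  qed
  have "(NN z. enorm (s i z) * indicator A z) = (\<Sum>y\<in>F. NN z. enorm (s i z) * indicator (B y) z)" by (rule sumI[symmetric]) measurable
  also have "\<dots> <= (\<Sum>y\<in>F. (NN z. M z * indicator (B y) z) + (NN z. enorm (H z - s i z) * indicator (B y) z))" by (intro sum_mono one)
  also have "\<dots> = (NN z. M z * indicator A z) + (NN z. enorm (H z - s i z) * indicator A z)"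
   unfolding sum.distrib by (intro arg_cong2[where f="(+)"] sumI) measurable
  also have "(NN z. enorm (H z - s i z) * indicator A z) <= ?e i" by (intro nn_integral_mono) (auto simp: indicator_def)
  finally have 1: "(NN z. enorm (s i z) * indicator A z) <= (NN z. M z * indicator A z) + ?e i" by (simp add: add_left_mono)
  have "(NN z. enorm (H z) * indicator A z) <= (NN z. enorm (s i z) * indicator A z + enorm (H z - s i z))"
  proof (intro nn_integral_mono)
   fix z
   have "norm (H z) <= norm (s i z) + norm (H z - s i z)" using norm_triangle_sub by blast
   then show "enorm (H z) * indicator A z <= enorm (s i z) * indicator A z + enorm (H z - s i z)" by (auto simp: indicator_def simp flip: ennreal_plus)
  qed
  also have "\<dots> = (NN z. enorm (s i z) * indicator A z) + ?e i" by (rule nn_integral_add) auto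
  also have "\<dots> <= (NN z. M z * indicator A z) + ?e i + ?e i" by (intro add_right_mono 1)
  finally show ?thesis by (simp add: add.assoc)
 qed
 moreover have "(%i. (NN z. M z * indicator A z) + (?e i + ?e i)) ---> (NN z. M z * indicator A z) + (0 + 0)" by (intro tendsto_add tendsto_const s)
 ultimately show ?thesis by (intro LIMSEQ_le_const) auto
qed

text \<open>The previous bound on the set where \<open>norm (H z) > M z\<close> forces this set to be null. The form with a majorant
\<open>M\<close>, and not only \<open>M = 0\<close>, is what turns weak derivative identities into pointwise estimates of difference quotients.\<close>

lemma fundamental_lemma_rect:
 "AE z in lborel. z \<in> {c1<..<d1} \<times> {c2<..<d2} --> enorm (H z) <= M z"
proof -
 note [measurable] = measurable_norm_abs_integrable[OF H]
 define A where "A = {z \<in> {c1<..<d1} \<times> {c2<..<d2}. M z < enorm (H z)}"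
 have "open ({c1<..<d1} \<times> {c2<..<d2})" by (intro open_Times) auto
 then have [measurable]: "{c1<..<d1} \<times> {c2<..<d2} \<in> sets (borel :: plane measure)" by (rule borel_open)
 have Am [measurable]: "A \<in> sets borel" unfolding A_def by measurable
 have le: "(NN z. enorm (H z) * indicator A z) <= (NN z. M z * indicator A z)" by (rule dominated_norm_integral[OF Am]) (auto simp: A_def)
 have "(NN z. M z * indicator A z) <= (NN z. M z)" by (intro nn_integral_mono) (auto simp: indicator_def)
 then have fin: "(NN z. M z * indicator A z) ~= \<infinity>" using Mfin by (auto simp: top_unique)
 have "(NN z. enorm (H z) * indicator A z - M z * indicator A z)
   = (NN z. enorm (H z) * indicator A z) - (NN z. M z * indicator A z)" by (rule nn_integral_diff[OF _ _ fin]) (auto simp: A_def indicator_def less_imp_le)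
 also have "\<dots> = 0" using le le_less_trans[OF le, of top] fin by (simp add: diff_eq_0_iff_ennreal less_top)
 finally have "AE z in lborel. enorm (H z) * indicator A z - M z * indicator A z = 0" by (subst (asm) nn_integral_0_iff_AE) auto
 then show ?thesis
 proof eventually_elim
  case (elim z)
  show ?case
  proof (intro impI, rule ccontr)
   assume z: "z \<in> {c1<..<d1} \<times> {c2<..<d2}" "\<not> enorm (H z) <= M z"
   then have zA: "z \<in> A" by (simp add: A_def)
   then have "enorm (H z) - M z = 0" using elim by simp
   then have "enorm (H z) <= M z" by (metis diff_eq_0_iff_ennreal ennreal_less_top infinity_ennreal_def order_less_imp_le top.not_eq_extremum)
   then show False using z by simp
  qed
 qed
qed

end
end

section \<open>Continuous representatives\<close>

lemma integrable_test:
 assumes "smooth a" "supported_in c d a" shows "integrable lborel a"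
proof -
 obtain C where C: "!!x. \<bar>a x\<bar> <= C" using supported_in_bounded[OF assms] by blast
 have "emeasure lborel {c..d} < \<infinity>" using emeasure_lborel_cbox_finite[of c d] by simp
 then have "integrable lborel (%x. C * indicator {c..d} x)" by (intro integrable_mult_right integrable_real_indicator) auto
 then show ?thesis
 proof (rule Bochner_Integration.integrable_bound)
  show "AE x in lborel. norm (a x) <= norm (C * indicator {c..d} x)"
  proof (intro AE_I2)
   fix x show "norm (a x) <= norm (C * indicator {c..d} x)"
    using C[of x] supported_in_outside[OF assms(2), of x] by (auto simp: indicator_def not_le)
  qed
 qed (use smooth_measurable[OF assms(1)] in simp)
qed

lemma tensor_outside:
 assumes "supported_in c d a" "supported_in c' d' b" "z \<notin> {c<..<d} \<times> {c'<..<d'}"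
 shows "tensor a b z = 0"
proof -
 have "(fst z <= c \<or> d <= fst z) \<or> (snd z <= c' \<or> d' <= snd z)" using assms(3) by (cases z) auto
 then show ?thesis using supported_in_outside[OF assms(1)] supported_in_outside[OF assms(2)]
  unfolding tensor_def by (metis mult_zero_left mult_zero_right)
qed

lemma integral_tensor:
 assumes "integrable lborel a" "integrable lborel b"
 shows "integrable lborel (tensor a b)" "(\<integral>z. tensor a b z \<partial>lborel) = (\<integral>x. a x \<partial>lborel) * (\<integral>y. b y \<partial>lborel)"
proof -
 have [measurable]: "a \<in> Borel" "b \<in> Borel" using assms by auto
 have eq: "tensor a b = (%(x, y). a x * b y)" by (auto simp: tensor_def)
 have i: "integrable (lborel \<Otimes>\<^sub>M lborel) (%(x, y). a x * b y)"
 proof (rule lborel_pair.Fubini_integrable)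
  show "integrable lborel (%x. \<integral>y. norm (case (x, y) of (x, y) => a x * b y) \<partial>lborel)"
   using assms by (simp add: abs_mult)
  show "AE x in lborel. integrable lborel (%y. case (x, y) of (x, y) => a x * b y)" using assms by simp
 qed measurable
 then show "integrable lborel (tensor a b)" by (simp add: eq lborel_prod)
 show "(\<integral>z. tensor a b z \<partial>lborel) = (\<integral>x. a x \<partial>lborel) * (\<integral>y. b y \<partial>lborel)"
  using lborel_pair.integral_fst'[OF i] by (simp add: eq lborel_prod)
qed

lemma AE_coordinates_neq: "AE z in lborel. fst z ~= (x::real) & snd z ~= (y::real)"
proof -
 have "emeasure lborel ({x} \<times> (UNIV :: real set)) = 0" "emeasure lborel ((UNIV :: real set) \<times> {y}) = 0"
  unfolding lborel_prod[symmetric] by (simp_all add: lborel.emeasure_pair_measure_Times)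
 then have "{x} \<times> UNIV \<in> null_sets (lborel :: plane measure)" "UNIV \<times> {y} \<in> null_sets (lborel :: plane measure)"
  by (auto simp: null_sets_def borel_prod[symmetric])
 from this[THEN AE_not_in] show ?thesis by eventually_elim auto
qed

lemma pairing_bound:
 assumes V: "L1 V" and \<phi>: "\<phi> \<in> Borel" and C: "!!z. \<bar>\<phi> z\<bar> <= C"
 shows "enorm (pairing V \<phi>) <= ennreal C * (NN z. enorm (V z))"
proof -
 note [measurable] = measurable_norm_abs_integrable[OF V]
 have "enorm (pairing V \<phi>) <= (NN z. ennreal \<bar>\<phi> z\<bar> * enorm (V z))" by (rule pairing_norm_le[OF V bounded_measurableI[OF \<phi> C]])
 also have "\<dots> <= (NN z. ennreal C * enorm (V z))" by (intro nn_integral_mono mult_right_mono ennreal_leI C) auto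
 also have "\<dots> = ennreal C * (NN z. enorm (V z))" by (rule nn_integral_cmult) auto
 finally show ?thesis .
qed

text \<open>Both sides are bounded and additive in \<open>V\<close>, so \<open>density_principle\<close> reduces to the scalar Fubini theorem.\<close>

lemma kernel_fubini:
 fixes V :: "plane => 'a::banach"
 assumes K [measurable]: "(%p. K (fst p) (snd p)) \<in> borel_measurable (borel \<Otimes>\<^sub>M borel)"
  and C: "!!z \<zeta>. \<bar>K z \<zeta>\<bar> <= C"
  and U: "!!V :: plane => 'a. L1 V ==> simple_limit lborel (%z. pairing V (K z))"
  and \<phi>: "integrable lborel \<phi>" and V: "L1 V"
 shows "pairing (%z. pairing V (K z)) \<phi> = pairing V (%\<zeta>. \<integral>z. \<phi> z * K z \<zeta> \<partial>lborel)"
proof -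
 have C0: "0 <= C" using C[of undefined undefined] by linarith
 have \<phi>m [measurable]: "\<phi> \<in> Borel" using \<phi> by auto
 have Kz: "K z \<in> Borel" for z
 proof -
  have "(%\<zeta>. K (fst (z, \<zeta>)) (snd (z, \<zeta>))) \<in> Borel" by measurable
  then show ?thesis by simp
 qed
 define n\<phi> where "n\<phi> = (\<integral>z. \<bar>\<phi> z\<bar> \<partial>lborel)"
 have n\<phi>: "(NN z. ennreal \<bar>\<phi> z\<bar>) = ennreal n\<phi>" unfolding n\<phi>_def
  using \<phi> by (intro nn_integral_eq_integral) auto
 have n\<phi>0: "0 <= n\<phi>" unfolding n\<phi>_def by simp
 let ?B = "%\<zeta>. \<integral>z. \<phi> z * K z \<zeta> \<partial>lborel"
 have K\<zeta>: "(%z. K z \<zeta>) \<in> Borel" for \<zeta>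
 proof -
  have "(%z. K (fst (z, \<zeta>)) (snd (z, \<zeta>))) \<in> Borel" by measurable
  then show ?thesis by simp
 qed
 have i1: "integrable lborel (%z. \<phi> z * K z \<zeta>)" for \<zeta>
 proof (rule Bochner_Integration.integrable_bound)
  show "integrable lborel (%z. C * \<bar>\<phi> z\<bar>)" using \<phi> by auto
  show "(%z. \<phi> z * K z \<zeta>) \<in> borel_measurable lborel" using K\<zeta>[of \<zeta>] by auto
  show "AE z in lborel. norm (\<phi> z * K z \<zeta>) <= norm (C * \<bar>\<phi> z\<bar>)"
  proof (intro AE_I2)
   fix z show "norm (\<phi> z * K z \<zeta>) <= norm (C * \<bar>\<phi> z\<bar>)"
    using mult_right_mono[OF C[of z \<zeta>], of "\<bar>\<phi> z\<bar>"] C0 by (simp add: abs_mult mult.commute)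
  qed
 qed
 have Bb: "\<bar>?B \<zeta>\<bar> <= C * n\<phi>" for \<zeta>
 proof -
  have "\<bar>?B \<zeta>\<bar> <= (\<integral>z. \<bar>\<phi> z * K z \<zeta>\<bar> \<partial>lborel)" by (rule integral_abs_bound)
  also have "\<dots> <= (\<integral>z. C * \<bar>\<phi> z\<bar> \<partial>lborel)"
  proof (intro integral_mono integrable_abs i1)
   show "integrable lborel (%z. C * \<bar>\<phi> z\<bar>)" using \<phi> by auto
   fix z show "\<bar>\<phi> z * K z \<zeta>\<bar> <= C * \<bar>\<phi> z\<bar>"
    using mult_right_mono[OF C[of z \<zeta>], of "\<bar>\<phi> z\<bar>"] by (simp add: abs_mult mult.commute)
  qed
  finally show ?thesis by (simp add: n\<phi>_def)
 qed
 have Bm: "?B \<in> Borel"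
 proof -
  have "(%p. \<phi> (snd p) * K (snd p) (fst p)) \<in> borel_measurable (borel \<Otimes>\<^sub>M lborel)"
  proof -
   have "(%p::(real\<times>real)\<times>(real\<times>real). (snd p, fst p)) \<in> measurable (borel \<Otimes>\<^sub>M lborel) (borel \<Otimes>\<^sub>M borel)" by measurable
   from measurable_compose[OF this K] have "(%p. K (snd p) (fst p)) \<in> borel_measurable (borel \<Otimes>\<^sub>M lborel)" by simp
   then show ?thesis by measurable
  qed
  then have "(%\<zeta>. \<integral>z. (%p. \<phi> (snd p) * K (snd p) (fst p)) (\<zeta>, z) \<partial>lborel) \<in> Borel"
   using lborel.borel_measurable_lebesgue_integral[of "%\<zeta> z. \<phi> z * K z \<zeta>" borel] by (simp add: case_prod_beta')
  then show ?thesis by simp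
 qed
 have Bbm: "bounded_measurable ?B" by (rule bounded_measurableI[OF Bm Bb])
 have Ub: "enorm (\<phi> z *\<^sub>R pairing W (K z)) <= ennreal \<bar>\<phi> z\<bar> * (ennreal C * (NN z. enorm (W z)))"
  if "L1 W" for z and W :: "plane => 'a"
  using pairing_bound[OF that Kz C] by (simp add: ennreal_mult mult_left_mono)
 have Ubi: "(NN z. ennreal \<bar>\<phi> z\<bar> * (ennreal C * (NN z. enorm (W z))))
   = ennreal (C * n\<phi>) * (NN z. enorm (W z))" for W :: "plane => 'a" by (subst nn_integral_multc) (auto simp: n\<phi> ennreal_mult C0 n\<phi>0 mult_ac)
 have Uai: "L1 (%z. \<phi> z *\<^sub>R pairing W (K z))" if W: "L1 W" for W :: "plane => 'a"
 proof (rule abs_integrable_mono)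
  show "simple_limit lborel (%z. \<phi> z *\<^sub>R pairing W (K z))" by (intro simple_limit_scaleR U W) simp
  show "AE z in lborel. enorm (\<phi> z *\<^sub>R pairing W (K z)) <= ennreal \<bar>\<phi> z\<bar> * (ennreal C * (NN z. enorm (W z)))" by (intro AE_I2 Ub W)
  show "(NN z. ennreal \<bar>\<phi> z\<bar> * (ennreal C * (NN z. enorm (W z)))) < \<infinity>"
   unfolding Ubi using W by (auto simp: abs_integrable_def ennreal_mult_less_top)
 qed
 define T where "T W = pairing (%z. pairing W (K z)) \<phi> - pairing W ?B" for W :: "plane => 'a"
 have "T V = 0"
 proof (rule density_principle[where M=lborel and T=T and C="2 * ennreal (C * n\<phi>)"])
  fix g h :: "plane => 'a" assume gh: "L1 g" "L1 h"
  have "pairing (%z. pairing (%z. g z + h z) (K z)) \<phi> = strong_integral lborel (%z. \<phi> z *\<^sub>R pairing g (K z) + \<phi> z *\<^sub>R pairing h (K z))"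
   unfolding pairing_def[of _ \<phi>] pairing_add_left[OF gh bounded_measurableI[OF Kz C]] scaleR_add_right ..
  also have "\<dots> = pairing (%z. pairing g (K z)) \<phi> + pairing (%z. pairing h (K z)) \<phi>"
   unfolding pairing_def[of _ \<phi>] by (intro strong_integral_add Uai gh)
  finally show "T (%z. g z + h z) = T g + T h"
   unfolding T_def pairing_add_left[OF gh Bbm] by simp
 next
  fix g :: "plane => 'a" assume g: "L1 g"
  let ?n = "NN z. enorm (g z)"
  have "enorm (pairing (%z. pairing g (K z)) \<phi>) <= (NN z. enorm (\<phi> z *\<^sub>R pairing g (K z)))"
   unfolding pairing_def[of _ \<phi>] by (rule strong_integral_norm_le[OF Uai[OF g]])
  also have "\<dots> <= ennreal (C * n\<phi>) * ?n" unfolding Ubi[symmetric] by (intro nn_integral_mono Ub g)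
  finally have 1: "enorm (pairing (%z. pairing g (K z)) \<phi>) <= ennreal (C * n\<phi>) * ?n" .
  have 2: "enorm (pairing g ?B) <= ennreal (C * n\<phi>) * ?n" by (rule pairing_bound[OF g Bm Bb])
  have "enorm (T g) <= enorm (pairing (%z. pairing g (K z)) \<phi>) + enorm (pairing g ?B)"
   unfolding T_def by (simp add: norm_triangle_ineq4 flip: ennreal_plus)
  also have "\<dots> <= ennreal (C * n\<phi>) * ?n + ennreal (C * n\<phi>) * ?n" by (intro add_mono 1 2)
  also have "\<dots> = 2 * ennreal (C * n\<phi>) * ?n" by (simp only: mult_2 distrib_right)
  finally show "enorm (T g) <= 2 * ennreal (C * n\<phi>) * ?n" .
 next
  fix A :: "plane set" and x :: 'a assume A: "A \<in> sets lborel" "emeasure lborel A < \<infinity>"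
  have Ai: "integrable lborel (indicator A :: plane => real)" using A by simp
  have i2: "integrable lborel (%\<zeta>. K z \<zeta> * indicator A \<zeta>)" for z
  proof (rule Bochner_Integration.integrable_bound)
   show "integrable lborel (%\<zeta>. C * (indicator A \<zeta> :: real))" using Ai by auto
   show "(%\<zeta>. K z \<zeta> * indicator A \<zeta>) \<in> borel_measurable lborel" using Kz[of z] A by auto
   show "AE \<zeta> in lborel. norm (K z \<zeta> * indicator A \<zeta>) <= norm (C * indicator A \<zeta>)"
    by (intro AE_I2) (use C[of z] C0 in \<open>auto simp: indicator_def\<close>)
  qed
  have p1: "pairing (%\<zeta>. indicator A \<zeta> *\<^sub>R x) \<psi> = (\<integral>\<zeta>. \<psi> \<zeta> * indicator A \<zeta> \<partial>lborel) *\<^sub>R x"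
   if "integrable lborel (%\<zeta>. \<psi> \<zeta> * indicator A \<zeta>)" for \<psi>
   using strong_integral_scaleR_const[OF _ that, of x] by (simp add: pairing_def)
  have AM: "A \<in> sets borel" using A by simp
  note [measurable] = AM
  let ?f = "%p. \<phi> (fst p) * (K (fst p) (snd p) * indicator A (snd p))"
  have fm: "?f \<in> borel_measurable (lborel \<Otimes>\<^sub>M lborel)" by measurable
  have prod: "integrable (lborel \<Otimes>\<^sub>M lborel) ?f"
  proof (rule integrableI_bounded[OF fm])
   have "(\<integral>\<^sup>+p. enorm (?f p) \<partial>(lborel \<Otimes>\<^sub>M lborel)) = (NN z. NN \<zeta>. enorm (?f (z, \<zeta>)))"
    using fm by (intro lborel.nn_integral_fst[symmetric]) measurable
   also have "\<dots> <= (NN z. NN \<zeta>. ennreal \<bar>\<phi> z\<bar> * (ennreal C * indicator A \<zeta>))"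
   proof (intro nn_integral_mono)
    fix z \<zeta>
    have "norm (?f (z, \<zeta>)) <= \<bar>\<phi> z\<bar> * (C * indicator A \<zeta>)"
     using C[of z \<zeta>] by (auto simp: abs_mult indicator_def mult_left_mono)
    then have "enorm (?f (z, \<zeta>)) <= ennreal (\<bar>\<phi> z\<bar> * (C * indicator A \<zeta>))" by (rule ennreal_leI)
    also have "\<dots> = ennreal \<bar>\<phi> z\<bar> * (ennreal C * indicator A \<zeta>)" using C0 by (simp add: ennreal_mult ennreal_indicator)
    finally show "enorm (?f (z, \<zeta>)) <= ennreal \<bar>\<phi> z\<bar> * (ennreal C * indicator A \<zeta>)" .
   qed
   also have "\<dots> = (NN z. ennreal \<bar>\<phi> z\<bar> * (ennreal C * emeasure lborel A))"
    by (intro nn_integral_cong) (simp add: nn_integral_cmult nn_integral_cmult_indicator)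
   also have "\<dots> = ennreal n\<phi> * (ennreal C * emeasure lborel A)" by (subst nn_integral_multc) (auto simp: n\<phi>)
   also have "\<dots> < \<infinity>" using A by (auto simp: ennreal_mult_less_top)
   finally show "(\<integral>\<^sup>+p. enorm (?f p) \<partial>(lborel \<Otimes>\<^sub>M lborel)) < \<infinity>" .
  qed
  have f1: "integrable lborel (%z. \<phi> z * (\<integral>\<zeta>. K z \<zeta> * indicator A \<zeta> \<partial>lborel))"
   using lborel_pair.integrable_fst'[OF prod] by simp
  have f2: "integrable lborel (%\<zeta>. ?B \<zeta> * indicator A \<zeta>)"
   using lborel_pair.integrable_snd[of "%z \<zeta>. ?f (z, \<zeta>)"] prod by (simp add: case_prod_beta' mult.assoc[symmetric])
  have "(\<integral>z. \<phi> z * (\<integral>\<zeta>. K z \<zeta> * indicator A \<zeta> \<partial>lborel) \<partial>lborel) = (\<integral>z. \<integral>\<zeta>. ?f (z, \<zeta>) \<partial>lborel \<partial>lborel)"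
   by simp
  also have "\<dots> = (\<integral>\<zeta>. \<integral>z. ?f (z, \<zeta>) \<partial>lborel \<partial>lborel)"
   using lborel_pair.Fubini_integral[of "%z \<zeta>. ?f (z, \<zeta>)"] prod by (simp add: case_prod_beta')
  also have "\<dots> = (\<integral>\<zeta>. ?B \<zeta> * indicator A \<zeta> \<partial>lborel)" by (simp add: mult.assoc[symmetric])
  finally have fub: "(\<integral>z. \<phi> z * (\<integral>\<zeta>. K z \<zeta> * indicator A \<zeta> \<partial>lborel) \<partial>lborel) = (\<integral>\<zeta>. ?B \<zeta> * indicator A \<zeta> \<partial>lborel)" .
  have "pairing (%z. pairing (%\<zeta>. indicator A \<zeta> *\<^sub>R x) (K z)) \<phi>
    = strong_integral lborel (%z. (\<phi> z * (\<integral>\<zeta>. K z \<zeta> * indicator A \<zeta> \<partial>lborel)) *\<^sub>R x)"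
   unfolding pairing_def[of _ \<phi>] p1[OF i2] by simp
  also have "\<dots> = (\<integral>\<zeta>. ?B \<zeta> * indicator A \<zeta> \<partial>lborel) *\<^sub>R x"
   using strong_integral_scaleR_const[OF _ f1, of x] fub by simp
  finally show "T (%z. indicator A z *\<^sub>R x) = 0" unfolding T_def p1[OF f2] by simp
 qed (use V in \<open>auto simp: ennreal_mult_less_top\<close>)
 then show ?thesis by (simp add: T_def)
qed

text \<open>For a smooth \<open>v\<close> on the line, \<open>v(x) = \<integral> (step s - 1[s > x]) v'(s) ds + \<integral> step'(s) v(s) ds\<close> by integration by parts. \<open>kernel1 True\<close> goes with the derivative and \<open>kernel1 False\<close> with
the function. Since the transition of \<open>step\<close> lies in \<open>[1, 2] \<subseteq> (0, 2 \<pi>)\<close>, only values inside the strip enter.\<close>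

definition kernel1 :: "bool => real => real => real" where
 "kernel1 i x s = (if i then step s - indicator {x<..} s else deriv step s)"

definition kernel :: "bool => bool => plane => plane => real" where
 "kernel i j z = tensor (kernel1 i (fst z)) (kernel1 j (snd z))"

lemma supported_deriv_step: assumes "2 < d" shows "supported_in 0 d (deriv step)"
proof -
 have "deriv step x = 0" if "\<not> (1 <= x & x <= 2)" for x
 proof -
  have "(step has_real_derivative 0) (at x)"
  proof (cases "x < 1")
   case True show ?thesis by (rule has_field_derivative_transform_within_open[of "%_. 0" _ _ "{..<1}"]) (use True in \<open>auto simp: step_0\<close>)
  next
   case False show ?thesis by (rule has_field_derivative_transform_within_open[of "%_. 1" _ _ "{2<..}"]) (use False that in \<open>auto simp: step_1\<close>)
  qed
  then show ?thesis by (rule DERIV_imp_deriv)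
 qed
 then show ?thesis using assms unfolding supported_in_def by (intro exI[of _ 1] exI[of _ 2]) auto
qed

lemma deriv_step_bound: obtains C where "C \<ge> 1" "!!s. \<bar>deriv step s\<bar> <= C"
proof -
 have "supported_in 0 3 (deriv step)" by (rule supported_deriv_step) simp
 then obtain C where C: "C \<ge> 0" "!!s. \<bar>deriv step s\<bar> <= C"
  using supported_in_bounded[OF smooth_deriv(2)[OF smooth_step]] by metis
 have "\<bar>deriv step s\<bar> <= max C 1" for s by (rule order_trans[OF C(2)]) simp
 then show thesis using that[of "max C 1"] by simp
qed

lemma kernel1_measurable2: "(%p. kernel1 i (fst p) (snd p)) \<in> borel_measurable (borel \<Otimes>\<^sub>M borel)"
proof -
 have [measurable]: "step \<in> Borel" "deriv step \<in> Borel" by (intro smooth_measurable smooth_step smooth_deriv(2))+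
 have "(%p::real\<times>real. indicator {fst p<..} (snd p) :: real) = (%p. if fst p < snd p then 1 else 0)" by (auto simp: indicator_def)
 then have [measurable]: "(%p::real\<times>real. indicator {fst p<..} (snd p) :: real) \<in> borel_measurable (borel \<Otimes>\<^sub>M borel)" by simp
 show ?thesis unfolding kernel1_def by (cases i) measurable
qed

lemma kernel1_bound: obtains C where "C \<ge> 1" "!!i x s. \<bar>kernel1 i x s\<bar> <= C"
proof -
 obtain C where C: "C \<ge> 1" "!!s. \<bar>deriv step s\<bar> <= C" using deriv_step_bound by blast
 have "\<bar>kernel1 i x s\<bar> <= C" for i x s
  using C(1) C(2)[of s] step_nonneg[of s] step_le_1[of s] by (auto simp: kernel1_def indicator_def)
 then show thesis using that C by blast
qed

lemma kernel1_measurable: "kernel1 i x \<in> Borel"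
proof -
 have "(%s. (%p. kernel1 i (fst p) (snd p)) (x, s)) \<in> Borel"
  using measurable_compose[OF _ kernel1_measurable2, of "%s. (x, s)" borel i] by simp
 then show ?thesis by simp
qed

lemma kernel_measurable2: "(%p. kernel i j (fst p) (snd p)) \<in> borel_measurable (borel \<Otimes>\<^sub>M borel)"
proof -
 have 1: "(%p::(real\<times>real)\<times>(real\<times>real). (fst (fst p), fst (snd p))) \<in> measurable (borel \<Otimes>\<^sub>M borel) (borel \<Otimes>\<^sub>M borel)"
  "(%p::(real\<times>real)\<times>(real\<times>real). (snd (fst p), snd (snd p))) \<in> measurable (borel \<Otimes>\<^sub>M borel) (borel \<Otimes>\<^sub>M borel)"
  unfolding borel_prod by (auto intro!: borel_measurable_continuous_onI continuous_intros)
 show ?thesis unfolding kernel_def tensor_def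
  using measurable_compose[OF 1(1) kernel1_measurable2[of i]] measurable_compose[OF 1(2) kernel1_measurable2[of j]] by (intro borel_measurable_times) simp_all
qed

lemma kernel_bound: obtains C where "C \<ge> 1" "!!i j z \<zeta>. \<bar>kernel i j z \<zeta>\<bar> <= C"
proof -
 obtain C where C: "C \<ge> 1" "!!i x s. \<bar>kernel1 i x s\<bar> <= C" using kernel1_bound by blast
 have "\<bar>kernel i j z \<zeta>\<bar> <= C * C" for i j z \<zeta>
  unfolding kernel_def tensor_def abs_mult by (intro mult_mono C) (use C(1) in auto)
 moreover have "1 <= C * C" using mult_mono[of 1 C 1 C] C(1) by simp
 ultimately show thesis using that by blast
qed

lemma kernel_measurable: "kernel i j z \<in> Borel"
 unfolding kernel_def by (intro measurable_tensor kernel1_measurable)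

lemma kernel1_tendsto:
 assumes "x ---> x0" "s ~= x0" shows "(%n. kernel1 i (x n) s) ---> kernel1 i x0 s"
proof -
 have "eventually (%n. indicator {x n<..} s = (indicator {x0<..} s :: real)) sequentially"
 proof (cases "s < x0")
  case True
  then have "eventually (%n. s < x n) sequentially" by (intro order_tendstoD(1)[OF assms(1)])
  then show ?thesis by eventually_elim (use True in auto)
 next
  case False
  then have "eventually (%n. x n < s) sequentially" using assms(2) by (intro order_tendstoD(2)[OF assms(1)]) auto
  then show ?thesis by eventually_elim (use False assms(2) in auto)
 qed
 then have "(%n. indicator {x n<..} s :: real) ---> indicator {x0<..} s" by (rule tendsto_eventually)
 then show ?thesis unfolding kernel1_def by (auto intro!: tendsto_intros)
qed

lemma kernel_continuous:
 assumes V: "L1 V" shows "continuous_on UNIV (%z. pairing V (kernel i j z))"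
proof -
 obtain C where C: "C \<ge> 1" "!!i j z \<zeta>. \<bar>kernel i j z \<zeta>\<bar> <= C" using kernel_bound by blast
 have "isCont (%z. pairing V (kernel i j z)) z0" for z0
  unfolding continuous_at_sequentially comp_def
 proof (intro allI impI)
  fix z assume z: "z ---> z0"
  show "(%n. pairing V (kernel i j (z n))) ---> pairing V (kernel i j z0)"
  proof (rule pairing_tendsto[OF V kernel_measurable kernel_measurable C(2) _ C(2)])
   show "AE \<zeta> in lborel. V \<zeta> ~= 0 --> (%n. kernel i j (z n) \<zeta>) ---> kernel i j z0 \<zeta>"
    using AE_coordinates_neq[of "fst z0" "snd z0"]
   proof eventually_elim
    case (elim \<zeta>)
    show ?case unfolding kernel_def tensor_def by (intro impI tendsto_mult kernel1_tendsto tendsto_fst tendsto_snd z) (use elim in auto)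
   qed
  qed
 qed
 then show ?thesis by (simp add: continuous_at_imp_continuous_on)
qed

text \<open>Dual form of the representation formula: \<open>\<alpha> False - \<alpha> True'\<close> reproduces the test function \<open>a\<close>.\<close>

lemma kernel1_moment:
 assumes a: "smooth a" "supported_in 0 d a" and d: "2 < d"
 defines "\<alpha> \<equiv> %i s. \<integral>x. a x * kernel1 i x s \<partial>lborel"
 shows "smooth (\<alpha> i)" "supported_in 0 d (\<alpha> i)" "deriv (\<alpha> True) s = \<alpha> False s - a s"
  "integrable lborel (%x. a x * kernel1 i x s)"
proof -
 note ai = integrable_test[OF a]
 obtain c' d' where cd: "0 < c'" "d' < d" "!!x. a x ~= 0 ==> c' <= x & x <= d'"
  using a(2) unfolding supported_in_def by blast
 have am: "a \<in> Borel" by (rule smooth_measurable[OF a(1)])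
 define m where "m = (\<integral>x. a x \<partial>lborel)"
 obtain A where A: "smooth A" "!!x. (A has_real_derivative a x) (at x)" "!!x. x <= 0 ==> A x = 0"
  using smooth_antiderivative[OF a(1), of 0] supported_in_outside[OF a(2)] by blast
 have Ai: "integrable lborel (%x. a x * indicator {..s} x)" for s
  using integrable_mult_indicator[of "{..s}" lborel a] ai by (simp add: mult.commute)
 have As: "(\<integral>x. a x * indicator {..s} x \<partial>lborel) = A s" for s
 proof -
  define q where "q = min 0 s - 1"
  have "(\<integral>x. a x * indicator {q..s} x \<partial>lborel) = A s - A q"
   by (rule integral_FTC_Icc_real) (use A(2) smooth_continuous[OF a(1), of UNIV] in \<open>auto simp: q_def continuous_on_eq_continuous_at\<close>)
  moreover have "(%x. a x * indicator {q..s} x) = (%x. a x * indicator {..s} x)"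
  proof
   fix x show "a x * indicator {q..s} x = a x * indicator {..s} x"
    using supported_in_outside[OF a(2), of x] by (cases "x <= 0") (auto simp: q_def indicator_def)
  qed
  ultimately show ?thesis using A(3)[of q] by (simp add: q_def)
 qed
 have AR: "A s = m" if "s \<ge> d'" for s
 proof -
  have "(%x. a x * indicator {..s} x) = a" using cd(3) that by (force simp: indicator_def)
  then show ?thesis using As[of s] by (simp add: m_def)
 qed
 have AL: "A s = 0" if "s < c'" for s
 proof -
  have "(%x. a x * indicator {..s} x) = (%x. 0)" using cd(3) that by (force simp: indicator_def)
  then show ?thesis using As[of s] by simp
 qed
 have ae: "AE x in lborel. a x * indicator {x<..} s = a x * indicator {..s} x" for s :: real
  using AE_lborel_singleton[of s] by eventually_elim (auto simp: indicator_def)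
 have I1: "integrable lborel (%x. a x * indicator {x<..} s)" for s
 proof -
  have "(%x. a x * indicator {x<..} s) = (%x. a x * indicator {..<s} x)" by (auto simp: indicator_def)
  then show ?thesis using integrable_mult_indicator[of "{..<s}" lborel a] ai by (simp add: mult.commute)
 qed
 have E1: "(\<integral>x. a x * indicator {x<..} s \<partial>lborel) = A s" for s
  using integral_cong_AE[OF _ _ ae[of s]] I1[of s] Ai[of s] As[of s] by (simp add: integrable_iff_bounded)
 have eT: "(%x. a x * kernel1 True x s) = (%x. a x * step s - a x * indicator {x<..} s)" for s by (auto simp: kernel1_def right_diff_distrib)
 have aT: "\<alpha> True = (%s. m * step s - A s)"
  unfolding \<alpha>_def eT using ai I1 by (auto simp: E1 m_def)
 have aF: "\<alpha> False = (%s. m * deriv step s)"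
  unfolding \<alpha>_def kernel1_def by (auto simp: m_def)
 show "integrable lborel (%x. a x * kernel1 i x s)"
 proof (cases i)
  case True
  then have i: "i = True" by simp
  show ?thesis unfolding i eT using ai I1 by auto
 next
  case False then show ?thesis using ai by (simp add: kernel1_def)
 qed
 show "smooth (\<alpha> i)" by (cases i) (simp_all add: aT aF smooth_diff smooth_mult smooth_step smooth_deriv(2) A)
 show "supported_in 0 d (\<alpha> i)"
 proof (cases i)
  case True
  then have i: "i = True" by simp
  have "\<alpha> True s = 0" if "\<not> (min c' 1 <= s & s <= max d' 2)" for s
  proof (cases "min c' 1 <= s")
   case True then show ?thesis using that AR[of s] step_1[of s] by (simp add: aT)
  next
   case False then show ?thesis using AL[of s] step_0[of s] by (simp add: aT)
  qed
  then show ?thesis unfolding i supported_in_def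
   using cd d by (intro exI[of _ "min c' 1"] exI[of _ "max d' 2"]) auto
 next
  case False
  show ?thesis using False supported_in_mult'[OF supported_deriv_step[OF d], of "%_. m"] by (simp add: aF)
 qed
 have "((%s. m * step s - A s) has_real_derivative m * deriv step s - a s) (at s)" by (intro DERIV_diff DERIV_cmult smooth_deriv(1) smooth_step A)
 then show "deriv (\<alpha> True) s = \<alpha> False s - a s"
  unfolding aT aF by (rule DERIV_imp_deriv)
qed

text \<open>Weak derivatives tested on tensors only: all one-variable arguments below need no more.\<close>

definition weak_dx :: "(plane => 'a::banach) => (plane => 'a) => bool" where
 "weak_dx F G \<longleftrightarrow> (\<forall>a b d. smooth a & smooth b & supported_in 0 (2 * pi) a & supported_in 0 d b -->
   pairing F (tensor (deriv a) b) = - pairing G (tensor a b))"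

definition weak_dy :: "(plane => 'a::banach) => (plane => 'a) => bool" where
 "weak_dy F G \<longleftrightarrow> (\<forall>a b d. smooth a & smooth b & supported_in 0 (2 * pi) a & supported_in 0 d b -->
   pairing F (tensor a (deriv b)) = - pairing G (tensor a b))"

lemma weak_dxD: "weak_dx F G ==> smooth a ==> smooth b ==> supported_in 0 (2 * pi) a ==> supported_in 0 d b ==>
   pairing F (tensor (deriv a) b) = - pairing G (tensor a b)"
 unfolding weak_dx_def by blast

lemma weak_dyD: "weak_dy F G ==> smooth a ==> smooth b ==> supported_in 0 (2 * pi) a ==> supported_in 0 d b ==>
   pairing F (tensor a (deriv b)) = - pairing G (tensor a b)"
 unfolding weak_dy_def by blast

lemma two_less_two_pi: "2 < 2 * pi" using pi_gt3 by simp

text \<open>Applying the one-dimensional representation formula in each variable expresses \<open>V\<close> through integrals of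
\<open>V, V\<^sub>x, V\<^sub>y, V\<^sub>x\<^sub>y\<close> against bounded kernels whose discontinuity sets are null lines, hence as a bounded continuous
function. The formula is verified by pairing with tensors.\<close>

lemma continuous_representative:
 fixes V Vx Vy Vxy :: "plane => 'a::banach"
 assumes ai: "L1 V" "L1 Vx" "L1 Vy" "L1 Vxy"
  and dx: "weak_dx V Vx" and dy: "weak_dy V Vy" and dxy: "weak_dx Vy Vxy"
 obtains W C where "continuous_on UNIV W" "!!z. norm (W z) <= C" "AE z in lborel. z \<in> strip --> W z = V z"
proof -
 define U where "U i j = (if i then (if j then Vxy else Vx) else (if j then Vy else V))" for i j
 have Ui: "L1 (U i j)" for i j using ai by (auto simp: U_def)
 define P where "P i j z = pairing (U i j) (kernel i j z)" for i j z
 have Pc: "continuous_on UNIV (P i j)" for i j unfolding P_def by (rule kernel_continuous[OF Ui])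
 define W where "W z = P False False z + P True False z + P False True z + P True True z" for z
 have Wc: "continuous_on UNIV W" unfolding W_def by (intro continuous_on_add Pc)
 obtain C where C: "C \<ge> 1" "!!i j z \<zeta>. \<bar>kernel i j z \<zeta>\<bar> <= C" using kernel_bound by blast
 have "\<exists>B. \<forall>z. norm (P i j z) <= B" for i j
 proof -
  let ?n = "NN z. enorm (U i j z)"
  have fin: "ennreal C * ?n < \<infinity>" using Ui[of i j] by (auto simp: abs_integrable_def ennreal_mult_less_top)
  have "norm (P i j z) <= enn2real (ennreal C * ?n)" for z
  proof -
   have "enorm (P i j z) <= ennreal C * ?n"
    unfolding P_def by (rule pairing_bound[OF Ui kernel_measurable C(2)])
   then show ?thesis using fin enn2real_mono[of "enorm (P i j z)"] by simp
  qed
  then show ?thesis by blast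
 qed
 then obtain B where B: "!!i j z. norm (P i j z) <= B i j" by metis
 have Wb: "norm (W z) <= B False False + B True False + B False True + B True True" for z
  unfolding W_def by (intro norm_triangle_le add_mono B)
 have key: "pairing W (tensor a b) = pairing V (tensor a b)"
  if ab: "smooth a" "smooth b" "supported_in 0 (2 * pi) a" "supported_in 0 d0 b" for a b d0
 proof -
  define d where "d = max d0 3"
  have b': "supported_in 0 d b" "2 < d" using supported_in_mono[OF ab(4), of 0 d] by (auto simp: d_def)
  let ?\<alpha> = "%i s. \<integral>x. a x * kernel1 i x s \<partial>lborel"
  let ?\<beta> = "%i s. \<integral>x. b x * kernel1 i x s \<partial>lborel"
  note mA = kernel1_moment[OF ab(1,3) two_less_two_pi]
  note mB = kernel1_moment[OF ab(2) b']
  note iab = integral_tensor(1)[OF integrable_test[OF ab(1,3)] integrable_test[OF ab(2,4)]]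
  have Pf: "pairing (P i j) (tensor a b) = pairing (U i j) (tensor (?\<alpha> i) (?\<beta> j))" for i j
  proof -
   have "pairing (P i j) (tensor a b) = pairing (U i j) (%\<zeta>. \<integral>z. tensor a b z * kernel i j z \<zeta> \<partial>lborel)"
    unfolding P_def by (rule kernel_fubini[OF kernel_measurable2 C(2) simple_limit_continuous[OF kernel_continuous] iab Ui])
   also have "(%\<zeta>. \<integral>z. tensor a b z * kernel i j z \<zeta> \<partial>lborel) = tensor (?\<alpha> i) (?\<beta> j)"
   proof
    fix \<zeta> :: "plane"
    have "(%z. tensor a b z * kernel i j z \<zeta>) = tensor (%x. a x * kernel1 i x (fst \<zeta>)) (%y. b y * kernel1 j y (snd \<zeta>))"
     by (auto simp: tensor_def kernel_def fun_eq_iff)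
    then show "(\<integral>z. tensor a b z * kernel i j z \<zeta> \<partial>lborel) = tensor (?\<alpha> i) (?\<beta> j) \<zeta>"
     using integral_tensor(2)[OF mA(4)[of i "fst \<zeta>"] mB(4)[of j "snd \<zeta>"]]
     unfolding tensor_def[of "%s. \<integral>x. a x * kernel1 i x s \<partial>lborel" "%s. \<integral>x. b x * kernel1 j x s \<partial>lborel" \<zeta>] by metis
   qed
   finally show ?thesis .
  qed
  have bmt: "bounded_measurable (tensor a b)" by (rule bounded_measurable_test[OF ab(1,3,2,4)])
  have Pab: "L1 (%z. tensor a b z *\<^sub>R P i j z)" for i j
  proof (rule abs_integrable_mono)
   show "simple_limit lborel (%z. tensor a b z *\<^sub>R P i j z)"
    using bmt by (intro simple_limit_scaleR simple_limit_continuous Pc) (simp add: bounded_measurable_def)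
   show "AE z in lborel. enorm (tensor a b z *\<^sub>R P i j z) <= ennreal \<bar>tensor a b z\<bar> * ennreal (B i j)"
    using B[of i j] by (intro AE_I2) (simp add: ennreal_mult mult_left_mono ennreal_leI)
   show "(NN z. ennreal \<bar>tensor a b z\<bar> * ennreal (B i j)) < \<infinity>"
    using iab by (subst nn_integral_multc) (auto simp: integrable_iff_bounded ennreal_mult_less_top)
  qed
  have "pairing W (tensor a b) = pairing (P False False) (tensor a b) + pairing (P True False) (tensor a b)
    + pairing (P False True) (tensor a b) + pairing (P True True) (tensor a b)"
   unfolding pairing_def W_def scaleR_add_right by (simp add: strong_integral_add Pab abs_integrable_add)
  also have "\<dots> = pairing V (tensor (?\<alpha> False) (?\<beta> False)) + pairing Vx (tensor (?\<alpha> True) (?\<beta> False))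
    + pairing Vy (tensor (?\<alpha> False) (?\<beta> True)) + pairing Vxy (tensor (?\<alpha> True) (?\<beta> True))"
   unfolding Pf by (simp add: U_def)
  also have "pairing Vx (tensor (?\<alpha> True) (?\<beta> False)) = - pairing V (tensor (deriv (?\<alpha> True)) (?\<beta> False))"
   using weak_dxD[OF dx mA(1)[of True] mB(1)[of False] mA(2) mB(2)] by simp
  also have "pairing Vy (tensor (?\<alpha> False) (?\<beta> True)) = - pairing V (tensor (?\<alpha> False) (deriv (?\<beta> True)))"
   using weak_dyD[OF dy mA(1)[of False] mB(1)[of True] mA(2) mB(2)] by simp
  also have "pairing Vxy (tensor (?\<alpha> True) (?\<beta> True)) = pairing V (tensor (deriv (?\<alpha> True)) (deriv (?\<beta> True)))"
   using weak_dxD[OF dxy mA(1)[of True] mB(1)[of True] mA(2) mB(2)]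
    weak_dyD[OF dy smooth_deriv(2)[OF mA(1)[of True]] mB(1)[of True] supported_in_deriv[OF mA(2)] mB(2)] by simp
  also have "deriv (?\<alpha> True) = (%s. ?\<alpha> False s - a s)" using mA(3) by blast
  also have "deriv (?\<beta> True) = (%s. ?\<beta> False s - b s)" using mB(3) by blast
  also have "pairing V (tensor (?\<alpha> False) (?\<beta> False)) + - pairing V (tensor (%s. ?\<alpha> False s - a s) (?\<beta> False))
    + - pairing V (tensor (?\<alpha> False) (%s. ?\<beta> False s - b s)) + pairing V (tensor (%s. ?\<alpha> False s - a s) (%s. ?\<beta> False s - b s))
    = pairing V (tensor a b)"
  proof -
   let ?A = "?\<alpha> False" and ?B = "?\<beta> False"
   have bm: "bounded_measurable (tensor ?A ?B)" "bounded_measurable (tensor a ?B)" "bounded_measurable (tensor ?A b)"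
    by (rule bounded_measurable_test[OF mA(1,2) mB(1,2)] bounded_measurable_test[OF ab(1,3) mB(1,2)] bounded_measurable_test[OF mA(1,2) ab(2,4)])+
   have e: "tensor (%s. ?A s - a s) ?B = (%z. tensor ?A ?B z - tensor a ?B z)"
    "tensor ?A (%s. ?B s - b s) = (%z. tensor ?A ?B z - tensor ?A b z)"
    "tensor (%s. ?A s - a s) (%s. ?B s - b s) = (%z. (tensor ?A ?B z - tensor a ?B z) - (tensor ?A b z - tensor a b z))"
    by (auto simp: tensor_def fun_eq_iff algebra_simps)
   show ?thesis unfolding e by (simp add: pairing_diff[OF ai(1)] bm bmt bounded_measurable_diff)
  qed
  finally show ?thesis .
 qed
 have ae: "AE z in lborel. z \<in> {0<..<2 * pi} \<times> {0<..<real n} --> W z = V z" for n :: nat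
 proof -
  let ?R = "{0<..<2 * pi} \<times> {0<..<real n}"
  have Rb: "?R \<in> sets borel" by (intro borel_open open_Times) auto
  have Rf: "emeasure lborel ?R < \<infinity>"
  proof -
   have "emeasure lborel ?R <= emeasure lborel (cbox (0, 0) (2 * pi, real n))"
   proof (rule emeasure_mono)
    show "?R \<subseteq> cbox (0, 0) (2 * pi, real n)" by (auto simp: cbox_Pair_eq)
   qed simp
   also have "\<dots> < \<infinity>" by (rule emeasure_lborel_cbox_finite)
   finally show ?thesis .
  qed
  have WR: "L1 (%z. indicator ?R z *\<^sub>R W z)"
  proof (rule abs_integrable_mono)
   show "simple_limit lborel (%z. indicator ?R z *\<^sub>R W z)" by (intro simple_limit_scaleR simple_limit_continuous Wc) (use Rb in simp)
   let ?D = "B False False + B True False + B False True + B True True"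
   show "AE z in lborel. enorm (indicator ?R z *\<^sub>R W z) <= ennreal ?D * indicator ?R z"
    using Wb by (intro AE_I2) (auto simp: indicator_def intro!: ennreal_leI)
   show "(NN z. ennreal ?D * indicator ?R z) < \<infinity>"
    using Rb Rf by (subst nn_integral_cmult_indicator) (auto simp: ennreal_mult_less_top)
  qed
  have VR: "L1 (%z. indicator ?R z *\<^sub>R W z - V z)" by (intro abs_integrable_diff WR ai)
  have "AE z in lborel. z \<in> {0<..<2 * pi} \<times> {0<..<real n} --> enorm (indicator ?R z *\<^sub>R W z - V z) <= 0"
  proof (rule fundamental_lemma_rect[OF VR])
   fix a b assume ab: "smooth a" "smooth b" "supported_in 0 (2 * pi) a" "supported_in 0 (real n) b"
   have bmt: "bounded_measurable (tensor a b)" by (rule bounded_measurable_test[OF ab(1,3,2,4)])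
   have "tensor a b z *\<^sub>R indicator ?R z *\<^sub>R W z = tensor a b z *\<^sub>R W z" for z
    using tensor_outside[OF ab(3,4), of z] by (cases "z \<in> ?R") simp_all
   then have "pairing (%z. indicator ?R z *\<^sub>R W z) (tensor a b) = pairing W (tensor a b)"
    unfolding pairing_def by (simp only:)
   then have "pairing (%z. indicator ?R z *\<^sub>R W z - V z) (tensor a b) = 0"
    unfolding pairing_diff_left[OF WR ai(1) bmt] using key[OF ab] by simp
   then show "enorm (pairing (%z. indicator ?R z *\<^sub>R W z - V z) (tensor a b)) <= (NN z. ennreal (tensor a b z) * 0)" by simp
  qed auto
  then show ?thesis by eventually_elim (auto simp: indicator_def)
 qed
 have "AE z in lborel. \<forall>n. z \<in> {0<..<2 * pi} \<times> {0<..<real n} --> W z = V z"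
  unfolding AE_all_countable using ae by blast
 then have "AE z in lborel. z \<in> strip --> W z = V z"
 proof eventually_elim
  case (elim z)
  obtain n :: nat where "snd z < real n" using reals_Archimedean2 by blast
  then show ?case using elim by (cases z) (auto simp: strip_def II_def)
 qed
 then show thesis using that[OF Wc Wb] by blast
qed

section \<open>The mixed norm and density of tensors\<close>

lemma ennreal_powr_real: "0 <= a ==> ennreal_powr (ennreal a) r = ennreal (a powr r)"
 by (simp add: ennreal_powr_def)

lemma ennreal_powr_top [simp]: "ennreal_powr top r = top"
 by (simp add: ennreal_powr_def)

lemma ennreal_powr_0 [simp]: "ennreal_powr 0 r = 0"
 by (simp add: ennreal_powr_def)

lemma ennreal_powr_eq_0_iff [simp]: "ennreal_powr x r = 0 \<longleftrightarrow> x = 0"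
 by (cases x rule: ennreal_cases) (auto simp: ennreal_powr_real ennreal_eq_0_iff)

lemma ennreal_powr_eq_top_iff [simp]: "ennreal_powr x r = top \<longleftrightarrow> x = top"
 by (cases x rule: ennreal_cases) (auto simp: ennreal_powr_real)

lemma ennreal_powr_mono: assumes "x <= y" "0 < r" shows "ennreal_powr x r <= ennreal_powr y r"
proof (cases y rule: ennreal_cases)
 case (real b)
 then obtain a where "x = ennreal a" "0 <= a" using assms(1) by (cases x rule: ennreal_cases) (auto simp: top_unique)
 then show ?thesis using assms real by (auto simp: ennreal_powr_real intro!: ennreal_leI powr_mono2)
qed simp

lemma ennreal_powr_mult: "0 <= c ==> 0 < r ==> ennreal_powr (ennreal c * x) r = ennreal (c powr r) * ennreal_powr x r"
proof (cases x rule: ennreal_cases)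
 case (real a) then show "0 <= c ==> 0 < r ==> ?thesis" by (simp add: ennreal_powr_real powr_mult flip: ennreal_mult)
next
 case top then show "0 <= c ==> 0 < r ==> ?thesis" by (cases "c = 0") (simp_all add: ennreal_mult_top)
qed

lemma measurable_ennreal_powr [measurable (raw)]:
 assumes [measurable]: "f \<in> borel_measurable M" shows "(%x. ennreal_powr (f x) r) \<in> borel_measurable M"
 unfolding ennreal_powr_def by measurable

lemma ennreal_powr_add_le:
 assumes r: "0 < r" shows "ennreal_powr (x + y) r <= ennreal (2 powr r) * (ennreal_powr x r + ennreal_powr y r)"
proof -
 have "x + y <= ennreal 2 * max x y" by (cases "x <= y") (auto simp: mult_2 add_mono max_def)
 then have "ennreal_powr (x + y) r <= ennreal_powr (ennreal 2 * max x y) r" using r by (rule ennreal_powr_mono)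
 also have "\<dots> = ennreal (2 powr r) * ennreal_powr (max x y) r" using r by (simp add: ennreal_powr_mult del: ennreal_numeral)
 also have "ennreal_powr (max x y) r <= ennreal_powr x r + ennreal_powr y r" by (auto simp: max_def)
 finally show ?thesis by (simp add: mult_left_mono)
qed

lemma tendsto_ennreal_powr_0:
 assumes "x ---> 0" "0 < r" shows "(%n. ennreal_powr (x n) r) ---> 0"
proof (rule order_tendstoI)
 fix e :: ennreal assume "0 < e"
 then obtain d where d: "0 < d" "d < e" using dense by blast
 define e' where "e' = enn2real d"
 have "d < top" using d(2) by (simp add: order_less_le_trans)
 then have e': "0 < e'" "ennreal e' < e" "0 < ennreal e'"
  using d by (auto simp: e'_def enn2real_positive_iff)
 have "0 < ennreal (e' powr (1 / r))" using e' by simp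
 then have "eventually (%n. x n < ennreal (e' powr (1 / r))) sequentially" using assms(1) by (intro order_tendstoD(2))
 then show "eventually (%n. ennreal_powr (x n) r < e) sequentially"
 proof eventually_elim
  case (elim n)
  have "ennreal_powr (x n) r <= ennreal_powr (ennreal (e' powr (1 / r))) r" using elim assms(2) by (intro ennreal_powr_mono) auto
  also have "\<dots> = ennreal e'" using e' assms(2) by (simp add: ennreal_powr_real powr_powr)
  finally show ?case using e' by simp
 qed
qed simp

text \<open>The norm of \<open>L\<^sup>p\<^sup>,\<^sup>1\<close> for nonnegative integrands; values outside the strip do not enter.\<close>

definition mixed_norm :: "real => (plane => ennreal) => ennreal" where
 "mixed_norm p N = (NN y. ennreal_powr (NN x. ennreal_powr (N (x, y)) p * indicator II x) (1 / p) * indicator {0<..} y)"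

abbreviation (input) "strip_norm p F \<equiv> mixed_norm p (%z. enorm (F z))"

lemma II_borel [measurable, simp]: "II \<in> sets borel" by (simp add: II_def)

lemma strip_borel [measurable, simp]: "strip \<in> sets borel"
 unfolding strip_def II_def by (intro borel_open open_Times) auto

lemma Lp1_norm_eq: "Lp1_norm p u = strip_norm p u"
 unfolding Lp1_norm_def Lp_norm_def mixed_norm_def by (simp add: nn_integral_lebesgue_on ennreal_powr_real)

lemma mixed_norm_mono:
 assumes "AE z in lborel. z \<in> strip --> N z <= N' z" "0 < p"
 shows "mixed_norm p N <= mixed_norm p N'"
 unfolding mixed_norm_def
proof (rule nn_integral_mono_AE)
 show "AE y in lborel. ennreal_powr (NN x. ennreal_powr (N (x, y)) p * indicator II x) (1 / p) * indicator {0<..} y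
   <= ennreal_powr (NN x. ennreal_powr (N' (x, y)) p * indicator II x) (1 / p) * indicator {0<..} y"
  using AE_plane[OF assms(1)]
 proof eventually_elim
  case (elim y)
  show ?case
  proof (cases "y > 0")
   case True
   have "(NN x. ennreal_powr (N (x, y)) p * indicator II x) <= (NN x. ennreal_powr (N' (x, y)) p * indicator II x)"
    by (rule nn_integral_mono_AE) (use elim True assms(2) in \<open>auto simp: strip_def indicator_def elim!: eventually_mono intro: ennreal_powr_mono\<close>)
   then show ?thesis using assms(2) by (intro mult_right_mono ennreal_powr_mono) auto
  qed simp
 qed
qed

lemma mixed_norm_cong: "AE z in lborel. z \<in> strip --> N z = N' z ==> 0 < p ==> mixed_norm p N = mixed_norm p N'"
 by (intro antisym mixed_norm_mono) auto

lemma measurable_mixed_section: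
 fixes N :: "plane => ennreal"
 assumes N: "N \<in> Borel"
 shows "(%y. ennreal_powr (NN x. ennreal_powr (N (x, y)) p * indicator II x) r * indicator {0<..} y) \<in> Borel"
  "(%x. ennreal_powr (N (x, y)) p * indicator II x) \<in> Borel"
proof -
 have [measurable]: "N \<in> borel_measurable (borel \<Otimes>\<^sub>M borel)" using N by (simp add: borel_prod)
 show "(%y. ennreal_powr (NN x. ennreal_powr (N (x, y)) p * indicator II x) r * indicator {0<..} y) \<in> Borel" by measurable
 show "(%x. ennreal_powr (N (x, y)) p * indicator II x) \<in> Borel" by measurable
qed

text \<open>A quasi-triangle inequality with constant \<open>4\<close> from \<open>(a + b)\<^sup>p \<le> 2\<^sup>p (a\<^sup>p + b\<^sup>p)\<close> is enough here and avoids
Minkowski's inequality.\<close>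

lemma mixed_norm_add:
 assumes N: "N \<in> Borel" "N' \<in> Borel" and p: "1 < p"
 shows "mixed_norm p (%z. N z + N' z) <= 4 * (mixed_norm p N + mixed_norm p N')"
proof -
 let ?s = "%N y. NN x. ennreal_powr (N (x, y)) p * indicator II x"
 have 1: "?s (%z. N z + N' z) y <= ennreal (2 powr p) * (?s N y + ?s N' y)" for y
 proof -
  have "?s (%z. N z + N' z) y <= (NN x. ennreal (2 powr p) * (ennreal_powr (N (x, y)) p * indicator II x + ennreal_powr (N' (x, y)) p * indicator II x))"
   using ennreal_powr_add_le[of p "N (_, y)" "N' (_, y)"] p by (intro nn_integral_mono) (auto simp: indicator_def)
  also have "\<dots> = ennreal (2 powr p) * (?s N y + ?s N' y)"
   using measurable_mixed_section(2)[OF N(1)] measurable_mixed_section(2)[OF N(2)] by (subst nn_integral_cmult) (auto simp: nn_integral_add)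
  finally show ?thesis .
 qed
 have 2: "ennreal_powr (?s (%z. N z + N' z) y) (1 / p) <= 4 * (ennreal_powr (?s N y) (1 / p) + ennreal_powr (?s N' y) (1 / p))" for y
 proof -
  have "ennreal_powr (?s (%z. N z + N' z) y) (1 / p) <= ennreal_powr (ennreal (2 powr p) * (?s N y + ?s N' y)) (1 / p)"
   using 1 p by (intro ennreal_powr_mono) auto
  also have "\<dots> = 2 * ennreal_powr (?s N y + ?s N' y) (1 / p)"
   using p by (subst ennreal_powr_mult) (auto simp: powr_powr)
  also have "ennreal_powr (?s N y + ?s N' y) (1 / p) <= ennreal (2 powr (1 / p)) * (ennreal_powr (?s N y) (1 / p) + ennreal_powr (?s N' y) (1 / p))"
   using p by (intro ennreal_powr_add_le) auto
  also have "\<dots> <= ennreal 2 * (ennreal_powr (?s N y) (1 / p) + ennreal_powr (?s N' y) (1 / p))"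
  proof (intro mult_right_mono ennreal_leI)
   show "2 powr (1 / p) <= 2" using powr_mono[of "1 / p" 1 2] p by simp
  qed auto
  finally have "ennreal_powr (?s (%z. N z + N' z) y) (1 / p) <= 2 * (ennreal 2 * (ennreal_powr (?s N y) (1 / p) + ennreal_powr (?s N' y) (1 / p)))"
   by (simp add: mult_left_mono)
  then show ?thesis by (simp add: mult.assoc[symmetric])
 qed
 have "mixed_norm p (%z. N z + N' z) <= (NN y. 4 * (ennreal_powr (?s N y) (1 / p) * indicator {0<..} y + ennreal_powr (?s N' y) (1 / p) * indicator {0<..} y))"
  unfolding mixed_norm_def
 proof (intro nn_integral_mono)
  fix y show "ennreal_powr (?s (%z. N z + N' z) y) (1 / p) * indicator {0<..} y
   <= 4 * (ennreal_powr (?s N y) (1 / p) * indicator {0<..} y + ennreal_powr (?s N' y) (1 / p) * indicator {0<..} y)"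
   using 2[of y] by (cases "y > 0") simp_all
 qed
 also have "\<dots> = 4 * (mixed_norm p N + mixed_norm p N')"
  unfolding mixed_norm_def
  using measurable_mixed_section(1)[OF N(1), of p "1/p"] measurable_mixed_section(1)[OF N(2), of p "1/p"]
  by (subst nn_integral_cmult) (auto simp: nn_integral_add)
 finally show ?thesis .
qed

lemma mixed_norm_cmult:
 assumes N: "N \<in> Borel" and p: "1 < p" and c: "0 <= c"
 shows "mixed_norm p (%z. ennreal c * N z) = ennreal c * mixed_norm p N"
proof -
 let ?s = "%N y. NN x. ennreal_powr (N (x, y)) p * indicator II x"
 have "?s (%z. ennreal c * N z) y = ennreal (c powr p) * ?s N y" for y
  using measurable_mixed_section(2)[OF N] p c by (subst nn_integral_cmult[symmetric]) (auto simp: ennreal_powr_mult mult.assoc)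
 then have "ennreal_powr (?s (%z. ennreal c * N z) y) (1 / p) = ennreal c * ennreal_powr (?s N y) (1 / p)" for y
  using p c by (simp add: ennreal_powr_mult powr_powr)
 then show ?thesis unfolding mixed_norm_def
  using measurable_mixed_section(1)[OF N, of p "1/p"] by (simp add: nn_integral_cmult mult.assoc)
qed

text \<open>The inner interval has finite length, so \<open>t \<le> 1 + t\<^sup>p\<close> after normalising each slice does the work of Hoelder.\<close>

lemma integral_le_mixed_norm:
 assumes N: "N \<in> Borel" and p: "1 < p"
 shows "(NN z. N z * indicator strip z) <= ennreal (2 * pi + 1) * mixed_norm p N"
proof -
 let ?s = "%y. NN x. ennreal_powr (N (x, y)) p * indicator II x"
 have pw: "(NN x. N (x, y) * indicator II x) <= ennreal (2 * pi + 1) * ennreal_powr (?s y) (1 / p)" for y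
 proof (cases "?s y" rule: ennreal_cases)
  case top
  then show ?thesis by (simp add: ennreal_mult_top pi_gt_zero add_pos_pos)
 next
  case (real A)
  note m = measurable_mixed_section(2)[OF N, where y=y and p=p]
  note m1 = measurable_section_integral(2)[OF N, of y]
  show ?thesis
  proof (cases "A = 0")
   case True
   then have "AE x in lborel. ennreal_powr (N (x, y)) p * indicator II x = 0"
    using real m nn_integral_0_iff_AE[of "%x. ennreal_powr (N (x, y)) p * indicator II x" lborel] by simp
   then have "AE x in lborel. N (x, y) * indicator II x = 0" by eventually_elim (auto simp: indicator_def)
   then have "(NN x. N (x, y) * indicator II x) = (\<integral>\<^sup>+x. 0 \<partial>(lborel :: real measure))" by (rule nn_integral_cong_AE)
   then show ?thesis by simp
  next
   case False
   then have A: "A > 0" using real by simp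
   define L where "L = A powr (1 / p)"
   have L: "L > 0" "L powr p = A" using A p by (auto simp: L_def powr_powr)
   have "t <= L + L powr (1 - p) * t powr p" if "t \<ge> 0" for t
   proof (cases "t <= L")
    case True then show ?thesis by (simp add: add_increasing2)
   next
    case False
    have "1 <= (t / L) powr (p - 1)" using False L p by (intro ge_one_powr_ge_zero) auto
    then have "t <= t * (t / L) powr (p - 1)" using that by (simp add: mult_le_cancel_left1)
    also have "\<dots> = L powr (1 - p) * t powr p"
     using False L by (simp add: powr_divide powr_diff field_simps)
    finally show ?thesis using L by simp
   qed
   then have "n <= ennreal L + ennreal (L powr (1 - p)) * ennreal_powr n p" for n
    using L by (cases n rule: ennreal_cases)
     (auto simp: ennreal_powr_real ennreal_mult_top simp flip: ennreal_mult ennreal_plus intro!: ennreal_leI)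
   then have "(NN x. N (x, y) * indicator II x) <= (NN x. ennreal L * indicator II x + ennreal (L powr (1 - p)) * (ennreal_powr (N (x, y)) p * indicator II x))"
    by (intro nn_integral_mono) (auto simp: indicator_def)
   also have "\<dots> = ennreal L * emeasure lborel II + ennreal (L powr (1 - p)) * ?s y"
    using m by (subst nn_integral_add) (auto simp: nn_integral_cmult nn_integral_cmult_indicator)
   also have "\<dots> = ennreal (L * (2 * pi) + L powr (1 - p) * A)"
    using L real pi_gt_zero by (simp add: II_def flip: ennreal_mult ennreal_plus)
   also have "L powr (1 - p) * A = L" using L by (simp flip: L(2) powr_add)
   also have "ennreal (L * (2 * pi) + L) = ennreal (2 * pi + 1) * ennreal_powr (?s y) (1 / p)"
    using L real pi_gt_zero by (simp add: ennreal_powr_real L_def algebra_simps flip: ennreal_mult)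
   finally show ?thesis .
  qed
 qed
 have [measurable]: "(%z. N z * indicator strip z) \<in> Borel" using N by measurable
 have "(NN z. N z * indicator strip z) = (NN y. NN x. N (x, y) * indicator strip (x, y))" by (rule nn_integral_plane(1)) measurable
 also have "\<dots> <= (NN y. ennreal (2 * pi + 1) * (ennreal_powr (?s y) (1 / p) * indicator {0<..} y))"
 proof (intro nn_integral_mono)
  fix y
  have "(%x. N (x, y) * indicator strip (x, y)) = (%x. (N (x, y) * indicator II x) * indicator {0<..} y)" by (auto simp: strip_def indicator_def)
  then have "(NN x. N (x, y) * indicator strip (x, y)) = (NN x. N (x, y) * indicator II x) * indicator {0<..} y"
   using measurable_section_integral(2)[OF N, of y] by (simp add: nn_integral_multc)
  then show "(NN x. N (x, y) * indicator strip (x, y)) <= ennreal (2 * pi + 1) * (ennreal_powr (?s y) (1 / p) * indicator {0<..} y)"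
   using pw[of y] by (cases "y > 0") simp_all
 qed
 also have "\<dots> = ennreal (2 * pi + 1) * mixed_norm p N"
  unfolding mixed_norm_def using measurable_mixed_section(1)[OF N, of p "1/p"] by (subst nn_integral_cmult) auto
 finally show ?thesis .
qed

lemma mixed_norm_dominated:
 assumes N: "!!j::nat. N j \<in> Borel" and D: "D \<in> Borel" "mixed_norm p D < \<infinity>"
  and le: "!!j. AE z in lborel. z \<in> strip --> N j z <= D z" and lim: "AE z in lborel. z \<in> strip --> (%j. N j z) ---> 0"
  and p: "1 < p"
 shows "(%j. mixed_norm p (N j)) ---> 0"
proof -
 let ?s = "%N y. NN x. ennreal_powr (N (x, y)) p * indicator II x"
 let ?t = "%N y. ennreal_powr (?s N y) (1 / p) * indicator {0<..} y"
 have "AE z in lborel. \<forall>j. z \<in> strip --> N j z <= D z" using le unfolding AE_all_countable by blast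
 from AE_plane[OF this] have le': "AE y in lborel. AE x in lborel. \<forall>j. (x, y) \<in> strip --> N j (x, y) <= D (x, y)" .
 note lim' = AE_plane[OF lim]
 note mD = measurable_mixed_section[OF D(1)] and mN = measurable_mixed_section[OF N]
 have "(NN y. ?t D y) ~= \<infinity>" using D(2) by (simp add: mixed_norm_def)
 then have Dfin: "AE y in lborel. ?t D y ~= \<infinity>" using mD(1)[of p "1/p"] by (intro nn_integral_PInf_AE) auto
 have tle: "AE y in lborel. ?t (N j) y <= ?t D y" for j
  using le'
 proof eventually_elim
  case (elim y)
  show ?case
  proof (cases "y > 0")
   case True
   have "?s (N j) y <= ?s D y" by (rule nn_integral_mono_AE, use elim in eventually_elim)
      (use True p in \<open>auto simp: strip_def indicator_def intro: ennreal_powr_mono\<close>)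
   then show ?thesis using p by (intro mult_right_mono ennreal_powr_mono) auto
  qed simp
 qed
 have tlim: "AE y in lborel. (%j. ?t (N j) y) ---> 0"
  using Dfin lim' le'
 proof eventually_elim
  case (elim y)
  show ?case
  proof (cases "y > 0")
   case True
   have "(%j. ?s (N j) y) ---> (\<integral>\<^sup>+x. 0 \<partial>(lborel :: real measure))"
   proof (rule nn_integral_dominated_convergence[where w="%x. ennreal_powr (D (x, y)) p * indicator II x"])
    show "(NN x. ennreal_powr (D (x, y)) p * indicator II x) < \<infinity>"
     using elim(1) True by (simp add: less_top)
    show "AE x in lborel. ennreal_powr (N j (x, y)) p * indicator II x <= ennreal_powr (D (x, y)) p * indicator II x" for j
     using elim(3) by eventually_elim (use True p in \<open>auto simp: strip_def indicator_def intro: ennreal_powr_mono\<close>)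
    show "AE x in lborel. (%j. ennreal_powr (N j (x, y)) p * indicator II x) ---> 0"
     using elim(2) by eventually_elim (use True p in \<open>auto simp: strip_def indicator_def intro: tendsto_ennreal_powr_0\<close>)
   qed (use mD(2)[where p=p and y=y] mN(2)[where p=p and y=y] in auto)
   then have "(%j. ennreal_powr (?s (N j) y) (1 / p)) ---> 0" using p by (intro tendsto_ennreal_powr_0) auto
   then show ?thesis using True by simp
  qed simp
 qed
 have "(%j. NN y. ?t (N j) y) ---> (\<integral>\<^sup>+y. 0 \<partial>(lborel :: real measure))" by (rule nn_integral_dominated_convergence[where w="?t D"])
    (use mD(1)[of p "1/p"] mN(1)[of _ p "1/p"] D(2) tle tlim in \<open>auto simp: mixed_norm_def\<close>)
 then show ?thesis by (simp add: mixed_norm_def)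
qed

lemma mixed_norm_bounded_set:
 assumes p: "1 < p" shows "mixed_norm p (indicator (UNIV \<times> {..R})) < \<infinity>"
proof -
 have "ennreal_powr (NN x. ennreal_powr (indicator (UNIV \<times> {..R}) (x, y)) p * indicator II x) (1 / p) * indicator {0<..} y
   = ennreal ((2 * pi) powr (1 / p)) * indicator {0<..R} y" for y
 proof (cases "y <= R")
  case True
  have "(%x. ennreal_powr (indicator (UNIV \<times> {..R}) (x, y)) p * indicator II x) = indicator II"
   using True ennreal_powr_real[of 1 p] by (auto simp: indicator_def)
  then show ?thesis using True pi_gt_zero ennreal_powr_real[of "2 * pi" "1/p"] by (auto simp: II_def indicator_def)
 next
  case False
  have "(%x. ennreal_powr (indicator (UNIV \<times> {..R}) (x, y)) p * indicator II x) = (%x. 0)"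
   using False by (auto simp: indicator_def)
  then show ?thesis using False by (simp add: indicator_def)
 qed
 then have "mixed_norm p (indicator (UNIV \<times> {..R})) = ennreal ((2 * pi) powr (1 / p)) * emeasure lborel {0<..R}"
  unfolding mixed_norm_def by (simp add: nn_integral_cmult_indicator)
 also have "\<dots> < \<infinity>"
 proof -
  have "emeasure lborel {0<..R} <= emeasure lborel (cbox 0 R)" by (rule emeasure_mono) auto
  also have "\<dots> < \<infinity>" by (rule emeasure_lborel_cbox_finite)
  finally show ?thesis by (simp add: ennreal_mult_less_top)
 qed
 finally show ?thesis .
qed

text \<open>Finite sums of continuous compactly supported functions times vectors; they serve as the dense class.\<close>

inductive_set tensors :: "(plane => 'a::real_normed_vector) set" where
 zero: "(%z. 0) \<in> tensors"
| step: "\<lbrakk>continuous_on UNIV \<phi>; !!z. norm z > R ==> \<phi> z = 0; t \<in> tensors\<rbrakk> \<Longrightarrow> (%z. \<phi> z *\<^sub>R x + t z) \<in> tensors"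

lemma tensors_add: assumes "s \<in> tensors" "t \<in> tensors" shows "(%z. s z + t z) \<in> tensors"
 using assms
proof (induction rule: tensors.induct)
 case (step \<phi> R s x)
 then show ?case using tensors.step[of \<phi> R "%z. s z + t z" x] by (simp add: add.assoc)
qed simp

lemma tensors_continuous: "t \<in> tensors ==> continuous_on UNIV t"
 by (induction rule: tensors.induct) (auto intro!: continuous_intros)

lemma tensors_support: "t \<in> tensors ==> \<exists>R. \<forall>z. norm z > R --> t z = 0"
proof (induction rule: tensors.induct)
 case (step \<phi> R t x)
 then obtain R' where "\<forall>z. norm z > R' --> t z = 0" by blast
 then show ?case using step(2) by (intro exI[of _ "max R R'"]) auto
qed auto

definition tensor_approximable :: "real => (plane => 'a::real_normed_vector) => bool" where
 "tensor_approximable p G \<longleftrightarrow> (\<forall>e>0. \<exists>t\<in>tensors. mixed_norm p (%z. enorm (G z - t z)) < ennreal e)"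

lemma mixed_norm_triangle:
 assumes "simple_limit lborel F" "simple_limit lborel G" "1 < p"
 shows "mixed_norm p (%z. enorm (F z + G z)) <= 4 * (strip_norm p F + strip_norm p G)"
proof -
 have "mixed_norm p (%z. enorm (F z + G z)) <= mixed_norm p (%z. enorm (F z) + enorm (G z))"
  using assms(3) by (intro mixed_norm_mono AE_I2) (auto simp: norm_triangle_ineq simp flip: ennreal_plus)
 also have "\<dots> <= 4 * (strip_norm p F + strip_norm p G)"
  using assms simple_limit_norm_measurable[of lborel F] simple_limit_norm_measurable[of lborel G] by (intro mixed_norm_add) auto
 finally show ?thesis .
qed

lemma ennreal_quasi_sum:
 assumes "x < ennreal (e / 8)" "y < ennreal (e / 8)" "0 < e" shows "4 * (x + y) < ennreal e"
proof -
 have "x + y < ennreal (e / 8) + ennreal (e / 8)" using assms by (intro add_strict_mono)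
 then have "4 * (x + y) < 4 * (ennreal (e / 8) + ennreal (e / 8))" by (intro ennreal_mult_strict_left_mono) auto
 also have "\<dots> = ennreal e" using assms(3) by (simp flip: ennreal_plus ennreal_mult ennreal_numeral)
 finally show ?thesis .
qed

lemma simple_limit_tensors: "t \<in> tensors ==> simple_limit lborel t"
 by (intro simple_limit_continuous tensors_continuous)

lemma tensor_approximable_add:
 assumes "tensor_approximable p F" "tensor_approximable p G" "simple_limit lborel F" "simple_limit lborel G" "1 < p"
 shows "tensor_approximable p (%z. F z + G z)"
 unfolding tensor_approximable_def
proof (intro allI impI)
 fix e :: real assume e: "0 < e"
 then have "0 < e / 8" by simp
 then obtain s t where st: "s \<in> tensors" "t \<in> tensors"
  "mixed_norm p (%z. enorm (F z - s z)) < ennreal (e / 8)" "mixed_norm p (%z. enorm (G z - t z)) < ennreal (e / 8)"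
  using assms(1,2) unfolding tensor_approximable_def by meson
 have "mixed_norm p (%z. enorm ((F z - s z) + (G z - t z))) <= 4 * (mixed_norm p (%z. enorm (F z - s z)) + mixed_norm p (%z. enorm (G z - t z)))"
  by (intro mixed_norm_triangle simple_limit_diff simple_limit_tensors assms st)
 also have "\<dots> < ennreal e" by (intro ennreal_quasi_sum st e)
 finally show "\<exists>t\<in>tensors. mixed_norm p (%z. enorm (F z + G z - t z)) < ennreal e"
  using tensors_add[OF st(1,2)] by (intro bexI[of _ "%z. s z + t z"]) (auto simp: algebra_simps)
qed

lemma tensor_approximable_limit:
 assumes a: "!!j::nat. tensor_approximable p (F j)" and s: "!!j. simple_limit lborel (F j)" "simple_limit lborel G" and p: "1 < p"
  and lim: "(%j. mixed_norm p (%z. enorm (G z - F j z))) ---> 0"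
 shows "tensor_approximable p G"
 unfolding tensor_approximable_def
proof (intro allI impI)
 fix e :: real assume e: "0 < e"
 then have e8: "0 < e / 8" by simp
 then have "eventually (%j. mixed_norm p (%z. enorm (G z - F j z)) < ennreal (e / 8)) sequentially" by (intro order_tendstoD(2)[OF lim]) auto
 then obtain j where j: "mixed_norm p (%z. enorm (G z - F j z)) < ennreal (e / 8)"
  unfolding eventually_sequentially by blast
 obtain t where t: "t \<in> tensors" "mixed_norm p (%z. enorm (F j z - t z)) < ennreal (e / 8)"
  using a[of j] e8 unfolding tensor_approximable_def by meson
 have "mixed_norm p (%z. enorm ((G z - F j z) + (F j z - t z))) <= 4 * (mixed_norm p (%z. enorm (G z - F j z)) + mixed_norm p (%z. enorm (F j z - t z)))"
  by (intro mixed_norm_triangle simple_limit_diff simple_limit_tensors s t p)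
 also have "\<dots> < ennreal e" by (intro ennreal_quasi_sum j t e)
 finally show "\<exists>t\<in>tensors. mixed_norm p (%z. enorm (G z - t z)) < ennreal e"
  using t(1) by auto
qed

text \<open>Continuous functions converging to the indicator almost everywhere, with values cut to \<open>[0, 1]\<close> and support cut to a
ball.\<close>

lemma tensor_approximable_indicator:
 assumes A: "A \<in> sets borel" "!!z. z \<in> A ==> norm z <= R" and p: "1 < p"
 shows "tensor_approximable p (%z. indicator A z *\<^sub>R x)"
proof -
 have "(indicator A :: plane => real) measurable_on UNIV"
 proof (rule lebesgue_measurable_imp_measurable_on_nnreal)
  have "A \<in> sets lebesgue" using A(1) by simp
  then show "(indicator A :: plane => real) \<in> borel_measurable lebesgue" by (rule borel_measurable_indicator)
 qed auto
 then obtain N g where N: "negligible N" and g: "!!n::nat. continuous_on UNIV (g n)"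
  "!!z. z \<notin> N ==> (%n. g n z) ---> (indicator A z :: real)"
  unfolding measurable_on_def by auto
 define \<phi> where "\<phi> n z = max 0 (min 1 (g n z)) * max 0 (min 1 (R + 1 - norm z))" for n z
 have \<phi>c: "continuous_on UNIV (\<phi> n)" for n
  unfolding \<phi>_def by (intro continuous_intros g)
 have \<phi>b: "0 <= \<phi> n z" "\<phi> n z <= 1" "norm z > R + 1 ==> \<phi> n z = 0" for n z by (auto simp: \<phi>_def intro!: mult_le_one)
 have "N \<in> null_sets lebesgue" using N negligible_iff_null_sets by blast
 then have "AE z in lebesgue. z \<notin> N" by (rule AE_not_in)
 then have ae: "AE z in lborel. z \<notin> N" by (simp add: AE_completion_iff)
 show ?thesis
 proof (rule tensor_approximable_limit[where F="%n z. \<phi> n z *\<^sub>R x"])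
  have t: "(%z. \<phi> n z *\<^sub>R x) \<in> tensors" for n
   using tensors.step[OF \<phi>c, of "R + 1" n "%z. 0" x] \<phi>b tensors.zero by auto
  have m0: "mixed_norm p (%z. 0) = 0" by (simp add: mixed_norm_def)
  show "tensor_approximable p (%z. \<phi> n z *\<^sub>R x)" for n
   unfolding tensor_approximable_def using t by (intro allI impI bexI[of _ "%z. \<phi> n z *\<^sub>R x"]) (auto simp: m0)
  show "simple_limit lborel (%z. \<phi> n z *\<^sub>R x)" for n by (rule simple_limit_tensors[OF t])
  show sA: "simple_limit lborel (%z. indicator A z *\<^sub>R x)" by (intro simple_limit_scaleR simple_limit_const) (use A in simp)
  show "(%j. mixed_norm p (%z. enorm (indicator A z *\<^sub>R x - \<phi> j z *\<^sub>R x))) ---> 0"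
  proof (rule mixed_norm_dominated[OF _ _ _ _ _ p, where D="%z. enorm x * indicator (UNIV \<times> {..R + 1}) z"])
   show "(%z. enorm (indicator A z *\<^sub>R x - \<phi> j z *\<^sub>R x)) \<in> Borel" for j
    using simple_limit_norm_measurable[OF simple_limit_diff[OF sA simple_limit_tensors[OF t[of j]]]] by simp
   have "closed (UNIV \<times> {..R + 1} :: plane set)" by (intro closed_Times) auto
   then have ib: "(indicator (UNIV \<times> {..R + 1}) :: plane => ennreal) \<in> Borel" by (intro borel_measurable_indicator borel_closed)
   show "(%z :: plane. enorm x * indicator (UNIV \<times> {..R + 1}) z) \<in> Borel"
    using borel_measurable_times_ennreal[OF borel_measurable_const ib, of "enorm x"] by simp
   show "mixed_norm p (%z. enorm x * indicator (UNIV \<times> {..R + 1}) z) < \<infinity>"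
    using mixed_norm_bounded_set[OF p, of "R + 1"] by (subst mixed_norm_cmult[OF ib p]) (auto simp: ennreal_mult_less_top)
   show "AE z in lborel. z \<in> strip --> enorm (indicator A z *\<^sub>R x - \<phi> j z *\<^sub>R x) <= enorm x * indicator (UNIV \<times> {..R + 1}) z" for j
   proof (intro AE_I2 impI)
    fix z :: "plane"
    show "enorm (indicator A z *\<^sub>R x - \<phi> j z *\<^sub>R x) <= enorm x * indicator (UNIV \<times> {..R + 1}) z"
    proof (cases "norm z > R + 1")
     case True
     then have "z \<notin> A" using A(2)[of z] by auto
     then show ?thesis using True \<phi>b(3) by simp
    next
     case False
     have "\<bar>snd z\<bar> <= norm z" using norm_snd_le[of "snd z" "fst z"] by simp
     then have "z \<in> UNIV \<times> {..R + 1}" using False by (cases z) auto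
     moreover have "norm (indicator A z *\<^sub>R x - \<phi> j z *\<^sub>R x) <= norm x"
     proof -
      have "\<bar>indicator A z - \<phi> j z\<bar> <= 1" using \<phi>b(1,2)[of j z] by (auto simp: indicator_def)
      then show ?thesis by (simp add: mult_left_le_one_le flip: scaleR_diff_left)
     qed
     ultimately show ?thesis by (simp add: ennreal_leI)
    qed
   qed
   show "AE z in lborel. z \<in> strip --> (%j. enorm (indicator A z *\<^sub>R x - \<phi> j z *\<^sub>R x)) ---> 0"
    using ae
   proof eventually_elim
    case (elim z)
    have "(%j. \<phi> j z) ---> max 0 (min 1 (indicator A z)) * max 0 (min 1 (R + 1 - norm z))"
     unfolding \<phi>_def by (intro tendsto_intros g elim)
    also have "max 0 (min 1 (indicator A z)) * max 0 (min 1 (R + 1 - norm z)) = indicator A z"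
     using A(2)[of z] by (auto simp: indicator_def)
    finally have "(%j. enorm (indicator A z *\<^sub>R x - \<phi> j z *\<^sub>R x)) ---> enorm (indicator A z *\<^sub>R x - indicator A z *\<^sub>R x)"
     by (intro tendsto_ennrealI tendsto_norm tendsto_diff tendsto_scaleR tendsto_const)
    then show ?case by simp
   qed
  qed
 qed (rule p)
qed

text \<open>Simple approximations of \<open>G\<close> dominated by \<open>2 * norm G\<close> converge in the mixed norm, after truncation to bounded \<open>y\<close>.\<close>

lemma tensors_dense:
 fixes G :: "plane => 'a::real_normed_vector"
 assumes G: "L1 G" "!!z. z \<notin> strip ==> G z = 0" "strip_norm p G < \<infinity>" and p: "1 < p"
 shows "tensor_approximable p G"
proof -
 obtain s where s: "!!i::nat. bochner_simple lborel (s i)"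
  "!!x. (%i. s i x) ---> G x"
  "!!i x. norm (s i x) <= 2 * norm (G x)"
 proof (rule abs_integrable_simple_approx[OF G(1)])
 qed (use that in auto)
 have sG: "simple_limit lborel G" using G(1) by (simp add: abs_integrable_def)
 have cl: "closed (UNIV \<times> {..r} :: plane set)" for r by (intro closed_Times) auto
 then have ib: "UNIV \<times> {..r} \<in> sets (borel :: plane measure)" for r by (rule borel_closed)
 define F where "F i z = indicator (UNIV \<times> {..real i}) z *\<^sub>R s i z" for i and z :: "plane"
 have sF: "simple_limit lborel (F i)" for i
  unfolding F_def by (intro simple_limit_scaleR simple_bochner_imp_simple_limit s) (use ib in simp)
 show ?thesis
 proof (rule tensor_approximable_limit[OF _ sF sG p])
  show "tensor_approximable p (F i)" for i
  proof -
   have sf: "simple_function lborel (s i)" using s(1)[of i] by (auto elim: simple_bochner_integrable.cases)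
   define Y where "Y = range (s i) - {0}"
   have Yfin: "finite Y" using simple_functionD(1)[OF sf] by (simp add: Y_def)
   define A where "A y = (UNIV \<times> {..real i}) \<inter> s i -` {y}" for y
   have Ab: "A y \<in> sets borel" for y
    using simple_functionD(2)[OF sf, of "{y}"] ib by (auto simp: A_def)
   have An: "norm z <= 2 * pi + real i" if "z \<in> A y" "y \<in> Y" for z y
   proof -
    have "s i z ~= 0" using that by (auto simp: A_def Y_def)
    then have "z \<in> strip" using s(3)[of i z] G(2)[of z] by (cases "z \<in> strip") simp_all
    then have "0 < fst z" "fst z < 2 * pi" "0 < snd z" by (auto simp: strip_def II_def)
    moreover have "snd z <= real i" using that by (auto simp: A_def)
    moreover have "norm z <= \<bar>fst z\<bar> + \<bar>snd z\<bar>" by (cases z) (simp add: norm_prod_def sqrt_sum_squares_le_sum_abs)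
    ultimately show ?thesis by simp
   qed
   have eq: "F i = (%z. \<Sum>y\<in>Y. indicator (A y) z *\<^sub>R y)"
   proof
    fix z
    have "(\<Sum>y\<in>Y. indicator (A y) z *\<^sub>R y) = (\<Sum>y\<in>Y. if y = s i z then F i z else 0)"
     by (intro sum.cong) (auto simp: A_def F_def indicator_def)
    also have "\<dots> = F i z" using Yfin by (auto simp: Y_def F_def)
    finally show "F i z = (\<Sum>y\<in>Y. indicator (A y) z *\<^sub>R y)" by simp
   qed
   have sl: "simple_limit lborel (%z. indicator (A y) z *\<^sub>R y)" for y by (intro simple_limit_scaleR simple_limit_const) (use Ab in simp)
   have "tensor_approximable p (%z. \<Sum>y\<in>Z. indicator (A y) z *\<^sub>R y) & simple_limit lborel (%z. \<Sum>y\<in>Z. indicator (A y) z *\<^sub>R y)"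
    if "finite Z" "Z \<subseteq> Y" for Z
    using that
   proof (induction Z)
    case empty
    have m0: "mixed_norm p (%z. 0) = 0" by (simp add: mixed_norm_def)
    show ?case unfolding tensor_approximable_def using tensors.zero by (auto simp: m0 intro!: bexI[of _ "%z. 0"])
   next
    case (insert y Z)
    have "tensor_approximable p (%z. indicator (A y) z *\<^sub>R y)" by (rule tensor_approximable_indicator[OF Ab An p]) (use insert.prems in auto)
    then show ?case using insert.IH insert.prems sl[of y] p unfolding sum.insert[OF insert.hyps]
     by (intro conjI tensor_approximable_add simple_limit_add) blast+
   qed
   then show ?thesis unfolding eq using Yfin by blast
  qed
  show "(%j. mixed_norm p (%z. enorm (G z - F j z))) ---> 0"
  proof (rule mixed_norm_dominated[OF _ _ _ _ _ p, where D="%z. ennreal 3 * enorm (G z)"])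
   have Gm: "(%z. enorm (G z)) \<in> Borel" using measurable_norm_abs_integrable[of G] simple_limit_norm_measurable[OF sG] by simp
   show "(%z. enorm (G z - F j z)) \<in> Borel" for j
    using simple_limit_norm_measurable[OF simple_limit_diff[OF sG sF[of j]]] by simp
   show "(%z. ennreal 3 * enorm (G z)) \<in> Borel" using Gm by measurable
   show "mixed_norm p (%z. ennreal 3 * enorm (G z)) < \<infinity>"
    using G(3) by (subst mixed_norm_cmult[OF Gm p]) (auto simp: ennreal_mult_less_top simp del: ennreal_numeral)
   show "AE z in lborel. z \<in> strip --> enorm (G z - F j z) <= ennreal 3 * enorm (G z)" for j
   proof (intro AE_I2 impI)
    fix z
    have "norm (F j z) <= 2 * norm (G z)" using s(3)[of j z] by (auto simp: F_def indicator_def)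
    then have "norm (G z - F j z) <= 3 * norm (G z)" using norm_triangle_ineq4[of "G z" "F j z"] by linarith
    then show "enorm (G z - F j z) <= ennreal 3 * enorm (G z)" by (simp add: ennreal_leI flip: ennreal_mult del: ennreal_numeral)
   qed
   show "AE z in lborel. z \<in> strip --> (%j. enorm (G z - F j z)) ---> 0"
   proof (intro AE_I2 impI)
    fix z :: "plane"
    obtain n :: nat where n: "snd z <= real n" using real_arch_simple by blast
    have "F j z = s j z" if "j \<ge> n" for j
     using that n by (cases z) (auto simp: F_def indicator_def)
    then have "eventually (%j. s j z = F j z) sequentially" unfolding eventually_sequentially by metis
    then have "(%j. F j z) ---> G z" using s(2)[of z] by (rule Lim_transform_eventually[rotated])
    then have "(%j. enorm (G z - F j z)) ---> enorm (G z - G z)" by (intro tendsto_ennrealI tendsto_norm tendsto_diff tendsto_const)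
    then show "(%j. enorm (G z - F j z)) ---> 0" by simp
   qed
  qed
 qed
qed

section \<open>Difference quotients converge in the mixed norm\<close>

lemma power_tangent_le:
 fixes g m p :: real assumes "0 <= g" "0 <= m" "1 < p"
 shows "p * m powr (p - 1) * g <= g powr p + (p - 1) * m powr p"
proof -
 define q where "q = p / (p - 1)"
 have pq: "p > 1" "1 / p + 1 / q = 1" "q > 1" using assms by (auto simp: q_def field_simps)
 have "g * m powr (p - 1) <= g powr p / p + (m powr (p - 1)) powr q / q"
  using Youngs_inequality[of p q g "m powr (p - 1)"] pq assms by auto
 also have "(m powr (p - 1)) powr q = m powr p" using assms by (simp add: powr_powr q_def)
 also have "m powr p / q = (p - 1) * m powr p / p" by (simp add: q_def)
 finally have "p * (g * m powr (p - 1)) <= p * (g powr p / p + (p - 1) * m powr p / p)"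
  using assms by (intro mult_left_mono) auto
 also have "\<dots> = g powr p + (p - 1) * m powr p" using assms by (simp add: field_simps)
 finally show ?thesis by (simp add: mult_ac)
qed

text \<open>Integrate the tangent line inequality of \<open>t \<mapsto> t\<^sup>p\<close> at the mean value.\<close>

lemma jensen_powr:
 assumes g [measurable]: "g \<in> Borel" and p: "1 < p"
 shows "ennreal_powr (NN s. g s * indicator {0<..<1::real} s) p <= (NN s. ennreal_powr (g s) p * indicator {0<..<1} s)"
  (is "ennreal_powr ?m p <= ?I")
proof (cases ?m rule: ennreal_cases)
 case top
 have le: "x <= 1 + ennreal_powr x p" for x
 proof (cases x rule: ennreal_cases)
  case (real a)
  have "a <= 1 + a powr p"
  proof (cases "a <= 1")
   case False then have "a powr 1 <= a powr p" using p by (intro powr_mono) auto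
   then show ?thesis using False by simp
  qed (use real in \<open>simp add: add_increasing2\<close>)
  then show ?thesis using real by (simp add: ennreal_powr_real ennreal_leI flip: ennreal_1 ennreal_plus)
 qed simp
 have "?m <= (NN s. indicator {0<..<1::real} s + ennreal_powr (g s) p * indicator {0<..<1} s)"
  by (intro nn_integral_mono) (use le in \<open>auto simp: indicator_def\<close>)
 also have "\<dots> = 1 + ?I" by (subst nn_integral_add) auto
 finally have "?I = top" using top by (auto simp: top_unique)
 then show ?thesis by simp
next
 case (real m)
 have le: "ennreal (p * m powr (p - 1)) * x <= ennreal_powr x p + ennreal ((p - 1) * m powr p)" for x
 proof (cases x rule: ennreal_cases)
  case (real a)
  then show ?thesis using power_tangent_le[of a m p] p \<open>0 <= m\<close> by (simp add: ennreal_powr_real ennreal_leI flip: ennreal_plus ennreal_mult)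
 qed simp
 have "ennreal (p * m powr (p - 1)) * ?m = (NN s. ennreal (p * m powr (p - 1)) * (g s * indicator {0<..<1} s))" by (subst nn_integral_cmult) auto
 also have "\<dots> <= (NN s. ennreal_powr (g s) p * indicator {0<..<1} s + ennreal ((p - 1) * m powr p) * indicator {0<..<1} s)"
  by (intro nn_integral_mono) (use le in \<open>auto simp: indicator_def\<close>)
 also have "\<dots> = ?I + ennreal ((p - 1) * m powr p)" by (subst nn_integral_add) (auto simp: nn_integral_cmult_indicator)
 finally have 1: "ennreal (p * m powr (p - 1)) * ennreal m <= ?I + ennreal ((p - 1) * m powr p)" using real by simp
 have "ennreal (p * m powr (p - 1)) * ennreal m = ennreal (m powr p + (p - 1) * m powr p)"
 proof (cases "m = 0")
  case False
  then have "m powr (p - 1) * m = m powr p" using real by (simp add: powr_diff)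
  then show ?thesis using p real by (simp add: algebra_simps flip: ennreal_mult)
 qed (use p in simp)
 also have "\<dots> = ennreal (m powr p) + ennreal ((p - 1) * m powr p)" using p by simp
 finally have "ennreal ((p - 1) * m powr p) + ennreal (m powr p) <= ennreal ((p - 1) * m powr p) + ?I"
  using 1 by (simp only: add.commute)
 then have "ennreal (m powr p) <= ?I" by (simp only: ennreal_add_left_cancel_le) simp
 then show ?thesis using real by (simp add: ennreal_powr_real)
qed

definition average :: "real => (plane => ennreal) => plane => ennreal" where
 "average r N z = (NN s. N (fst z + r * s, snd z) * indicator {0<..<1} s)"

lemma measurable_average:
 assumes "N \<in> Borel" shows "average r N \<in> Borel"
proof -
 have N: "N \<in> borel_measurable (borel :: plane measure)" by (rule assms)
 have T: "(%p :: plane \<times> real. (fst (fst p) + r * snd p, snd (fst p))) \<in> borel_measurable (borel \<Otimes>\<^sub>M borel)"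
  unfolding borel_prod by (intro borel_measurable_continuous_onI continuous_intros)
 note [measurable] = measurable_compose[OF T N]
 show ?thesis unfolding average_def by measurable
qed

text \<open>Jensen in \<open>s\<close> and a dilation in \<open>x\<close> for each fixed \<open>s\<close>; \<open>1 - h \<ge> 1/2\<close> bounds the Jacobian. The maps
\<open>x \<mapsto> (1 - h) x + 2 \<pi> h s\<close> send \<open>(0, 2 \<pi>)\<close> into itself.\<close>

lemma mixed_norm_average:
 assumes N: "N \<in> Borel" and p: "1 < p" and h: "0 < h" "h <= 1 / 2"
 shows "mixed_norm p (%z. average (2 * pi * h) N (shear (1 - h) 0 z)) <= 2 * mixed_norm p N"
proof -
 let ?c = "1 - h" and ?r = "2 * pi * h"
 have c: "?c > 0" "1 / ?c <= 2" using h by (auto simp: field_simps)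
 have "ennreal_powr (NN x. ennreal_powr (average ?r N (shear ?c 0 (x, y))) p * indicator II x) (1 / p)
   <= 2 * ennreal_powr (NN x. ennreal_powr (N (x, y)) p * indicator II x) (1 / p)" for y
 proof -
  define f where "f x = ennreal_powr (N (x, y)) p * indicator II x" for x
  have f [measurable]: "f \<in> Borel" unfolding f_def by (rule measurable_mixed_section(2)[OF N])
  have Ny [measurable]: "(%x. N (x, y)) \<in> Borel" by (rule measurable_section_integral(2)[OF N])
  have "(NN x. ennreal_powr (average ?r N (shear ?c 0 (x, y))) p * indicator II x)
    <= (NN x. (NN s. f (?c * x + ?r * s) * indicator {0<..<1} s))"
  proof (intro nn_integral_mono)
   fix x
   show "ennreal_powr (average ?r N (shear ?c 0 (x, y))) p * indicator II x <= (NN s. f (?c * x + ?r * s) * indicator {0<..<1} s)"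
   proof (cases "x \<in> II")
    case True
    have in_II: "?c * x + ?r * s \<in> II" if "s \<in> {0<..<1}" for s
    proof -
     have 1: "?r * s < ?r" "0 < ?r * s" using that h pi_gt_zero by auto
     have 2: "?c * x < ?c * (2 * pi)" "0 < ?c * x" using True c by (auto simp: II_def)
     have "?c * x + ?r * s < ?c * (2 * pi) + ?r" using 1 2 by (intro add_strict_mono)
     also have "\<dots> = 2 * pi" by (simp add: algebra_simps)
     finally show ?thesis using add_pos_pos[OF 2(2) 1(2)] by (simp add: II_def)
    qed
    have "ennreal_powr (average ?r N (shear ?c 0 (x, y))) p
      <= (NN s. ennreal_powr (N (?c * x + ?r * s, y)) p * indicator {0<..<1} s)"
     unfolding average_def shear_def using jensen_powr[of "%s. N (?c * x + ?r * s, y)" p] p by simp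
    also have "\<dots> = (NN s. f (?c * x + ?r * s) * indicator {0<..<1} s)"
     by (intro nn_integral_cong) (use in_II in \<open>auto simp: f_def indicator_def\<close>)
    finally show ?thesis using True by simp
   qed simp
  qed
  also have "\<dots> = (NN s. (NN x. f (?c * x + ?r * s) * indicator {0<..<1} s))" by (rule lborel_pair.Fubini') measurable
  also have "\<dots> = (NN s. ennreal (1 / ?c) * (NN x. f x) * indicator {0<..<1::real} s)"
  proof (intro nn_integral_cong)
   fix s :: real
   have "ennreal (1 / ?c) * (NN x. f x) = ennreal (1 / ?c) * (ennreal \<bar>?c\<bar> * (NN x. f (?r * s + ?c * x)))"
    using nn_integral_real_affine[OF f, of ?c "?r * s"] c by simp
   also have "\<dots> = (NN x. f (?c * x + ?r * s))"
    using c by (simp add: add.commute mult.assoc[symmetric] flip: ennreal_mult)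
   finally show "(NN x. f (?c * x + ?r * s) * indicator {0<..<1} s) = ennreal (1 / ?c) * (NN x. f x) * indicator {0<..<1} s" by (simp add: nn_integral_multc)
  qed
  also have "\<dots> = ennreal (1 / ?c) * (NN x. f x)" by (simp add: nn_integral_cmult_indicator)
  finally have "ennreal_powr (NN x. ennreal_powr (average ?r N (shear ?c 0 (x, y))) p * indicator II x) (1 / p)
    <= ennreal_powr (ennreal (1 / ?c) * (NN x. f x)) (1 / p)" using p by (intro ennreal_powr_mono) auto
  also have "\<dots> = ennreal ((1 / ?c) powr (1 / p)) * ennreal_powr (NN x. f x) (1 / p)"
   using c p by (intro ennreal_powr_mult) auto
  also have "\<dots> <= ennreal 2 * ennreal_powr (NN x. f x) (1 / p)"
  proof (intro mult_right_mono ennreal_leI)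
   have "(1 / ?c) powr (1 / p) <= 2 powr (1 / p)" using c p by (intro powr_mono2) auto
   also have "\<dots> <= 2" using powr_mono[of "1 / p" 1 2] p by simp
   finally show "(1 / ?c) powr (1 / p) <= 2" .
  qed auto
  finally show ?thesis by (simp add: f_def)
 qed
 then have "mixed_norm p (%z. average ?r N (shear ?c 0 z)) <= (NN y. 2 * (ennreal_powr (NN x. ennreal_powr (N (x, y)) p * indicator II x) (1 / p) * indicator {0<..} y))"
  unfolding mixed_norm_def by (intro nn_integral_mono) (auto simp: indicator_def)
 also have "\<dots> = 2 * mixed_norm p N"
  unfolding mixed_norm_def using measurable_mixed_section(1)[OF N, of p "1/p"] by (subst nn_integral_cmult) auto
 finally show ?thesis .
qed

text \<open>The vector-valued counterpart of \<open>average\<close>, needed for continuous integrands only.\<close>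

definition mean :: "real => (plane => 'a::banach) => plane => 'a" where
 "mean r t z = integral {0..1} (%s. t (fst z + r * s, snd z))"

lemma mean_continuous:
 assumes "continuous_on UNIV t" shows "continuous_on UNIV (mean r t)"
proof -
 have "continuous_on UNIV (%z. integral (cbox 0 1) ((%z s. t (fst z + r * s, snd z)) z))"
 proof (rule integral_continuous_on_param)
  have "continuous_on (UNIV \<times> cbox 0 1) (%p :: plane \<times> real. t (fst (fst p) + r * snd p, snd (fst p)))"
   by (rule continuous_on_compose2[OF assms]) (auto intro!: continuous_intros)
  then show "continuous_on (UNIV \<times> cbox 0 1) (%(z, s). t (fst z + r * s, snd z))" by (simp add: case_prod_beta')
 qed
 then show ?thesis unfolding mean_def by simp
qed

lemma mean_integrable:
 fixes t :: "plane => 'a::banach"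
 assumes "continuous_on UNIV t" shows "(%s. t (fst z + r * s, snd z)) integrable_on {0..1}"
 by (rule integrable_continuous_interval, rule continuous_on_compose2[OF assms]) (auto intro!: continuous_intros)

lemma integrable_Icc: "integrable lborel (%x. c * indicator {a..b::real} x :: real)"
proof -
 have "emeasure lborel {a..b} < \<infinity>" using emeasure_lborel_cbox_finite[of a b] by simp
 then show ?thesis by (intro integrable_mult_right integrable_real_indicator) auto
qed

lemma integral_product:
 fixes g :: "'b::euclidean_space => real" and k :: "'c::euclidean_space => real"
 assumes "integrable lborel g" "integrable lborel k"
 shows "integrable (lborel \<Otimes>\<^sub>M lborel) (%(z, s). g z * k s)"
proof (rule lborel_pair.Fubini_integrable)
 have [measurable]: "g \<in> Borel" "k \<in> Borel" using assms by auto
 show "(%(z, s). g z * k s) \<in> borel_measurable (lborel \<Otimes>\<^sub>M lborel)" by measurable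
 show "integrable lborel (%x. \<integral>y. norm (case (x, y) of (z, s) => g z * k s) \<partial>lborel)"
  using assms by (simp add: abs_mult)
 show "AE x in lborel. integrable lborel (%y. case (x, y) of (z, s) => g z * k s)" using assms by simp
qed

text \<open>\<open>L\<close> is \<open>r\<close> times the average of \<open>a\<close> over \<open>[x - r, x]\<close>. It transposes the difference quotient: the translation difference of \<open>a\<close> is
\<open>deriv L\<close>, a legitimate weak derivative test function.\<close>

lemma window_function:
 assumes a: "smooth a" "supported_in 0 (d - r) a" and r: "0 < r"
 obtains L where "smooth L" "supported_in 0 d L" "!!x. deriv L x = a x - a (x - r)"
  "!!x. L x = r * (\<integral>s. a (x - r * s) * indicator {0..1} s \<partial>lborel)"
proof -
 obtain c' d' where cd: "0 < c'" "d' < d - r" "!!x. a x ~= 0 ==> c' <= x & x <= d'"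
  using a(2) unfolding supported_in_def by blast
 obtain A where A: "smooth A" "!!x. (A has_real_derivative a x) (at x)" "!!x. x <= 0 ==> A x = 0"
  using smooth_antiderivative[OF a(1), of 0] supported_in_outside[OF a(2)] by blast
 define L where "L x = A x - A (x - r)" for x
 have As: "smooth (%x. A (x - r))" using smooth_affine[OF A(1), of 1 "-r"] by simp
 have 1: "smooth L" unfolding L_def by (intro smooth_diff A As)
 have "((%x. A (x - r)) has_real_derivative a (x - r)) (at x)" for x
 proof -
  have "((%x. x - r) has_real_derivative 1) (at x)" by (auto intro!: derivative_eq_intros)
  from DERIV_chain2[where f=A and g="%x. x - r", OF A(2) this] show ?thesis by simp
 qed
 then have d: "(L has_real_derivative a x - a (x - r)) (at x)" for x
  unfolding L_def by (intro DERIV_diff A)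
 have L: "L x = r * (\<integral>s. a (x - r * s) * indicator {0..1} s \<partial>lborel)" for x
 proof -
  have "(\<integral>s. (r * a (x - r * s)) * indicator {0..1} s \<partial>lborel) = - A (x - r * 1) - (- A (x - r * 0))"
  proof (rule integral_FTC_Icc_real)
   fix s :: real
   have "((%s. x - r * s) has_real_derivative - r) (at s)" by (auto intro!: derivative_eq_intros)
   from DERIV_minus[OF DERIV_chain2[where f=A and g="%s. x - r * s", OF A(2) this]]
   show "((%s. - A (x - r * s)) has_real_derivative r * a (x - r * s)) (at s)" by (simp add: mult.commute)
   have "continuous_on UNIV (%s. r * a (x - r * s))" by (intro continuous_intros continuous_on_compose2[OF smooth_continuous[OF a(1), of UNIV]]) auto
   then show "isCont (%s. r * a (x - r * s)) s" by (simp add: continuous_on_eq_continuous_at)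
  qed simp
  then show ?thesis by (simp add: L_def mult.assoc)
 qed
 have "L x = 0" if "\<not> (c' <= x & x <= d' + r)" for x
 proof -
  have "a (x - r * s) * indicator {0..1} s = 0" for s
  proof (cases "s \<in> {0..1}")
   case True
   then have "0 <= r * s" "r * s <= r" using r by auto
   then have "\<not> (c' <= x - r * s & x - r * s <= d')" using that by auto
   then show ?thesis using cd(3)[of "x - r * s"] by auto
  qed simp
  then have "(%s. a (x - r * s) * indicator {0..1} s) = (%s. 0)" by (intro ext)
  then show ?thesis by (simp only: L) simp
 qed
 note Lz = this
 have 2: "supported_in 0 d L" unfolding supported_in_def
 proof (rule exI[of _ c'], rule exI[of _ "d' + r"], intro conjI allI impI)
  show "0 < c'" "d' + r < d" using cd by auto
  fix x assume "L x ~= 0"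
  then show "c' <= x" "x <= d' + r" using Lz by blast+
 qed
 show thesis by (rule that[OF 1 2 DERIV_imp_deriv[OF d] L])
qed

lemma mean_fubini_real:
 fixes \<phi> :: "plane => real"
 assumes \<phi>: "continuous_on UNIV \<phi>" and b0: "!!z. \<bar>\<phi> z\<bar> <= C"
  and a: "smooth a" "supported_in c d a" and b: "smooth b" "supported_in c' d' b"
  and L: "!!x. L x = r * (\<integral>s. a (x - r * s) * indicator {0..1} s \<partial>lborel)"
 shows "(\<integral>z. tensor a b z * (r * mean r \<phi> z) \<partial>lborel) = (\<integral>z. tensor L b z * \<phi> z \<partial>lborel)"
proof -
 have \<phi>m: "\<phi> \<in> Borel" using \<phi> by (rule borel_measurable_continuous_onI)
 note iab = integral_tensor(1)[OF integrable_test[OF a] integrable_test[OF b]]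
 have mean: "mean r \<phi> z = (\<integral>s. \<phi> (fst z + r * s, snd z) * indicator {0..1} s \<partial>lborel)" for z
 proof -
  have "set_integrable lborel {0..1} (%s. \<phi> (fst z + r * s, snd z))"
   unfolding set_integrable_def by (rule borel_integrable_compact) (auto intro!: continuous_on_compose2[OF \<phi>] continuous_intros)
  from set_borel_integral_eq_integral(2)[OF this] show ?thesis
   unfolding mean_def set_lebesgue_integral_def by (simp add: mult.commute)
 qed
 have T: "(%p :: plane \<times> real. (fst (fst p) + r * snd p, snd (fst p))) \<in> borel_measurable (borel \<Otimes>\<^sub>M borel)"
  and T': "(%p :: plane \<times> real. fst (fst p) - r * snd p) \<in> borel_measurable (borel \<Otimes>\<^sub>M borel)"
  and S: "(%p :: plane \<times> real. snd (fst p)) \<in> borel_measurable (borel \<Otimes>\<^sub>M borel)"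
  unfolding borel_prod by (intro borel_measurable_continuous_onI continuous_intros)+
 have tm [measurable]: "tensor a b \<in> Borel" by (intro measurable_tensor smooth_measurable a b)
 have m1: "(%p. tensor a b (fst p) * (\<phi> (fst (fst p) + r * snd p, snd (fst p)) * indicator {0..1} (snd p))) \<in> borel_measurable (lborel \<Otimes>\<^sub>M lborel)"
  using measurable_compose[OF T \<phi>m] by simp
 have k: "integrable lborel (%s. C * indicator {0..1::real} s)" by (rule integrable_Icc)
 have C0: "0 <= C" using b0[of undefined] by linarith
 have i1: "integrable (lborel \<Otimes>\<^sub>M lborel) (%p. tensor a b (fst p) * (\<phi> (fst (fst p) + r * snd p, snd (fst p)) * indicator {0..1} (snd p)))"
 proof (rule Bochner_Integration.integrable_bound[OF integral_product[OF iab k] m1])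
  show "AE p in lborel \<Otimes>\<^sub>M lborel. norm (tensor a b (fst p) * (\<phi> (fst (fst p) + r * snd p, snd (fst p)) * indicator {0..1} (snd p)))
    <= norm (case p of (z, s) => tensor a b z * (C * indicator {0..1} s))"
   using b0 C0 by (intro AE_I2) (auto simp: abs_mult indicator_def mult_left_mono)
 qed
 have shift: "(\<integral>z. tensor a b z * \<phi> (fst z + r * s, snd z) \<partial>lborel) = (\<integral>z. (a (fst z - r * s) * b (snd z)) * \<phi> z \<partial>lborel)" for s
 proof -
  let ?g = "%z. (a (fst z - r * s) * b (snd z)) * \<phi> z"
  have e: "?g (shear 1 (r * s) z) = tensor a b z * \<phi> (fst z + r * s, snd z)" for z by (simp add: shear_def tensor_def)
  have bm: "bounded_measurable \<phi>" by (rule bounded_measurableI[OF \<phi>m b0])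
  have sa: "smooth (%x. a (x - r * s))" using smooth_affine[OF a(1), of 1 "- (r * s)"] by simp
  have ss: "supported_in (c + r * s) (d + r * s) (%x. a (x - r * s))"
  proof -
   obtain p q where pq: "c < p" "q < d" "!!x. a x ~= 0 ==> p <= x & x <= q" using a(2) unfolding supported_in_def by blast
   show ?thesis unfolding supported_in_def by (intro exI[of _ "p + r * s"] exI[of _ "q + r * s"]) (use pq in \<open>auto, force+\<close>)
  qed
  have ai: "L1 (tensor (%x. a (x - r * s)) b)"
   using integral_tensor(1)[OF integrable_test[OF sa ss] integrable_test[OF b]] by (simp add: abs_integrable_real_iff)
  have gi: "L1 ?g"
   using bounded_measurable_abs_integrable[OF ai bm] by (simp add: tensor_def mult_ac)
  have i: "integrable lborel ?g" using gi by (simp add: abs_integrable_real_iff)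
  have i': "integrable lborel (%z. ?g (shear 1 (r * s) z))"
   using strong_integral_shear(1)[OF _ gi, of 1 "r * s"] by (simp add: abs_integrable_real_iff)
  have eq: "strong_integral lborel f = (\<integral>z. f z \<partial>lborel)" if "integrable lborel f" for f :: "plane => real"
   using strong_integral_scaleR_const[OF _ that, of "1::real"] by simp
  show ?thesis using strong_integral_shear(2)[OF _ gi, of 1 "r * s"] eq[OF i] eq[OF i'] by (simp add: e)
 qed
 have am [measurable]: "a \<in> Borel" "b \<in> Borel" by (intro smooth_measurable a b)+
 have "(\<integral>z. tensor a b z * (r * mean r \<phi> z) \<partial>lborel) = r * (\<integral>z. \<integral>s. tensor a b z * (\<phi> (fst z + r * s, snd z) * indicator {0..1} s) \<partial>lborel \<partial>lborel)"
  by (simp add: mean mult.left_commute[of _ r])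
 also have "(\<integral>z. \<integral>s. tensor a b z * (\<phi> (fst z + r * s, snd z) * indicator {0..1} s) \<partial>lborel \<partial>lborel)
   = (\<integral>s. \<integral>z. tensor a b z * (\<phi> (fst z + r * s, snd z) * indicator {0..1} s) \<partial>lborel \<partial>lborel)"
  using lborel_pair.Fubini_integral[of "%z s. tensor a b z * (\<phi> (fst z + r * s, snd z) * indicator {0..1} s)"] i1 by (simp add: case_prod_beta')
 also have "\<dots> = (\<integral>s. indicator {0..1} s * (\<integral>z. (a (fst z - r * s) * b (snd z)) * \<phi> z \<partial>lborel) \<partial>lborel)"
  unfolding shift[symmetric] by (simp add: mult_ac flip: integral_mult_right_zero)
 also have "\<dots> = (\<integral>s. \<integral>z. a (fst z - r * s) * b (snd z) * \<phi> z * indicator {0..1} s \<partial>lborel \<partial>lborel)"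
  by (simp add: mult_ac flip: integral_mult_right_zero)
 also have "\<dots> = (\<integral>z. \<integral>s. a (fst z - r * s) * b (snd z) * \<phi> z * indicator {0..1} s \<partial>lborel \<partial>lborel)"
 proof -
  obtain p q where pq: "!!x. a x ~= 0 ==> p <= x & x <= q" using a(2) unfolding supported_in_def by blast
  obtain Ca where Ca: "Ca \<ge> 0" "!!x. \<bar>a x\<bar> <= Ca" using supported_in_bounded[OF a] by blast
  define I where "I = {p - \<bar>r\<bar>..q + \<bar>r\<bar>}"
  have iI: "integrable lborel (%x. Ca * C * indicator I x)" unfolding I_def by (rule integrable_Icc)
  have m2: "(%x. a (fst (fst x) - r * snd x) * b (snd (fst x)) * \<phi> (fst x) * indicator {0..1} (snd x)) \<in> borel_measurable (lborel \<Otimes>\<^sub>M lborel)"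
   using measurable_compose[OF T' am(1)] measurable_compose[OF S am(2)] \<phi>m by measurable
  have i2: "integrable (lborel \<Otimes>\<^sub>M lborel) (%x. a (fst (fst x) - r * snd x) * b (snd (fst x)) * \<phi> (fst x) * indicator {0..1} (snd x))"
  proof (rule Bochner_Integration.integrable_bound[OF integral_product[OF integral_tensor(1)[OF iI integrable_test[OF b]], of "indicator {0..1::real}"] m2])
   show "integrable lborel (indicator {0..1::real} :: real => real)" by simp
   show "AE x in lborel \<Otimes>\<^sub>M lborel. norm (a (fst (fst x) - r * snd x) * b (snd (fst x)) * \<phi> (fst x) * indicator {0..1} (snd x))
     <= norm (case x of (z, s) => tensor (%x. Ca * C * indicator I x) b z * indicator {0..1} s)"
   proof (intro AE_I2)
    fix x :: "plane \<times> real"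
    obtain u v s where x: "x = ((u, v), s)" by (metis surj_pair)
    show "norm (a (fst (fst x) - r * snd x) * b (snd (fst x)) * \<phi> (fst x) * indicator {0..1} (snd x))
     <= norm (case x of (z, s) => tensor (%x. Ca * C * indicator I x) b z * indicator {0..1} s)"
    proof (cases "s \<in> {0..1} & a (u - r * s) ~= 0")
     case True
     then have "\<bar>r * s\<bar> <= \<bar>r\<bar>" by (simp add: abs_mult mult_left_le)
     then have "u \<in> I" using pq[of "u - r * s"] True by (auto simp: I_def abs_le_iff)
     moreover have "\<bar>a (u - r * s)\<bar> * \<bar>b v\<bar> * \<bar>\<phi> (u, v)\<bar> <= Ca * \<bar>b v\<bar> * C"
      by (intro mult_mono Ca b0) (auto simp: Ca)
     ultimately show ?thesis using True Ca C0 by (simp add: x tensor_def abs_mult mult_ac)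
    qed (auto simp: x)
   qed
  qed
  show ?thesis
   using lborel_pair.Fubini_integral[of "%z s. a (fst z - r * s) * b (snd z) * \<phi> z * indicator {0..1} s"] i2 by (simp add: case_prod_beta')
 qed
 also have "r * (\<integral>z. \<integral>s. a (fst z - r * s) * b (snd z) * \<phi> z * indicator {0..1} s \<partial>lborel \<partial>lborel)
   = (\<integral>z. r * (\<integral>s. a (fst z - r * s) * b (snd z) * \<phi> z * indicator {0..1} s \<partial>lborel) \<partial>lborel)"
  by (rule integral_mult_right_zero[symmetric])
 also have "\<dots> = (\<integral>z. tensor L b z * \<phi> z \<partial>lborel)"
 proof (rule Bochner_Integration.integral_cong)
  fix z :: "plane"
  have "(\<integral>s. a (fst z - r * s) * b (snd z) * \<phi> z * indicator {0..1} s \<partial>lborel) = (\<integral>s. (a (fst z - r * s) * indicator {0..1} s) * (b (snd z) * \<phi> z) \<partial>lborel)"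
   by (simp add: mult_ac)
  also have "\<dots> = (\<integral>s. a (fst z - r * s) * indicator {0..1} s \<partial>lborel) * (b (snd z) * \<phi> z)" by (rule integral_mult_left_zero)
  finally show "r * (\<integral>s. a (fst z - r * s) * b (snd z) * \<phi> z * indicator {0..1} s \<partial>lborel) = tensor L b z * \<phi> z"
   by (simp add: tensor_def L mult_ac)
 qed simp
 finally show ?thesis .
qed

lemma abs_integrable_compact:
 fixes f :: "plane => 'a::real_normed_vector"
 assumes "continuous_on UNIV f" "!!z. norm z > R ==> f z = 0"
 shows "L1 f"
proof -
 have "compact (f ` cball 0 R)" by (intro compact_continuous_image continuous_on_subset[OF assms(1)]) auto
 then obtain C where C: "!!z. z \<in> cball 0 R ==> norm (f z) <= C"
  using compact_imp_bounded bounded_iff by (metis image_eqI)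
 show ?thesis
 proof (rule abs_integrable_mono[OF simple_limit_continuous[OF assms(1)]])
  show "AE z in lborel. enorm (f z) <= ennreal C * indicator (cball 0 R) z"
  proof (intro AE_I2)
   fix z show "enorm (f z) <= ennreal C * indicator (cball 0 R) z"
    using C[of z] assms(2)[of z] by (cases "norm z <= R") (auto intro: ennreal_leI)
  qed
  have "emeasure lborel (cball (0::plane) R) < \<infinity>" using emeasure_bounded_finite[of "cball 0 R"] by simp
  then show "(NN z::plane. ennreal C * indicator (cball 0 R) z) < \<infinity>" by (subst nn_integral_cmult_indicator) (auto simp: ennreal_mult_less_top)
 qed
qed

lemma mean_support:
 fixes t :: "plane => 'a::banach"
 assumes "!!z. norm z > R ==> t z = 0" "norm z > R + \<bar>r\<bar>" shows "mean r t z = 0"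
proof -
 have "t (fst z + r * s, snd z) = 0" if "s \<in> {0..1}" for s
 proof (rule assms(1))
  have "norm z = norm ((fst z + r * s, snd z) - (r * s, 0))" by (cases z) simp
  also have "\<dots> <= norm (fst z + r * s, snd z) + norm (r * s, 0::real)" by (rule norm_triangle_ineq4)
  also have "norm (r * s, 0::real) <= \<bar>r\<bar>" using that by (simp add: norm_prod_def abs_mult mult_left_le)
  finally show "R < norm (fst z + r * s, snd z)" using assms(2) by linarith
 qed
 then have "((%s. t (fst z + r * s, snd z)) has_integral 0) {0..1}" by (rule has_integral_is_0)
 then show ?thesis unfolding mean_def by (rule integral_unique)
qed

lemma tensors_abs_integrable:
 assumes "t \<in> tensors" shows "L1 t" "L1 (mean r t)"
proof -
 obtain R where R: "!!z. norm z > R ==> t z = 0" using tensors_support[OF assms] by blast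
 show "L1 t" by (rule abs_integrable_compact[OF tensors_continuous[OF assms] R])
 show "L1 (mean r t)" by (rule abs_integrable_compact[OF mean_continuous[OF tensors_continuous[OF assms]] mean_support[OF R]])
qed

lemma pairing_scaleR_const:
 fixes x :: "'a::banach"
 assumes "L1 (f :: plane => real)" "bounded_measurable \<phi>"
 shows "pairing (%z. f z *\<^sub>R x) \<phi> = (\<integral>z. \<phi> z * f z \<partial>lborel) *\<^sub>R x"
proof -
 have "integrable lborel (%z. \<phi> z * f z)"
  using bounded_measurable_abs_integrable[OF assms] by (simp add: abs_integrable_real_iff)
 from strong_integral_scaleR_const[OF _ this, of x] show ?thesis by (simp add: pairing_def)
qed

lemma mean_pairing:
 fixes t :: "plane => 'a::banach"
 assumes t: "t \<in> tensors"
  and a: "smooth a" "supported_in c d a" and b: "smooth b" "supported_in c' d' b" and Ls: "smooth L" "supported_in e f L"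
  and L: "!!x. L x = r * (\<integral>s. a (x - r * s) * indicator {0..1} s \<partial>lborel)"
 shows "r *\<^sub>R pairing (mean r t) (tensor a b) = pairing t (tensor L b)"
 using t
proof (induction rule: tensors.induct)
 case zero
 have "mean r (%z. 0 :: 'a) = (%z. 0)" by (auto simp: mean_def)
 then show ?case by (simp add: pairing_def)
next
 case (step \<phi> R t x)
 have bm: "bounded_measurable (tensor a b)" "bounded_measurable (tensor L b)" by (rule bounded_measurable_test[OF a b] bounded_measurable_test[OF Ls b])+
 have \<phi>a: "L1 \<phi>" by (rule abs_integrable_compact[OF step(1,2)])
 have m\<phi>a: "L1 (mean r \<phi>)" by (rule abs_integrable_compact[OF mean_continuous[OF step(1)] mean_support[OF step(2)]])
 have xa: "L1 (%z. \<phi> z *\<^sub>R x)" "L1 (%z. mean r \<phi> z *\<^sub>R x)"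
  using \<phi>a m\<phi>a by (simp_all add: abs_integrable_real_iff abs_integrable_scaleR_const)
 have mx: "mean r (%z. \<phi> z *\<^sub>R x + t z) = (%z. mean r \<phi> z *\<^sub>R x + mean r t z)"
 proof
  fix z
  have hi: "((%s. \<phi> (fst z + r * s, snd z) *\<^sub>R x) has_integral integral {0..1} (%s. \<phi> (fst z + r * s, snd z)) *\<^sub>R x) {0..1}"
   by (rule has_integral_scaleR_left[OF integrable_integral[OF mean_integrable[OF step(1)]]])
  show "mean r (%z. \<phi> z *\<^sub>R x + t z) z = mean r \<phi> z *\<^sub>R x + mean r t z"
   unfolding mean_def
   using integral_unique[OF has_integral_add[OF hi integrable_integral[OF mean_integrable[OF tensors_continuous[OF step(3)]]]]] by simp
 qed
 have "compact (\<phi> ` cball 0 R)" by (intro compact_continuous_image continuous_on_subset[OF step(1)]) auto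
 then obtain C where C: "!!z. z \<in> cball 0 R ==> norm (\<phi> z) <= C"
  using compact_imp_bounded bounded_iff by (metis image_eqI)
 have Cb: "\<bar>\<phi> z\<bar> <= max C 0" for z using C[of z] step(2)[of z] by (cases "norm z <= R") auto
 have "r *\<^sub>R pairing (mean r (%z. \<phi> z *\<^sub>R x + t z)) (tensor a b)
   = (r * (\<integral>z. tensor a b z * mean r \<phi> z \<partial>lborel)) *\<^sub>R x + pairing t (tensor L b)"
  unfolding mx pairing_add_left[OF xa(2) tensors_abs_integrable(2)[OF step(3)] bm(1)] scaleR_add_right step.IH
  by (simp add: pairing_scaleR_const[OF m\<phi>a bm(1)])
 also have "r * (\<integral>z. tensor a b z * mean r \<phi> z \<partial>lborel) = (\<integral>z. tensor L b z * \<phi> z \<partial>lborel)"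
  using mean_fubini_real[OF step(1) Cb a b L] by (simp add: mult.left_commute[of _ r])
 also have "(\<integral>z. tensor L b z * \<phi> z \<partial>lborel) *\<^sub>R x + pairing t (tensor L b) = pairing (%z. \<phi> z *\<^sub>R x + t z) (tensor L b)"
  unfolding pairing_add_left[OF xa(1) tensors_abs_integrable(1)[OF step(3)] bm(2)] pairing_scaleR_const[OF \<phi>a bm(2)] ..
 finally show ?case .
qed

lemma average_tonelli:
 assumes N [measurable]: "N \<in> Borel" and a: "a \<in> Borel" and b: "b \<in> Borel"
 shows "(NN z. a (fst z) * b (snd z) * average r N z)
   = (NN z::plane. (NN s. a (fst z - r * s) * indicator {0<..<1} s) * b (snd z) * N z)"
proof -
 have T: "(%p :: plane \<times> real. (fst (fst p) + r * snd p, snd (fst p))) \<in> borel_measurable (borel \<Otimes>\<^sub>M borel)"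
  and T': "(%p :: plane \<times> real. fst (fst p) - r * snd p) \<in> borel_measurable (borel \<Otimes>\<^sub>M borel)"
  and S: "(%p :: plane \<times> real. fst (fst p)) \<in> borel_measurable (borel \<Otimes>\<^sub>M borel)"
  and S': "(%p :: plane \<times> real. snd (fst p)) \<in> borel_measurable (borel \<Otimes>\<^sub>M borel)"
  unfolding borel_prod by (intro borel_measurable_continuous_onI continuous_intros)+
 have R: "(%z :: plane. (fst z + r * s, snd z)) \<in> Borel" "(%z :: plane. fst z) \<in> Borel"
  "(%z :: plane. fst z - r * s) \<in> Borel" "(%z :: plane. snd z) \<in> Borel" for s
  by (intro borel_measurable_continuous_onI continuous_intros)+
 have Q: "(%s. (fst z + r * s, snd z)) \<in> Borel" for z :: "plane" by (intro borel_measurable_continuous_onI continuous_intros)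
 note [measurable] = measurable_compose[OF T N] measurable_compose[OF T' a] measurable_compose[OF S a] measurable_compose[OF S' b]
  measurable_compose[OF R(1) N] measurable_compose[OF R(2) a] measurable_compose[OF R(3) a] measurable_compose[OF R(4) b] measurable_compose[OF Q N] a b
 have "(NN z. a (fst z) * b (snd z) * average r N z)
   = (NN z::plane. NN s. a (fst z) * b (snd z) * (N (fst z + r * s, snd z) * indicator {0<..<1} s))"
  unfolding average_def by (intro nn_integral_cong) (simp add: nn_integral_cmult)
 also have "\<dots> = (NN s. NN z::plane. a (fst z) * b (snd z) * (N (fst z + r * s, snd z) * indicator {0<..<1} s))"
  by (rule lborel_pair.Fubini'[symmetric]) measurable
 also have "\<dots> = (NN s. NN z::plane. a (fst z - r * s) * b (snd z) * N z * indicator {0<..<1} s)"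
 proof (rule nn_integral_cong)
  fix s :: real
  let ?g = "%z :: plane. a (fst z - r * s) * b (snd z) * N z * indicator {0<..<1} s"
  have "?g \<in> Borel" by measurable
  from nn_integral_shear[OF this, of 1 "r * s"]
  show "(NN z. a (fst z) * b (snd z) * (N (fst z + r * s, snd z) * indicator {0<..<1} s)) = (NN z. ?g z)" by (simp add: shear_def mult.assoc)
 qed
 also have "\<dots> = (NN z::plane. NN s. a (fst z - r * s) * b (snd z) * N z * indicator {0<..<1} s)" by (rule lborel_pair.Fubini') measurable
 also have "\<dots> = (NN z::plane. (NN s. a (fst z - r * s) * indicator {0<..<1} s) * b (snd z) * N z)"
 proof (intro nn_integral_cong)
  fix z :: "plane"
  have "(%s. a (fst z - r * s) * indicator {0<..<1} s) \<in> borel_measurable lborel" by measurable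
  from nn_integral_multc[OF this, of "b (snd z) * N z"]
  show "(NN s. a (fst z - r * s) * b (snd z) * N z * indicator {0<..<1} s) = (NN s. a (fst z - r * s) * indicator {0<..<1} s) * b (snd z) * N z"
   by (simp add: mult_ac)
 qed
 finally show ?thesis .
qed

text \<open>The fundamental theorem of calculus with an error term. The difference quotient of \<open>F\<close> is the average of \<open>G\<close>
over \<open>[x, x + r]\<close>; subtracting the average of a tensor \<open>t\<close> leaves the average of \<open>G - t\<close>, whose norm is at most the
average of the norms. Comparison with \<open>t\<close> avoids vector-valued averages of the discontinuous \<open>G\<close>.\<close>

lemma difference_quotient_bound:
 fixes F G t :: "plane => 'a::banach"
 assumes F: "L1 F" and G: "L1 G" and dx: "weak_dx F G" and t: "t \<in> tensors" and r: "0 < r"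
 shows "AE z in lborel. 0 < fst z & fst z + r < 2 * pi & 0 < snd z -->
   enorm ((1 / r) *\<^sub>R (F (shear 1 r z) - F z) - mean r t z) <= average r (%z. enorm (G z - t z)) z"
proof -
 define H where "H z = (1 / r) *\<^sub>R (F (shear 1 r z) - F z) - mean r t z" for z
 define N where "N z = enorm (G z - t z)" for z
 note ta = tensors_abs_integrable[OF t]
 have Fs: "L1 (%z. F (shear 1 r z))" by (rule strong_integral_shear(1)[OF _ F]) simp
 have Fd: "L1 (%z. F (shear 1 r z) - F z)" by (rule abs_integrable_diff[OF Fs F])
 have Ha: "L1 H" unfolding H_def by (intro abs_integrable_diff abs_integrable_scaleR Fd ta)
 have Gt: "L1 (%z. G z - t z)" by (intro abs_integrable_diff G ta)
 have Nm [measurable]: "N \<in> Borel" unfolding N_def using measurable_norm_abs_integrable[OF Gt] by measurable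
 have Mm: "average r N \<in> Borel" by (rule measurable_average[OF Nm])
 have "(NN z. average r N z) = (NN z. N z)"
  using average_tonelli[OF Nm, of "%_. 1" "%_. 1" r] by simp
 then have Mfin: "(NN z. average r N z) < \<infinity>" using Gt by (simp add: N_def abs_integrable_def)
 have ae: "AE z in lborel. z \<in> {0<..<2 * pi - r} \<times> {0<..<real n} --> enorm (H z) <= average r N z" for n :: nat
 proof (rule fundamental_lemma_rect[OF Ha Mm Mfin])
  fix a b assume ab: "smooth a" "smooth b" "supported_in 0 (2 * pi - r) a" "supported_in 0 (real n) b" "!!x. 0 <= a x" "!!x. 0 <= b x"
  obtain L where L: "smooth L" "supported_in 0 (2 * pi) L" "!!x. deriv L x = a x - a (x - r)"
   "!!x. L x = r * (\<integral>s. a (x - r * s) * indicator {0..1} s \<partial>lborel)"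
   using window_function[OF ab(1,3) r] by blast
  have a': "supported_in 0 (2 * pi) a" using supported_in_mono[OF ab(3), of 0 "2 * pi"] r by simp
  have as: "smooth (%x. a (x - r))" using smooth_affine[OF ab(1), of 1 "-r"] by simp
  have ass: "supported_in 0 (2 * pi) (%x. a (x - r))"
  proof -
   obtain p q where pq: "0 < p" "q < 2 * pi - r" "!!x. a x ~= 0 ==> p <= x & x <= q" using ab(3) unfolding supported_in_def by blast
   show ?thesis unfolding supported_in_def
   proof (rule exI[of _ "p + r"], rule exI[of _ "q + r"], intro conjI allI impI)
    fix x assume "a (x - r) ~= 0"
    then show "p + r <= x" "x <= q + r" using pq(3)[of "x - r"] by auto
   qed (use pq r in auto)
  qed
  have bm: "bounded_measurable (tensor a b)" "bounded_measurable (tensor (%x. a (x - r)) b)" "bounded_measurable (tensor L b)"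
   by (rule bounded_measurable_test[OF ab(1,3,2,4)] bounded_measurable_test[OF as ass ab(2,4)] bounded_measurable_test[OF L(1,2) ab(2,4)])+
  have 1: "pairing (%z. F (shear 1 r z)) (tensor a b) = pairing F (tensor (%x. a (x - r)) b)"
  proof -
   have "(%z. tensor (%x. a (x - r)) b (shear 1 r z)) = tensor a b" by (auto simp: tensor_def shear_def)
   then show ?thesis using pairing_shear[OF F bm(2), of 1 r] by simp
  qed
  have "pairing (%z. F (shear 1 r z) - F z) (tensor a b) = pairing F (tensor (%x. a (x - r)) b) - pairing F (tensor a b)"
   unfolding pairing_diff_left[OF Fs F bm(1)] 1 ..
  also have "\<dots> = - pairing F (%z. tensor a b z - tensor (%x. a (x - r)) b z)"
   unfolding pairing_diff[OF F bm(1,2)] by simp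
  also have "(%z. tensor a b z - tensor (%x. a (x - r)) b z) = tensor (deriv L) b" by (auto simp: tensor_def L(3) left_diff_distrib)
  also have "- pairing F (tensor (deriv L) b) = pairing G (tensor L b)"
   using weak_dxD[OF dx L(1) ab(2) L(2) ab(4)] by simp
  finally have 2: "pairing (%z. F (shear 1 r z) - F z) (tensor a b) = pairing G (tensor L b)" .
  have 3: "r *\<^sub>R pairing (mean r t) (tensor a b) = pairing t (tensor L b)" by (rule mean_pairing[OF t ab(1,3,2,4) L(1,2,4)])
  have "pairing H (tensor a b) = (1 / r) *\<^sub>R pairing G (tensor L b) - pairing (mean r t) (tensor a b)"
   unfolding H_def by (simp add: pairing_diff_left[OF abs_integrable_scaleR[OF Fd] ta(2) bm(1)] pairing_scaleR_left[OF Fd bm(1)] 2)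
  also have "pairing (mean r t) (tensor a b) = (1 / r) *\<^sub>R pairing t (tensor L b)" using r by (simp flip: 3)
  also have "(1 / r) *\<^sub>R pairing G (tensor L b) - (1 / r) *\<^sub>R pairing t (tensor L b) = (1 / r) *\<^sub>R pairing (%z. G z - t z) (tensor L b)"
   by (simp add: pairing_diff_left[OF G ta(1) bm(3)] scaleR_diff_right)
  finally have HL: "pairing H (tensor a b) = (1 / r) *\<^sub>R pairing (%z. G z - t z) (tensor L b)" .
  have Lr: "ennreal (L x) = ennreal r * (NN s. ennreal (a (x - r * s)) * indicator {0<..<1} s)" and L0: "0 <= L x" for x
  proof -
   obtain Ca where Ca: "Ca \<ge> 0" "!!x. \<bar>a x\<bar> <= Ca" using supported_in_bounded[OF ab(1,3)] by blast
   have am [measurable]: "a \<in> Borel" by (rule smooth_measurable[OF ab(1)])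
   have i: "integrable lborel (%s. a (x - r * s) * indicator {0..1} s)"
   proof (rule Bochner_Integration.integrable_bound[OF integrable_Icc[of Ca 0 1]])
    show "AE s in lborel. norm (a (x - r * s) * indicator {0..1} s) <= norm (Ca * indicator {0..1} s)"
     using Ca by (intro AE_I2) (auto simp: indicator_def)
   qed measurable
   have "(NN s. ennreal (a (x - r * s) * indicator {0..1} s)) = ennreal (\<integral>s. a (x - r * s) * indicator {0..1} s \<partial>lborel)"
    by (rule nn_integral_eq_integral[OF i]) (use ab(5) in auto)
   moreover have "(NN s. ennreal (a (x - r * s) * indicator {0..1} s)) = (NN s. ennreal (a (x - r * s)) * indicator {0<..<1} s)"
   proof (rule nn_integral_cong_AE)
    show "AE s in lborel. ennreal (a (x - r * s) * indicator {0..1} s) = ennreal (a (x - r * s)) * indicator {0<..<1} s"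
     using AE_lborel_singleton[of "0::real"] AE_lborel_singleton[of "1::real"] by eventually_elim (auto simp: indicator_def)
   qed
   moreover have "0 <= (\<integral>s. a (x - r * s) * indicator {0..1} s \<partial>lborel)" using ab(5) by (intro integral_nonneg_AE AE_I2) auto
   ultimately show "ennreal (L x) = ennreal r * (NN s. ennreal (a (x - r * s)) * indicator {0<..<1} s)" "0 <= L x"
    using r L(4)[of x] by (simp_all add: ennreal_mult)
  qed
  have "enorm (pairing H (tensor a b)) = ennreal (1 / r) * enorm (pairing (%z. G z - t z) (tensor L b))"
   unfolding HL using r by (simp add: ennreal_mult[symmetric])
  also have "\<dots> <= ennreal (1 / r) * (NN z. ennreal \<bar>tensor L b z\<bar> * N z)"
   unfolding N_def by (intro mult_left_mono pairing_norm_le Gt bm) simp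
  also have "(NN z. ennreal \<bar>tensor L b z\<bar> * N z)
    = (NN z. ennreal r * ((NN s. ennreal (a (fst z - r * s)) * indicator {0<..<1} s) * ennreal (b (snd z)) * N z))"
   using ab(6) L0 by (intro nn_integral_cong) (simp add: tensor_def ennreal_mult Lr mult.assoc)
  also have "\<dots> = ennreal r * (NN z. (NN s. ennreal (a (fst z - r * s)) * indicator {0<..<1} s) * ennreal (b (snd z)) * N z)"
  proof (rule nn_integral_cmult)
   have T': "(%p :: plane \<times> real. fst (fst p) - r * snd p) \<in> borel_measurable (borel \<Otimes>\<^sub>M borel)"
    unfolding borel_prod by (intro borel_measurable_continuous_onI continuous_intros)
   have "(%z :: plane. snd z) \<in> Borel" by (intro borel_measurable_continuous_onI continuous_intros)
   note [measurable] = measurable_compose[OF T' smooth_measurable[OF ab(1)]] measurable_compose[OF this smooth_measurable[OF ab(2)]]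
   show "(%z. (NN s. ennreal (a (fst z - r * s)) * indicator {0<..<1} s) * ennreal (b (snd z)) * N z) \<in> borel_measurable lborel" by measurable
  qed
  also have "\<dots> = ennreal r * (NN z. ennreal (a (fst z)) * ennreal (b (snd z)) * average r N z)"
   using average_tonelli[OF Nm, of "%x. ennreal (a x)" "%x. ennreal (b x)" r] smooth_measurable[OF ab(1)] smooth_measurable[OF ab(2)] by simp
  also have "ennreal (1 / r) * (ennreal r * (NN z. ennreal (a (fst z)) * ennreal (b (snd z)) * average r N z))
    = (NN z. ennreal (tensor a b z) * average r N z)"
   using r ab(5,6) by (simp add: mult.assoc[symmetric] tensor_def ennreal_mult[symmetric])
  finally show "enorm (pairing H (tensor a b)) <= (NN z. ennreal (tensor a b z) * average r N z)" .
 qed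
 have "AE z in lborel. \<forall>n. z \<in> {0<..<2 * pi - r} \<times> {0<..<real n} --> enorm (H z) <= average r N z"
  unfolding AE_all_countable using ae by blast
 then show ?thesis
 proof eventually_elim
  case (elim z)
  obtain n :: nat where "snd z < real n" using reals_Archimedean2 by blast
  then show ?case using elim unfolding H_def N_def by (cases z) auto
 qed
qed

text \<open>A plain translation would leave the strip; the factor \<open>1 - h\<close> keeps both points inside and makes the quotient at
\<open>x = 0\<close> start exactly at the side \<open>x = 0\<close>.\<close>

definition dilated_quotient :: "real => (plane => 'a::real_normed_vector) => plane => 'a" where
 "dilated_quotient h F z = (1 / (2 * pi * h)) *\<^sub>R (F (shear (1 - h) (2 * pi * h) z) - F (shear (1 - h) 0 z))"

lemma tensors_uniformly_continuous:
 assumes "t \<in> tensors" "0 < e" obtains d where "0 < d" "!!z z'. dist z z' < d ==> norm (t z - t z') < e"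
proof -
 obtain R where R: "!!z. norm z > R ==> t z = 0" using tensors_support[OF assms(1)] by blast
 have "uniformly_continuous_on (cball 0 (R + 1)) t" by (intro compact_uniformly_continuous continuous_on_subset[OF tensors_continuous[OF assms(1)]]) auto
 then obtain d where d: "0 < d" "!!z z'. z \<in> cball 0 (R + 1) ==> z' \<in> cball 0 (R + 1) ==> dist z' z < d ==> dist (t z') (t z) < e"
  using assms(2) unfolding uniformly_continuous_on_def by metis
 show thesis
 proof (rule that[of "min d 1"])
  fix z z' :: "plane" assume zz: "dist z z' < min d 1"
  show "norm (t z - t z') < e"
  proof (cases "norm z <= R + 1 & norm z' <= R + 1")
   case True then show ?thesis using d(2)[of z' z] zz by (simp add: dist_norm dist_commute)
  next
   case False
   have "norm z <= norm z' + 1" "norm z' <= norm z + 1"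
    using zz norm_triangle_sub[of z z'] norm_triangle_sub[of z' z] by (auto simp: dist_norm norm_minus_commute)
   then have "norm z > R" "norm z' > R" using False by auto
   then show ?thesis using R assms(2) by simp
  qed
 qed (use d in auto)
qed

lemma mean_close:
 fixes t :: "plane => 'a::banach"
 assumes t: "t \<in> tensors" and d: "!!z z'. dist z z' < d ==> norm (t z - t z') < e" and h: "0 < h" "h < 1" "2 * pi * h < d" and z: "z \<in> strip"
 shows "norm (mean (2 * pi * h) t (shear (1 - h) 0 z) - t z) <= e"
proof -
 let ?g = "%s. t ((1 - h) * fst z + 2 * pi * h * s, snd z)"
 have gi: "?g integrable_on {0..1}" using mean_integrable[OF tensors_continuous[OF t], of "shear (1 - h) 0 z" "2 * pi * h"] by (simp add: shear_def)
 have "mean (2 * pi * h) t (shear (1 - h) 0 z) - t z = integral {0..1} (%s. ?g s - t z)"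
  using gi by (subst integral_diff) (auto simp: mean_def shear_def)
 also have "norm \<dots> <= e * (1 - 0)"
 proof (rule integral_bound)
  show "continuous_on {0..1} (%s. ?g s - t z)" by (intro continuous_intros continuous_on_compose2[OF tensors_continuous[OF t]]) auto
  fix s :: real assume s: "s \<in> {0..1}"
  have x: "0 < fst z" "fst z < 2 * pi" using z by (auto simp: strip_def II_def)
  have "\<bar>(1 - h) * fst z + 2 * pi * h * s - fst z\<bar> = h * \<bar>2 * pi * s - fst z\<bar>"
  proof -
   have "(1 - h) * fst z + 2 * pi * h * s - fst z = h * (2 * pi * s - fst z)" by (simp add: algebra_simps)
   then show ?thesis using h by (simp add: abs_mult)
  qed
  also have "\<dots> <= h * (2 * pi)"
  proof (intro mult_left_mono)
   have "0 <= 2 * pi * s" "2 * pi * s <= 2 * pi" using s pi_gt_zero by auto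
   then show "\<bar>2 * pi * s - fst z\<bar> <= 2 * pi" using x by linarith
  qed (use h in auto)
  also have "\<dots> < d" using h(3) by (simp add: mult_ac)
  finally have "dist ((1 - h) * fst z + 2 * pi * h * s, snd z) z < d" by (cases z) (simp add: dist_prod_def dist_real_def)
  then show "norm (?g s - t z) <= e" using d less_imp_le by blast
 qed simp
 finally show ?thesis by simp
qed

text \<open>Add and subtract \<open>mean t\<close> and \<open>t\<close>: two terms are of the size of \<open>G - t\<close>, and the third is small by uniform
continuity of \<open>t\<close>.\<close>

lemma dilated_quotient_bound:
 fixes F G :: "plane => 'a::banach"
 assumes F: "L1 F" and G: "L1 G" and dx: "weak_dx F G" and t: "t \<in> tensors"
  and p: "1 < p" and h: "0 < h" "h <= 1 / 2" "2 * pi * h < d" and d: "!!z z'. dist z z' < d ==> norm (t z - t z') < e" and e: "0 < e"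
  and R: "!!z. norm z > R ==> t z = 0"
 shows "mixed_norm p (%z. enorm (dilated_quotient h F z - G z))
   <= 24 * mixed_norm p (%z. enorm (G z - t z)) + 16 * (ennreal e * mixed_norm p (indicator (UNIV \<times> {..R + 2 * pi})))"
proof -
 let ?r = "2 * pi * h"
 define N where "N z = enorm (G z - t z)" for z
 have Gt: "L1 (%z. G z - t z)" by (intro abs_integrable_diff G tensors_abs_integrable t)
 have Nm [measurable]: "N \<in> Borel" unfolding N_def using measurable_norm_abs_integrable[OF Gt] by measurable
 define A where "A z = average ?r N (shear (1 - h) 0 z)" for z
 have Am [measurable]: "A \<in> Borel" unfolding A_def using measurable_compose[OF measurable_shear measurable_average[OF Nm]] by simp
 have r: "0 < ?r" using h pi_gt_zero by simp
 have AEb: "AE z in lborel. 0 < fst (shear (1 - h) 0 z) & fst (shear (1 - h) 0 z) + ?r < 2 * pi & 0 < snd (shear (1 - h) 0 z) -->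
   enorm ((1 / ?r) *\<^sub>R (F (shear 1 ?r (shear (1 - h) 0 z)) - F (shear (1 - h) 0 z)) - mean ?r t (shear (1 - h) 0 z)) <= average ?r N (shear (1 - h) 0 z)"
  unfolding N_def by (rule AE_shear[OF difference_quotient_bound[OF F G dx t r]]) (use h in auto)
 define E where "E z = ennreal e * indicator (UNIV \<times> {..R + 2 * pi}) z" for z :: "plane"
 have "closed (UNIV \<times> {..R + 2 * pi} :: plane set)" by (intro closed_Times) auto
 then have ib: "(indicator (UNIV \<times> {..R + 2 * pi}) :: plane => ennreal) \<in> Borel" by (intro borel_measurable_indicator borel_closed)
 then have Em [measurable]: "E \<in> Borel" unfolding E_def by (rule borel_measurable_times_ennreal[OF borel_measurable_const])
 have "AE z in lborel. z \<in> strip --> enorm (dilated_quotient h F z - G z) <= A z + (E z + N z)"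
  using AEb
 proof eventually_elim
  case (elim z)
  show ?case
  proof
   assume z: "z \<in> strip"
   then have x: "0 < fst z" "fst z < 2 * pi" "0 < snd z" by (auto simp: strip_def II_def)
   have "(1 - h) * fst z < (1 - h) * (2 * pi)" using x h by (intro mult_strict_left_mono) auto
   then have "(1 - h) * fst z + ?r < 2 * pi" by (simp add: algebra_simps)
   moreover have "shear 1 ?r (shear (1 - h) 0 z) = shear (1 - h) ?r z" by (simp add: shear_def)
   ultimately have 1: "enorm (dilated_quotient h F z - mean ?r t (shear (1 - h) 0 z)) <= A z"
    using elim x h by (simp add: shear_def dilated_quotient_def A_def)
   have 2: "enorm (mean ?r t (shear (1 - h) 0 z) - t z) <= E z"
   proof (cases "snd z <= R + 2 * pi")
    case True
    then have "z \<in> UNIV \<times> {..R + 2 * pi}" by (cases z) auto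
    then show ?thesis using mean_close[OF t d, where h=h and z=z] h z by (simp add: E_def ennreal_leI)
   next
    case False
    have "\<bar>snd z\<bar> <= norm z" "\<bar>snd z\<bar> <= norm (shear (1 - h) 0 z)"
     using norm_snd_le[of "snd z" "fst z"] norm_snd_le[of "snd z" "(1 - h) * fst z"] by (auto simp: shear_def)
    moreover have "\<bar>?r\<bar> <= 2 * pi" using h pi_gt_zero by (simp add: mult_left_le)
    ultimately have "norm z > R" "norm (shear (1 - h) 0 z) > R + \<bar>?r\<bar>" using False x pi_gt_zero by auto
    then show ?thesis using R mean_support[of R t, OF R] by simp
   qed
   have "norm (dilated_quotient h F z - G z) <= norm (dilated_quotient h F z - mean ?r t (shear (1 - h) 0 z)) + (norm (mean ?r t (shear (1 - h) 0 z) - t z) + norm (G z - t z))"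
   proof -
    have "norm ((u - m) + ((m - t) - (g - t))) <= norm (u - m) + (norm (m - t) + norm (g - t))" for u m t g :: 'a
     by (intro norm_triangle_le add_left_mono norm_triangle_ineq4)
    then show ?thesis by simp
   qed
   then have "enorm (dilated_quotient h F z - G z) <= enorm (dilated_quotient h F z - mean ?r t (shear (1 - h) 0 z)) + (enorm (mean ?r t (shear (1 - h) 0 z) - t z) + N z)"
    unfolding N_def by (simp add: ennreal_leI flip: ennreal_plus)
   also have "\<dots> <= A z + (E z + N z)" by (intro add_mono 1 2 order_refl)
   finally show "enorm (dilated_quotient h F z - G z) <= A z + (E z + N z)" .
  qed
 qed
 then have "mixed_norm p (%z. enorm (dilated_quotient h F z - G z)) <= mixed_norm p (%z. A z + (E z + N z))"
  using p by (intro mixed_norm_mono) auto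
 also have "\<dots> <= 4 * (mixed_norm p A + mixed_norm p (%z. E z + N z))"
  using p by (intro mixed_norm_add) auto
 also have "\<dots> <= 4 * (2 * mixed_norm p N + 4 * (mixed_norm p E + mixed_norm p N))"
  using p mixed_norm_average[OF Nm p h(1,2)] by (intro mult_left_mono add_mono mixed_norm_add) (auto simp: A_def[abs_def])
 also have "mixed_norm p E = ennreal e * mixed_norm p (indicator (UNIV \<times> {..R + 2 * pi}))"
  unfolding E_def using e by (intro mixed_norm_cmult ib p) auto
 also have "4 * (2 * mixed_norm p N + 4 * (ennreal e * mixed_norm p (indicator (UNIV \<times> {..R + 2 * pi})) + mixed_norm p N))
   = 24 * mixed_norm p N + 16 * (ennreal e * mixed_norm p (indicator (UNIV \<times> {..R + 2 * pi})))"
 proof -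
  have "4 * (2 * x + 4 * (y + x)) = 24 * x + 16 * y" for x y :: ennreal
  proof -
   have "4 * (2 * x + 4 * (y + x)) = (8 * x + 16 * x) + 16 * y" by (simp add: distrib_left mult.assoc[symmetric] add_ac)
   also have "8 * x + 16 * x = (8 + 16) * x" by (simp only: distrib_right)
   finally show ?thesis by simp
  qed
  then show ?thesis .
 qed
 finally show ?thesis by (simp add: N_def[abs_def])
qed

lemma dilated_quotient_tendsto:
 fixes F G :: "plane => 'a::banach"
 assumes F: "L1 F" and G: "L1 G" "!!z. z \<notin> strip ==> G z = 0" "strip_norm p G < \<infinity>"
  and dx: "weak_dx F G" and p: "1 < p" and h: "!!n::nat. 0 < h n" "!!n. h n <= 1 / 2" "h ---> 0"
 shows "(%n. mixed_norm p (%z. enorm (dilated_quotient (h n) F z - G z))) ---> 0"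
proof (rule order_tendstoI)
 fix \<epsilon> :: ennreal assume "0 < \<epsilon>"
 then obtain d where d: "0 < d" "d < \<epsilon>" using dense by blast
 define e where "e = enn2real d"
 have "d < top" using d(2) by (simp add: order_less_le_trans)
 then have e: "0 < e" "ennreal e < \<epsilon>" using d by (auto simp: e_def enn2real_positive_iff)
 have "0 < e / 48" using e by simp
 then obtain t where t: "t \<in> tensors" "mixed_norm p (%z. enorm (G z - t z)) < ennreal (e / 48)"
  using tensors_dense[OF G p] unfolding tensor_approximable_def by meson
 obtain R where R: "!!z. norm z > R ==> t z = 0" using tensors_support[OF t(1)] by blast
 define B where "B = enn2real (mixed_norm p (indicator (UNIV \<times> {..R + 2 * pi})))"
 have B: "mixed_norm p (indicator (UNIV \<times> {..R + 2 * pi})) = ennreal B" "0 <= B"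
  using mixed_norm_bounded_set[OF p, of "R + 2 * pi"] by (simp_all add: B_def less_top)
 define \<eta> where "\<eta> = e / (32 * (B + 1))"
 have \<eta>: "0 < \<eta>" using e B by (simp add: \<eta>_def)
 obtain \<delta> where \<delta>: "0 < \<delta>" "!!z z'. dist z z' < \<delta> ==> norm (t z - t z') < \<eta>"
  using tensors_uniformly_continuous[OF t(1) \<eta>] by blast
 have "(%n. 2 * pi * h n) ---> 2 * pi * 0" by (intro tendsto_intros h)
 then have "eventually (%n. 2 * pi * h n < \<delta>) sequentially" using \<delta>(1) by (intro order_tendstoD(2)) auto
 then show "eventually (%n. mixed_norm p (%z. enorm (dilated_quotient (h n) F z - G z)) < \<epsilon>) sequentially"
 proof eventually_elim
  case (elim n)
  have "mixed_norm p (%z. enorm (dilated_quotient (h n) F z - G z))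
   <= 24 * mixed_norm p (%z. enorm (G z - t z)) + 16 * (ennreal \<eta> * mixed_norm p (indicator (UNIV \<times> {..R + 2 * pi})))"
   by (rule dilated_quotient_bound[OF F G(1) dx t(1) p h(1,2) elim \<delta>(2) \<eta> R])
  also have "\<dots> <= 24 * ennreal (e / 48) + 16 * (ennreal \<eta> * ennreal B)"
   unfolding B(1) using t(2) by (intro add_mono mult_left_mono) auto
  also have "\<dots> = ennreal (e / 2 + 16 * \<eta> * B)"
   using e \<eta> B by (simp add: ennreal_mult'[symmetric] flip: ennreal_plus ennreal_numeral)
  also have "\<dots> <= ennreal e"
  proof (rule ennreal_leI)
   have "16 * \<eta> * B <= e / 2"
   proof -
    have "B / (B + 1) <= 1" using B by simp
    then have "(e / 2) * (B / (B + 1)) <= (e / 2) * 1" using e by (intro mult_left_mono) auto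
    moreover have "16 * \<eta> * B = (e / 2) * (B / (B + 1))" using B by (simp add: \<eta>_def field_simps)
    ultimately show ?thesis by simp
   qed
   then show "e / 2 + 16 * \<eta> * B <= e" by simp
  qed
  finally show ?case using e(2) by simp
 qed
qed simp

section \<open>Test functions on the plane\<close>

lemma partials_Nil [simp]: "partials [] \<phi> = \<phi>" by (simp add: partials_def)
lemma partials_Cons: "partials (b # bs) \<phi> = partials bs (%z. frechet_derivative \<phi> (at z) b)" by (simp add: partials_def)
abbreviation ex :: "plane" where "ex \<equiv> (1, 0)"
abbreviation ey :: "plane" where "ey \<equiv> (0, 1)"

lemma Basis_plane: "Basis = {ex, ey}" by (auto simp: Basis_prod_def)

lemma frechet_derivative_eq: "(f has_derivative f') (at x) ==> frechet_derivative f (at x) = f'"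
 using frechet_derivative_at by metis

lemma tensor_has_derivative:
 assumes "smooth a" "smooth b"
 shows "(tensor a b has_derivative (%h. deriv a (fst z) * fst h * b (snd z) + a (fst z) * (deriv b (snd z) * snd h))) (at z)"
proof -
 have a: "(a has_derivative (%h. deriv a (fst z) * h)) (at (fst z))" and b: "(b has_derivative (%h. deriv b (snd z) * h)) (at (snd z))"
  using smooth_deriv(1)[OF assms(1), of "fst z"] smooth_deriv(1)[OF assms(2), of "snd z"] by (simp_all add: has_field_derivative_def)
 have 1: "((%z. a (fst z)) has_derivative (%h. deriv a (fst z) * fst h)) (at z)"
  by (rule has_derivative_compose[OF has_derivative_fst[OF has_derivative_ident] a])
 have 2: "((%z. b (snd z)) has_derivative (%h. deriv b (snd z) * snd h)) (at z)"
  by (rule has_derivative_compose[OF has_derivative_snd[OF has_derivative_ident] b])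
 have "((%z. a (fst z) * b (snd z)) has_derivative (%h. a (fst z) * (deriv b (snd z) * snd h) + deriv a (fst z) * fst h * b (snd z))) (at z)"
  by (rule has_derivative_mult[OF 1 2])
 then show ?thesis unfolding tensor_def[abs_def] by (simp add: add.commute)
qed

lemma partial_tensor:
 assumes "smooth a" "smooth b"
 shows "(%z. frechet_derivative (tensor a b) (at z) ex) = tensor (deriv a) b"
  "(%z. frechet_derivative (tensor a b) (at z) ey) = tensor a (deriv b)"
 using frechet_derivative_eq[OF tensor_has_derivative[OF assms]] by (auto simp: tensor_def fun_eq_iff)

text \<open>Smooth tensors are closed under partial derivatives, which makes them test functions.\<close>

lemma partials_tensor:
 assumes "set bs \<subseteq> Basis" "smooth a" "smooth b"
 shows "\<exists>a' b'. smooth a' & smooth b' & partials bs (tensor a b) = tensor a' b'"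
 using assms
proof (induction bs arbitrary: a b)
 case (Cons c bs)
 then consider "c = ex" | "c = ey" by (auto simp: Basis_plane)
 then show ?case
 proof cases
  case 1 then show ?thesis using Cons.IH[of "deriv a" b] Cons.prems by (simp add: partials_Cons partial_tensor smooth_deriv(2))
 next
  case 2 then show ?thesis using Cons.IH[of a "deriv b"] Cons.prems by (simp add: partials_Cons partial_tensor smooth_deriv(2))
 qed
qed auto

lemma test_function_tensor:
 assumes a: "smooth a" "supported_in 0 (2 * pi) a" and b: "smooth b" "supported_in 0 d b"
 shows "test_function strip (tensor a b)"
 unfolding test_function_def
proof (intro conjI allI impI)
 fix bs :: "plane list" assume "set bs \<subseteq> Basis"
 then obtain a' b' where "smooth a'" "smooth b'" "partials bs (tensor a b) = tensor a' b'" using partials_tensor a b by blast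
 then show "partials bs (tensor a b) differentiable_on UNIV"
  using differentiableI[OF tensor_has_derivative] by (simp add: differentiable_on_def)
next
 obtain p q where pq: "0 < p" "q < 2 * pi" "!!x. a x ~= 0 ==> p <= x & x <= q" using a(2) unfolding supported_in_def by blast
 obtain p' q' where pq': "0 < p'" "q' < d" "!!x. b x ~= 0 ==> p' <= x & x <= q'" using b(2) unfolding supported_in_def by blast
 show "\<exists>K. compact K & K \<subseteq> strip & (\<forall>z. z \<notin> K --> tensor a b z = 0)"
 proof (intro exI[of _ "{p..q} \<times> {p'..q'}"] conjI allI impI)
  show "compact ({p..q} \<times> {p'..q'})" by (intro compact_Times) auto
  show "{p..q} \<times> {p'..q'} \<subseteq> strip" using pq pq' by (auto simp: strip_def II_def)
  fix z assume "z \<notin> {p..q} \<times> {p'..q'}"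
  then have "\<not> (p <= fst z & fst z <= q) \<or> \<not> (p' <= snd z & snd z <= q')" by (cases z) auto
  then show "tensor a b z = 0" using pq(3)[of "fst z"] pq'(3)[of "snd z"] by (auto simp: tensor_def)
 qed
qed

lemma test_function_differentiable: "test_function S \<phi> ==> set bs \<subseteq> Basis ==> partials bs \<phi> differentiable (at z)"
 unfolding test_function_def differentiable_on_def by auto

lemma test_function_partial:
 assumes \<phi>: "test_function S (\<phi> :: plane => real)" and c: "c \<in> Basis"
 shows "test_function S (%z. frechet_derivative \<phi> (at z) c)"
 unfolding test_function_def
proof (intro conjI allI impI)
 fix bs :: "plane list" assume "set bs \<subseteq> Basis"
 then show "partials bs (%z. frechet_derivative \<phi> (at z) c) differentiable_on UNIV"
  using \<phi> c unfolding test_function_def by (simp flip: partials_Cons)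
next
 obtain K where K: "compact K" "K \<subseteq> S" "!!z. z \<notin> K ==> \<phi> z = 0" using \<phi> unfolding test_function_def by blast
 have "frechet_derivative \<phi> (at z) c = 0" if "z \<notin> K" for z
 proof -
  have "(\<phi> has_derivative (%h. 0)) (at z)"
  proof (rule has_derivative_transform_within_open[where s="- K" and f="%_. 0"])
   show "open (- K)" using K(1) compact_imp_closed by blast
  qed (use that K in auto)
  then show ?thesis using frechet_derivative_eq by metis
 qed
 then show "\<exists>K. compact K & K \<subseteq> S & (\<forall>z. z \<notin> K --> frechet_derivative \<phi> (at z) c = 0)" using K by blast
qed

lemma test_function_partials:
 "test_function S \<phi> ==> set bs \<subseteq> Basis ==> test_function S (partials bs (\<phi> :: plane => real))"
 by (induction bs arbitrary: \<phi>) (auto simp: partials_Cons test_function_partial)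

lemma test_function_continuous: "test_function S \<phi> ==> continuous_on UNIV \<phi>"
 using test_function_differentiable[of S \<phi> "[]"] differentiable_imp_continuous_within by (auto intro!: continuous_at_imp_continuous_on)

lemma test_function_bounded:
 assumes "test_function S (\<phi> :: plane => real)" shows "bounded_measurable \<phi>"
proof -
 obtain K where K: "compact K" "!!z. z \<notin> K ==> \<phi> z = 0" using assms unfolding test_function_def by blast
 note c = test_function_continuous[OF assms]
 have "compact (\<phi> ` K)" by (intro compact_continuous_image continuous_on_subset[OF c] K) auto
 then obtain C where C: "!!z. z \<in> K ==> norm (\<phi> z) <= C"
  using compact_imp_bounded bounded_iff by (metis image_eqI)
 have "\<bar>\<phi> z\<bar> <= max C 0" for z using C[of z] K(2)[of z] by (cases "z \<in> K") auto
 then show ?thesis using borel_measurable_continuous_onI[OF c] by (rule bounded_measurableI[rotated])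
qed

lemma shear_has_derivative: "(shear c d has_derivative (%h. (c * fst h, snd h))) (at z)"
 unfolding shear_def by (auto intro!: derivative_eq_intros)

lemma partial_shear:
 assumes "\<phi> differentiable (at (shear c d z))"
 shows "(%z. m * \<phi> (shear c d z)) differentiable (at z)"
  "frechet_derivative (%z. m * \<phi> (shear c d z)) (at z) ex = (m * c) * frechet_derivative \<phi> (at (shear c d z)) ex"
  "frechet_derivative (%z. m * \<phi> (shear c d z)) (at z) ey = m * frechet_derivative \<phi> (at (shear c d z)) ey"
proof -
 let ?D = "frechet_derivative \<phi> (at (shear c d z))"
 have \<phi>: "(\<phi> has_derivative ?D) (at (shear c d z))" using assms frechet_derivative_works by blast
 have D: "((%z. m * \<phi> (shear c d z)) has_derivative (%h. m * ?D (c * fst h, snd h))) (at z)"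
  by (intro has_derivative_mult_right has_derivative_compose[OF shear_has_derivative \<phi>])
 then show "(%z. m * \<phi> (shear c d z)) differentiable (at z)" by (rule differentiableI)
 have "linear ?D" using \<phi> has_derivative_linear by blast
 then have "?D (c, 0) = c * ?D ex" using linear_scale[of ?D c ex] by simp
 then show "frechet_derivative (%z. m * \<phi> (shear c d z)) (at z) ex = (m * c) * ?D ex"
  "frechet_derivative (%z. m * \<phi> (shear c d z)) (at z) ey = m * ?D ey"
  using frechet_derivative_eq[OF D] by simp_all
qed

lemma test_function_shear:
 assumes \<phi>: "test_function strip \<phi>" and c: "c ~= 0" and S: "!!z. z \<in> strip ==> shear (1 / c) (- d / c) z \<in> strip"
 shows "test_function strip (%z. \<phi> (shear c d z))"
 unfolding test_function_def
proof (intro conjI allI impI)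
 fix bs :: "plane list" assume bs: "set bs \<subseteq> Basis"
 have "\<exists>k. partials bs (%z. m * \<psi> (shear c d z)) = (%z. k * partials bs \<psi> (shear c d z))"
  if "test_function strip \<psi>" for m \<psi>
  using bs that
 proof (induction bs arbitrary: m \<psi>)
  case (Cons b bs)
  have d: "\<psi> differentiable (at (shear c d z))" for z using test_function_differentiable[OF Cons.prems(2), of "[]"] by simp
  have t: "test_function strip (%z. frechet_derivative \<psi> (at z) b)" using Cons.prems by (intro test_function_partial) auto
  consider "b = ex" | "b = ey" using Cons.prems by (auto simp: Basis_plane)
  then show ?case
  proof cases
   case 1
   then show ?thesis using Cons.IH[OF _ t, of "m * c"] Cons.prems by (simp add: partials_Cons partial_shear(2)[OF d])
  next
   case 2
   then show ?thesis using Cons.IH[OF _ t, of "m"] Cons.prems by (simp add: partials_Cons partial_shear(3)[OF d])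
  qed
 qed auto
 from this[OF \<phi>, of 1] obtain k where k: "partials bs (%z. \<phi> (shear c d z)) = (%z. k * partials bs \<phi> (shear c d z))" by auto
 show "partials bs (%z. \<phi> (shear c d z)) differentiable_on UNIV"
  unfolding k using partial_shear(1)[OF test_function_differentiable[OF \<phi> bs]] by (auto simp: differentiable_on_def)
next
 obtain K where K: "compact K" "K \<subseteq> strip" "!!z. z \<notin> K ==> \<phi> z = 0" using \<phi> unfolding test_function_def by blast
 have inv: "shear (1 / c) (- d / c) (shear c d z) = z" for z using c by (cases z) (simp add: shear_def field_simps)
 show "\<exists>K. compact K & K \<subseteq> strip & (\<forall>z. z \<notin> K --> \<phi> (shear c d z) = 0)"
 proof (intro exI[of _ "shear (1 / c) (- d / c) ` K"] conjI allI impI)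
  show "compact (shear (1 / c) (- d / c) ` K)"
   unfolding shear_def by (intro compact_continuous_image K continuous_intros)
  show "shear (1 / c) (- d / c) ` K \<subseteq> strip" using K(2) S by auto
  fix z assume "z \<notin> shear (1 / c) (- d / c) ` K"
  then have "shear c d z \<notin> K" using inv[of z] image_eqI[of z "shear (1 / c) (- d / c)" "shear c d z" K] by auto
  then show "\<phi> (shear c d z) = 0" by (rule K(3))
 qed
qed

lemma partial_derivatives:
 assumes "\<phi> differentiable (at (x, y))"
 shows "((%t. \<phi> (t, y)) has_real_derivative frechet_derivative \<phi> (at (x, y)) ex) (at x)"
  "((%t. \<phi> (x, t)) has_real_derivative frechet_derivative \<phi> (at (x, y)) ey) (at y)"
proof -
 let ?D = "frechet_derivative \<phi> (at (x, y))"
 have \<phi>: "(\<phi> has_derivative ?D) (at (x, y))" using assms frechet_derivative_works by blast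
 have l: "linear ?D" using \<phi> has_derivative_linear by blast
 have 1: "((%t. (t, y)) has_derivative (%h. (h, 0))) (at x)" and 2: "((%t. (x, t)) has_derivative (%h. (0, h))) (at y)" by (auto intro!: derivative_eq_intros)
 have e: "?D (h, 0) = ?D ex * h" "?D (0, h) = ?D ey * h" for h
  using linear_scale[OF l, of h ex] linear_scale[OF l, of h ey] by (simp_all add: mult.commute)
 show "((%t. \<phi> (t, y)) has_real_derivative ?D ex) (at x)" "((%t. \<phi> (x, t)) has_real_derivative ?D ey) (at y)"
 proof -
  have e': "(*) (?D ex) = (%h. ?D (h, 0))" "(*) (?D ey) = (%h. ?D (0, h))" by (rule ext, rule e[symmetric])+
  show "((%t. \<phi> (t, y)) has_real_derivative ?D ex) (at x)" "((%t. \<phi> (x, t)) has_real_derivative ?D ey) (at y)"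
   unfolding has_field_derivative_def e' by (rule has_derivative_compose[OF 1 \<phi>] has_derivative_compose[OF 2 \<phi>])+
 qed
qed

lemma mixed_partials_commute:
 assumes \<phi>: "test_function S \<phi>"
 shows "partials [ex, ey] \<phi> = partials [ey, ex] \<phi>"
proof
 fix z :: "plane"
 obtain x y where z: "z = (x, y)" by (cases z)
 define X where "X = partials [ex] \<phi>"
 define Y where "Y = partials [ey] \<phi>"
 define XY where "XY = partials [ex, ey] \<phi>"
 define YX where "YX = partials [ey, ex] \<phi>"
 have d0: "\<phi> differentiable (at w)" for w using test_function_differentiable[OF \<phi>, of "[]"] by simp
 have dX: "X differentiable (at w)" and dY: "Y differentiable (at w)" for w
  unfolding X_def Y_def by (rule test_function_differentiable[OF \<phi>], simp add: Basis_plane)+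
 have tXY: "test_function S XY" and tYX: "test_function S YX"
  unfolding XY_def YX_def by (rule test_function_partials[OF \<phi>], simp add: Basis_plane)+
 have D1: "((%t. \<phi> (t, y)) has_real_derivative X (x, y)) (at x)" "((%t. \<phi> (x, t)) has_real_derivative Y (x, y)) (at y)" for x y
  using partial_derivatives[OF d0[of "(x, y)"]] by (simp_all add: X_def Y_def partials_Cons)
 have D2: "((%t. X (x, t)) has_real_derivative XY (x, y)) (at y)" for x y
  using partial_derivatives(2)[OF dX[of "(x, y)"]] by (simp add: X_def XY_def partials_Cons)
 have D3: "((%t. Y (t, y)) has_real_derivative YX (x, y)) (at x)" for x y
  using partial_derivatives(1)[OF dY[of "(x, y)"]] by (simp add: Y_def YX_def partials_Cons)
 define h where "h n = 1 / real (Suc n)" for n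
 have h: "0 < h n" for n by (simp add: h_def)
 have hl: "h ---> 0" unfolding h_def by (rule LIMSEQ_Suc[OF lim_1_over_n])
 define \<Delta> where "\<Delta> n = \<phi> (x + h n, y + h n) - \<phi> (x + h n, y) - \<phi> (x, y + h n) + \<phi> (x, y)" for n
 have "\<exists>p. x < fst p & fst p < x + h n & y < snd p & snd p < y + h n & \<Delta> n = h n * (h n * XY p)" for n
 proof -
  have "\<exists>\<xi>>x. \<xi> < x + h n & (\<phi> (x + h n, y + h n) - \<phi> (x + h n, y)) - (\<phi> (x, y + h n) - \<phi> (x, y)) = (x + h n - x) * (X (\<xi>, y + h n) - X (\<xi>, y))"
   using h[of n] by (intro MVT2) (auto intro!: DERIV_diff D1)
  then obtain \<xi> where \<xi>: "x < \<xi>" "\<xi> < x + h n" "\<Delta> n = h n * (X (\<xi>, y + h n) - X (\<xi>, y))" by (auto simp: \<Delta>_def)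
  have "\<exists>\<eta>>y. \<eta> < y + h n & X (\<xi>, y + h n) - X (\<xi>, y) = (y + h n - y) * XY (\<xi>, \<eta>)"
   using h[of n] by (intro MVT2) (auto intro!: D2)
  then show ?thesis using \<xi> by auto
 qed
 then obtain p where p: "!!n. x < fst (p n)" "!!n. fst (p n) < x + h n" "!!n. y < snd (p n)" "!!n. snd (p n) < y + h n" "!!n. \<Delta> n = h n * (h n * XY (p n))"
  by metis
 have "\<exists>q. x < fst q & fst q < x + h n & y < snd q & snd q < y + h n & \<Delta> n = h n * (h n * YX q)" for n
 proof -
  have "\<exists>\<eta>>y. \<eta> < y + h n & (\<phi> (x + h n, y + h n) - \<phi> (x, y + h n)) - (\<phi> (x + h n, y) - \<phi> (x, y)) = (y + h n - y) * (Y (x + h n, \<eta>) - Y (x, \<eta>))"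
   using h[of n] by (intro MVT2) (auto intro!: DERIV_diff D1)
  then obtain \<eta> where \<eta>: "y < \<eta>" "\<eta> < y + h n" "\<Delta> n = h n * (Y (x + h n, \<eta>) - Y (x, \<eta>))" by (auto simp: \<Delta>_def)
  have "\<exists>\<xi>>x. \<xi> < x + h n & Y (x + h n, \<eta>) - Y (x, \<eta>) = (x + h n - x) * YX (\<xi>, \<eta>)"
   using h[of n] by (intro MVT2) (auto intro!: D3)
  then show ?thesis using \<eta> by auto
 qed
 then obtain q where q: "!!n. x < fst (q n)" "!!n. fst (q n) < x + h n" "!!n. y < snd (q n)" "!!n. snd (q n) < y + h n" "!!n. \<Delta> n = h n * (h n * YX (q n))"
  by metis
 have lim: "r ---> (x, y)" if "!!n. x < fst (r n)" "!!n. fst (r n) < x + h n" "!!n. y < snd (r n)" "!!n. snd (r n) < y + h n" for r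
 proof -
  have u: "(%n. x + h n) ---> x" "(%n. y + h n) ---> y" using tendsto_add[OF tendsto_const hl] by auto
  have "(%n. fst (r n)) ---> x" by (rule tendsto_sandwich[OF _ _ tendsto_const u(1)]) (intro always_eventually allI less_imp_le that)+
  moreover have "(%n. snd (r n)) ---> y" by (rule tendsto_sandwich[OF _ _ tendsto_const u(2)]) (intro always_eventually allI less_imp_le that)+
  ultimately have "(%n. (fst (r n), snd (r n))) ---> (x, y)" by (rule tendsto_Pair)
  then show ?thesis by simp
 qed
 have "isCont XY (x, y)" "isCont YX (x, y)"
  using test_function_continuous[OF tXY] test_function_continuous[OF tYX] by (auto simp: continuous_on_eq_continuous_at)
 then have "(%n. XY (p n)) ---> XY (x, y)" "(%n. YX (q n)) ---> YX (x, y)"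
  using lim[OF p(1-4)] lim[OF q(1-4)] isCont_tendsto_compose by blast+
 moreover have "XY (p n) = YX (q n)" for n using p(5)[of n] q(5)[of n] h[of n] by simp
 ultimately have "XY (x, y) = YX (x, y)" using LIMSEQ_unique by auto
 then show "partials [ex, ey] \<phi> z = partials [ey, ex] \<phi> z" by (simp add: XY_def YX_def z)
qed

section \<open>Weak derivatives on the half-strip\<close>

text \<open>An integrable Borel function on the plane, zero outside the strip, that agrees with \<open>f\<close> almost everywhere
in it. Everything is proved for such representatives and transferred.\<close>

definition represents :: "(plane => 'a::banach) => (plane => 'a) => bool" where
 "represents F f \<longleftrightarrow> L1 F & (\<forall>z. z \<notin> strip --> F z = 0) & (AE z in lborel. z \<in> strip --> f z = F z)"

lemma Lp1_representative:
 assumes u: "u \<in> Lp1_space p" and p: "1 < p"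
 obtains g where "represents g u" "strip_norm p g = Lp1_norm p u" "Lp1_norm p u < \<infinity>"
proof -
 have s: "strongly_measurable (lebesgue_on strip) u" and fin: "Lp1_norm p u < \<infinity>" using u by (auto simp: Lp1_space_def)
 obtain g where g: "simple_limit lborel g" "!!x. x \<notin> strip ==> g x = 0" "AE x in lborel. x \<in> strip --> u x = g x"
  using strongly_measurable_lebesgue_on_rep[OF strip_borel s] by blast
 have eq: "strip_norm p g = Lp1_norm p u"
  unfolding Lp1_norm_eq by (rule mixed_norm_cong) (use g(3) p in auto)
 have "(NN z. enorm (g z)) = (NN z. enorm (g z) * indicator strip z)" by (intro nn_integral_cong) (use g(2) in \<open>auto simp: indicator_def\<close>)
 also have "\<dots> <= ennreal (2 * pi + 1) * strip_norm p g"
  using simple_limit_norm_measurable[OF g(1)] by (intro integral_le_mixed_norm p) auto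
 also have "\<dots> < \<infinity>" using fin eq by (simp add: ennreal_mult_less_top)
 finally have "L1 g" using g(1) by (simp add: abs_integrable_def)
 then show thesis using that[of g] g eq fin by (auto simp: represents_def)
qed

lemma Lp1_norm_represents: "represents F f ==> 1 < p ==> Lp1_norm p f = strip_norm p F"
 unfolding Lp1_norm_eq represents_def by (intro mixed_norm_cong) auto

lemma Lp1_spaceI:
 assumes F: "represents F f" "strip_norm p F < \<infinity>" and p: "1 < p"
 shows "f \<in> Lp1_space p"
proof -
 have "has_strong_integral (lebesgue_on strip) f (strong_integral lborel F)"
  by (rule has_strong_integral_lebesgue_on[OF strip_borel]) (use F in \<open>auto simp: represents_def\<close>)
 then show ?thesis using Lp1_norm_represents[OF F(1) p] F(2) by (simp add: Lp1_space_def has_strong_integral_def)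
qed

lemma represents_integral:
 assumes F: "represents F f" and \<phi>: "bounded_measurable \<phi>"
 shows "strong_integral (lebesgue_on strip) (%z. \<phi> z *\<^sub>R f z) = pairing F \<phi>"
 unfolding pairing_def
proof (rule strong_integral_eq[OF has_strong_integral_lebesgue_on[OF strip_borel]])
 show "L1 (%z. \<phi> z *\<^sub>R F z)" using F \<phi> by (intro bounded_measurable_abs_integrable) (auto simp: represents_def)
 have "AE z in lborel. z \<in> strip --> f z = F z" using F by (auto simp: represents_def)
 then show "AE z in lborel. z \<in> strip --> \<phi> z *\<^sub>R f z = \<phi> z *\<^sub>R F z" by eventually_elim auto
qed (use F in \<open>auto simp: represents_def\<close>)

lemma represents_locally_integrable:
 assumes F: "represents F f" shows "locally_integrable strip f"
 unfolding locally_integrable_def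
proof (intro allI impI)
 fix K assume K: "compact K & K \<subseteq> strip"
 then have Kb: "K \<in> sets borel" using compact_imp_closed borel_closed by blast
 have "has_strong_integral (lebesgue_on K) f (strong_integral lborel (%z. indicator K z *\<^sub>R F z))"
 proof (rule has_strong_integral_lebesgue_on[OF Kb])
  show "L1 (%z. indicator K z *\<^sub>R F z)"
   using F Kb by (intro bounded_measurable_abs_integrable bounded_measurable_indicator) (auto simp: represents_def)
  have "AE z in lborel. z \<in> strip --> f z = F z" using F by (auto simp: represents_def)
  then show "AE z in lborel. z \<in> K --> f z = indicator K z *\<^sub>R F z" by eventually_elim (use K in auto)
 qed auto
 then show "\<exists>J. has_strong_integral (lebesgue_on K) f J" by blast
qed

definition weak_partial :: "plane list => (plane => 'a::banach) => (plane => 'a) => bool" where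
 "weak_partial bs F G \<longleftrightarrow> (\<forall>\<phi>. test_function strip \<phi> --> pairing F (partials bs \<phi>) = (-1) ^ length bs *\<^sub>R pairing G \<phi>)"

lemma is_weak_derivative_iff:
 assumes "represents F f" "represents G g" "set bs \<subseteq> Basis"
 shows "is_weak_derivative strip bs f g \<longleftrightarrow> weak_partial bs F G"
proof -
 have "strong_integral (lebesgue_on strip) (%z. partials bs \<phi> z *\<^sub>R f z) = pairing F (partials bs \<phi>)"
  "strong_integral (lebesgue_on strip) (%z. \<phi> z *\<^sub>R g z) = pairing G \<phi>" if "test_function strip \<phi>" for \<phi>
  using represents_integral[OF assms(1) test_function_bounded[OF test_function_partials[OF that assms(3)]]]
   represents_integral[OF assms(2) test_function_bounded[OF that]] by auto
 then show ?thesis unfolding is_weak_derivative_def weak_partial_def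
  using represents_locally_integrable[OF assms(1)] represents_locally_integrable[OF assms(2)] by auto
qed

lemma locally_integrable_AE_eq:
 fixes f g :: "plane => 'a::banach"
 assumes f: "locally_integrable strip f" and g: "locally_integrable strip g"
  and eq: "!!\<phi>. test_function strip \<phi> ==> strong_integral (lebesgue_on strip) (%z. \<phi> z *\<^sub>R f z) = strong_integral (lebesgue_on strip) (%z. \<phi> z *\<^sub>R g z)"
 shows "AE z in lborel. z \<in> strip --> f z = g z"
proof -
 define e where "e n = 1 / real (Suc n)" for n
 have e: "e n > 0" for n by (simp add: e_def)
 have "AE z in lborel. z \<in> {e n<..<2 * pi - e n} \<times> {e n<..<real n} --> f z = g z" for n
 proof -
  define K where "K = {e n..2 * pi - e n} \<times> {e n..real n}"
  have Kc: "compact K" unfolding K_def by (intro compact_Times) auto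
  have Ks: "K \<subseteq> strip" using e[of n] by (auto simp: K_def strip_def II_def)
  have Kb: "K \<in> sets borel" using Kc compact_imp_closed borel_closed by blast
  obtain J J' where J: "has_strong_integral (lebesgue_on K) f J" "has_strong_integral (lebesgue_on K) g J'"
   using f g Kc Ks unfolding locally_integrable_def by meson
  obtain F where F: "L1 F" "!!x. x \<notin> K ==> F x = 0" "AE x in lborel. x \<in> K --> f x = F x"
   using has_strong_integral_lebesgue_on_rep[OF Kb J(1)] by blast
  obtain G where G: "L1 G" "!!x. x \<notin> K ==> G x = 0" "AE x in lborel. x \<in> K --> g x = G x"
   using has_strong_integral_lebesgue_on_rep[OF Kb J(2)] by blast
  have "AE z in lborel. z \<in> {e n<..<2 * pi - e n} \<times> {e n<..<real n} --> enorm (F z - G z) <= 0"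
  proof (rule fundamental_lemma_rect[OF abs_integrable_diff[OF F(1) G(1)]])
   fix a b assume ab: "smooth a" "smooth b" "supported_in (e n) (2 * pi - e n) a" "supported_in (e n) (real n) b"
   have s: "supported_in 0 (2 * pi) a" "supported_in 0 (real n) b"
    using supported_in_mono[OF ab(3), of 0 "2 * pi"] supported_in_mono[OF ab(4), of 0 "real n"] e[of n] by auto
   have t: "test_function strip (tensor a b)" by (rule test_function_tensor[OF ab(1) s(1) ab(2) s(2)])
   have bm: "bounded_measurable (tensor a b)" by (rule test_function_bounded[OF t])
   have out: "tensor a b z = 0" if "z \<notin> K" for z by (rule tensor_outside[OF ab(3,4)]) (use that in \<open>auto simp: K_def\<close>)
   have *: "strong_integral (lebesgue_on strip) (%z. tensor a b z *\<^sub>R h z) = pairing H (tensor a b)"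
    if "L1 H" "!!x. x \<notin> K ==> H x = 0" "AE x in lborel. x \<in> K --> h x = H x" for h H :: "plane => 'a"
    unfolding pairing_def
   proof (rule strong_integral_eq[OF has_strong_integral_lebesgue_on[OF strip_borel]])
    show "L1 (%z. tensor a b z *\<^sub>R H z)" by (rule bounded_measurable_abs_integrable[OF that(1) bm])
    show "tensor a b z *\<^sub>R H z = 0" if "z \<notin> strip" for z using out[of z] Ks that by auto
    show "AE z in lborel. z \<in> strip --> tensor a b z *\<^sub>R h z = tensor a b z *\<^sub>R H z"
     using that(3)
    proof eventually_elim
     case (elim z) then show ?case using out[of z] by (cases "z \<in> K") auto
    qed
   qed
   have "pairing F (tensor a b) = pairing G (tensor a b)" using eq[OF t] *[OF F] *[OF G] by simp
   then show "enorm (pairing (%z. F z - G z) (tensor a b)) <= (NN z. ennreal (tensor a b z) * 0)" by (simp add: pairing_diff_left[OF F(1) G(1) bm])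
  qed auto
  then show ?thesis using F(3) G(3) by eventually_elim (auto simp: K_def)
 qed
 then have "AE z in lborel. \<forall>n. z \<in> {e n<..<2 * pi - e n} \<times> {e n<..<real n} --> f z = g z"
  unfolding AE_all_countable by blast
 then show ?thesis
 proof eventually_elim
  case (elim z)
  show ?case
  proof
   assume "z \<in> strip"
   then have z: "0 < fst z" "fst z < 2 * pi" "0 < snd z" by (auto simp: strip_def II_def)
   have el: "e ---> 0" unfolding e_def by (rule LIMSEQ_Suc[OF lim_1_over_n])
   have "eventually (%n. e n < fst z) sequentially" "eventually (%n. e n < 2 * pi - fst z) sequentially" "eventually (%n. e n < snd z) sequentially"
    using z by (intro order_tendstoD(2)[OF el]; simp)+
   moreover have "eventually (%n. snd z < real n) sequentially"
    using filterlim_real_sequentially unfolding filterlim_at_top_dense by blast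
   ultimately have "eventually (%n. z \<in> {e n<..<2 * pi - e n} \<times> {e n<..<real n}) sequentially" by eventually_elim (cases z, auto)
   then obtain n where "z \<in> {e n<..<2 * pi - e n} \<times> {e n<..<real n}" unfolding eventually_sequentially by blast
   then show "f z = g z" using elim by blast
  qed
 qed
qed

text \<open>The fundamental lemma with \<open>M = 0\<close> on rectangles exhausting the strip. It identifies the chosen \<open>weak_derivative\<close> with any
function known to be one.\<close>

lemma weak_derivative_unique:
 assumes "is_weak_derivative strip bs u v" "is_weak_derivative strip bs u v'"
 shows "AE z in lborel. z \<in> strip --> v z = v' z"
proof (rule locally_integrable_AE_eq)
 fix \<phi> :: "plane => real" assume "test_function strip \<phi>"
 then have "(-1) ^ length bs *\<^sub>R strong_integral (lebesgue_on strip) (%z. \<phi> z *\<^sub>R v z) = (-1) ^ length bs *\<^sub>R strong_integral (lebesgue_on strip) (%z. \<phi> z *\<^sub>R v' z)"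
  using assms[unfolded is_weak_derivative_def] by (auto dest!: conjunct2 spec[where x=\<phi>])
 then show "strong_integral (lebesgue_on strip) (%z. \<phi> z *\<^sub>R v z) = strong_integral (lebesgue_on strip) (%z. \<phi> z *\<^sub>R v' z)" by simp
qed (use assms in \<open>auto simp: is_weak_derivative_def\<close>)

lemma weak_derivative_works:
 assumes "has_weak_derivative strip bs u" shows "is_weak_derivative strip bs u (weak_derivative strip bs u)"
 using assms unfolding has_weak_derivative_def weak_derivative_def by (rule someI_ex)

lemma midx_Basis: "set (midx i j) \<subseteq> Basis" by (auto simp: midx_def Basis_plane)

lemma weak_partial_represents:
 assumes "represents F f" "represents G g" "weak_partial (midx i j) F G"
 shows "has_weak_derivative strip (midx i j) f" "represents G (wD i j f)"
proof -
 have 1: "is_weak_derivative strip (midx i j) f g" using is_weak_derivative_iff[OF assms(1,2) midx_Basis] assms(3) by blast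
 then show h: "has_weak_derivative strip (midx i j) f" unfolding has_weak_derivative_def by blast
 have "AE z in lborel. z \<in> strip --> wD i j f z = g z" by (rule weak_derivative_unique[OF weak_derivative_works[OF h] 1])
 moreover have "AE z in lborel. z \<in> strip --> g z = G z" using assms(2) by (simp add: represents_def)
 ultimately have "AE z in lborel. z \<in> strip --> wD i j f z = G z" by eventually_elim auto
 then show "represents G (wD i j f)" using assms(2) by (simp add: represents_def)
qed

lemma midx_simps: "midx 0 0 = []" "midx 1 0 = [ex]" "midx 0 1 = [ey]" "midx 2 0 = [ex, ex]" "midx 0 2 = [ey, ey]" "midx 1 1 = [ex, ey]"
 by (simp_all add: midx_def numeral_2_eq_2)

lemma represents_self: "represents F f ==> represents F F" by (auto simp: represents_def)

lemma Wp1_1I: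
 fixes F Fx Fy :: "plane => 'a::banach"
 assumes F: "represents F f" "represents Fx fx" "represents Fy fy"
  and fin: "strip_norm p F < \<infinity>" "strip_norm p Fx < \<infinity>" "strip_norm p Fy < \<infinity>"
  and w: "weak_partial [ex] F Fx" "weak_partial [ey] F Fy" and p: "1 < p"
 shows "f \<in> Wp1 1 p"
  "Wp1_norm 1 p f = strip_norm p F + (strip_norm p Fx + strip_norm p Fy)"
proof -
 have w0: "weak_partial (midx 0 0) F F" by (simp add: weak_partial_def midx_simps)
 note r0 = weak_partial_represents[OF F(1,1) w0]
 note rx = weak_partial_represents[OF F(1,2) w(1)[folded midx_simps]]
 note ry = weak_partial_represents[OF F(1,3) w(2)[folded midx_simps]]
 have ij: "{(i, j). i + j <= (1::nat)} = {(0, 0), (1, 0), (0, 1)}" by auto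
 show "f \<in> Wp1 1 p"
  unfolding Wp1_def
 proof (intro CollectI conjI allI impI)
  show "f \<in> Lp1_space p" by (rule Lp1_spaceI[OF F(1) fin(1) p])
  fix i j :: nat assume "i + j <= 1"
  then have c: "(i = 0 & j = 0) \<or> (i = 1 & j = 0) \<or> (i = 0 & j = 1)" by auto
  then show "has_weak_derivative strip (midx i j) f" using r0(1) rx(1) ry(1) by auto
  show "wD i j f \<in> Lp1_space p"
   using c Lp1_spaceI[OF r0(2) fin(1) p] Lp1_spaceI[OF rx(2) fin(2) p] Lp1_spaceI[OF ry(2) fin(3) p] by auto
 qed
 show "Wp1_norm 1 p f = strip_norm p F + (strip_norm p Fx + strip_norm p Fy)"
  unfolding Wp1_norm_def ij by (simp add: Lp1_norm_represents[OF r0(2) p] Lp1_norm_represents[OF rx(2) p] Lp1_norm_represents[OF ry(2) p] del: One_nat_def)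
qed

lemma weak_partial_imp_weak_dx: "weak_partial [ex] F G ==> weak_dx F G"
 unfolding weak_dx_def
proof (intro allI impI)
 fix a b d assume w: "weak_partial [ex] F G" and ab: "smooth a & smooth b & supported_in 0 (2 * pi) a & supported_in 0 d b"
 have "test_function strip (tensor a b)" by (rule test_function_tensor) (use ab in auto)
 then have "pairing F (partials [ex] (tensor a b)) = (-1) ^ length [ex] *\<^sub>R pairing G (tensor a b)" using w unfolding weak_partial_def by blast
 then show "pairing F (tensor (deriv a) b) = - pairing G (tensor a b)" using ab by (simp add: partials_Cons partial_tensor)
qed

lemma weak_partial_imp_weak_dy: "weak_partial [ey] F G ==> weak_dy F G"
 unfolding weak_dy_def
proof (intro allI impI)
 fix a b d assume w: "weak_partial [ey] F G" and ab: "smooth a & smooth b & supported_in 0 (2 * pi) a & supported_in 0 d b"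
 have "test_function strip (tensor a b)" by (rule test_function_tensor) (use ab in auto)
 then have "pairing F (partials [ey] (tensor a b)) = (-1) ^ length [ey] *\<^sub>R pairing G (tensor a b)" using w unfolding weak_partial_def by blast
 then show "pairing F (tensor a (deriv b)) = - pairing G (tensor a b)" using ab by (simp add: partials_Cons partial_tensor)
qed

text \<open>A second order weak derivative is a weak derivative of the first order one: test with a partial derivative.\<close>

lemma weak_partial_split:
 assumes "weak_partial [b] F G" "weak_partial [c, b] F K" "b \<in> Basis" "c \<in> Basis"
 shows "weak_partial [c] G K"
 unfolding weak_partial_def
proof (intro allI impI)
 fix \<phi> :: "plane => real" assume \<phi>: "test_function strip \<phi>"
 have t: "test_function strip (partials [c] \<phi>)" by (rule test_function_partials[OF \<phi>]) (use assms in auto)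
 have "pairing F (partials [b] (partials [c] \<phi>)) = - pairing G (partials [c] \<phi>)"
  using assms(1) t unfolding weak_partial_def by simp
 moreover have "pairing F (partials [c, b] \<phi>) = pairing K \<phi>" using assms(2) \<phi> unfolding weak_partial_def by simp
 moreover have "partials [b] (partials [c] \<phi>) = partials [c, b] \<phi>" by (simp add: partials_Cons)
 ultimately show "pairing G (partials [c] \<phi>) = (-1) ^ length [c] *\<^sub>R pairing K \<phi>" by (simp add: minus_equation_iff)
qed

lemma weak_partial_swap: "weak_partial [ex, ey] F G ==> weak_partial [ey, ex] F G"
 unfolding weak_partial_def using mixed_partials_commute by (metis length_Cons)

lemma weak_partial_axpy:
 assumes "weak_partial bs F G" "weak_partial bs F' G'" "set bs \<subseteq> Basis"
  "L1 F" "L1 F'" "L1 G" "L1 G'"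
 shows "weak_partial bs (%z. F z + c *\<^sub>R F' z) (%z. G z + c *\<^sub>R G' z)"
 unfolding weak_partial_def
proof (intro allI impI)
 fix \<phi> :: "plane => real" assume \<phi>: "test_function strip \<phi>"
 note bm = test_function_bounded[OF \<phi>] test_function_bounded[OF test_function_partials[OF \<phi> assms(3)]]
 show "pairing (%z. F z + c *\<^sub>R F' z) (partials bs \<phi>) = (-1) ^ length bs *\<^sub>R pairing (%z. G z + c *\<^sub>R G' z) \<phi>"
  using assms(1,2) \<phi>
  unfolding pairing_add_left[OF assms(4) abs_integrable_scaleR[OF assms(5)] bm(2)] pairing_add_left[OF assms(6) abs_integrable_scaleR[OF assms(7)] bm(1)]
   pairing_scaleR_left[OF assms(5) bm(2)] pairing_scaleR_left[OF assms(7) bm(1)] weak_partial_def by (simp add: scaleR_add_right)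
qed

lemma represents_axpy: "represents F f ==> represents G g ==> represents (%z. F z + c *\<^sub>R G z) (%z. f z + c *\<^sub>R g z)"
 unfolding represents_def by (auto intro: abs_integrable_add abs_integrable_scaleR elim: eventually_elim2)

lemma represents_cong: "represents F f ==> (AE z in lborel. z \<in> strip --> g z = f z) ==> represents F g"
 unfolding represents_def by (auto elim: eventually_elim2)

definition on_strip :: "(plane => 'a::real_vector) => plane => 'a" where
 "on_strip f z = indicator strip z *\<^sub>R f z"

lemma shear_strip:
 assumes h: "0 < h" "h <= 1 / 2" and d: "0 <= d" "d <= 2 * pi * h" and z: "z \<in> strip" shows "shear (1 - h) d z \<in> strip"
proof -
 have x: "0 < fst z" "fst z < 2 * pi" "0 < snd z" using z by (auto simp: strip_def II_def)
 have "(1 - h) * fst z < (1 - h) * (2 * pi)" "0 < (1 - h) * fst z" using x h by auto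
 then have "0 < (1 - h) * fst z + d" "(1 - h) * fst z + d < (1 - h) * (2 * pi) + 2 * pi * h" using d by auto
 moreover have "(1 - h) * (2 * pi) + 2 * pi * h = 2 * pi" by (simp add: algebra_simps)
 ultimately show ?thesis using x by (auto simp: strip_def II_def shear_def)
qed

lemma represents_shear:
 assumes F: "represents F f" and c: "c ~= 0" and S: "!!z. z \<in> strip ==> shear c d z \<in> strip"
 shows "represents (on_strip (%z. F (shear c d z))) (%z. f (shear c d z))"
 unfolding represents_def
proof (intro conjI allI impI)
 have Fa: "L1 F" and ae: "AE z in lborel. z \<in> strip --> f z = F z" using F by (auto simp: represents_def)
 show "L1 (on_strip (%z. F (shear c d z)))"
  unfolding on_strip_def[abs_def] by (intro bounded_measurable_abs_integrable strong_integral_shear(1) c Fa bounded_measurable_indicator) simp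
 show "AE z in lborel. z \<in> strip --> f (shear c d z) = on_strip (%z. F (shear c d z)) z"
  using AE_shear[OF ae c, of d] by eventually_elim (use S in \<open>auto simp: on_strip_def\<close>)
qed (auto simp: on_strip_def)

lemma pairing_on_strip:
 assumes "test_function strip \<phi>" shows "pairing (on_strip f) \<phi> = pairing f \<phi>"
proof -
 have "\<phi> z *\<^sub>R on_strip f z = \<phi> z *\<^sub>R f z" for z
 proof (cases "z \<in> strip")
  case False
  then have "\<phi> z = 0" using assms unfolding test_function_def by blast
  then show ?thesis by simp
 qed (simp add: on_strip_def)
 then show ?thesis unfolding pairing_def by (simp only:)
qed

lemma weak_partial_shear:
 assumes F: "L1 F" "L1 G" and w: "weak_partial [b] F G" and c: "c ~= 0"
  and S: "!!z. z \<in> strip ==> shear c d z \<in> strip" and b: "(b = ex & k = c) \<or> (b = ey & k = 1)"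
 shows "weak_partial [b] (on_strip (%z. F (shear c d z))) (on_strip (%z. k *\<^sub>R G (shear c d z)))"
 unfolding weak_partial_def
proof (intro allI impI)
 fix \<phi> :: "plane => real" assume \<phi>: "test_function strip \<phi>"
 have bB: "b \<in> Basis" using b by (auto simp: Basis_plane)
 define \<psi> where "\<psi> z = \<phi> (shear (1 / c) (- d / c) z)" for z
 have inv: "shear (1 / c) (- d / c) (shear c d z) = z" for z using c by (cases z) (simp add: shear_def field_simps)
 have \<psi>: "test_function strip \<psi>" unfolding \<psi>_def by (rule test_function_shear[OF \<phi>]) (use c S in auto)
 have \<psi>1: "\<psi> (shear c d z) = \<phi> z" for z unfolding \<psi>_def inv ..
 have k0: "k ~= 0" using b c by auto
 have d\<psi>: "partials [b] \<psi> (shear c d z) = (1 / k) * partials [b] \<phi> z" for z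
 proof -
  have dif: "\<phi> differentiable (at (shear (1 / c) (- d / c) w))" for w using test_function_differentiable[OF \<phi>, of "[]"] by simp
  have inv': "shear (1 / c) (- (d / c)) (shear c d z) = z" using inv[of z] by simp
  show ?thesis using b c partial_shear(2)[OF dif, of 1 "shear c d z"] partial_shear(3)[OF dif, of 1 "shear c d z"]
   by (auto simp: partials_Cons \<psi>_def[abs_def] inv')
 qed
 note bm = test_function_bounded[OF \<psi>] test_function_bounded[OF test_function_partials[OF \<psi>, of "[b]"]]
  and bm\<phi> = test_function_bounded[OF \<phi>] test_function_bounded[OF test_function_partials[OF \<phi>, of "[b]"]]
 have b': "set [b] \<subseteq> Basis" using bB by simp
 have Fs: "L1 (%z. F (shear c d z))" "L1 (%z. G (shear c d z))" by (intro strong_integral_shear(1) c F)+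
 have "pairing (on_strip (%z. F (shear c d z))) (partials [b] \<phi>) = pairing (%z. F (shear c d z)) (partials [b] \<phi>)"
  by (rule pairing_on_strip[OF test_function_partials[OF \<phi> b']])
 also have "\<dots> = pairing (%z. F (shear c d z)) (%z. k * partials [b] \<psi> (shear c d z))"
  using k0 by (simp add: d\<psi>)
 also have "\<dots> = k *\<^sub>R ((1 / \<bar>c\<bar>) *\<^sub>R pairing F (partials [b] \<psi>))"
  using pairing_cmult[OF Fs(1) bounded_measurable_compose[OF bm(2)[OF b'] measurable_shear], of k c d] pairing_shear[OF F(1) bm(2)[OF b'] c, of d] by simp
 also have "pairing F (partials [b] \<psi>) = - pairing G \<psi>" using w \<psi> unfolding weak_partial_def by simp
 also have "k *\<^sub>R ((1 / \<bar>c\<bar>) *\<^sub>R - pairing G \<psi>) = - (k *\<^sub>R pairing (%z. G (shear c d z)) \<phi>)"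
  using pairing_shear[OF F(2) bm(1) c, of d] by (simp add: \<psi>1)
 also have "k *\<^sub>R pairing (%z. G (shear c d z)) \<phi> = pairing (on_strip (%z. k *\<^sub>R G (shear c d z))) \<phi>"
  unfolding pairing_on_strip[OF \<phi>] pairing_scaleR_left[OF Fs(2) bm\<phi>(1)] ..
 finally show "pairing (on_strip (%z. F (shear c d z))) (partials [b] \<phi>) = (-1) ^ length [b] *\<^sub>R pairing (on_strip (%z. k *\<^sub>R G (shear c d z))) \<phi>"
  by simp
qed

section \<open>Traces and the difference of two solutions\<close>

lemma mixed_norm_axpy_finite:
 assumes "L1 F" "L1 G" "1 < p"
  "strip_norm p F < \<infinity>" "strip_norm p G < \<infinity>"
 shows "mixed_norm p (%z. enorm (F z + c *\<^sub>R G z)) < \<infinity>"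
proof -
 have s: "simple_limit lborel F" "simple_limit lborel (%z. c *\<^sub>R G z)" "simple_limit lborel G"
  using assms(1,2) abs_integrable_scaleR[of lborel G c] by (auto simp: abs_integrable_def)
 have "mixed_norm p (%z. enorm (c *\<^sub>R G z)) = mixed_norm p (%z. ennreal \<bar>c\<bar> * enorm (G z))" by (simp add: ennreal_mult)
 also have "\<dots> = ennreal \<bar>c\<bar> * strip_norm p G"
  using simple_limit_norm_measurable[OF s(3)] by (intro mixed_norm_cmult assms) auto
 also have "\<dots> < \<infinity>" using assms(5) by (simp add: ennreal_mult_less_top)
 finally have "4 * (strip_norm p F + mixed_norm p (%z. enorm (c *\<^sub>R G z))) < \<infinity>"
  using assms(4) by (simp add: ennreal_mult_less_top)
 then show ?thesis using mixed_norm_triangle[OF s(1,2) assms(3)] le_less_trans by blast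
qed

definition sobolev_data :: "(plane => 'a::banach) => (plane => 'a) => (plane => 'a) => (plane => 'a) => bool" where
 "sobolev_data f F Fx Fy \<longleftrightarrow> represents F f & represents Fx Fx & represents Fy Fy & weak_partial [ex] F Fx & weak_partial [ey] F Fy"

definition finite_norms :: "real => (plane => 'a::banach) => (plane => 'a) => (plane => 'a) => bool" where
 "finite_norms p F Fx Fy \<longleftrightarrow> strip_norm p F < \<infinity> & strip_norm p Fx < \<infinity> & strip_norm p Fy < \<infinity>"

lemma sobolev_data_axpy:
 assumes "sobolev_data f F Fx Fy" "sobolev_data g G Gx Gy"
 shows "sobolev_data (%z. f z + c *\<^sub>R g z) (%z. F z + c *\<^sub>R G z) (%z. Fx z + c *\<^sub>R Gx z) (%z. Fy z + c *\<^sub>R Gy z)"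
 using assms unfolding sobolev_data_def by (auto intro!: represents_axpy weak_partial_axpy simp: Basis_plane represents_def[of F f] represents_def[of G g]
   represents_def[of Fx Fx] represents_def[of Gx Gx] represents_def[of Fy Fy] represents_def[of Gy Gy])

lemma finite_norms_axpy:
 assumes "sobolev_data f F Fx Fy" "sobolev_data g G Gx Gy" "finite_norms p F Fx Fy" "finite_norms p G Gx Gy" "1 < p"
 shows "finite_norms p (%z. F z + c *\<^sub>R G z) (%z. Fx z + c *\<^sub>R Gx z) (%z. Fy z + c *\<^sub>R Gy z)"
 using assms unfolding sobolev_data_def finite_norms_def represents_def by (auto intro!: mixed_norm_axpy_finite[simplified])

lemma Wp1_1_sobolev:
 assumes "sobolev_data f F Fx Fy" "finite_norms p F Fx Fy" "1 < p"
 shows "f \<in> Wp1 1 p"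
  "Wp1_norm 1 p f = strip_norm p F + (strip_norm p Fx + strip_norm p Fy)"
 using Wp1_1I[of F f Fx Fx Fy Fy p] assms unfolding sobolev_data_def finite_norms_def by auto

lemma Wp1_representatives:
 assumes f: "f \<in> Wp1 m p" and p: "1 < p"
 obtains F R where "represents F f" "strip_norm p F < \<infinity>"
  "!!i j. i + j <= m ==> represents (R i j) (wD i j f)"
  "!!i j. i + j <= m ==> strip_norm p (R i j) < \<infinity>"
  "!!i j. i + j <= m ==> weak_partial (midx i j) F (R i j)"
proof -
 have fL: "f \<in> Lp1_space p" and d: "!!i j. i + j <= m ==> has_weak_derivative strip (midx i j) f" "!!i j. i + j <= m ==> wD i j f \<in> Lp1_space p"
  using f by (auto simp: Wp1_def)
 obtain F where F: "represents F f" "strip_norm p F < \<infinity>"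
  using Lp1_representative[OF fL p] by metis
 have "\<forall>i j. \<exists>G. i + j <= m --> represents G (wD i j f) & strip_norm p G < \<infinity>"
 proof (intro allI)
  fix i j show "\<exists>G. i + j <= m --> represents G (wD i j f) & strip_norm p G < \<infinity>"
  proof (cases "i + j <= m")
   case True
   obtain G where "represents G (wD i j f)" "strip_norm p G < \<infinity>"
    using Lp1_representative[OF d(2)[OF True] p] by metis
   then show ?thesis by blast
  qed auto
 qed
 then obtain R where R: "!!i j. i + j <= m ==> represents (R i j) (wD i j f)" "!!i j. i + j <= m ==> strip_norm p (R i j) < \<infinity>" by metis
 have "weak_partial (midx i j) F (R i j)" if "i + j <= m" for i j
  using weak_derivative_works[OF d(1)[OF that]] is_weak_derivative_iff[OF F(1) R(1)[OF that] midx_Basis] by blast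
 then show thesis using that[OF F R] by blast
qed

lemma Wp1_1_data:
 assumes f: "f \<in> Wp1 1 p" and p: "1 < p"
 obtains F Fx Fy where "sobolev_data f F Fx Fy" "finite_norms p F Fx Fy"
proof -
 obtain F R where R: "represents F f" "strip_norm p F < \<infinity>"
  "!!i j. i + j <= 1 ==> represents (R i j) (wD i j f)"
  "!!i j. i + j <= 1 ==> strip_norm p (R i j) < \<infinity>"
  "!!i j. i + j <= 1 ==> weak_partial (midx i j) F (R i j)"
  by (rule Wp1_representatives[OF f p]) blast
 have 10: "1 + 0 <= (1::nat)" "0 + 1 <= (1::nat)" by auto
 show thesis by (rule that[of F "R 1 0" "R 0 1"])
    (use R(1,2) R(3-5)[OF 10(1)] R(3-5)[OF 10(2)] in \<open>auto simp: sobolev_data_def finite_norms_def midx_simps intro: represents_self simp del: One_nat_def\<close>)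
qed

lemma Wp1_1_axpy: "f \<in> Wp1 1 p ==> g \<in> Wp1 1 p ==> 1 < p ==> (%z. f z + c *\<^sub>R g z) \<in> Wp1 1 p"
proof -
 assume f: "f \<in> Wp1 1 p" and g: "g \<in> Wp1 1 p" and p: "1 < p"
 obtain F Fx Fy where F: "sobolev_data f F Fx Fy" "finite_norms p F Fx Fy" using Wp1_1_data[OF f p] by blast
 obtain G Gx Gy where G: "sobolev_data g G Gx Gy" "finite_norms p G Gx Gy" using Wp1_1_data[OF g p] by blast
 show ?thesis by (rule Wp1_1_sobolev(1)[OF sobolev_data_axpy[OF F(1) G(1)] finite_norms_axpy[OF F(1) G(1) F(2) G(2) p] p])
qed

lemma Wp1_1_scaleR:
 assumes f: "f \<in> Wp1 1 p" and p: "1 < p" shows "(%z. c *\<^sub>R f z) \<in> Wp1 1 p"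
 using Wp1_1_axpy[OF f f p, of "c - 1"] by (simp add: scaleR_diff_left)

lemma trace_diff:
 assumes l: "trace_linear p S \<Gamma>" and S: "S \<in> sets borel" and f: "f \<in> Wp1 1 p" and g: "g \<in> Wp1 1 p" and p: "1 < p"
 shows "AE t in lborel. t \<in> S --> \<Gamma> (%z. f z + (-1) *\<^sub>R g z) t = \<Gamma> f t - \<Gamma> g t"
proof -
 have "AE t in lebesgue_on S. \<Gamma> (%z. (-1) *\<^sub>R g z) t = (-1) *\<^sub>R \<Gamma> g t"
  using l g unfolding trace_linear_def by blast
 moreover have "AE t in lebesgue_on S. \<Gamma> (%z. f z + (-1) *\<^sub>R g z) t = \<Gamma> f t + \<Gamma> (%z. (-1) *\<^sub>R g z) t"
  by (rule bspec[OF bspec[OF conjunct1[OF l[unfolded trace_linear_def]] f] Wp1_1_scaleR[OF g p, of "-1"]])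
 ultimately have "AE t in lebesgue_on S. \<Gamma> (%z. f z + (-1) *\<^sub>R g z) t = \<Gamma> f t - \<Gamma> g t" by eventually_elim simp
 then show ?thesis unfolding AE_lebesgue_on[OF S] .
qed

text \<open>Elements of the trace spaces are only strongly measurable; vanishing of the norm integral is read off from an
everywhere defined representative.\<close>

lemma representative_zero:
 fixes f :: "real => 'a::banach"
 assumes S: "S \<in> sets borel" and f: "strongly_measurable (lebesgue_on S) f" and z: "(\<integral>\<^sup>+y. g (norm (f y)) \<partial>lebesgue_on S) = 0"
  and g: "g \<in> Borel" "!!t. g t = (0::ennreal) ==> 0 <= t ==> t = 0"
 shows "AE y in lborel. y \<in> S --> f y = 0"
proof -
 obtain F where F: "simple_limit lborel F" "!!x. x \<notin> S ==> F x = 0" "AE x in lborel. x \<in> S --> f x = F x"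
  using strongly_measurable_lebesgue_on_rep[OF S f] by blast
 have "(NN y. g (norm (F y)) * indicator S y) = (NN y. g (norm (f y)) * indicator S y)"
  by (rule nn_integral_cong_AE) (use F(3) in eventually_elim, auto simp: indicator_def)
 then have "(NN y. g (norm (F y)) * indicator S y) = 0" using z unfolding nn_integral_lebesgue_on[OF S] by simp
 moreover have "(%y. g (norm (F y)) * indicator S y) \<in> borel_measurable lborel"
  using measurable_compose[OF simple_limit_norm_measurable[OF F(1)] g(1)] S by measurable
 ultimately have "AE y in lborel. g (norm (F y)) * indicator S y = 0" using nn_integral_0_iff_AE by blast
 then show ?thesis using F(3)
 proof eventually_elim
  case (elim y)
  then show ?case using g(2)[of "norm (F y)"] by (auto simp: indicator_def)
 qed
qed

text \<open>Boundedness of the trace on \<open>(0, \<xi>)\<close> for every \<open>\<xi>\<close>; local integrability supplies the measurability.\<close>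

lemma side_trace_zero:
 fixes \<Gamma> :: "(plane => 'a::banach) => real => 'a"
 assumes \<Gamma>: "side_trace p a \<Gamma>" and e: "e \<in> Wp1 1 p" "Wp1_norm 1 p e = 0"
 shows "AE y in lborel. y \<in> {0<..} --> \<Gamma> e y = 0"
proof -
 have li: "locally_integrable {0<..} (\<Gamma> e)" using \<Gamma> e(1) unfolding side_trace_def by blast
 have zero: "(\<integral>\<^sup>+ y. enorm (\<Gamma> e y) \<partial>lebesgue_on {0<..<\<xi>}) = 0" if "\<xi> > 0" for \<xi>
 proof -
  obtain C :: real where "\<forall>u\<in>Wp1 1 p. (\<integral>\<^sup>+ y. enorm (\<Gamma> u y) \<partial>lebesgue_on {0<..<\<xi>}) <= ennreal C * Wp1_norm 1 p u"
   using \<Gamma> \<open>\<xi> > 0\<close> unfolding side_trace_def by meson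
  then have "(\<integral>\<^sup>+ y. enorm (\<Gamma> e y) \<partial>lebesgue_on {0<..<\<xi>}) <= ennreal C * Wp1_norm 1 p e" using e(1) by blast
  then show ?thesis using e(2) by simp
 qed
 have "AE y in lborel. y \<in> {1 / real (Suc n)..real (Suc n)} --> \<Gamma> e y = 0" for n
 proof -
  define K where "K = {1 / real (Suc n)..real (Suc n)}"
  have pos: "0 < 1 / real (Suc n)" by simp
  have K: "compact K" "K \<subseteq> {0<..}" "K \<in> sets borel" "K \<subseteq> {0<..<real n + 2}"
   unfolding K_def using less_le_trans[OF pos] by auto
  obtain J where "has_strong_integral (lebesgue_on K) (\<Gamma> e) J" using li K unfolding locally_integrable_def by blast
  then have sm: "strongly_measurable (lebesgue_on K) (\<Gamma> e)" unfolding has_strong_integral_def by blast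
  have "(\<integral>\<^sup>+ y. enorm (\<Gamma> e y) \<partial>lebesgue_on K) <= (\<integral>\<^sup>+ y. enorm (\<Gamma> e y) \<partial>lebesgue_on {0<..<real n + 2})"
   unfolding nn_integral_lebesgue_on[OF K(3)] nn_integral_lebesgue_on[OF borel_open[OF open_greaterThanLessThan]]
   by (intro nn_integral_mono) (use K(4) in \<open>auto simp: indicator_def\<close>)
  then have "(\<integral>\<^sup>+ y. enorm (\<Gamma> e y) \<partial>lebesgue_on K) = 0" using zero[of "real n + 2"] by simp
  from representative_zero[OF K(3) sm this] show ?thesis unfolding K_def by (simp add: ennreal_eq_0_iff)
 qed
 then have "AE y in lborel. \<forall>n. y \<in> {1 / real (Suc n)..real (Suc n)} --> \<Gamma> e y = 0" unfolding AE_all_countable by blast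
 then show ?thesis
 proof eventually_elim
  case (elim y)
  show ?case
  proof
   assume "y \<in> {0<..}"
   then have y: "0 < y" by simp
   obtain n :: nat where n: "y < real n" "1 / y < real n" using reals_Archimedean2[of "max y (1 / y)"] by auto
   then have "1 / real (Suc n) <= y" using y by (simp add: field_simps)
   then show "\<Gamma> e y = 0" using elim n by force
  qed
 qed
qed

lemma bottom_trace_zero:
 fixes \<Gamma> :: "(plane => 'a::banach) => real => 'a"
 assumes \<Gamma>: "bottom_trace p \<Gamma>" and e: "e \<in> Wp1 1 p" "Wp1_norm 1 p e = 0" and p: "1 < p"
 shows "AE x in lborel. x \<in> II --> \<Gamma> e x = 0"
proof -
 obtain C :: real where "\<forall>u\<in>Wp1 1 p. Lp_norm p II (\<Gamma> u) <= ennreal C * Wp1_norm 1 p u" using \<Gamma> unfolding bottom_trace_def by blast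
 then have "Lp_norm p II (\<Gamma> e) <= ennreal C * Wp1_norm 1 p e" using e(1) by blast
 then have "Lp_norm p II (\<Gamma> e) = 0" using e(2) by simp
 then have 1: "(\<integral>\<^sup>+x. ennreal (norm (\<Gamma> e x) powr p) \<partial>lebesgue_on II) = 0" by (simp add: Lp_norm_def)
 have "\<Gamma> e \<in> Lp_space p II" using \<Gamma> e(1) unfolding bottom_trace_def by blast
 then have sm: "strongly_measurable (lebesgue_on II) (\<Gamma> e)" by (simp add: Lp_space_def)
 show ?thesis by (rule representative_zero[OF II_borel sm 1]) (auto simp: ennreal_eq_0_iff)
qed

lemma continuous_AE_zero:
 fixes f :: "'b::euclidean_space => 'a::real_normed_vector"
 assumes f: "continuous_on UNIV f" and ae: "AE x in lborel. x \<in> S --> f x = 0" and S: "open S" and x: "x \<in> closure S"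
 shows "f x = 0"
proof -
 define U where "U = S \<inter> f -` (- {0})"
 have Uo: "open U" unfolding U_def by (intro open_Int S open_vimage f) auto
 have "AE x in lborel. x \<notin> U" using ae by eventually_elim (auto simp: U_def)
 then have "AE x in lebesgue. x \<notin> U" by (rule AE_completion)
 moreover have "U \<in> sets lebesgue" using Uo by simp
 ultimately have "U \<in> null_sets lebesgue" using AE_iff_null_sets by blast
 then have "negligible U" by (simp add: negligible_iff_null_sets)
 then have "U = {}" using Uo open_not_negligible by blast
 then have "S \<subseteq> f -` {0}" by (auto simp: U_def)
 moreover have "closed (f -` {0})" using f by (intro closed_vimage) auto
 ultimately have "closure S \<subseteq> f -` {0}" by (rule closure_minimal)
 then show ?thesis using x by auto
qed

lemma continuous_line:
 fixes W :: "plane => 'a::topological_space"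
 assumes "continuous_on UNIV W"
 shows "continuous_on UNIV (%x. W (x, y))" "continuous_on UNIV (%y. W (x, y))"
 by (rule continuous_on_compose2[OF assms]; auto intro!: continuous_intros)+

text \<open>The dilated quotient is a linear combination of two substitutions, and the chain rule only
produces the factor \<open>1 - h\<close> in the \<open>x\<close>-derivative.\<close>

lemma sobolev_data_quotient:
 assumes F: "sobolev_data f F Fx Fy" and h: "0 < h" "h <= 1 / 2"
 shows "sobolev_data (dilated_quotient h f) (on_strip (dilated_quotient h F)) (%z. (1 - h) *\<^sub>R on_strip (dilated_quotient h Fx) z) (on_strip (dilated_quotient h Fy))"
proof -
 have c: "1 - h ~= 0" using h by simp
 have S: "shear (1 - h) d z \<in> strip" if "z \<in> strip" "d = 0 \<or> d = 2 * pi * h" for z d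
  using that h pi_gt_zero by (intro shear_strip) auto
 have r: "represents F f" "represents Fx Fx" "represents Fy Fy" and w: "weak_partial [ex] F Fx" "weak_partial [ey] F Fy"
  using F by (auto simp: sobolev_data_def)
 then have ai: "L1 F" "L1 Fx" "L1 Fy" by (auto simp: represents_def)
 have data: "sobolev_data (%z. f (shear (1 - h) d z)) (on_strip (%z. F (shear (1 - h) d z)))
   (on_strip (%z. (1 - h) *\<^sub>R Fx (shear (1 - h) d z))) (on_strip (%z. 1 *\<^sub>R Fy (shear (1 - h) d z)))" if d: "d = 0 \<or> d = 2 * pi * h" for d
 proof -
  have S': "!!z. z \<in> strip ==> shear (1 - h) d z \<in> strip" using S d by blast
  have "represents (%z. (1 - h) *\<^sub>R Fx z) (%z. (1 - h) *\<^sub>R Fx z)"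
   using represents_axpy[OF r(2) r(2), of "- h"] by (simp add: scaleR_diff_left)
  from represents_shear[OF this c S'] represents_shear[OF r(3) c S'] represents_shear[OF r(1) c S']
  show ?thesis
   unfolding sobolev_data_def
   using weak_partial_shear[OF ai(1,2) w(1) c S', of "1 - h"] weak_partial_shear[OF ai(1,3) w(2) c S', of 1] by (auto intro: represents_self)
 qed
 define k where "k = 1 / (2 * pi * h)"
 define T where "T d G z = on_strip (%z. G (shear (1 - h) d z)) z" for d and G :: "plane => 'a" and z
 have 1: "sobolev_data (%z. f (shear (1 - h) (2 * pi * h) z) + (k - 1) *\<^sub>R f (shear (1 - h) (2 * pi * h) z))
   (%z. T (2 * pi * h) F z + (k - 1) *\<^sub>R T (2 * pi * h) F z)
   (%z. on_strip (%z. (1 - h) *\<^sub>R Fx (shear (1 - h) (2 * pi * h) z)) z + (k - 1) *\<^sub>R on_strip (%z. (1 - h) *\<^sub>R Fx (shear (1 - h) (2 * pi * h) z)) z)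
   (%z. on_strip (%z. 1 *\<^sub>R Fy (shear (1 - h) (2 * pi * h) z)) z + (k - 1) *\<^sub>R on_strip (%z. 1 *\<^sub>R Fy (shear (1 - h) (2 * pi * h) z)) z)"
  unfolding T_def using sobolev_data_axpy[OF data[of "2 * pi * h"] data[of "2 * pi * h"], of "k - 1"] by simp
 note 2 = sobolev_data_axpy[OF 1 data[OF disjI1[OF refl]], of "- k"]
 have eq: "(x + (k - 1) *\<^sub>R x) + (- k) *\<^sub>R y = k *\<^sub>R (x - y)" for x y :: 'a by (simp add: scaleR_diff_left scaleR_diff_right)
 have q: "dilated_quotient h G z = k *\<^sub>R (G (shear (1 - h) (2 * pi * h) z) - G (shear (1 - h) 0 z))" for G :: "plane => 'a" and z
  unfolding dilated_quotient_def k_def ..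
 have e: "dilated_quotient h f = (%z. k *\<^sub>R (f (shear (1 - h) (2 * pi * h) z) - f (shear (1 - h) 0 z)))"
  "on_strip (dilated_quotient h F) = (%z. k *\<^sub>R (on_strip (%z. F (shear (1 - h) (2 * pi * h) z)) z - on_strip (%z. F (shear (1 - h) 0 z)) z))"
  "on_strip (dilated_quotient h Fy) = (%z. k *\<^sub>R (on_strip (%z. 1 *\<^sub>R Fy (shear (1 - h) (2 * pi * h) z)) z - on_strip (%z. 1 *\<^sub>R Fy (shear (1 - h) 0 z)) z))"
  "(%z. (1 - h) *\<^sub>R on_strip (dilated_quotient h Fx) z) = (%z. k *\<^sub>R (on_strip (%z. (1 - h) *\<^sub>R Fx (shear (1 - h) (2 * pi * h) z)) z - on_strip (%z. (1 - h) *\<^sub>R Fx (shear (1 - h) 0 z)) z))"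
  by (rule ext, simp add: q on_strip_def scaleR_diff_right mult_ac)+
 show ?thesis unfolding e using 2 unfolding T_def eq .
qed

lemma represents_on_strip: "represents F f ==> (AE z in lborel. z \<in> strip --> g z = f z) ==> simple_limit lborel g ==> represents (on_strip g) g"
proof -
 assume F: "represents F f" and ae: "AE z in lborel. z \<in> strip --> g z = f z" and g: "simple_limit lborel g"
 have o: "!!z. z \<notin> strip ==> F z = 0" using F unfolding represents_def by blast
 have "AE z in lborel. z \<in> strip --> f z = F z" using F by (simp add: represents_def)
 then have eq: "AE z in lborel. on_strip g z = F z"
  using ae by (eventually_elim, unfold on_strip_def indicator_def, use o in force)
 have "L1 (on_strip g)"
 proof (rule abs_integrable_mono)
  show "simple_limit lborel (on_strip g)" unfolding on_strip_def[abs_def] by (intro simple_limit_scaleR g) simp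
  show "AE z in lborel. enorm (on_strip g z) <= enorm (F z)" using eq by eventually_elim simp
  show "(NN z. enorm (F z)) < \<infinity>" using F by (simp add: represents_def abs_integrable_def)
 qed
 then show ?thesis by (auto simp: represents_def on_strip_def)
qed

text \<open>All analytic information about the problem, restated for one continuous function. The last property is the Neumann
condition. Its proof applies the bounded trace operator to the quotient minus \<open>w\<^sub>x\<close>; as the trace
of \<open>w\<^sub>x\<close> vanishes, the quotient at \<open>x = 0\<close> is small in \<open>L\<^sup>1(0, \<xi>)\<close>.\<close>

lemma difference_of_solutions:
 fixes \<Gamma>I \<Gamma>0 \<Gamma>2\<pi> :: "(plane => 'a::banach) => real => 'a"
 assumes p: "1 < p" and \<Gamma>I: "bottom_trace p \<Gamma>I" and \<Gamma>0: "side_trace p 0 \<Gamma>0" and \<Gamma>2: "side_trace p (2 * pi) \<Gamma>2\<pi>"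
  and u: "is_solution p \<Gamma>I \<Gamma>0 \<Gamma>2\<pi> f u" and v: "is_solution p \<Gamma>I \<Gamma>0 \<Gamma>2\<pi> f v"
 obtains W C where "continuous_on UNIV W" "!!z. norm (W z) <= C" "AE z in lborel. z \<in> strip --> W z = u z - v z"
  "L1 (on_strip W)"
  "!!a b d. smooth a ==> smooth b ==> supported_in 0 (2 * pi) a ==> supported_in 0 d b ==>
    pairing (on_strip W) (tensor (deriv (deriv a)) b) + pairing (on_strip W) (tensor a (deriv (deriv b))) = 0"
  "!!x. 0 <= x ==> x <= 2 * pi ==> W (x, 0) = 0"
  "!!y. 0 <= y ==> W (0, y) = W (2 * pi, y)"
  "!!\<xi> e. 0 < \<xi> ==> 0 < e ==> \<exists>\<delta>>0. \<forall>x. 0 < x & x < \<delta> -->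
    (NN y. enorm (W (x, y) - W (0, y)) * indicator {0<..<\<xi>} y) <= ennreal (e * x)"
proof -
 have uW: "u \<in> Wp1 2 p" and vW: "v \<in> Wp1 2 p" using u v by (auto simp: is_solution_def)
 obtain U RU where U: "represents U u" "strip_norm p U < \<infinity>"
  "!!i j. i + j <= 2 ==> represents (RU i j) (wD i j u)" "!!i j. i + j <= 2 ==> strip_norm p (RU i j) < \<infinity>"
  "!!i j. i + j <= 2 ==> weak_partial (midx i j) U (RU i j)"
  by (rule Wp1_representatives[OF uW p]) blast
 obtain V RV where V: "represents V v" "strip_norm p V < \<infinity>"
  "!!i j. i + j <= 2 ==> represents (RV i j) (wD i j v)" "!!i j. i + j <= 2 ==> strip_norm p (RV i j) < \<infinity>"
  "!!i j. i + j <= 2 ==> weak_partial (midx i j) V (RV i j)"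
  by (rule Wp1_representatives[OF vW p]) blast
 have ia: "represents F g ==> L1 F" for F g :: "plane => 'a" by (simp add: represents_def)
 define D where "D z = U z + (-1) *\<^sub>R V z" for z
 define R where "R i j z = RU i j z + (-1) *\<^sub>R RV i j z" for i j z
 define wD' where "wD' i j z = wD i j u z + (-1) *\<^sub>R wD i j v z" for i j z
 have D: "represents D (%z. u z + (-1) *\<^sub>R v z)" unfolding D_def[abs_def] by (rule represents_axpy[OF U(1) V(1)])
 have Dfin: "strip_norm p D < \<infinity>" unfolding D_def by (rule mixed_norm_axpy_finite[OF ia[OF U(1)] ia[OF V(1)] p U(2) V(2)])
 have R: "represents (R i j) (wD' i j)" "strip_norm p (R i j) < \<infinity>" "weak_partial (midx i j) D (R i j)" if ij: "i + j <= 2" for i j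
 proof -
  show "represents (R i j) (wD' i j)" unfolding R_def[abs_def] wD'_def[abs_def] by (rule represents_axpy[OF U(3) V(3)]) (use ij in auto)
  show "strip_norm p (R i j) < \<infinity>" unfolding R_def by (rule mixed_norm_axpy_finite[OF ia[OF U(3)] ia[OF V(3)] p U(4) V(4)]) (use ij in auto)
  show "weak_partial (midx i j) D (R i j)" unfolding R_def[abs_def] D_def[abs_def]
   by (rule weak_partial_axpy[OF U(5) V(5) midx_Basis ia[OF U(1)] ia[OF V(1)] ia[OF U(3)] ia[OF V(3)]]) (use ij in auto)
 qed
 have le: "1 + 0 <= (2::nat)" "0 + 1 <= (2::nat)" "2 + 0 <= (2::nat)" "0 + 2 <= (2::nat)" "1 + 1 <= (2::nat)" by auto
 note wp = R(3)[OF le(1), unfolded midx_simps] R(3)[OF le(2), unfolded midx_simps] R(3)[OF le(3), unfolded midx_simps]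
  R(3)[OF le(4), unfolded midx_simps] R(3)[OF le(5), unfolded midx_simps]
 have eB: "ex \<in> Basis" "ey \<in> Basis" by (simp_all add: Basis_plane)
 have wyx: "weak_partial [ex] (R 0 1) (R 1 1)" by (rule weak_partial_split[OF wp(2,5) eB(2,1)])
 have wxx: "weak_partial [ex] (R 1 0) (R 2 0)" by (rule weak_partial_split[OF wp(1,3) eB(1,1)])
 have wxy: "weak_partial [ey] (R 1 0) (R 1 1)" by (rule weak_partial_split[OF wp(1) weak_partial_swap[OF wp(5)] eB(1,2)])
 note Da = ia[OF D] and Ra = ia[OF R(1)]
 obtain W C where W: "continuous_on UNIV W" "!!z. norm (W z) <= C" "AE z in lborel. z \<in> strip --> W z = D z"
  using continuous_representative[OF Da Ra[OF le(1)] Ra[OF le(2)] Ra[OF le(5)] weak_partial_imp_weak_dx[OF wp(1)]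
    weak_partial_imp_weak_dy[OF wp(2)] weak_partial_imp_weak_dx[OF wyx]] by blast
 have Duv: "AE z in lborel. z \<in> strip --> u z + (-1) *\<^sub>R v z = D z" using D by (simp add: represents_def)
 have Wuv: "AE z in lborel. z \<in> strip --> W z = u z - v z" using W(3) Duv by eventually_elim auto
 have DW: "represents D W" by (rule represents_cong[OF D]) (use Wuv in auto)
 have sW: "represents (on_strip W) W" by (rule represents_on_strip[OF D _ simple_limit_continuous[OF W(1)]]) (use Wuv in auto)
 have o: "!!z. z \<notin> strip ==> D z = 0" using D unfolding represents_def by blast
 have WD: "AE z in lborel. on_strip W z = D z"
  using W(3) by (eventually_elim, unfold on_strip_def indicator_def, use o in force)
 have pair_eq: "pairing (on_strip W) \<phi> = pairing D \<phi>" for \<phi> by (rule pairing_cong_AE) (use WD in eventually_elim, simp)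
 have dataW: "sobolev_data W D (R 1 0) (R 0 1)"
  using DW R(1)[OF le(1)] R(1)[OF le(2)] wp(1,2) unfolding sobolev_data_def by (auto intro: represents_self)
 have finW: "finite_norms p D (R 1 0) (R 0 1)" using Dfin R(2)[OF le(1)] R(2)[OF le(2)] by (simp add: finite_norms_def)
 have W1: "W \<in> Wp1 1 p" by (rule Wp1_1_sobolev(1)[OF dataW finW p])
 have sol1: "w \<in> Wp1 1 p" "wD 1 0 w \<in> Wp1 1 p" if w: "w \<in> Wp1 2 p" for w :: "plane => 'a"
 proof -
  obtain F G where F: "represents F w" "strip_norm p F < \<infinity>"
   "!!i j. i + j <= 2 ==> represents (G i j) (wD i j w)" "!!i j. i + j <= 2 ==> strip_norm p (G i j) < \<infinity>"
   "!!i j. i + j <= 2 ==> weak_partial (midx i j) F (G i j)"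
   by (rule Wp1_representatives[OF w p]) blast
  note wq = F(5)[OF le(1), unfolded midx_simps] F(5)[OF le(2), unfolded midx_simps] F(5)[OF le(3), unfolded midx_simps] F(5)[OF le(5), unfolded midx_simps]
  have "sobolev_data w F (G 1 0) (G 0 1)" "finite_norms p F (G 1 0) (G 0 1)"
   using F(1,2) F(3,4)[OF le(1)] F(3,4)[OF le(2)] wq(1,2) by (auto simp: sobolev_data_def finite_norms_def intro: represents_self)
  then show "w \<in> Wp1 1 p" using p by (rule Wp1_1_sobolev(1))
  have "weak_partial [ex] (G 1 0) (G 2 0)" by (rule weak_partial_split[OF wq(1,3) eB(1,1)])
  moreover have "weak_partial [ey] (G 1 0) (G 1 1)" by (rule weak_partial_split[OF wq(1) weak_partial_swap[OF wq(4)] eB(1,2)])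
  ultimately have "sobolev_data (wD 1 0 w) (G 1 0) (G 2 0) (G 1 1)" "finite_norms p (G 1 0) (G 2 0) (G 1 1)"
   using F(3,4)[OF le(1)] F(3,4)[OF le(3)] F(3,4)[OF le(5)] by (auto simp: sobolev_data_def finite_norms_def intro: represents_self)
  then show "wD 1 0 w \<in> Wp1 1 p" using p by (rule Wp1_1_sobolev(1))
 qed
 note u1 = sol1[OF uW] and v1 = sol1[OF vW]
 define s where "s z = u z + (-1) *\<^sub>R v z" for z
 have s1: "s \<in> Wp1 1 p" unfolding s_def[abs_def] by (rule Wp1_1_axpy[OF u1(1) v1(1) p])
 define e where "e z = W z + (-1) *\<^sub>R s z" for z
 have e1: "e \<in> Wp1 1 p" unfolding e_def[abs_def] by (rule Wp1_1_axpy[OF W1 s1 p])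
 have e0: "Wp1_norm 1 p e = 0"
 proof -
  have r0: "represents (%z. 0) (%z. 0 :: 'a)" by (simp add: represents_def)
  have "represents (%z. 0) e" by (rule represents_cong[OF r0]) (use Wuv in \<open>auto simp: e_def s_def\<close>)
  moreover have "weak_partial [b] (%z. 0) (%z. 0 :: 'a)" for b by (simp add: weak_partial_def pairing_def)
  ultimately have "sobolev_data e (%z. 0) (%z. 0) (%z. 0)" using r0 by (simp add: sobolev_data_def)
  moreover have m0: "mixed_norm p (%z. enorm (0 :: 'a)) = 0" by (simp add: mixed_norm_def)
  moreover have "finite_norms p (%z. 0 :: 'a) (%z. 0) (%z. 0)" unfolding finite_norms_def m0 by simp
  ultimately show ?thesis using Wp1_1_sobolev(2)[of e "%z. 0" "%z. 0" "%z. 0" p] p by simp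
 qed
 have lin: "trace_linear p II \<Gamma>I" "trace_linear p {0<..} \<Gamma>0" "trace_linear p {0<..} \<Gamma>2\<pi>"
  using \<Gamma>I \<Gamma>0 \<Gamma>2 by (auto simp: bottom_trace_def side_trace_def)
 have Jb: "{0<..} \<in> sets (borel :: real measure)" by simp
 have cW: "continuous_on (closure strip) W" using W(1) continuous_on_subset by blast
 have IIc: "x \<in> closure II" if "0 <= x" "x <= 2 * pi" for x
  using that pi_gt_zero by (simp add: II_def closure_greaterThanLessThan)
 have Jc: "y \<in> closure {0<..}" if "0 <= y" for y :: real using that by (simp add: closure_greaterThan)

 have bottom: "W (x, 0) = 0" if x: "0 <= x" "x <= 2 * pi" for x
 proof -
  have "AE x in lborel. x \<in> II --> \<Gamma>I u x = f x" "AE x in lborel. x \<in> II --> \<Gamma>I v x = f x"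
   using u v by (auto simp: is_solution_def AE_lebesgue_on)
  moreover have "AE x in lborel. x \<in> II --> \<Gamma>I W x = W (x, 0)"
   using \<Gamma>I W1 cW unfolding bottom_trace_def AE_lebesgue_on[OF II_borel] by blast
  moreover note bottom_trace_zero[OF \<Gamma>I e1 e0 p] trace_diff[OF lin(1) II_borel W1 s1 p] trace_diff[OF lin(1) II_borel u1(1) v1(1) p]
  ultimately have "AE x in lborel. x \<in> II --> W (x, 0) = 0"
   unfolding e_def[abs_def, symmetric] s_def[abs_def, symmetric] by eventually_elim auto
  then show ?thesis by (rule continuous_AE_zero[OF continuous_line(1)[OF W(1)] _ _ IIc[OF x]]) (simp add: II_def)
 qed
 have side: "AE y in lborel. y \<in> {0<..} --> W (a, y) = \<Gamma> u y - \<Gamma> v y"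
  if \<Gamma>: "side_trace p a \<Gamma>" for a and \<Gamma> :: "(plane => 'a) => real => 'a"
 proof -
  have l: "trace_linear p {0<..} \<Gamma>" using \<Gamma> by (simp add: side_trace_def)
  have "AE y in lborel. y \<in> {0<..} --> \<Gamma> W y = W (a, y)"
   using \<Gamma> W1 cW unfolding side_trace_def AE_lebesgue_on[OF Jb] by blast
  moreover note side_trace_zero[OF \<Gamma> e1 e0] trace_diff[OF l Jb W1 s1 p] trace_diff[OF l Jb u1(1) v1(1) p]
  ultimately show ?thesis
   unfolding e_def[abs_def, symmetric] s_def[abs_def, symmetric] by eventually_elim auto
 qed
 have periodic: "W (0, y) = W (2 * pi, y)" if y: "0 <= y" for y
 proof -
  have "AE y in lborel. y \<in> {0<..} --> \<Gamma>0 u y = \<Gamma>2\<pi> u y" "AE y in lborel. y \<in> {0<..} --> \<Gamma>0 v y = \<Gamma>2\<pi> v y"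
   using u v by (auto simp: is_solution_def AE_lebesgue_on)
  then have "AE y in lborel. y \<in> {0<..} --> W (0, y) - W (2 * pi, y) = 0"
   using side[OF \<Gamma>0] side[OF \<Gamma>2] by eventually_elim auto
  then have "W (0, y) - W (2 * pi, y) = 0"
   by (rule continuous_AE_zero[OF continuous_on_diff[OF continuous_line(2)[OF W(1)] continuous_line(2)[OF W(1)]] _ _ Jc[OF y]]) simp
  then show ?thesis by simp
 qed

 have harmonic: "pairing (on_strip W) (tensor (deriv (deriv a)) b) + pairing (on_strip W) (tensor a (deriv (deriv b))) = 0"
  if ab: "smooth a" "smooth b" "supported_in 0 (2 * pi) a" "supported_in 0 d b" for a b d
 proof -
  have t: "test_function strip (tensor a b)" by (rule test_function_tensor[OF ab(1,3,2,4)])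
  have bm: "bounded_measurable (tensor a b)" by (rule test_function_bounded[OF t])
  have 1: "partials [ex, ex] (tensor a b) = tensor (deriv (deriv a)) b" "partials [ey, ey] (tensor a b) = tensor a (deriv (deriv b))"
   using ab by (simp_all add: partials_Cons partial_tensor smooth_deriv(2))
  have "pairing D (tensor (deriv (deriv a)) b) = pairing (R 2 0) (tensor a b)" "pairing D (tensor a (deriv (deriv b))) = pairing (R 0 2) (tensor a b)"
   using wp(3,4) t unfolding weak_partial_def by (auto simp flip: 1)
  then have "pairing D (tensor (deriv (deriv a)) b) + pairing D (tensor a (deriv (deriv b))) = pairing (%z. R 2 0 z + R 0 2 z) (tensor a b)"
   by (simp add: pairing_add_left[OF Ra[OF le(3)] Ra[OF le(4)] bm])
  also have "\<dots> = pairing (%z. 0 :: 'a) (tensor a b)"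
  proof (rule pairing_cong_AE)
   have o: "R 2 0 z = 0" "R 0 2 z = 0" if "z \<notin> strip" for z
    using R(1)[OF le(3)] R(1)[OF le(4)] that unfolding represents_def by blast+
   have "AE z in lborel. z \<in> strip --> wD 2 0 u z + wD 0 2 u z = 0" "AE z in lborel. z \<in> strip --> wD 2 0 v z + wD 0 2 v z = 0"
    using u v by (auto simp: is_solution_def AE_lebesgue_on)
   moreover have "AE z in lborel. z \<in> strip --> wD' 2 0 z = R 2 0 z" "AE z in lborel. z \<in> strip --> wD' 0 2 z = R 0 2 z"
    using R(1)[OF le(3)] R(1)[OF le(4)] by (auto simp: represents_def)
   ultimately show "AE z in lborel. tensor a b z *\<^sub>R (R 2 0 z + R 0 2 z) = tensor a b z *\<^sub>R 0"
   proof eventually_elim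
    case (elim z)
    have "R 2 0 z + R 0 2 z = 0"
    proof (cases "z \<in> strip")
     case True
     then have "R 2 0 z = wD 2 0 u z - wD 2 0 v z" "R 0 2 z = wD 0 2 u z - wD 0 2 v z"
      using elim by (simp_all add: wD'_def)
     then have "R 2 0 z + R 0 2 z = (wD 2 0 u z + wD 0 2 u z) - (wD 2 0 v z + wD 0 2 v z)" by simp
     then show ?thesis using elim True by simp
    qed (use o in simp)
    then show ?case by simp
   qed
  qed
  finally show ?thesis by (simp add: pair_eq) (simp add: pairing_def)
 qed

 have quotient: "\<exists>\<delta>>0. \<forall>x. 0 < x & x < \<delta> -->
    (NN y. enorm (W (x, y) - W (0, y)) * indicator {0<..<\<xi>} y) <= ennreal (\<epsilon> * x)"
  if \<xi>: "0 < \<xi>" and \<epsilon>: "0 < \<epsilon>" for \<xi> \<epsilon>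
 proof (rule ccontr)
  assume neg: "\<not> ?thesis"
  have "\<exists>x. 0 < x & x < 1 / real (Suc n) & \<not> (NN y. enorm (W (x, y) - W (0, y)) * indicator {0<..<\<xi>} y) <= ennreal (\<epsilon> * x)" for n
  proof -
   have "0 < 1 / real (Suc n)" by simp
   then show ?thesis using neg by blast
  qed
  then obtain x where x: "!!n. 0 < x n" "!!n. x n < 1 / real (Suc n)"
   "!!n. \<not> (NN y. enorm (W (x n, y) - W (0, y)) * indicator {0<..<\<xi>} y) <= ennreal (\<epsilon> * x n)"
   using choice[of "%n x. 0 < x & x < 1 / real (Suc n) & \<not> (NN y. enorm (W (x, y) - W (0, y)) * indicator {0<..<\<xi>} y) <= ennreal (\<epsilon> * x)"] by blast
  define h where "h n = x n / (2 * pi)" for n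
  have h0: "0 < h n" for n using x(1)[of n] pi_gt_zero by (simp add: h_def)
  have hx: "2 * pi * h n = x n" for n using pi_gt_zero by (simp add: h_def)
  have x1: "x n < 1" for n using x(2)[of n] by (rule less_le_trans) simp
  have h1: "h n <= 1 / 2" for n using x1[of n] pi_gt3 by (simp add: h_def field_simps)
  have xl: "x ---> 0"
   by (rule tendsto_sandwich[OF _ _ tendsto_const LIMSEQ_Suc[OF lim_1_over_n]]) (use x(1,2) in \<open>auto intro!: always_eventually less_imp_le\<close>)
  have hl: "h ---> 0" using tendsto_divide[OF xl tendsto_const, of "2 * pi"] by (simp add: h_def[abs_def])
  have Rz: "R i j z = 0" if "i + j <= 2" "z \<notin> strip" for i j z using R(1)[OF that(1)] that(2) unfolding represents_def by blast
  let ?q = "%n F G. mixed_norm p (%z. enorm (dilated_quotient (h n) F z - G z))"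
  have q0: "(%n. ?q n D (R 1 0)) ---> 0"
   by (rule dilated_quotient_tendsto[OF Da Ra[OF le(1)] _ R(2)[OF le(1)] weak_partial_imp_weak_dx[OF wp(1)] p h0 h1 hl]) (use Rz[of 1 0] in simp)
  have q1: "(%n. ?q n (R 1 0) (R 2 0)) ---> 0"
   by (rule dilated_quotient_tendsto[OF Ra[OF le(1)] Ra[OF le(3)] _ R(2)[OF le(3)] weak_partial_imp_weak_dx[OF wxx] p h0 h1 hl]) (use Rz[of 2 0] in simp)
  have q2: "(%n. ?q n (R 0 1) (R 1 1)) ---> 0"
   by (rule dilated_quotient_tendsto[OF Ra[OF le(2)] Ra[OF le(5)] _ R(2)[OF le(5)] weak_partial_imp_weak_dx[OF wyx] p h0 h1 hl]) (use Rz[of 1 1] in simp)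
  define g where "g n = dilated_quotient (h n) W" for n
  have datag: "sobolev_data (g n) (on_strip (dilated_quotient (h n) D)) (%z. (1 - h n) *\<^sub>R on_strip (dilated_quotient (h n) (R 1 0)) z) (on_strip (dilated_quotient (h n) (R 0 1)))" for n
   unfolding g_def by (rule sobolev_data_quotient[OF dataW h0 h1])
  have datad: "sobolev_data (wD' 1 0) (R 1 0) (R 2 0) (R 1 1)"
   using R(1)[OF le(1)] R(1)[OF le(3)] R(1)[OF le(5)] wxx wxy by (auto simp: sobolev_data_def intro: represents_self)
  have find: "finite_norms p (R 1 0) (R 2 0) (R 1 1)" using R(2)[OF le(1)] R(2)[OF le(3)] R(2)[OF le(5)] by (simp add: finite_norms_def)
  define r where "r n z = g n z + (-1) *\<^sub>R wD' 1 0 z" for n z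
  define E0 where "E0 n z = on_strip (dilated_quotient (h n) D) z + (-1) *\<^sub>R R 1 0 z" for n z
  define E1 where "E1 n z = (1 - h n) *\<^sub>R on_strip (dilated_quotient (h n) (R 1 0)) z + (-1) *\<^sub>R R 2 0 z" for n z
  define E2 where "E2 n z = on_strip (dilated_quotient (h n) (R 0 1)) z + (-1) *\<^sub>R R 1 1 z" for n z
  have datar: "sobolev_data (r n) (E0 n) (E1 n) (E2 n)" for n
   unfolding r_def[abs_def] E0_def[abs_def] E1_def[abs_def] E2_def[abs_def] by (rule sobolev_data_axpy[OF datag datad])
  let ?m = "%F. strip_norm p F"
  have n0: "?m (E0 n) = ?q n D (R 1 0)" and n2: "?m (E2 n) = ?q n (R 0 1) (R 1 1)" for n
   using p by (auto intro!: mixed_norm_cong simp: E0_def E2_def on_strip_def)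
  have n1: "?m (E1 n) <= 4 * (?q n (R 1 0) (R 2 0) + ennreal (h n) * ?m (R 2 0))" for n
  proof -
   have ss: "simple_limit lborel (%z. dilated_quotient (h n) (R 1 0) z - R 2 0 z)" "simple_limit lborel (R 2 0)"
    using abs_integrable_diff[OF abs_integrable_scaleR[OF abs_integrable_diff[OF strong_integral_shear(1)[OF _ Ra[OF le(1)]] strong_integral_shear(1)[OF _ Ra[OF le(1)]]]] Ra[OF le(3)]] Ra[OF le(3)] h1[of n]
    by (auto simp: dilated_quotient_def abs_integrable_def)
   have mm: "(%z. enorm (dilated_quotient (h n) (R 1 0) z - R 2 0 z)) \<in> Borel"
    "(%z. enorm (R 2 0 z)) \<in> Borel"
    using simple_limit_norm_measurable[OF ss(1)] simple_limit_norm_measurable[OF ss(2)] by simp_all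
   have "?m (E1 n) <= mixed_norm p (%z. enorm (dilated_quotient (h n) (R 1 0) z - R 2 0 z) + ennreal (h n) * enorm (R 2 0 z))"
   proof (intro mixed_norm_mono AE_I2 impI)
    fix z assume z: "z \<in> strip"
    let ?a = "dilated_quotient (h n) (R 1 0) z" and ?b = "R 2 0 z"
    have "E1 n z = (1 - h n) *\<^sub>R (?a - ?b) - h n *\<^sub>R ?b" using z by (simp add: E1_def on_strip_def algebra_simps)
    then have "norm (E1 n z) <= norm ((1 - h n) *\<^sub>R (?a - ?b)) + norm (h n *\<^sub>R ?b)" by (simp only: norm_triangle_ineq4)
    also have "\<dots> <= norm (?a - ?b) + h n * norm ?b" using h0[of n] h1[of n] by (simp add: mult_left_le_one_le)
    finally show "enorm (E1 n z) <= enorm (?a - ?b) + ennreal (h n) * ennreal (norm ?b)"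
     using h0[of n] by (simp add: ennreal_leI flip: ennreal_mult ennreal_plus)
   qed (use p in simp)
   also have "\<dots> <= 4 * (?q n (R 1 0) (R 2 0) + mixed_norm p (%z. ennreal (h n) * enorm (R 2 0 z)))"
    by (rule mixed_norm_add[OF mm(1) _ p]) (use mm(2) in measurable)
   also have "mixed_norm p (%z. ennreal (h n) * enorm (R 2 0 z)) = ennreal (h n) * ?m (R 2 0)"
    using h0[of n] by (intro mixed_norm_cmult p mm) auto
   finally show ?thesis .
  qed
  let ?N = "%n. ?q n D (R 1 0) + (4 * (?q n (R 1 0) (R 2 0) + ennreal (h n) * ?m (R 2 0)) + ?q n (R 0 1) (R 1 1))"
  have Nl: "?N ---> 0 + (4 * (0 + 0) + 0)"
  proof (intro tendsto_add q0 q2 ennreal_tendsto_cmult q1)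
   have "(%n. ?m (R 2 0) * ennreal (h n)) ---> ?m (R 2 0) * ennreal 0"
    using R(2)[OF le(3)] by (intro ennreal_tendsto_cmult tendsto_ennrealI hl) auto
   then show "(%n. ennreal (h n) * ?m (R 2 0)) ---> 0" by (simp add: mult.commute)
  qed simp
  obtain C0 :: real where C0: "\<forall>u\<in>Wp1 1 p. (\<integral>\<^sup>+ y. enorm (\<Gamma>0 u y) \<partial>lebesgue_on {0<..<\<xi>}) <= ennreal C0 * Wp1_norm 1 p u"
   using \<Gamma>0 \<xi> unfolding side_trace_def by meson
  have "(%n. ennreal C0 * ?N n) ---> ennreal C0 * 0" using Nl by (intro ennreal_tendsto_cmult) auto
  then have "eventually (%n. ennreal C0 * ?N n < ennreal \<epsilon>) sequentially" using \<epsilon> by (intro order_tendstoD(2)) auto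
  moreover have "eventually (%n. ?N n < 1) sequentially" using Nl by (intro order_tendstoD(2)) auto
  ultimately have "eventually (%n. ennreal C0 * ?N n < ennreal \<epsilon> & ?N n < 1) sequentially" by eventually_elim simp
  then obtain n where n: "ennreal C0 * ?N n < ennreal \<epsilon>" "?N n < 1" unfolding eventually_sequentially by blast
  have Nsum: "?m (E0 n) + (?m (E1 n) + ?m (E2 n)) <= ?N n" unfolding n0 n2 by (intro add_mono n1 order_refl)
  then have "?m (E0 n) + (?m (E1 n) + ?m (E2 n)) < \<infinity>" by (rule le_less_trans[OF _ less_trans[OF n(2) ennreal_one_less_top, folded infinity_ennreal_def]])
  then have finr: "finite_norms p (E0 n) (E1 n) (E2 n)" by (simp add: finite_norms_def)
  note r1 = Wp1_1_sobolev[OF datar finr p]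
  have d1: "wD' 1 0 \<in> Wp1 1 p" by (rule Wp1_1_sobolev(1)[OF datad find p])
  have g1: "g n \<in> Wp1 1 p"
  proof -
   have "(%z. r n z + 1 *\<^sub>R wD' 1 0 z) \<in> Wp1 1 p" by (rule Wp1_1_axpy[OF r1(1) d1 p])
   then show ?thesis by (simp add: r_def)
  qed
  have shc: "continuous_on UNIV (shear c' d')" for c' d' unfolding shear_def by (intro continuous_intros)
  have gc: "continuous_on UNIV (g n)" unfolding g_def dilated_quotient_def by (intro continuous_intros continuous_on_compose2[OF W(1) shc]) auto
  have "AE y in lborel. y \<in> {0<..} --> \<Gamma>0 (g n) y = g n (0, y)"
   using \<Gamma>0 g1 continuous_on_subset[OF gc] unfolding side_trace_def AE_lebesgue_on[OF Jb] by blast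
  moreover have "AE y in lborel. y \<in> {0<..} --> \<Gamma>0 (wD 1 0 u) y = 0" "AE y in lborel. y \<in> {0<..} --> \<Gamma>0 (wD 1 0 v) y = 0"
   using u v by (auto simp: is_solution_def AE_lebesgue_on)
  moreover note trace_diff[OF lin(2) Jb g1 d1 p, folded r_def] trace_diff[OF lin(2) Jb u1(2) v1(2) p, folded wD'_def]
  ultimately have tr: "AE y in lborel. y \<in> {0<..} --> \<Gamma>0 (r n) y = g n (0, y)"
   unfolding r_def[abs_def, symmetric] wD'_def[abs_def, symmetric] by eventually_elim auto
  have gn: "norm (g n (0, y)) = norm (W (x n, y) - W (0, y)) / x n" for y
  proof -
   have "g n (0, y) = (1 / x n) *\<^sub>R (W (x n, y) - W (0, y))"
    unfolding g_def dilated_quotient_def shear_def hx by simp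
   then show ?thesis using x(1)[of n] by simp
  qed
  have xi_m: "(%y. enorm (g n (0, y)) * indicator {0<..<\<xi>} y) \<in> borel_measurable lborel"
  proof -
   have "(%y. norm (g n (0, y))) \<in> Borel" by (intro borel_measurable_continuous_onI continuous_on_norm continuous_line(2)[OF gc])
   then show ?thesis by measurable
  qed
  have "(NN y. enorm (W (x n, y) - W (0, y)) * indicator {0<..<\<xi>} y)
    = (NN y. ennreal (x n) * (enorm (g n (0, y)) * indicator {0<..<\<xi>} y))"
   using x(1)[of n] by (intro nn_integral_cong) (simp add: gn mult.assoc[symmetric] flip: ennreal_mult)
  also have "\<dots> = ennreal (x n) * (NN y. enorm (g n (0, y)) * indicator {0<..<\<xi>} y)" by (rule nn_integral_cmult[OF xi_m])
  also have "(NN y. enorm (g n (0, y)) * indicator {0<..<\<xi>} y) = (\<integral>\<^sup>+ y. enorm (\<Gamma>0 (r n) y) \<partial>lebesgue_on {0<..<\<xi>})"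
   unfolding nn_integral_lebesgue_on[OF borel_open[OF open_greaterThanLessThan]]
   by (rule nn_integral_cong_AE, use tr in eventually_elim) (auto simp: indicator_def)
  also have "\<dots> <= ennreal C0 * Wp1_norm 1 p (r n)" using C0 r1(1) by blast
  also have "\<dots> <= ennreal C0 * ?N n" unfolding r1(2) by (intro mult_left_mono Nsum) simp
  also have "\<dots> <= ennreal \<epsilon>" using n(1) by simp
  finally have "(NN y. enorm (W (x n, y) - W (0, y)) * indicator {0<..<\<xi>} y) <= ennreal (x n) * ennreal \<epsilon>" by (simp add: mult_left_mono)
  then show False using x(3)[of n] x(1)[of n] \<epsilon> by (simp add: mult.commute flip: ennreal_mult)
 qed
 show thesis by (rule that[OF W(1,2) Wuv ia[OF sW] harmonic bottom periodic quotient])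
qed

section \<open>Boundary layers of cutoff functions\<close>

lemma deriv_locally_constant:
 fixes f :: "real => real"
 assumes "open S" "x \<in> S" "!!y. y \<in> S ==> f y = c" shows "deriv f x = 0"
proof -
 have "(f has_real_derivative 0) (at x)" by (rule has_field_derivative_transform_within_open[of "%_. c" _ _ S]) (use assms in auto)
 then show ?thesis by (rule DERIV_imp_deriv)
qed

lemma step_deriv_support:
 assumes "\<not> (1 <= t & t <= 2)" shows "deriv step t = 0" "deriv (deriv step) t = 0"
proof -
 have o: "open ({..<1} \<union> {2<..} :: real set)" by (intro open_Un) auto
 have 1: "deriv step s = 0" if "s \<in> {..<1} \<union> {2<..}" for s
 proof (cases "s < 1")
  case True
  then show ?thesis by (intro deriv_locally_constant[of "{..<1}" s step 0]) (auto intro: step_0)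
 next
  case False
  then show ?thesis using that by (intro deriv_locally_constant[of "{2<..}" s step 1]) (auto intro: step_1)
 qed
 have t: "t \<in> {..<1} \<union> {2<..}" using assms by auto
 show "deriv step t = 0" by (rule 1[OF t])
 show "deriv (deriv step) t = 0" by (rule deriv_locally_constant[OF o t 1])
qed

lemmas step_deriv = smooth_deriv[OF smooth_step] and step_deriv2 = smooth_deriv[OF smooth_deriv(2)[OF smooth_step]]

lemma step_deriv2_reflect: "deriv (deriv step) (3 - t) = - deriv (deriv step) t"
proof -
 have eq: "(%t. step (3 - t)) = (%t. 1 - step t)" by (rule ext) (rule step_reflect)
 have 1: "deriv step (3 - t) = deriv step t" for t
 proof -
  have "((%t. step (3 - t)) has_real_derivative deriv step (3 - t) * (- 1)) (at t)" by (rule DERIV_chain2[OF step_deriv(1)]) (auto intro!: derivative_eq_intros)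
  moreover have "((%t. 1 - step t) has_real_derivative - deriv step t) (at t)" by (auto intro!: derivative_eq_intros step_deriv(1))
  ultimately show ?thesis using DERIV_unique[of "%t. step (3 - t)"] unfolding eq by fastforce
 qed
 have "((%t. deriv step (3 - t)) has_real_derivative deriv (deriv step) (3 - t) * (- 1)) (at t)"
  by (rule DERIV_chain2[OF step_deriv2(1)]) (auto intro!: derivative_eq_intros)
 then show ?thesis using DERIV_unique[OF _ step_deriv2(1)[of t]] unfolding 1 by fastforce
qed

text \<open>The commutator of \<open>d\<^sup>2/dx\<^sup>2\<close> with multiplication by the cutoff \<open>step (x / \<epsilon>)\<close>, applied to \<open>g\<close> with derivative \<open>g'\<close>. It lives
on \<open>[\<epsilon>, 2 \<epsilon>]\<close>.\<close>

definition layer :: "real => (real => real) => (real => real) => real => real" where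
 "layer \<epsilon> g g' x = deriv (deriv step) (x / \<epsilon>) / \<epsilon>\<^sup>2 * g x + 2 * (deriv step (x / \<epsilon>) / \<epsilon>) * g' x"

lemma cutoff_derivatives:
 assumes g: "!!x. (g has_real_derivative g' x) (at x)" "!!x. (g' has_real_derivative g'' x) (at x)" and \<epsilon>: "0 < \<epsilon>"
 shows "((%x. step (x / \<epsilon>) * g x) has_real_derivative deriv step (x / \<epsilon>) / \<epsilon> * g x + step (x / \<epsilon>) * g' x) (at x)"
  and "((%x. deriv step (x / \<epsilon>) / \<epsilon> * g x + step (x / \<epsilon>) * g' x) has_real_derivative step (x / \<epsilon>) * g'' x + layer \<epsilon> g g' x) (at x)"
proof -
 have i: "((%x. x / \<epsilon>) has_real_derivative 1 / \<epsilon>) (at x)" for x using \<epsilon> by (auto intro!: derivative_eq_intros)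
 note d = DERIV_chain2[OF step_deriv(1) i] DERIV_chain2[OF step_deriv2(1) i]
 show "((%x. step (x / \<epsilon>) * g x) has_real_derivative deriv step (x / \<epsilon>) / \<epsilon> * g x + step (x / \<epsilon>) * g' x) (at x)"
  using DERIV_mult[OF d(1)[of x] g(1)] by (simp add: algebra_simps)
 have "((%x. deriv step (x / \<epsilon>) / \<epsilon> * g x + step (x / \<epsilon>) * g' x) has_real_derivative
   (deriv (deriv step) (x / \<epsilon>) * (1 / \<epsilon>) / \<epsilon> * g x + g' x * (deriv step (x / \<epsilon>) / \<epsilon>)) + (deriv step (x / \<epsilon>) * (1 / \<epsilon>) * g' x + g'' x * step (x / \<epsilon>))) (at x)"
  by (intro DERIV_add DERIV_mult DERIV_cdivide d g)
 then show "((%x. deriv step (x / \<epsilon>) / \<epsilon> * g x + step (x / \<epsilon>) * g' x) has_real_derivative step (x / \<epsilon>) * g'' x + layer \<epsilon> g g' x) (at x)"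
  by (rule DERIV_cong) (simp add: layer_def power2_eq_square algebra_simps)
qed

lemma layer_outside: "0 < \<epsilon> ==> \<not> (\<epsilon> <= x & x <= 2 * \<epsilon>) ==> layer \<epsilon> g g' x = 0"
 using step_deriv_support[of "x / \<epsilon>"] by (auto simp: layer_def field_simps)

lemma layer_test:
 assumes "0 < \<epsilon>" "smooth g" "smooth g'"
 shows "smooth (layer \<epsilon> g g')" "supported_in 0 (3 * \<epsilon>) (layer \<epsilon> g g')"
proof -
 have "smooth (%x. deriv step (inverse \<epsilon> * x + 0))" "smooth (%x. deriv (deriv step) (inverse \<epsilon> * x + 0))"
  by (intro smooth_affine step_deriv(2) step_deriv2(2))+
 then have s: "smooth (%x. (1 / \<epsilon>\<^sup>2) * deriv (deriv step) (inverse \<epsilon> * x + 0) * g x + (2 / \<epsilon>) * deriv step (inverse \<epsilon> * x + 0) * g' x)"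
  by (intro smooth_add smooth_mult smooth_const assms)
 have e: "layer \<epsilon> g g' = (%x. (1 / \<epsilon>\<^sup>2) * deriv (deriv step) (inverse \<epsilon> * x + 0) * g x + (2 / \<epsilon>) * deriv step (inverse \<epsilon> * x + 0) * g' x)"
  by (rule ext) (simp add: layer_def divide_inverse mult.commute)
 show "smooth (layer \<epsilon> g g')" unfolding e by (rule s)
 show "supported_in 0 (3 * \<epsilon>) (layer \<epsilon> g g')"
  unfolding supported_in_def by (rule exI[of _ \<epsilon>], rule exI[of _ "2 * \<epsilon>"]) (use layer_outside[OF assms(1)] assms(1) in auto)
qed

text \<open>Second derivatives of the cutoff cost \<open>1 / \<epsilon>\<^sup>2\<close>; if \<open>g\<close> is of order \<open>\<epsilon>\<close> on the layer, one factor is regained, and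
integration over a layer of width \<open>\<epsilon>\<close> regains the other.\<close>

lemma layer_bounded:
 obtains S where "0 < S" "!!\<epsilon> g g' P x. 0 < \<epsilon> ==> 0 <= P ==>
  (\<epsilon> <= x ==> x <= 2 * \<epsilon> ==> \<bar>g x\<bar> <= 2 * P * \<epsilon> & \<bar>g' x\<bar> <= P) ==> \<bar>layer \<epsilon> g g' x\<bar> <= 4 * S * P / \<epsilon>"
  "!!t. \<bar>deriv (deriv step) t\<bar> <= S"
proof -
 have "supported_in 0 3 f" if "!!t. \<not> (1 <= t & t <= 2) ==> f t = 0" for f
  unfolding supported_in_def by (rule exI[of _ 1], rule exI[of _ 2]) (use that in auto)
 then have s: "supported_in 0 3 (deriv step)" "supported_in 0 3 (deriv (deriv step))"
  using step_deriv_support by blast+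
 obtain A B where A: "0 <= A" "!!t. \<bar>deriv step t\<bar> <= A" and B: "0 <= B" "!!t. \<bar>deriv (deriv step) t\<bar> <= B"
  by (rule supported_in_bounded[OF step_deriv(2) s(1)], rule supported_in_bounded[OF step_deriv2(2) s(2)]) blast
 define S where "S = max A B + 1"
 have S: "0 < S" "\<bar>deriv step t\<bar> <= S" "\<bar>deriv (deriv step) t\<bar> <= S" for t
  using A(1) A(2)[of t] B(2)[of t] by (auto simp: S_def)
 show thesis
 proof (rule that[OF S(1) _ S(3)])
  fix \<epsilon> P x :: real and g g' :: "real => real"
  assume \<epsilon>: "0 < \<epsilon>" and P: "0 <= P" and b: "\<epsilon> <= x ==> x <= 2 * \<epsilon> ==> \<bar>g x\<bar> <= 2 * P * \<epsilon> & \<bar>g' x\<bar> <= P"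
  show "\<bar>layer \<epsilon> g g' x\<bar> <= 4 * S * P / \<epsilon>"
  proof (cases "\<epsilon> <= x & x <= 2 * \<epsilon>")
   case True
   then have g: "\<bar>g x\<bar> <= 2 * P * \<epsilon>" "\<bar>g' x\<bar> <= P" using b by auto
   have "\<bar>layer \<epsilon> g g' x\<bar> <= \<bar>deriv (deriv step) (x / \<epsilon>)\<bar> / \<epsilon>\<^sup>2 * \<bar>g x\<bar> + 2 * (\<bar>deriv step (x / \<epsilon>)\<bar> / \<epsilon>) * \<bar>g' x\<bar>"
    unfolding layer_def using \<epsilon> by (intro order_trans[OF abs_triangle_ineq]) (simp add: abs_mult)
   also have "\<dots> <= S / \<epsilon>\<^sup>2 * (2 * P * \<epsilon>) + 2 * (S / \<epsilon>) * P"
    using S \<epsilon> g P by (intro add_mono mult_mono divide_right_mono order_refl) auto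
   also have "\<dots> = 4 * S * P / \<epsilon>" using \<epsilon> by (simp add: power2_eq_square field_simps)
   finally show ?thesis .
  qed (use layer_outside[OF \<epsilon>] S(1) P \<epsilon> in auto)
 qed
qed

text \<open>A null sequence of layer widths, with \<open>width j \<le> 1/2\<close> so that the layers at the two ends of \<open>(0, 2 \<pi>)\<close> are disjoint.\<close>

definition width :: "nat => real" where "width j = inverse (real j + 2)"

lemma width_pos: "0 < width j" and width_le: "width j <= 1 / 2" by (simp_all add: width_def field_simps)

lemma width_tendsto: "width ---> 0"
proof -
 have "(%j. inverse (real (Suc (Suc j)))) ---> 0" by (intro LIMSEQ_Suc LIMSEQ_inverse_real_of_nat)
 moreover have "(%j. inverse (real (Suc (Suc j)))) = width" by (simp add: width_def[abs_def] add.commute)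
 ultimately show ?thesis by simp
qed

lemma eventually_width: "0 < \<delta> ==> eventually (%j. width j < \<delta>) sequentially"
 using order_tendstoD(2)[OF width_tendsto] .

lemma tendsto_zero_if_eventually_small:
 fixes f :: "nat => 'a::real_normed_vector"
 assumes K: "0 <= K" and e: "!!e. 0 < e ==> eventually (%j. norm (f j) <= K * e) sequentially"
 shows "f ---> 0"
proof (rule tendstoI)
 fix r :: real assume r: "0 < r"
 have "K * (r / (K + 1)) < r" using K r by (simp add: field_simps)
 moreover have "0 < r / (K + 1)" using K r by simp
 ultimately show "eventually (%j. dist (f j) 0 < r) sequentially"
  using e[of "r / (K + 1)"] by (auto elim!: eventually_mono)
qed

lemma pairing_box_bound:
 assumes V: "L1 V" and \<phi>: "\<phi> \<in> Borel" and A: "!!z. \<bar>\<phi> z\<bar> <= A"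
  and m: "0 <= m" "!!z. z \<in> {c..c'} \<times> {e..e'} ==> norm (V z) <= m"
  and out: "!!z. z \<notin> {c..c'} \<times> {e..e'} ==> \<phi> z = 0 \<or> V z = 0" and le: "c <= c'" "e <= e'"
 shows "norm (pairing V \<phi>) <= A * m * ((c' - c) * (e' - e))"
proof -
 have A0: "0 <= A" using order_trans[OF abs_ge_zero A] .
 have B: "{c..c'} \<times> {e..e'} \<in> sets (borel :: plane measure)" by (intro borel_closed closed_Times) auto
 have "enorm (pairing V \<phi>) <= (NN z. ennreal \<bar>\<phi> z\<bar> * enorm (V z))" by (rule pairing_norm_le[OF V bounded_measurableI[OF \<phi> A]])
 also have "\<dots> <= (NN z. ennreal (A * m) * indicator ({c..c'} \<times> {e..e'}) z)"
 proof (intro nn_integral_mono)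
  fix z
  show "ennreal \<bar>\<phi> z\<bar> * enorm (V z) <= ennreal (A * m) * indicator ({c..c'} \<times> {e..e'}) z"
  proof (cases "z \<in> {c..c'} \<times> {e..e'}")
   case True
   have "\<bar>\<phi> z\<bar> * norm (V z) <= A * m" by (intro mult_mono A m(2) True A0) auto
   then show ?thesis using True by (simp add: ennreal_leI flip: ennreal_mult)
  next
   case False
   then show ?thesis using out[OF False] by auto
  qed
 qed
 also have "\<dots> = ennreal (A * m) * emeasure lborel ({c..c'} \<times> {e..e'})" by (rule nn_integral_cmult_indicator) (use B in simp)
 also have "emeasure lborel ({c..c'} \<times> {e..e'}) = ennreal ((c' - c) * (e' - e))"
  unfolding lborel_prod[symmetric] by (subst lborel.emeasure_pair_measure_Times) (use le in \<open>auto simp: ennreal_mult\<close>)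
 finally show ?thesis using A0 m(1) le by (simp flip: ennreal_mult)
qed

text \<open>Tonelli; only the \<open>y\<close>-integrals of \<open>V\<close> over vertical lines need to be small.\<close>

lemma pairing_slice_bound:
 assumes V: "L1 V" and a: "a \<in> Borel" "!!x. \<bar>a x\<bar> <= A" "!!x. \<not> (c <= x & x <= c') ==> a x = 0"
  and b: "b \<in> Borel" "!!y. \<bar>b y\<bar> <= B" and c: "c <= c'" and M: "0 <= M"
  "!!x. c <= x ==> x <= c' ==> (NN y. ennreal \<bar>b y\<bar> * enorm (V (x, y))) <= ennreal M"
 shows "norm (pairing V (tensor a b)) <= A * M * (c' - c)"
proof -
 have A0: "0 <= A" using order_trans[OF abs_ge_zero a(2)] .
 note [measurable] = a(1) b(1) measurable_tensor[OF a(1) b(1)] measurable_norm_abs_integrable[OF V]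
 have f: "(%z. ennreal \<bar>tensor a b z\<bar> * enorm (V z)) \<in> Borel" by measurable
 have f2: "(%z. ennreal \<bar>b (snd z)\<bar> * enorm (V z)) \<in> Borel"
  using measurable_compose[OF borel_measurable_continuous_onI[OF continuous_on_snd[OF continuous_on_id]] b(1)] by measurable
 have sec: "(%y. ennreal \<bar>b y\<bar> * enorm (V (x, y))) \<in> borel_measurable lborel" for x
  using measurable_compose[OF borel_measurable_continuous_onI[OF continuous_on_Pair[OF continuous_on_const continuous_on_id]] f2, of x] by simp
 have "enorm (pairing V (tensor a b)) <= (NN z. ennreal \<bar>tensor a b z\<bar> * enorm (V z))"
  by (rule pairing_norm_le[OF V bounded_measurable_tensor[OF a(1) b(1) a(2) b(2)]])
 also have "\<dots> = (NN x. NN y. ennreal \<bar>a x\<bar> * (ennreal \<bar>b y\<bar> * enorm (V (x, y))))"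
  unfolding nn_integral_plane(2)[OF f] by (simp add: tensor_def abs_mult ennreal_mult mult.assoc)
 also have "\<dots> = (NN x. ennreal \<bar>a x\<bar> * (NN y. ennreal \<bar>b y\<bar> * enorm (V (x, y))))"
  unfolding nn_integral_cmult[OF sec] ..
 also have "\<dots> <= (NN x. ennreal (A * M) * indicator {c..c'} x)"
 proof (intro nn_integral_mono)
  fix x
  show "ennreal \<bar>a x\<bar> * (NN y. ennreal \<bar>b y\<bar> * enorm (V (x, y))) <= ennreal (A * M) * indicator {c..c'} x"
  proof (cases "c <= x & x <= c'")
   case True
   then have "ennreal \<bar>a x\<bar> * (NN y. ennreal \<bar>b y\<bar> * enorm (V (x, y))) <= ennreal A * ennreal M"
    by (intro mult_mono ennreal_leI a(2) M(2)) auto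
   then show ?thesis using True A0 M(1) by (simp flip: ennreal_mult)
  qed (simp add: a(3))
 qed
 also have "\<dots> = ennreal (A * M * (c' - c))"
  using A0 M(1) c by (simp add: nn_integral_cmult_indicator flip: ennreal_mult)
 finally show ?thesis using A0 M(1) c by simp
qed

lemma pairing_reflect:
 assumes V: "L1 V" and b: "bounded_measurable (tensor a b)"
 shows "bounded_measurable (tensor (%x. a (c - x)) b)"
  "pairing V (tensor (%x. a (c - x)) b) = pairing (%z. V (shear (-1) c z)) (tensor a b)"
proof -
 have "bounded_measurable (%z. tensor a b (shear (-1) c z))" by (rule bounded_measurable_compose[OF b measurable_shear])
 then show b': "bounded_measurable (tensor (%x. a (c - x)) b)" by (simp add: tensor_def[abs_def] shear_def)
 show "pairing V (tensor (%x. a (c - x)) b) = pairing (%z. V (shear (-1) c z)) (tensor a b)"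
  using pairing_shear[OF V b', of "-1" c] by (simp add: tensor_def[abs_def] shear_def)
qed

lemma uniformly_small_near_axis:
 fixes F :: "plane => 'a::real_normed_vector"
 assumes F: "continuous_on UNIV F" and z: "!!y. 0 <= y ==> y <= d ==> F (0, y) = 0" and e: "0 < e"
 obtains \<delta> where "0 < \<delta>" "!!x y. 0 <= x ==> x < \<delta> ==> 0 <= y ==> y <= d ==> norm (F (x, y)) <= e"
proof -
 have "compact ({0..1} \<times> {0..d} :: plane set)" by (intro compact_Times compact_Icc)
 then have "uniformly_continuous_on ({0..1} \<times> {0..d}) F"
  using continuous_on_subset[OF F] by (intro compact_uniformly_continuous) auto
 then obtain \<delta> where \<delta>: "0 < \<delta>" "!!z z'. z \<in> {0..1} \<times> {0..d} ==> z' \<in> {0..1} \<times> {0..d} ==> dist z' z < \<delta> ==> dist (F z') (F z) < e"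
  using e unfolding uniformly_continuous_on_def by blast
 show thesis
 proof (rule that[of "min 1 \<delta>"])
  fix x y :: real assume *: "0 <= x" "x < min 1 \<delta>" "0 <= y" "y <= d"
  then have "dist (x, y) (0, y) < \<delta>" by (simp add: dist_Pair_Pair)
  then have "dist (F (x, y)) (F (0, y)) < e" using * by (intro \<delta>(2)) auto
  then show "norm (F (x, y)) <= e" using z[OF *(3,4)] by simp
 qed (use \<delta>(1) in simp)
qed

section \<open>Separation of variables\<close>

text \<open>The continuous difference of two solutions. The assumption \<open>normal\<close> is the integrated form of the Neumann
condition at \<open>x = 0\<close>.\<close>

locale zero_data_solution =
 fixes W :: "plane => 'a::banach" and C :: real
 assumes continuous: "continuous_on UNIV W" and bounded: "norm (W z) <= C" and integrable: "L1 (on_strip W)"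
  and harmonic: "smooth a ==> smooth b ==> supported_in 0 (2 * pi) a ==> supported_in 0 d b ==>
    pairing (on_strip W) (tensor (deriv (deriv a)) b) + pairing (on_strip W) (tensor a (deriv (deriv b))) = 0"
  and bottom: "0 <= x ==> x <= 2 * pi ==> W (x, 0) = 0"
  and periodic: "0 <= y ==> W (0, y) = W (2 * pi, y)"
  and normal: "0 < \<xi> ==> 0 < e ==> \<exists>\<delta>>0. \<forall>x. 0 < x & x < \<delta> -->
    (NN y. enorm (W (x, y) - W (0, y)) * indicator {0<..<\<xi>} y) <= ennreal (e * x)"
begin

abbreviation "w \<equiv> on_strip W"

text \<open>For \<open>\<sigma> = 1\<close> and \<open>\<sigma> = -1\<close> this is twice the part of \<open>w\<close> that is even, respectively odd, under \<open>x \<mapsto> 2 \<pi> - x\<close>.\<close>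

definition V :: "real => plane => 'a" where
 "V \<sigma> z = w z + \<sigma> *\<^sub>R w (shear (-1) (2 * pi) z)"

lemma w_reflected: "L1 (%z. w (shear (-1) (2 * pi) z))"
 by (rule strong_integral_shear(1)[OF _ integrable]) simp

lemma V_integrable: "L1 (V \<sigma>)"
 unfolding V_def[abs_def] by (intro abs_integrable_add abs_integrable_scaleR integrable w_reflected)

lemma V_eq: "V \<sigma> z = on_strip (%z. W z + \<sigma> *\<^sub>R W (shear (-1) (2 * pi) z)) z"
 by (cases z) (auto simp: V_def on_strip_def shear_def strip_def II_def indicator_def)

lemma pairing_V:
 assumes b: "bounded_measurable (tensor a b)"
 shows "pairing w (tensor a b) + \<sigma> *\<^sub>R pairing w (tensor (%x. a (2 * pi - x)) b) = pairing (V \<sigma>) (tensor a b)"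
 unfolding V_def[abs_def] pairing_add_left[OF integrable abs_integrable_scaleR[OF w_reflected] b]
  pairing_scaleR_left[OF w_reflected b] pairing_reflect(2)[OF integrable b] ..

lemma pairing_strip_cong: "(!!z. z \<in> strip ==> \<phi> z = \<psi> z) ==> pairing w \<phi> = pairing w \<psi>"
 by (rule pairing_cong_AE) (auto simp: on_strip_def indicator_def)

lemma pairing_zero_if_approximable:
 assumes \<phi>: "bounded_measurable \<phi>"
  and e: "!!e. 0 < e ==> \<exists>\<psi>. bounded_measurable \<psi> & pairing w \<psi> = 0 & (\<forall>z\<in>strip. \<bar>\<phi> z - \<psi> z\<bar> <= e)"
 shows "pairing w \<phi> = 0"
proof -
 obtain I where I: "(NN z. enorm (w z)) = ennreal I" "0 <= I"
  using integrable unfolding abs_integrable_def by (metis enn2real_nonneg ennreal_enn2real infinity_ennreal_def)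
 have le: "norm (pairing w \<phi>) <= I * e" if e0: "0 < e" for e
 proof -
  obtain \<psi> where \<psi>: "bounded_measurable \<psi>" "pairing w \<psi> = 0" "!!z. z \<in> strip ==> \<bar>\<phi> z - \<psi> z\<bar> <= e" using e[OF e0] by blast
  have "pairing w \<phi> = pairing w (%z. \<phi> z - \<psi> z)" using pairing_diff[OF integrable \<phi> \<psi>(1)] \<psi>(2) by simp
  then have "enorm (pairing w \<phi>) <= (NN z. ennreal \<bar>\<phi> z - \<psi> z\<bar> * enorm (w z))"
   using pairing_norm_le[OF integrable bounded_measurable_diff[OF \<phi> \<psi>(1)]] by simp
  also have "\<dots> <= (NN z. ennreal e * enorm (w z))"
   by (intro nn_integral_mono) (use \<psi>(3) in \<open>auto simp: on_strip_def indicator_def intro!: mult_right_mono ennreal_leI\<close>)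
  also have "\<dots> = ennreal e * ennreal I"
   using measurable_norm_abs_integrable[OF integrable] by (subst nn_integral_cmult) (simp_all add: I)
  finally show ?thesis using e0 I(2) by (simp add: mult.commute flip: ennreal_mult)
 qed
 have "(%j::nat. pairing w \<phi>) ---> 0" by (rule tendsto_zero_if_eventually_small[OF I(2)]) (use le in simp)
 then show ?thesis by (simp add: LIMSEQ_const_iff)
qed

text \<open>Insert the cutoff at both ends into the test function. By parity of \<open>\<psi>\<close> the two boundary layers combine into
one layer at \<open>x = 0\<close> paired with \<open>V \<sigma>\<close>.\<close>

lemma mode_equation:
 assumes \<psi>: "!!x. (\<psi> has_real_derivative \<psi>' x) (at x)" "!!x. (\<psi>' has_real_derivative - k * \<psi> x) (at x)"
  and s: "smooth \<psi>" "smooth \<psi>'" and b1: "!!x. \<bar>\<psi> x\<bar> <= 1" and r: "!!x. \<sigma> * \<psi> (2 * pi - x) = \<psi> x"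
  and b: "smooth b" "supported_in 0 d b"
  and lim: "(%j. pairing (V \<sigma>) (tensor (layer (width j) \<psi> \<psi>') b)) ---> 0"
 shows "pairing w (tensor \<psi> (%y. deriv (deriv b) y - k * b y)) = 0"
proof -
 (* A sum of two steps minus 1 agrees with their product, since at most one of them differs from 1. *)
 define a where "a j x = (step (x / width j) + step ((2 * pi - x) / width j) - 1) * \<psi> x" for j x
 let ?l = "%j. layer (width j) \<psi> \<psi>'"
 define \<beta> where "\<beta> y = deriv (deriv b) y - k * b y" for y
 have \<beta>: "smooth \<beta>" "supported_in 0 d \<beta>"
 proof -
  have e: "\<beta> = (%y. deriv (deriv b) y + (- k) * b y)" by (simp add: \<beta>_def fun_eq_iff)
  show "smooth \<beta>" unfolding e by (rule smooth_add[OF smooth_deriv(2)[OF smooth_deriv(2)[OF b(1)]] smooth_mult[OF smooth_const b(1)]])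
  show "supported_in 0 d \<beta>" unfolding e by (rule supported_in_add[OF supported_in_deriv[OF supported_in_deriv[OF b(2)]] supported_in_mult'[OF b(2)]])
 qed
 have as: "smooth (a j)" "supported_in 0 (2 * pi) (a j)" for j
 proof -
  have "smooth (%x. (step (inverse (width j) * x + 0) + step ((- inverse (width j)) * x + 2 * pi / width j) - 1) * \<psi> x)"
   by (rule smooth_mult[OF smooth_diff[OF smooth_add[OF smooth_affine[OF smooth_step] smooth_affine[OF smooth_step]] smooth_const] s(1)])
  moreover have "a j = (%x. (step (inverse (width j) * x + 0) + step ((- inverse (width j)) * x + 2 * pi / width j) - 1) * \<psi> x)"
   by (simp add: a_def[abs_def] divide_inverse algebra_simps)
  ultimately show "smooth (a j)" by simp
  have "a j x = 0" if "\<not> (width j <= x & x <= 2 * pi - width j)" for x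
  proof (cases "x < width j")
   case True
   then show ?thesis using width_pos[of j] width_le[of j] pi_gt3 by (simp add: a_def step_0 step_1 field_simps)
  next
   case False
   then show ?thesis using that width_pos[of j] width_le[of j] pi_gt3 by (simp add: a_def step_0 step_1 field_simps)
  qed
  then have "\<forall>x. a j x ~= 0 --> width j <= x & x <= 2 * pi - width j" by blast
  moreover have "0 < width j" "2 * pi - width j < 2 * pi" using width_pos[of j] by simp_all
  ultimately show "supported_in 0 (2 * pi) (a j)" unfolding supported_in_def by blast
 qed
 have a2: "deriv (deriv (a j)) x = - k * a j x + (?l j x + \<sigma> * ?l j (2 * pi - x))" for j x
 proof -
  let ?F = "%x. step (x / width j) * \<psi> x"
  let ?F1 = "%x. deriv step (x / width j) / width j * \<psi> x + step (x / width j) * \<psi>' x"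
  let ?F2 = "%x. step (x / width j) * (- k * \<psi> x) + ?l j x"
  have F: "(?F has_real_derivative ?F1 x) (at x)" "(?F1 has_real_derivative ?F2 x) (at x)" for x by (rule cutoff_derivatives[OF \<psi> width_pos])+
  have m: "((%x. 2 * pi - x) has_real_derivative - 1) (at x)" for x by (auto intro!: derivative_eq_intros)
  have eq: "a j = (%x. ?F x + \<sigma> * ?F (2 * pi - x) - \<psi> x)"
   using r by (simp add: a_def fun_eq_iff algebra_simps)
  have "(a j has_real_derivative ?F1 x + \<sigma> * (?F1 (2 * pi - x) * - 1) - \<psi>' x) (at x)" for x
   unfolding eq by (intro DERIV_diff DERIV_add DERIV_cmult F(1) \<psi>(1) DERIV_chain2[OF F(1) m])
  then have d1: "deriv (a j) = (%x. ?F1 x + \<sigma> * (?F1 (2 * pi - x) * - 1) - \<psi>' x)" by (intro ext DERIV_imp_deriv)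
  have "(deriv (a j) has_real_derivative ?F2 x + \<sigma> * (?F2 (2 * pi - x) * - 1 * - 1) - - k * \<psi> x) (at x)"
   unfolding d1 by (intro DERIV_diff DERIV_add DERIV_cmult DERIV_cmult_right F(2) \<psi>(2) DERIV_chain2[OF F(2) m])
  then have "deriv (deriv (a j)) x = ?F2 x + \<sigma> * (?F2 (2 * pi - x) * - 1 * - 1) - - k * \<psi> x" by (rule DERIV_imp_deriv)
  also have "\<dots> = - k * a j x + (?l j x + \<sigma> * ?l j (2 * pi - x))" unfolding eq by (simp add: algebra_simps)
  finally show ?thesis .
 qed
 have step: "pairing w (tensor (a j) \<beta>) = - pairing (V \<sigma>) (tensor (?l j) b)" for j
 proof -
  note bl = bounded_measurable_test[OF layer_test[OF width_pos s] b, of j]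
  note br = pairing_reflect(1)[OF integrable bl, of "2 * pi"]
  have ba: "bounded_measurable (tensor (a j) b)" "bounded_measurable (tensor (a j) (deriv (deriv b)))" by (rule bounded_measurable_test[OF as b],
     rule bounded_measurable_test[OF as smooth_deriv(2)[OF smooth_deriv(2)[OF b(1)]] supported_in_deriv[OF supported_in_deriv[OF b(2)]]])
  have "tensor (deriv (deriv (a j))) b = (%z. (- k) * tensor (a j) b z + (tensor (?l j) b z + \<sigma> * tensor (%x. ?l j (2 * pi - x)) b z))"
   by (simp add: tensor_def a2 fun_eq_iff algebra_simps)
  then have 1: "pairing w (tensor (deriv (deriv (a j))) b) = (- k) *\<^sub>R pairing w (tensor (a j) b) + pairing (V \<sigma>) (tensor (?l j) b)"
   by (simp only: pairing_add[OF integrable] pairing_cmult[OF integrable] pairing_V[OF bl, symmetric] ba bl br bounded_measurable_add bounded_measurable_cmult)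
  have "tensor (a j) \<beta> = (%z. tensor (a j) (deriv (deriv b)) z + (- k) * tensor (a j) b z)" by (simp add: tensor_def \<beta>_def fun_eq_iff algebra_simps)
  then have "pairing w (tensor (a j) \<beta>) = pairing w (tensor (a j) (deriv (deriv b))) + (- k) *\<^sub>R pairing w (tensor (a j) b)"
   by (simp only: pairing_add[OF integrable] pairing_cmult[OF integrable] ba bounded_measurable_cmult)
  moreover have "((- k) *\<^sub>R pairing w (tensor (a j) b) + pairing (V \<sigma>) (tensor (?l j) b)) + pairing w (tensor (a j) (deriv (deriv b))) = 0"
   using harmonic[OF as(1) b(1) as(2) b(2), of j] unfolding 1 .
  ultimately show ?thesis by (simp only: eq_neg_iff_add_eq_0) (simp only: ac_simps)
 qed
 obtain B where B: "0 <= B" "!!y. \<bar>\<beta> y\<bar> <= B" by (rule supported_in_bounded[OF \<beta>]) blast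
 have "(%j. pairing w (tensor (a j) \<beta>)) ---> pairing w (tensor \<psi> \<beta>)"
 proof (rule pairing_tendsto[OF integrable])
  show "tensor (a j) \<beta> \<in> Borel" "tensor \<psi> \<beta> \<in> Borel" for j by (intro measurable_tensor smooth_measurable as s \<beta>)+
  show "\<bar>tensor (a j) \<beta> z\<bar> <= B" for j z
  proof -
   have "\<bar>step (fst z / width j) + step ((2 * pi - fst z) / width j) - 1\<bar> <= 1"
    using step_nonneg step_le_1 by (smt (verit))
   then have "\<bar>tensor (a j) \<beta> z\<bar> <= (1 * 1) * B"
    unfolding tensor_def a_def abs_mult by (intro mult_mono B b1) auto
   then show ?thesis by simp
  qed
  show "\<bar>tensor \<psi> \<beta> z\<bar> <= B" for z
   using mult_mono[OF b1[of "fst z"] B(2)[of "snd z"]] by (simp add: tensor_def abs_mult)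
  show "AE z in lborel. w z ~= 0 --> (%j. tensor (a j) \<beta> z) ---> tensor \<psi> \<beta> z"
  proof (intro AE_I2 impI)
   fix z assume "w z ~= 0"
   then have z: "0 < fst z" "fst z < 2 * pi" by (auto simp: on_strip_def strip_def II_def indicator_def split: if_splits)
   show "(%j. tensor (a j) \<beta> z) ---> tensor \<psi> \<beta> z"
   proof (rule tendsto_eventually)
    have "eventually (%j. width j < min (fst z) (2 * pi - fst z) / 2) sequentially" by (rule eventually_width) (use z in simp)
    then show "eventually (%j. tensor (a j) \<beta> z = tensor \<psi> \<beta> z) sequentially"
     by eventually_elim (use width_pos in \<open>simp add: tensor_def a_def step_1 field_simps\<close>)
   qed
  qed
 qed
 moreover have "(%j. pairing w (tensor (a j) \<beta>)) ---> - 0" unfolding step by (rule tendsto_minus[OF lim])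
 ultimately have "pairing w (tensor \<psi> \<beta>) = - 0" by (rule LIMSEQ_unique)
 then show ?thesis by (simp add: \<beta>_def[abs_def])
qed

text \<open>The sine is of order \<open>\<epsilon>\<close> on the layer, so it suffices that \<open>V (-1)\<close> tends to \<open>0\<close> uniformly there. This is continuity and
\<open>W(0, y) = W(2 \<pi>, y)\<close>.\<close>

lemma sine_layers_vanish:
 assumes b: "smooth b" "supported_in 0 d b" and d: "0 < d"
 shows "(%j. pairing (V (-1)) (tensor (layer (width j) (%x. sin (n * x)) (%x. n * cos (n * x))) b)) ---> 0"
proof -
 obtain S where S: "0 < S" "!!\<epsilon> g g' P x. 0 < \<epsilon> ==> 0 <= P ==>
  (\<epsilon> <= x ==> x <= 2 * \<epsilon> ==> \<bar>g x\<bar> <= 2 * P * \<epsilon> & \<bar>g' x\<bar> <= P) ==> \<bar>layer \<epsilon> g g' x\<bar> <= 4 * S * P / \<epsilon>"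
  by (rule layer_bounded) blast
 obtain B where B: "0 <= B" "!!y. \<bar>b y\<bar> <= B" by (rule supported_in_bounded[OF b]) blast
 let ?l = "%j. layer (width j) (%x. sin (n * x)) (%x. n * cos (n * x))"
 have l: "\<bar>?l j x\<bar> <= 4 * S * \<bar>n\<bar> / width j" for j x
 proof (rule S(2)[OF width_pos])
  assume "width j <= x" "x <= 2 * width j"
  moreover have "0 < width j" by (rule width_pos)
  ultimately have "\<bar>n * x\<bar> <= \<bar>n\<bar> * (2 * width j)" unfolding abs_mult by (intro mult_left_mono) auto
  moreover have "\<bar>sin (n * x)\<bar> <= \<bar>n * x\<bar>" by (rule abs_sin_x_le_abs_x)
  moreover have "\<bar>n * cos (n * x)\<bar> <= \<bar>n\<bar>" by (simp add: abs_mult mult_left_le)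
  ultimately show "\<bar>sin (n * x)\<bar> <= 2 * \<bar>n\<bar> * width j & \<bar>n * cos (n * x)\<bar> <= \<bar>n\<bar>" by (simp add: algebra_simps)
 qed simp
 define F where "F z = W z + (-1) *\<^sub>R W (shear (-1) (2 * pi) z)" for z
 have shc: "continuous_on UNIV (shear (-1) (2 * pi))" unfolding shear_def by (intro continuous_intros)
 have Fc: "continuous_on UNIV F" unfolding F_def by (intro continuous_intros continuous continuous_on_compose2[OF continuous shc]) auto
 have F0: "F (0, y) = 0" if "0 <= y" for y using periodic[OF that] by (simp add: F_def shear_def)
 show ?thesis
 proof (rule tendsto_zero_if_eventually_small)
  show "0 <= 4 * S * \<bar>n\<bar> * B * d" using S(1) B(1) d by simp
  fix e :: real assume e: "0 < e"
  obtain \<delta> where \<delta>: "0 < \<delta>" "!!x y. 0 <= x ==> x < \<delta> ==> 0 <= y ==> y <= d ==> norm (F (x, y)) <= e"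
   by (rule uniformly_small_near_axis[OF Fc F0 e]) auto
  have "eventually (%j. width j < \<delta> / 2) sequentially" using \<delta>(1) by (intro eventually_width) simp
  then show "eventually (%j. norm (pairing (V (-1)) (tensor (?l j) b)) <= 4 * S * \<bar>n\<bar> * B * d * e) sequentially"
  proof eventually_elim
   case (elim j)
   have pos: "0 < width j" by (rule width_pos)
   have "norm (pairing (V (-1)) (tensor (?l j) b)) <= (4 * S * \<bar>n\<bar> / width j * B) * e * ((2 * width j - width j) * (d - 0))"
   proof (rule pairing_box_bound[OF V_integrable])
    show "tensor (?l j) b \<in> Borel"
    proof (intro measurable_tensor smooth_measurable layer_test width_pos b smooth_sin)
     show "smooth (%x. n * cos (n * x))" by (intro smooth_mult smooth_cos smooth_const)
    qed
    show "\<bar>tensor (?l j) b z\<bar> <= 4 * S * \<bar>n\<bar> / width j * B" for z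
     unfolding tensor_def abs_mult using S(1) pos by (intro mult_mono l B) auto
    show "norm (V (-1) z) <= e" if "z \<in> {width j..2 * width j} \<times> {0..d}" for z
    proof -
     have "norm (F (fst z, snd z)) <= e" using that elim pos by (intro \<delta>(2)) auto
     then show ?thesis using e unfolding V_eq F_def[symmetric] by (auto simp: on_strip_def indicator_def)
    qed
    show "tensor (?l j) b z = 0 \<or> V (-1) z = 0" if "z \<notin> {width j..2 * width j} \<times> {0..d}" for z
     using that layer_outside[OF pos, of "fst z"] supported_in_outside[OF b(2), of "snd z"] by (cases z) (auto simp: tensor_def)
   qed (use e pos d in auto)
   then show ?case using pos by (simp add: field_simps)
  qed
 qed
qed

text \<open>Write \<open>cos (n x) = (cos (n x) - 1) + 1\<close>. The first part is of order \<open>\<epsilon>\<^sup>2\<close> and its layer stays bounded. The layer of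
the constant \<open>1\<close> has size \<open>1 / \<epsilon>\<^sup>2\<close> but is odd under \<open>x \<mapsto> 3 \<epsilon> - x\<close>, so it sees only \<open>w(x, y) - w(3 \<epsilon> - x, y)\<close>,
and this is \<open>o(\<epsilon>)\<close> in \<open>L\<^sup>1(dy)\<close> by the Neumann condition. The symmetry of \<open>w\<close> is used to get rid of the side \<open>x = 2 \<pi>\<close>.\<close>

lemma cosine_layers_vanish:
 assumes b: "smooth b" "supported_in 0 d b" and d: "0 < d" and sym: "!!z. w (shear (-1) (2 * pi) z) = w z"
 shows "(%j. pairing (V 1) (tensor (layer (width j) (%x. cos (n * x)) (%x. - n * sin (n * x))) b)) ---> 0"
proof -
 obtain S where S: "0 < S" "!!\<epsilon> g g' P x. 0 < \<epsilon> ==> 0 <= P ==>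
  (\<epsilon> <= x ==> x <= 2 * \<epsilon> ==> \<bar>g x\<bar> <= 2 * P * \<epsilon> & \<bar>g' x\<bar> <= P) ==> \<bar>layer \<epsilon> g g' x\<bar> <= 4 * S * P / \<epsilon>"
  "!!t. \<bar>deriv (deriv step) t\<bar> <= S"
  by (rule layer_bounded) blast
 obtain B where B: "0 <= B" "!!y. \<bar>b y\<bar> <= B" by (rule supported_in_bounded[OF b]) blast
 have C: "0 <= C" using order_trans[OF norm_ge_zero bounded] .
 let ?c = "%j. layer (width j) (%x. cos (n * x) + (-1)) (%x. - n * sin (n * x))"
 let ?r = "%j. layer (width j) (%x. 1) (%x. 0)"
 have sm: "smooth (%x. cos (n * x) + (-1))" "smooth (%x. - n * sin (n * x))" by (intro smooth_add smooth_mult smooth_cos smooth_sin smooth_const)+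
 have bc: "bounded_measurable (tensor (?c j) b)" for j by (rule bounded_measurable_test[OF layer_test[OF width_pos sm] b])
 have br: "bounded_measurable (tensor (?r j) b)" for j by (rule bounded_measurable_test[OF layer_test[OF width_pos smooth_const smooth_const] b])
 have c: "\<bar>?c j x\<bar> <= 8 * S * n\<^sup>2" for j x
 proof -
  have "\<bar>?c j x\<bar> <= 4 * S * (2 * n\<^sup>2 * width j) / width j"
  proof (rule S(2)[OF width_pos])
   assume *: "width j <= x" "x <= 2 * width j"
   have pos: "0 < width j" by (rule width_pos)
   have nx: "\<bar>n * x\<bar> <= \<bar>n\<bar> * (2 * width j)" unfolding abs_mult using * pos by (intro mult_left_mono) auto
   have "\<bar>cos (n * x) + (-1)\<bar> = 2 * (sin (n * x / 2))\<^sup>2" using cos_double_sin[of "n * x / 2"] by simp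
   also have "\<dots> <= 2 * (n * x / 2)\<^sup>2"
    using abs_sin_x_le_abs_x[of "n * x / 2"] abs_le_square_iff[of "sin (n * x / 2)" "n * x / 2"] by simp
   also have "\<dots> <= 2 * (\<bar>n\<bar> * width j)\<^sup>2"
    using nx pos abs_le_square_iff[of "n * x / 2" "\<bar>n\<bar> * width j"] by (simp add: abs_mult)
   also have "\<dots> <= 2 * (2 * n\<^sup>2 * width j) * width j" using pos by (simp add: power2_eq_square algebra_simps)
   finally have 1: "\<bar>cos (n * x) + (-1)\<bar> <= 2 * (2 * n\<^sup>2 * width j) * width j" .
   have "\<bar>- n * sin (n * x)\<bar> <= \<bar>n\<bar> * (\<bar>n\<bar> * (2 * width j))"
    unfolding abs_mult abs_minus using order_trans[OF abs_sin_x_le_abs_x nx] by (intro mult_left_mono) auto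
   then have 2: "\<bar>- n * sin (n * x)\<bar> <= 2 * n\<^sup>2 * width j" by (simp add: power2_eq_square algebra_simps)
   show "\<bar>cos (n * x) + (-1)\<bar> <= 2 * (2 * n\<^sup>2 * width j) * width j & \<bar>- n * sin (n * x)\<bar> <= 2 * n\<^sup>2 * width j" using 1 2 by blast
  qed (use less_imp_le[OF width_pos[of j]] in simp)
  then show ?thesis using width_pos[of j] by simp
 qed
 have T1: "(%j. pairing w (tensor (?c j) b)) ---> 0"
 proof (rule tendsto_zero_if_eventually_small)
  show "0 <= 8 * S * n\<^sup>2 * B * C * d" using S(1) B(1) d C by simp
  fix e :: real assume "0 < e"
  then have "eventually (%j. width j < e) sequentially" by (rule eventually_width)
  then show "eventually (%j. norm (pairing w (tensor (?c j) b)) <= 8 * S * n\<^sup>2 * B * C * d * e) sequentially"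
  proof eventually_elim
   case (elim j)
   have pos: "0 < width j" by (rule width_pos)
   have "norm (pairing w (tensor (?c j) b)) <= (8 * S * n\<^sup>2 * B) * C * ((2 * width j - width j) * (d - 0))"
   proof (rule pairing_box_bound[OF integrable])
    show "tensor (?c j) b \<in> Borel" using bc[of j] by (simp add: bounded_measurable_def)
    show "\<bar>tensor (?c j) b z\<bar> <= 8 * S * n\<^sup>2 * B" for z
     unfolding tensor_def abs_mult using S(1) pos by (intro mult_mono c B) auto
    show "norm (w z) <= C" for z using bounded[of z] C by (auto simp: on_strip_def indicator_def)
    show "tensor (?c j) b z = 0 \<or> w z = 0" if "z \<notin> {width j..2 * width j} \<times> {0..d}" for z
     using that layer_outside[OF pos, of "fst z"] supported_in_outside[OF b(2), of "snd z"] by (cases z) (auto simp: tensor_def)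
   qed (use C pos d in auto)
   also have "\<dots> = 8 * S * n\<^sup>2 * B * C * d * width j" by simp
   also have "\<dots> <= 8 * S * n\<^sup>2 * B * C * d * e" using elim S(1) B(1) d C by (intro mult_left_mono) auto
   finally show ?case .
  qed
 qed
 have T2: "(%j. pairing w (tensor (?r j) b)) ---> 0"
 proof (rule tendsto_zero_if_eventually_small)
  show "0 <= 3 * S * B" using S(1) B(1) by simp
  fix e :: real assume e: "0 < e"
  obtain \<delta> where \<delta>: "0 < \<delta>" "!!x. 0 < x ==> x < \<delta> ==>
    (NN y. enorm (W (x, y) - W (0, y)) * indicator {0<..<d} y) <= ennreal (e * x)" using normal[OF d e] by blast
  have "eventually (%j. width j < min \<delta> 1 / 2) sequentially" using \<delta>(1) by (intro eventually_width) simp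
  then show "eventually (%j. norm (pairing w (tensor (?r j) b)) <= 3 * S * B * e) sequentially"
  proof eventually_elim
   case (elim j)
   let ?\<epsilon> = "width j" and ?w' = "%z. w (shear (-1) (3 * width j) z)"
   have pos: "0 < ?\<epsilon>" by (rule width_pos)
   have w': "L1 ?w'" by (rule strong_integral_shear(1)[OF _ integrable]) simp
   have "?r j (3 * ?\<epsilon> - x) = - ?r j x" for x
    using pos step_deriv2_reflect[of "x / ?\<epsilon>"] by (simp add: layer_def diff_divide_distrib)
   then have "tensor (%x. ?r j (3 * ?\<epsilon> - x)) b = (%z. (-1) * tensor (?r j) b z)" by (simp add: tensor_def fun_eq_iff)
   then have "(-1) *\<^sub>R pairing w (tensor (?r j) b) = pairing ?w' (tensor (?r j) b)"
    using pairing_reflect(2)[OF integrable br, of j "3 * ?\<epsilon>"] pairing_cmult[OF integrable br, of "-1" j] by simp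
   then have "pairing ?w' (tensor (?r j) b) = - pairing w (tensor (?r j) b)" by simp
   then have eq: "2 *\<^sub>R pairing w (tensor (?r j) b) = pairing (%z. w z - ?w' z) (tensor (?r j) b)"
    unfolding pairing_diff_left[OF integrable w' br] by (simp add: scaleR_2)
   have "norm (pairing (%z. w z - ?w' z) (tensor (?r j) b)) <= (S / ?\<epsilon>\<^sup>2) * (B * (3 * e * ?\<epsilon>)) * (2 * ?\<epsilon> - ?\<epsilon>)"
   proof (rule pairing_slice_bound[OF abs_integrable_diff[OF integrable w']])
    show "?r j \<in> Borel" by (intro smooth_measurable layer_test pos smooth_const)
    show "\<bar>?r j x\<bar> <= S / ?\<epsilon>\<^sup>2" for x using S(3)[of "x / ?\<epsilon>"] by (simp add: layer_def divide_right_mono)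
    show "?r j x = 0" if "\<not> (?\<epsilon> <= x & x <= 2 * ?\<epsilon>)" for x using layer_outside[OF pos that] .
    show "b \<in> Borel" by (rule smooth_measurable[OF b(1)])
    fix x assume x: "?\<epsilon> <= x" "x <= 2 * ?\<epsilon>"
    let ?D = "%x y. enorm (W (x, y) - W (0, y)) * indicator {0<..<d} y"
    have Dm: "?D x \<in> borel_measurable lborel" for x
     using borel_measurable_continuous_onI[OF continuous_on_norm[OF continuous_on_diff[OF continuous_line(2)[OF continuous, of x] continuous_line(2)[OF continuous, of 0]]]]
     by measurable
    have xs: "0 < x" "x < 2 * pi" "0 < 3 * ?\<epsilon> - x" "3 * ?\<epsilon> - x < 2 * pi" using x pos elim pi_gt3 by auto
    have "(NN y. ennreal \<bar>b y\<bar> * enorm (w (x, y) - ?w' (x, y)))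
      <= (NN y. ennreal B * (?D x y + ?D (3 * ?\<epsilon> - x) y))"
    proof (intro nn_integral_mono)
     fix y
     show "ennreal \<bar>b y\<bar> * enorm (w (x, y) - ?w' (x, y)) <= ennreal B * (?D x y + ?D (3 * ?\<epsilon> - x) y)"
     proof (cases "0 < y & y < d")
      case True
      then have "w (x, y) - ?w' (x, y) = (W (x, y) - W (0, y)) - (W (3 * ?\<epsilon> - x, y) - W (0, y))"
       using xs by (simp add: on_strip_def shear_def strip_def II_def)
      then have "norm (w (x, y) - ?w' (x, y)) <= norm (W (x, y) - W (0, y)) + norm (W (3 * ?\<epsilon> - x, y) - W (0, y))" by (simp only: norm_triangle_ineq4)
      then have "\<bar>b y\<bar> * norm (w (x, y) - ?w' (x, y)) <= B * (norm (W (x, y) - W (0, y)) + norm (W (3 * ?\<epsilon> - x, y) - W (0, y)))"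
       by (intro mult_mono B) auto
      then show ?thesis using True B(1) by (simp add: ennreal_leI flip: ennreal_mult ennreal_plus)
     next
      case False
      then show ?thesis using supported_in_outside[OF b(2), of y] by (simp add: not_less)
     qed
    qed
    also have "\<dots> = ennreal B * ((NN y. ?D x y) + (NN y. ?D (3 * ?\<epsilon> - x) y))"
     by (subst nn_integral_cmult[OF borel_measurable_add[OF Dm Dm]], subst nn_integral_add[OF Dm Dm]) simp
    also have "\<dots> <= ennreal B * (ennreal (e * x) + ennreal (e * (3 * ?\<epsilon> - x)))"
     using x xs elim by (intro mult_left_mono add_mono \<delta>(2)) auto
    also have "\<dots> = ennreal (B * (3 * e * ?\<epsilon>))"
     using xs(1,3) e B(1) by (simp add: algebra_simps flip: ennreal_mult ennreal_plus)
    finally show "(NN y. ennreal \<bar>b y\<bar> * enorm (w (x, y) - ?w' (x, y))) <= ennreal (B * (3 * e * ?\<epsilon>))" .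
   qed (use B pos e in auto)
   also have "\<dots> = 3 * S * B * e" using pos by (simp add: power2_eq_square)
   finally have "2 * norm (pairing w (tensor (?r j) b)) <= 3 * S * B * e" unfolding eq[symmetric] by simp
   then show ?case using norm_ge_zero[of "pairing w (tensor (?r j) b)"] by linarith
  qed
 qed
 have "pairing (V 1) (tensor (layer (width j) (%x. cos (n * x)) (%x. - n * sin (n * x))) b)
   = 2 *\<^sub>R (pairing w (tensor (?c j) b) + pairing w (tensor (?r j) b))" for j
 proof -
  have "layer (width j) (%x. cos (n * x)) (%x. - n * sin (n * x)) x = ?c j x + ?r j x" for x
   unfolding layer_def by (simp add: right_diff_distrib diff_divide_distrib)
  then have "tensor (layer (width j) (%x. cos (n * x)) (%x. - n * sin (n * x))) b = (%z. tensor (?c j) b z + tensor (?r j) b z)"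
   by (simp add: tensor_def fun_eq_iff distrib_right)
  moreover have "V 1 = (%z. 2 *\<^sub>R w z)" by (simp add: V_def[abs_def] sym scaleR_2)
  ultimately show ?thesis by (simp only: pairing_scaleR_left[OF integrable bounded_measurable_add[OF bc br]] pairing_add[OF integrable bc br])
 qed
 moreover have "(%j. 2 *\<^sub>R (pairing w (tensor (?c j) b) + pairing w (tensor (?r j) b))) ---> 2 *\<^sub>R (0 + 0)"
  by (intro tendsto_scaleR tendsto_const tendsto_add T1 T2)
 ultimately show ?thesis by simp
qed

end

context zero_data_solution
begin

text \<open>With \<open>\<eta>(y) = exp (- \<nu> y) - exp (- m y)\<close> one has \<open>\<eta>'' - \<nu>\<^sup>2 \<eta> = (\<nu>\<^sup>2 - m\<^sup>2) exp (- m y)\<close>. Since \<open>\<eta>\<close> is bounded and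
vanishes at \<open>0\<close>, it becomes admissible after cutting off near \<open>0\<close>, where \<open>w\<close> is small because \<open>W(x, 0) = 0\<close>, and near infinity,
where the layer has size \<open>\<epsilon>\<close> and \<open>w\<close> is integrable.\<close>

lemma exponential_mode:
 assumes \<psi>: "\<psi> \<in> Borel" "!!x. \<bar>\<psi> x\<bar> <= 1" and \<nu>: "0 <= \<nu>" "\<nu> < m"
  and eqn: "!!b d. smooth b ==> supported_in 0 d b ==> 0 < d ==> pairing w (tensor \<psi> (%y. deriv (deriv b) y - \<nu>\<^sup>2 * b y)) = 0"
 shows "pairing w (tensor \<psi> (%y. exp (- m * \<bar>y\<bar>))) = 0"
proof -
 obtain S where S: "0 < S" "!!\<epsilon> g g' P x. 0 < \<epsilon> ==> 0 <= P ==>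
  (\<epsilon> <= x ==> x <= 2 * \<epsilon> ==> \<bar>g x\<bar> <= 2 * P * \<epsilon> & \<bar>g' x\<bar> <= P) ==> \<bar>layer \<epsilon> g g' x\<bar> <= 4 * S * P / \<epsilon>"
  by (rule layer_bounded) blast
 define \<eta> where "\<eta> y = exp (- \<nu> * y) + (-1) * exp (- m * y)" for y
 define \<eta>' where "\<eta>' y = - \<nu> * exp (- \<nu> * y) + m * exp (- m * y)" for y
 define \<eta>'' where "\<eta>'' y = \<nu>\<^sup>2 * exp (- \<nu> * y) - m\<^sup>2 * exp (- m * y)" for y
 have D: "(\<eta> has_real_derivative \<eta>' y) (at y)" "(\<eta>' has_real_derivative \<eta>'' y) (at y)" for y
  unfolding \<eta>_def[abs_def] \<eta>'_def[abs_def] \<eta>''_def by (auto intro!: derivative_eq_intros simp: power2_eq_square)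
 have sm: "smooth \<eta>" "smooth \<eta>'" unfolding \<eta>_def[abs_def] \<eta>'_def[abs_def] by (intro smooth_add smooth_mult smooth_exp smooth_const)+
 have size: "\<bar>\<eta> y\<bar> <= m * y" "\<bar>\<eta>' y\<bar> <= 2 * m" if y: "0 <= y" for y
 proof -
  have e: "exp (- \<nu> * y) <= 1" "exp (- m * y) <= 1" "exp (- m * y) <= exp (- \<nu> * y)"
   using \<nu> y by (auto intro: mult_right_mono)
  have "1 + (- m * y) <= exp (- m * y)" by (rule exp_ge_add_one_self)
  then show "\<bar>\<eta> y\<bar> <= m * y" using e unfolding \<eta>_def by linarith
  have "\<nu> * exp (- \<nu> * y) <= m * 1" "m * exp (- m * y) <= m * 1" using \<nu> e by (intro mult_mono; simp)+
  moreover have "0 <= \<nu> * exp (- \<nu> * y)" "0 <= m * exp (- m * y)" using \<nu> by auto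
  ultimately show "\<bar>\<eta>' y\<bar> <= 2 * m" unfolding \<eta>'_def by linarith
 qed
 have layer_le: "\<bar>layer \<epsilon> \<eta> \<eta>' y\<bar> <= 4 * S * (2 * m) / \<epsilon>" if \<epsilon>: "0 < \<epsilon>" for \<epsilon> y
 proof (rule S(2)[OF \<epsilon>])
  assume y: "\<epsilon> <= y" "y <= 2 * \<epsilon>"
  then have "m * y <= m * (2 * \<epsilon>)" using \<nu> by (intro mult_left_mono) auto
  moreover have "0 <= m * \<epsilon>" using \<nu> \<epsilon> by simp
  moreover have "2 * (2 * m) * \<epsilon> = 4 * (m * \<epsilon>)" "m * (2 * \<epsilon>) = 2 * (m * \<epsilon>)" by simp_all
  ultimately show "\<bar>\<eta> y\<bar> <= 2 * (2 * m) * \<epsilon> & \<bar>\<eta>' y\<bar> <= 2 * m" using size[of y] y \<epsilon> by linarith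
 qed (use \<nu> in simp)
 let ?L = "%j. layer (width j) \<eta> \<eta>'" and ?U = "%j. layer (1 / width j) \<eta> \<eta>'"
 have ip: "0 < 1 / width j" for j using width_pos[of j] by simp
 (* A difference of two steps rather than a product: the two layers then separate. *)
 define \<theta> where "\<theta> j y = step (y / width j) - step (y / (1 / width j))" for j y
 define e where "e y = exp (- m * \<bar>y\<bar>)" for y
 have w2: "width j * width j <= 1 / 4" for j
  using mult_mono[OF width_le[of j] width_le[of j]] width_pos[of j] by simp
 have \<theta>0: "\<theta> j y = 0" if "\<not> (width j <= y & y <= 2 / width j)" for j y
 proof (cases "y < width j")
  case True
  have "y * width j <= width j * width j" using True width_pos[of j] by (intro mult_right_mono) auto
  then have "y * width j <= 1" using w2[of j] by linarith
  then show ?thesis using True width_pos[of j] by (simp add: \<theta>_def step_0)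
 next
  case False
  then have y: "2 / width j < y" using that by simp
  have "2 * width j <= 2 / width j" using w2[of j] width_pos[of j] by (simp add: field_simps)
  then have "2 * width j <= y" using y by linarith
  then have "2 <= y / width j" "2 <= y * width j" using y width_pos[of j] by (simp_all add: field_simps)
  then show ?thesis by (simp add: \<theta>_def step_1)
 qed
 have bs: "smooth (%y. \<theta> j y * \<eta> y)" for j
 proof -
  have "smooth (%y. (step (inverse (width j) * y + 0) - step (width j * y + 0)) * \<eta> y)"
   by (rule smooth_mult[OF smooth_diff[OF smooth_affine[OF smooth_step] smooth_affine[OF smooth_step]] sm(1)])
  then show ?thesis by (simp add: \<theta>_def divide_inverse mult.commute)
 qed
 have bsup: "supported_in 0 (3 / width j) (%y. \<theta> j y * \<eta> y)" for j
 proof -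
  have "\<forall>y. \<theta> j y * \<eta> y ~= 0 --> width j <= y & y <= 2 / width j" using \<theta>0[of j] by auto
  moreover have "0 < width j" "2 / width j < 3 / width j" using width_pos[of j] by (auto intro: divide_strict_right_mono)
  ultimately show ?thesis unfolding supported_in_def by blast
 qed
 have b2: "deriv (deriv (%y. \<theta> j y * \<eta> y)) y = \<theta> j y * \<eta>'' y + ?L j y - ?U j y" for j y
 proof -
  let ?G = "%\<epsilon> y. deriv step (y / \<epsilon>) / \<epsilon> * \<eta> y + step (y / \<epsilon>) * \<eta>' y"
  have eq: "(%y. \<theta> j y * \<eta> y) = (%y. step (y / width j) * \<eta> y - step (y / (1 / width j)) * \<eta> y)"
   by (simp add: \<theta>_def fun_eq_iff algebra_simps)
  have d1: "deriv (%y. \<theta> j y * \<eta> y) = (%y. ?G (width j) y - ?G (1 / width j) y)"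
   unfolding eq by (intro ext DERIV_imp_deriv DERIV_diff cutoff_derivatives(1)[OF D] width_pos ip)
  have "deriv (deriv (%y. \<theta> j y * \<eta> y)) y = (step (y / width j) * \<eta>'' y + ?L j y) - (step (y / (1 / width j)) * \<eta>'' y + ?U j y)"
   unfolding d1 by (intro DERIV_imp_deriv DERIV_diff cutoff_derivatives(2)[OF D] width_pos ip)
  then show ?thesis by (simp add: \<theta>_def left_diff_distrib)
 qed
 have \<theta>1: "\<bar>\<theta> j y\<bar> <= 1" for j y
  using step_nonneg step_le_1 unfolding \<theta>_def by (smt (verit))
 have e1: "0 <= e y" "e y <= 1" for y using \<nu> by (auto simp: e_def)
 have \<theta>m: "(%y. \<theta> j y * e y) \<in> Borel" for j
  unfolding \<theta>_def e_def using smooth_measurable[OF smooth_step] by measurable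
 have em: "e \<in> Borel" unfolding e_def[abs_def] by measurable
 have \<theta>e1: "\<bar>\<theta> j y * e y\<bar> <= 1" for j y
  using mult_mono[OF \<theta>1[of j y] e1(2)[of y]] e1(1)[of y] by (simp add: abs_mult)
 have Lm: "?L j \<in> Borel" "?U j \<in> Borel" for j by (intro smooth_measurable layer_test width_pos ip sm)+
 have bm: "bounded_measurable (tensor \<psi> (%y. \<theta> j y * e y))" "bounded_measurable (tensor \<psi> (?L j))" "bounded_measurable (tensor \<psi> (?U j))" for j
  by (rule bounded_measurable_tensor[OF \<psi>(1) \<theta>m \<psi>(2) \<theta>e1] bounded_measurable_tensor[OF \<psi>(1) Lm(1) \<psi>(2) layer_le[OF width_pos]]
    bounded_measurable_tensor[OF \<psi>(1) Lm(2) \<psi>(2) layer_le[OF ip]])+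
 have eq: "(\<nu>\<^sup>2 - m\<^sup>2) *\<^sub>R pairing w (tensor \<psi> (%y. \<theta> j y * e y)) = pairing w (tensor \<psi> (?U j)) - pairing w (tensor \<psi> (?L j))" for j
 proof -
  have "\<theta> j y * \<eta>'' y - \<nu>\<^sup>2 * (\<theta> j y * \<eta> y) = (\<nu>\<^sup>2 - m\<^sup>2) * (\<theta> j y * e y)" for y
  proof (cases "0 <= y")
   case True
   then show ?thesis by (simp add: \<eta>_def \<eta>''_def e_def algebra_simps)
  next
   case False
   then have "\<theta> j y = 0" using \<theta>0[of j y] width_pos[of j] by auto
   then show ?thesis by simp
  qed
  then have "deriv (deriv (%y. \<theta> j y * \<eta> y)) y - \<nu>\<^sup>2 * (\<theta> j y * \<eta> y) = (\<nu>\<^sup>2 - m\<^sup>2) * (\<theta> j y * e y) + (?L j y - ?U j y)" for y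
   unfolding b2 by (simp add: algebra_simps)
  then have "tensor \<psi> (%y. deriv (deriv (%y. \<theta> j y * \<eta> y)) y - \<nu>\<^sup>2 * (\<theta> j y * \<eta> y))
    = (%z. (\<nu>\<^sup>2 - m\<^sup>2) * tensor \<psi> (%y. \<theta> j y * e y) z + (tensor \<psi> (?L j) z - tensor \<psi> (?U j) z))"
   by (simp only: tensor_def fun_eq_iff distrib_left right_diff_distrib mult.left_commute) simp
  then have "(\<nu>\<^sup>2 - m\<^sup>2) *\<^sub>R pairing w (tensor \<psi> (%y. \<theta> j y * e y)) + (pairing w (tensor \<psi> (?L j)) - pairing w (tensor \<psi> (?U j))) = 0"
   using eqn[OF bs bsup, of j] width_pos[of j]
   by (simp add: pairing_add[OF integrable] pairing_diff[OF integrable] pairing_cmult[OF integrable] bm bounded_measurable_cmult bounded_measurable_diff)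
  then show ?thesis by (simp only: eq_neg_iff_add_eq_0[symmetric] minus_diff_eq)
 qed
 have U: "(%j. pairing w (tensor \<psi> (?U j))) ---> pairing w (tensor \<psi> (%y. 0))"
 proof (rule pairing_tendsto[OF integrable])
  have U1: "\<bar>tensor \<psi> (?U j) z\<bar> <= 8 * S * m * width j" for j z
   using mult_mono[OF \<psi>(2)[of "fst z"] layer_le[OF ip, of j "snd z"]] by (simp add: tensor_def abs_mult)
  show "\<bar>tensor \<psi> (?U j) z\<bar> <= 8 * S * m" for j z
  proof -
   have "8 * S * m * width j <= 8 * S * m * 1" using width_le[of j] S(1) \<nu> by (intro mult_left_mono) auto
   then show ?thesis using U1[of j z] by simp
  qed
  show "AE z in lborel. w z ~= 0 --> (%j. tensor \<psi> (?U j) z) ---> tensor \<psi> (%y. 0) z"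
  proof (intro AE_I2 impI)
   fix z
   have "(%j. 8 * S * m * width j) ---> 8 * S * m * 0" by (rule tendsto_mult[OF tendsto_const width_tendsto])
   then have "(%j. 8 * S * m * width j) ---> 0" by simp
   then have "(%j. tensor \<psi> (?U j) z) ---> 0" by (rule Lim_null_comparison[rotated]) (use U1 in simp)
   then show "(%j. tensor \<psi> (?U j) z) ---> tensor \<psi> (%y. 0) z" by (simp add: tensor_def)
  qed
  show "tensor \<psi> (?U j) \<in> Borel" "tensor \<psi> (%y. 0) \<in> Borel" for j
   by (rule measurable_tensor[OF \<psi>(1) Lm(2)], rule measurable_tensor[OF \<psi>(1)]) simp
  show "\<bar>tensor \<psi> (%y. 0) z\<bar> <= 8 * S * m" for z using S(1) \<nu> by (simp add: tensor_def)
 qed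
 have L: "(%j. pairing w (tensor \<psi> (?L j))) ---> 0"
 proof (rule tendsto_zero_if_eventually_small)
  show "0 <= 16 * pi * S * m" using S(1) \<nu> by simp
  fix r :: real assume r: "0 < r"
  have swap: "continuous_on UNIV (%z :: plane. (snd z, fst z))" by (intro continuous_intros)
  have "continuous_on UNIV (%z. W (snd z, fst z))" by (rule continuous_on_compose2[OF continuous swap]) simp
  then obtain \<delta> where \<delta>: "0 < \<delta>" "!!y x. 0 <= y ==> y < \<delta> ==> 0 <= x ==> x <= 2 * pi ==> norm (W (x, y)) <= r"
   by (rule uniformly_small_near_axis[where d = "2 * pi" and e = r]) (use r bottom in auto)
  have "eventually (%j. width j < \<delta> / 2) sequentially" using \<delta>(1) by (intro eventually_width) simp
  then show "eventually (%j. norm (pairing w (tensor \<psi> (?L j))) <= 16 * pi * S * m * r) sequentially"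
  proof eventually_elim
   case (elim j)
   have pos: "0 < width j" by (rule width_pos)
   have "norm (pairing w (tensor \<psi> (?L j))) <= (4 * S * (2 * m) / width j) * r * ((2 * pi - 0) * (2 * width j - width j))"
   proof (rule pairing_box_bound[OF integrable])
    show "tensor \<psi> (?L j) \<in> Borel" by (intro measurable_tensor \<psi> Lm)
    show "\<bar>tensor \<psi> (?L j) z\<bar> <= 4 * S * (2 * m) / width j" for z
     using mult_mono[OF \<psi>(2)[of "fst z"] layer_le[OF pos, of "snd z"]] by (simp add: tensor_def abs_mult)
    show "norm (w z) <= r" if "z \<in> {0..2 * pi} \<times> {width j..2 * width j}" for z
    proof -
     have "norm (W (fst z, snd z)) <= r" using that elim pos by (intro \<delta>(2)) auto
     then show ?thesis using r by (auto simp: on_strip_def indicator_def)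
    qed
    show "tensor \<psi> (?L j) z = 0 \<or> w z = 0" if "z \<notin> {0..2 * pi} \<times> {width j..2 * width j}" for z
     using that layer_outside[OF pos, of "snd z"] by (cases z) (auto simp: tensor_def on_strip_def strip_def II_def indicator_def)
   qed (use r pos in auto)
   then show ?case using pos by (simp add: field_simps)
  qed
 qed
 have "(%j. pairing w (tensor \<psi> (%y. \<theta> j y * e y))) ---> pairing w (tensor \<psi> e)"
 proof (rule pairing_tendsto[OF integrable])
  show "\<bar>tensor \<psi> (%y. \<theta> j y * e y) z\<bar> <= 1" for j z
   using mult_mono[OF \<psi>(2)[of "fst z"] \<theta>e1[of j "snd z"]] by (simp add: tensor_def abs_mult)
  show "\<bar>tensor \<psi> e z\<bar> <= 1" for z
   using mult_mono[OF \<psi>(2)[of "fst z"] e1(2)[of "snd z"]] e1(1)[of "snd z"] by (simp add: tensor_def abs_mult)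
  show "AE z in lborel. w z ~= 0 --> (%j. tensor \<psi> (%y. \<theta> j y * e y) z) ---> tensor \<psi> e z"
  proof (intro AE_I2 impI)
   fix z assume "w z ~= 0"
   then have y: "0 < snd z" by (auto simp: on_strip_def strip_def indicator_def split: if_splits)
   show "(%j. tensor \<psi> (%y. \<theta> j y * e y) z) ---> tensor \<psi> e z"
   proof (rule tendsto_eventually)
    have "eventually (%j. width j < min (snd z / 2) (1 / snd z)) sequentially" by (rule eventually_width) (use y in simp)
    then show "eventually (%j. tensor \<psi> (%y. \<theta> j y * e y) z = tensor \<psi> e z) sequentially"
    proof eventually_elim
     case (elim j)
     then have "2 <= snd z / width j" "snd z / (1 / width j) <= 1" using y width_pos[of j] by (simp_all add: field_simps)
     then show ?case by (simp add: tensor_def \<theta>_def step_1 step_0)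
    qed
   qed
  qed
 qed (intro measurable_tensor \<psi>(1) \<theta>m em)+
 then have "(%j. (\<nu>\<^sup>2 - m\<^sup>2) *\<^sub>R pairing w (tensor \<psi> (%y. \<theta> j y * e y))) ---> (\<nu>\<^sup>2 - m\<^sup>2) *\<^sub>R pairing w (tensor \<psi> e)"
  by (intro tendsto_scaleR tendsto_const)
 moreover have "(%j. (\<nu>\<^sup>2 - m\<^sup>2) *\<^sub>R pairing w (tensor \<psi> (%y. \<theta> j y * e y))) ---> pairing w (tensor \<psi> (%y. 0)) - 0"
  unfolding eq by (rule tendsto_diff[OF U L])
 moreover have "pairing w (tensor \<psi> (%y. 0)) = 0"
  using pairing_cmult[OF integrable bounded_measurable_const, of 0 0] by (simp add: tensor_def[abs_def])
 ultimately have "(\<nu>\<^sup>2 - m\<^sup>2) *\<^sub>R pairing w (tensor \<psi> e) = 0" using LIMSEQ_unique by fastforce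
 moreover have "\<nu>\<^sup>2 < m\<^sup>2" using \<nu> by (intro power_strict_mono) auto
 ultimately show ?thesis by (simp add: e_def[abs_def])
qed

text \<open>In the variable \<open>t = exp (- y)\<close> the exponentials with \<open>m \<ge> N\<close> are \<open>t\<^sup>N\<close> times polynomials. They approximate \<open>b\<close>
uniformly, as \<open>b\<close> vanishes for large \<open>y\<close>, that is, near \<open>t = 0\<close>.\<close>

lemma product_mode:
 assumes \<psi>: "\<psi> \<in> Borel" "!!x. \<bar>\<psi> x\<bar> <= 1"
  and exps: "!!m::nat. N <= m ==> pairing w (tensor \<psi> (%y. exp (- real m * \<bar>y\<bar>))) = 0"
  and b: "smooth b" "supported_in 0 d b" and d: "0 < d"
 shows "pairing w (tensor \<psi> b) = 0"
proof (rule pairing_zero_if_approximable)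
 obtain B where B: "!!y. \<bar>b y\<bar> <= B" by (rule supported_in_bounded[OF b]) blast
 show "bounded_measurable (tensor \<psi> b)" by (rule bounded_measurable_tensor[OF \<psi>(1) smooth_measurable[OF b(1)] \<psi>(2) B])
 fix e :: real assume e: "0 < e"
 (* Replacing t by max t (exp (- d)) removes the singularity of ln at 0 and changes nothing where b is nonzero. *)
 define G where "G t = b (- ln (max t (exp (- d)))) / (max t (exp (- d))) ^ N" for t :: real
 have pos: "0 < max t (exp (- d))" for t by (rule less_le_trans[OF exp_gt_zero max.cobounded2])
 have "continuous_on {0..1} G" unfolding G_def
  by (intro continuous_intros continuous_on_compose2[OF smooth_continuous[OF b(1), of UNIV]]) (use pos less_imp_neq[OF pos] in auto)
 then obtain g where g: "real_polynomial_function g" "!!t. t \<in> {0..1} ==> \<bar>G t - g t\<bar> < e"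
  using Stone_Weierstrass_real_polynomial_function[OF compact_Icc _ e, of 0 1 G] by blast
 obtain c k where ck: "g = (%t. \<Sum>i\<le>k. c i * t ^ i)" using g(1) unfolding real_polynomial_function_iff_sum by blast
 let ?E = "%i y. exp (- real (N + i) * \<bar>y\<bar>)"
 have E: "bounded_measurable (tensor \<psi> (?E i))" for i
  by (rule bounded_measurable_tensor[OF \<psi>(1) _ \<psi>(2), of _ 1]) (auto intro: mult_nonpos_nonneg)
 let ?\<phi> = "%z. \<Sum>i\<le>k. c i * tensor \<psi> (?E i) z"
 have near: "\<bar>tensor \<psi> b z - ?\<phi> z\<bar> <= e" if z: "z \<in> strip" for z
 proof -
  define y where "y = snd z"
  have y: "0 < y" using z by (auto simp: strip_def y_def)
  have pw: "?E i y = exp (- y) ^ N * exp (- y) ^ i" for i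
   using y by (simp add: exp_of_nat_mult[symmetric] exp_add[symmetric] algebra_simps)
  have bv: "b y = exp (- y) ^ N * G (exp (- y))"
  proof (cases "y <= d")
   case True
   then have "max (exp (- y)) (exp (- d)) = exp (- y)" by simp
   then show ?thesis by (simp add: G_def)
  next
   case False
   then have "max (exp (- y)) (exp (- d)) = exp (- d)" by simp
   then show ?thesis using False supported_in_outside[OF b(2), of y] supported_in_outside[OF b(2), of d] by (simp add: G_def)
  qed
  have "tensor \<psi> b z - ?\<phi> z = \<psi> (fst z) * (exp (- y) ^ N * (G (exp (- y)) - g (exp (- y))))"
   unfolding tensor_def y_def[symmetric] bv ck pw by (simp add: sum_distrib_left right_diff_distrib mult_ac)
  moreover have "\<bar>\<psi> (fst z)\<bar> * (\<bar>exp (- y) ^ N\<bar> * \<bar>G (exp (- y)) - g (exp (- y))\<bar>) <= 1 * (1 * e)"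
   using y \<psi>(2) g(2)[of "exp (- y)"] by (intro mult_mono) (auto intro: power_le_one less_imp_le)
  ultimately show ?thesis by (simp add: abs_mult)
 qed
 have "pairing w ?\<phi> = (\<Sum>i\<le>k. c i *\<^sub>R pairing w (tensor \<psi> (?E i)))"
  by (simp only: pairing_sum[OF integrable] pairing_cmult[OF integrable] bounded_measurable_cmult E)
 also have "\<dots> = 0" unfolding exps[OF le_add1] by simp
 finally have "pairing w ?\<phi> = 0" .
 moreover have "bounded_measurable ?\<phi>" by (intro bounded_measurable_sum bounded_measurable_cmult E)
 ultimately show "\<exists>\<psi>'. bounded_measurable \<psi>' & pairing w \<psi>' = 0 & (\<forall>z\<in>strip. \<bar>tensor \<psi> b z - \<psi>' z\<bar> <= e)"
  using near by blast
qed

text \<open>Product to sum formulas; negative frequencies make the recursion uniform.\<close>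

lemma cosine_powers:
 fixes \<psi> :: "int => real => real"
 assumes \<psi>: "!!n. \<psi> n \<in> Borel" "!!n x. \<bar>\<psi> n x\<bar> <= 1"
  and rec: "!!n x. \<psi> n x * cos x = (\<psi> (n + 1) x + \<psi> (n - 1) x) / 2"
  and b: "b \<in> Borel" "!!y. \<bar>b y\<bar> <= B" and zero: "!!n. pairing w (tensor (\<psi> n) b) = 0"
 shows "pairing w (tensor (%x. \<psi> n x * cos x ^ k) b) = 0"
proof (induction k arbitrary: n)
 case (Suc k)
 have bm: "bounded_measurable (tensor (%x. \<psi> n x * cos x ^ k) b)" for n
 proof (rule bounded_measurable_tensor[OF _ b(1) _ b(2)])
  show "(%x. \<psi> n x * cos x ^ k) \<in> Borel" using \<psi>(1) by measurable
  show "\<bar>\<psi> n x * cos x ^ k\<bar> <= 1" for x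
   using mult_mono[OF \<psi>(2)[of n x] power_le_one[of "\<bar>cos x\<bar>" k]] by (simp add: abs_mult power_abs)
 qed
 have "\<psi> n x * cos x ^ Suc k = 1 / 2 * (\<psi> (n + 1) x * cos x ^ k) + 1 / 2 * (\<psi> (n - 1) x * cos x ^ k)" for x
 proof -
  have "\<psi> n x * cos x ^ Suc k = \<psi> n x * cos x * cos x ^ k" by simp
  then show ?thesis unfolding rec by (simp add: field_simps)
 qed
 then have "tensor (%x. \<psi> n x * cos x ^ Suc k) b = (%z. 1 / 2 * tensor (%x. \<psi> (n + 1) x * cos x ^ k) b z + 1 / 2 * tensor (%x. \<psi> (n - 1) x * cos x ^ k) b z)"
  by (simp add: tensor_def fun_eq_iff algebra_simps)
 then show ?case by (simp only: pairing_add[OF integrable] pairing_cmult[OF integrable] bounded_measurable_cmult bm Suc.IH) simp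
qed (use zero in simp)

lemma even_functions:
 assumes \<rho>: "\<rho> \<in> Borel" "!!x. \<bar>\<rho> x\<bar> <= 1" and b: "b \<in> Borel" "!!y. \<bar>b y\<bar> <= B"
  and pow: "!!k. pairing w (tensor (%x. \<rho> x * cos x ^ k) b) = 0" and q: "continuous_on {-1..1} q"
  and qm: "(%x. q (cos x)) \<in> Borel"
 shows "pairing w (tensor (%x. \<rho> x * q (cos x)) b) = 0"
proof (rule pairing_zero_if_approximable)
 have B0: "0 <= B" using order_trans[OF abs_ge_zero b(2)] .
 obtain Q where Q: "!!t. t \<in> {-1..1} ==> \<bar>q t\<bar> <= Q"
  using compact_imp_bounded[OF compact_continuous_image[OF q compact_Icc]] unfolding bounded_iff by fastforce
 have "\<bar>\<rho> x * q (cos x)\<bar> <= 1 * Q" for x unfolding abs_mult by (intro mult_mono \<rho> Q) auto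
 then show "bounded_measurable (tensor (%x. \<rho> x * q (cos x)) b)"
  by (rule bounded_measurable_tensor[OF borel_measurable_times[OF \<rho>(1) qm] b(1) _ b(2)])
 fix e :: real assume e: "0 < e"
 have e': "0 < e / (B + 1)" using e B0 by simp
 obtain g where g: "real_polynomial_function g" "!!t. t \<in> {-1..1} ==> \<bar>q t - g t\<bar> < e / (B + 1)"
  using Stone_Weierstrass_real_polynomial_function[OF compact_Icc q e'] by blast
 obtain c k where ck: "g = (%t. \<Sum>i\<le>k. c i * t ^ i)" using g(1) unfolding real_polynomial_function_iff_sum by blast
 have bm: "bounded_measurable (tensor (%x. \<rho> x * cos x ^ i) b)" for i
 proof (rule bounded_measurable_tensor[OF _ b(1) _ b(2)])
  show "(%x. \<rho> x * cos x ^ i) \<in> Borel" using \<rho>(1) by measurable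
  show "\<bar>\<rho> x * cos x ^ i\<bar> <= 1" for x
   using mult_mono[OF \<rho>(2)[of x] power_le_one[of "\<bar>cos x\<bar>" i]] by (simp add: abs_mult power_abs)
 qed
 let ?\<phi> = "%z. \<Sum>i\<le>k. c i * tensor (%x. \<rho> x * cos x ^ i) b z"
 have near: "\<bar>tensor (%x. \<rho> x * q (cos x)) b z - ?\<phi> z\<bar> <= e" for z
 proof -
  have "tensor (%x. \<rho> x * q (cos x)) b z - ?\<phi> z = \<rho> (fst z) * ((q (cos (fst z)) - g (cos (fst z))) * b (snd z))"
   unfolding tensor_def ck by (simp add: sum_distrib_left sum_distrib_right right_diff_distrib left_diff_distrib mult_ac)
  also have "\<bar>\<dots>\<bar> <= 1 * (e / (B + 1) * B)"
   unfolding abs_mult using e B0 by (intro mult_mono \<rho> b less_imp_le[OF g(2)]) auto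
  also have "\<dots> <= e" using e B0 by (simp add: field_simps)
  finally show ?thesis .
 qed
 have "pairing w ?\<phi> = (\<Sum>i\<le>k. c i *\<^sub>R pairing w (tensor (%x. \<rho> x * cos x ^ i) b))"
  by (simp only: pairing_sum[OF integrable] pairing_cmult[OF integrable] bounded_measurable_cmult bm)
 then have "pairing w ?\<phi> = 0" using pow by simp
 moreover have "bounded_measurable ?\<phi>" by (intro bounded_measurable_sum bounded_measurable_cmult bm)
 ultimately show "\<exists>\<psi>. bounded_measurable \<psi> & pairing w \<psi> = 0 & (\<forall>z\<in>strip. \<bar>tensor (%x. \<rho> x * q (cos x)) b z - \<psi> z\<bar> <= e)"
  using near by blast
qed

text \<open>A test function \<open>a\<close> supported in \<open>(0, \<pi>)\<close> plus its reflection is the function \<open>a (arccos c)\<close> of \<open>c = cos x\<close>, which is a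
uniform limit of polynomials in \<open>cos x\<close>. The weight \<open>\<rho>\<close> (which is \<open>sin\<close> or \<open>1\<close>) carries the parity \<open>\<sigma>\<close>; keeping it in the conclusion avoids a
division by \<open>sin\<close>.\<close>

lemma vanishing_parity_part:
 assumes \<rho>: "continuous_on UNIV \<rho>" "!!x. \<bar>\<rho> x\<bar> <= 1" "!!x. \<rho> (2 * pi - x) = \<sigma> * \<rho> x" and \<sigma>: "\<sigma> * \<sigma> = 1"
  and pow: "!!b d k. smooth b ==> supported_in 0 d b ==> 0 < d ==> pairing w (tensor (%x. \<rho> x * cos x ^ k) b) = 0"
  and x: "0 <= x" "x <= pi" and y: "0 <= y"
 shows "\<rho> x *\<^sub>R (W (x, y) + \<sigma> *\<^sub>R W (2 * pi - x, y)) = 0"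
proof -
 define d where "d = y + 1"
 have d: "0 < d" using y by (simp add: d_def)
 have \<rho>m: "\<rho> \<in> Borel" by (rule borel_measurable_continuous_onI[OF \<rho>(1)])
 have \<rho>m2: "(%z :: plane. \<rho> (fst z)) \<in> Borel"
  by (intro borel_measurable_continuous_onI continuous_on_compose2[OF \<rho>(1)] continuous_intros) auto
 define H where "H z = \<rho> (fst z) *\<^sub>R V \<sigma> z" for z
 have H: "L1 H" unfolding H_def[abs_def] by (rule abs_integrable_bounded_scaleR[OF V_integrable, of _ 1]) (use \<rho>m2 \<rho>(2) in auto)
 have zero: "pairing H (tensor a b) = 0"
  if a: "smooth a" "supported_in 0 pi a" and b: "smooth b" "supported_in 0 d b" for a b
 proof -
  obtain A where A: "!!x. \<bar>a x\<bar> <= A" by (rule supported_in_bounded[OF a]) blast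
  obtain B where B: "!!y. \<bar>b y\<bar> <= B" by (rule supported_in_bounded[OF b]) blast
  have bm: "bounded_measurable (tensor (%x. \<rho> x * a x) b)"
  proof (rule bounded_measurable_tensor[OF borel_measurable_times[OF \<rho>m smooth_measurable[OF a(1)]] smooth_measurable[OF b(1)] _ B])
   show "\<bar>\<rho> x * a x\<bar> <= 1 * A" for x unfolding abs_mult by (intro mult_mono \<rho> A) auto
  qed
  have "pairing H (tensor a b) = pairing (V \<sigma>) (tensor (%x. \<rho> x * a x) b)"
   unfolding pairing_def H_def by (simp add: tensor_def mult_ac)
  also have "\<dots> = pairing w (tensor (%x. \<rho> x * a x) b) + \<sigma> *\<^sub>R pairing w (tensor (%x. \<rho> (2 * pi - x) * a (2 * pi - x)) b)"
   using pairing_V[OF bm, of \<sigma>] by simp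
  also have "\<dots> = pairing w (%z. tensor (%x. \<rho> x * a x) b z + \<sigma> * tensor (%x. \<rho> (2 * pi - x) * a (2 * pi - x)) b z)"
   using pairing_reflect(1)[OF integrable bm, of "2 * pi"] bm by (simp add: pairing_add[OF integrable] pairing_cmult[OF integrable] bounded_measurable_cmult)
  also have "\<dots> = pairing w (tensor (%x. \<rho> x * (a \<circ> arccos) (cos x)) b)"
  proof (rule pairing_strip_cong)
   fix z assume "z \<in> strip"
   then have z: "0 < fst z" "fst z < 2 * pi" by (auto simp: strip_def II_def)
   have ac: "a (arccos (cos (fst z))) = a (fst z) + a (2 * pi - fst z)"
   proof (cases "fst z <= pi")
    case True
    then show ?thesis using z supported_in_outside[OF a(2), of "2 * pi - fst z"] by (simp add: arccos_cos)
   next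
    case False
    have "cos (fst z) = cos (2 * pi - fst z)" by (simp add: cos_diff)
    moreover have "arccos (cos (2 * pi - fst z)) = 2 * pi - fst z" using z False by (intro arccos_cos) auto
    ultimately show ?thesis using False supported_in_outside[OF a(2), of "fst z"] by simp
   qed
   have "\<sigma> * (\<sigma> * t) = t" for t using \<sigma> by (simp add: mult.assoc[symmetric])
   then show "tensor (%x. \<rho> x * a x) b z + \<sigma> * tensor (%x. \<rho> (2 * pi - x) * a (2 * pi - x)) b z
     = tensor (%x. \<rho> x * (a \<circ> arccos) (cos x)) b z"
    unfolding tensor_def \<rho>(3) o_def ac by (simp add: algebra_simps)
  qed
  also have "\<dots> = 0"
  proof (rule even_functions[OF \<rho>m \<rho>(2) smooth_measurable[OF b(1)] B pow[OF b d]])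
   have ca: "continuous_on {-1..1} (a \<circ> arccos)" by (intro continuous_on_compose continuous_on_arccos' smooth_continuous[OF a(1)])
   then show "continuous_on {-1..1} (a \<circ> arccos)" .
   have "continuous_on UNIV (%x. (a \<circ> arccos) (cos x))" by (rule continuous_on_compose2[OF ca]) (auto intro: continuous_intros)
   then show "(%x. (a \<circ> arccos) (cos x)) \<in> Borel" by (rule borel_measurable_continuous_onI)
  qed
  finally show ?thesis .
 qed
 let ?F = "%z. \<rho> (fst z) *\<^sub>R (W z + \<sigma> *\<^sub>R W (shear (-1) (2 * pi) z))"
 have "AE z in lborel. z \<in> {0<..<pi} \<times> {0<..<d} --> enorm (H z) <= 0" by (rule fundamental_lemma_rect[OF H]) (use zero in auto)
 then have "AE z in lborel. z \<in> {0<..<pi} \<times> {0<..<d} --> ?F z = 0"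
 proof eventually_elim
  case (elim z)
  show ?case
  proof
   assume z: "z \<in> {0<..<pi} \<times> {0<..<d}"
   then have s: "z \<in> strip" by (auto simp: strip_def II_def)
   have "norm (H z) = 0" using elim z by (simp add: ennreal_eq_0_iff)
   then show "?F z = 0" using s by (simp add: H_def V_eq on_strip_def)
  qed
 qed
 moreover have "continuous_on UNIV ?F"
 proof -
  have shc: "continuous_on UNIV (shear (-1) (2 * pi))" unfolding shear_def by (intro continuous_intros)
  show ?thesis
   by (intro continuous_on_scaleR continuous_on_add continuous_on_const continuous continuous_on_compose2[OF continuous shc] continuous_on_compose2[OF \<rho>(1)] continuous_intros) auto
 qed
 moreover have "(x, y) \<in> closure ({0<..<pi} \<times> {0<..<d})"
  using x y d pi_gt_zero by (simp add: closure_Times closure_greaterThanLessThan d_def)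
 ultimately have "?F (x, y) = 0" by (intro continuous_AE_zero[of ?F "{0<..<pi} \<times> {0<..<d}"]) (auto intro: open_Times)
 then show ?thesis by (simp add: shear_def)
qed

lemma separated_modes_vanish:
 fixes \<psi> :: "int => real => real"
 assumes \<psi>: "!!n. \<psi> n \<in> Borel" "!!n x. \<bar>\<psi> n x\<bar> <= 1"
  and rec: "!!n x. \<psi> n x * cos x = (\<psi> (n + 1) x + \<psi> (n - 1) x) / 2"
  and eqn: "!!n b d. smooth b ==> supported_in 0 d b ==> 0 < d ==>
   pairing w (tensor (\<psi> n) (%y. deriv (deriv b) y - (real_of_int n)\<^sup>2 * b y)) = 0"
  and b: "smooth b" "supported_in 0 d b" "0 < d"
 shows "pairing w (tensor (%x. \<psi> n x * cos x ^ k) b) = 0"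
proof -
 obtain B where B: "!!y. \<bar>b y\<bar> <= B" by (rule supported_in_bounded[OF b(1,2)]) blast
 have "pairing w (tensor (\<psi> n) b) = 0" for n
 proof (rule product_mode[OF \<psi> _ b])
  fix m :: nat assume "nat \<bar>n\<bar> + 1 <= m"
  then have "\<bar>real_of_int n\<bar> < real m" by linarith
  then show "pairing w (tensor (\<psi> n) (%y. exp (- real m * \<bar>y\<bar>))) = 0"
   using eqn[of _ _ n] by (intro exponential_mode[OF \<psi>, of "\<bar>real_of_int n\<bar>"]) auto
 qed
 from cosine_powers[OF \<psi> rec smooth_measurable[OF b(1)] B this] show ?thesis .
qed

text \<open>The odd part vanishes: all sine modes, with \<open>\<rho> = sin\<close> of frequency \<open>1\<close>, which has no zero in \<open>(0, \<pi>)\<close>.\<close>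

lemma symmetric:
 assumes x: "0 <= x" "x <= 2 * pi" and y: "0 <= y"
 shows "W (2 * pi - x, y) = W (x, y)"
proof -
 have pow: "pairing w (tensor (%x. sin (real_of_int n * x) * cos x ^ k) b) = 0"
  if b: "smooth b" "supported_in 0 d b" "0 < d" for b d n k
 proof (rule separated_modes_vanish[OF _ _ _ _ b, of "%n x. sin (real_of_int n * x)"])
  show "pairing w (tensor (%x. sin (real_of_int n * x)) (%y. deriv (deriv b) y - (real_of_int n)\<^sup>2 * b y)) = 0"
   if b: "smooth b" "supported_in 0 d b" "0 < d" for n b d
  proof (rule mode_equation[OF _ _ _ _ _ _ b(1,2) sine_layers_vanish[OF b]])
   have "sin (of_int n * (2 * pi)) = (0::real)" "cos (of_int n * (2 * pi)) = (1::real)"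
    using sin_int_2pin[of n] cos_int_2pin[of n] by (simp_all add: mult_ac)
   then show "- 1 * sin (of_int n * (2 * pi - x)) = sin (of_int n * x)" for x :: real by (simp add: right_diff_distrib sin_diff)
  qed (auto intro!: derivative_eq_intros smooth_sin smooth_mult smooth_cos simp: power2_eq_square)
  show "sin (real_of_int n * x) * cos x = (sin (real_of_int (n + 1) * x) + sin (real_of_int (n - 1) * x)) / 2" for n x
   by (simp add: algebra_simps sin_add sin_diff)
 qed auto
 have half: "W (2 * pi - x, y) = W (x, y)" if x: "0 <= x" "x <= pi" for x
 proof (cases "x = 0 \<or> x = pi")
  case True
  then show ?thesis using periodic[OF y] by auto
 next
  case False
  then have "0 < sin x" using x by (intro sin_gt_zero) auto
  moreover have "sin x *\<^sub>R (W (x, y) + (-1) *\<^sub>R W (2 * pi - x, y)) = 0"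
   by (rule vanishing_parity_part[OF _ _ _ _ _ x y]) (use pow[of _ _ 1] in \<open>auto intro: continuous_intros simp: sin_diff\<close>)
  ultimately show ?thesis by simp
 qed
 show ?thesis
 proof (cases "x <= pi")
  case False
  then show ?thesis using half[of "2 * pi - x"] x by simp
 qed (use half x in simp)
qed

text \<open>The even part vanishes: all cosine modes, with \<open>\<rho> = 1\<close> of frequency \<open>0\<close>.\<close>

lemma vanishes:
 assumes x: "0 <= x" "x <= 2 * pi" and y: "0 <= y"
 shows "W (x, y) = 0"
proof -
 have sym: "w (shear (-1) (2 * pi) z) = w z" for z
  using symmetric[of "fst z" "snd z"] by (cases z) (auto simp: on_strip_def shear_def strip_def II_def indicator_def)
 have pow: "pairing w (tensor (%x. cos (real_of_int n * x) * cos x ^ k) b) = 0"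
  if b: "smooth b" "supported_in 0 d b" "0 < d" for b d n k
 proof (rule separated_modes_vanish[OF _ _ _ _ b, of "%n x. cos (real_of_int n * x)"])
  show "pairing w (tensor (%x. cos (real_of_int n * x)) (%y. deriv (deriv b) y - (real_of_int n)\<^sup>2 * b y)) = 0"
   if b: "smooth b" "supported_in 0 d b" "0 < d" for n b d
  proof (rule mode_equation[OF _ _ _ _ _ _ b(1,2) cosine_layers_vanish[OF b sym]])
   have "sin (of_int n * (2 * pi)) = (0::real)" "cos (of_int n * (2 * pi)) = (1::real)"
    using sin_int_2pin[of n] cos_int_2pin[of n] by (simp_all add: mult_ac)
   then show "1 * cos (of_int n * (2 * pi - x)) = cos (of_int n * x)" for x :: real by (simp add: right_diff_distrib cos_diff)
   show "smooth (%x. - of_int n * sin (of_int n * x))" by (intro smooth_mult smooth_const smooth_sin)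
  qed (auto intro!: derivative_eq_intros smooth_cos simp: power2_eq_square)
  show "cos (real_of_int n * x) * cos x = (cos (real_of_int (n + 1) * x) + cos (real_of_int (n - 1) * x)) / 2" for n x
   by (simp add: algebra_simps cos_add cos_diff)
 qed auto
 have half: "W (x, y) = 0" if x: "0 <= x" "x <= pi" for x
 proof -
  have "1 *\<^sub>R (W (x, y) + 1 *\<^sub>R W (2 * pi - x, y)) = 0" by (rule vanishing_parity_part[OF _ _ _ _ _ x y]) (use pow[of _ _ 0] in auto)
  then show ?thesis using symmetric[of x y] x y by (simp flip: scaleR_2)
 qed
 show ?thesis
 proof (cases "x <= pi")
  case False
  then show ?thesis using half[of "2 * pi - x"] symmetric[OF x y] x by simp
 qed (use half x in simp)
qed

end

theorem theorem4p1:
  fixes p :: real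
    and f :: "real \<Rightarrow> 'a::banach"
    and \<Gamma>I \<Gamma>0 \<Gamma>2\<pi> :: "(real \<times> real \<Rightarrow> 'a) \<Rightarrow> real \<Rightarrow> 'a"
    and u :: "real \<times> real \<Rightarrow> 'a"
  assumes "1 < p"
    and "f \<in> Wp 2 p"
    and "bottom_trace p \<Gamma>I"
    and "side_trace p 0 \<Gamma>0"
    and "side_trace p (2 * pi) \<Gamma>2\<pi>"
    and "is_solution p \<Gamma>I \<Gamma>0 \<Gamma>2\<pi> f u"
  shows "\<forall>v. is_solution p \<Gamma>I \<Gamma>0 \<Gamma>2\<pi> f v \<longrightarrow> (AE z in lebesgue_on strip. v z = u z)"
proof (intro allI impI)
 fix v assume v: "is_solution p \<Gamma>I \<Gamma>0 \<Gamma>2\<pi> f v"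
 show "AE z in lebesgue_on strip. v z = u z"
 proof (rule difference_of_solutions[OF assms(1,3,4,5,6) v])
  fix W C
  assume ae: "AE z in lborel. z \<in> strip --> W z = u z - v z"
   and W: "continuous_on UNIV W" "!!z. norm (W z) <= C" "L1 (on_strip W)"
    "!!a b d. smooth a ==> smooth b ==> supported_in 0 (2 * pi) a ==> supported_in 0 d b ==>
      pairing (on_strip W) (tensor (deriv (deriv a)) b) + pairing (on_strip W) (tensor a (deriv (deriv b))) = 0"
    "!!x. 0 <= x ==> x <= 2 * pi ==> W (x, 0) = 0"
    "!!y. 0 <= y ==> W (0, y) = W (2 * pi, y)"
    "!!\<xi> e. 0 < \<xi> ==> 0 < e ==> \<exists>\<delta>>0. \<forall>x. 0 < x & x < \<delta> -->
      (NN y. enorm (W (x, y) - W (0, y)) * indicator {0<..<\<xi>} y) <= ennreal (e * x)"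
  interpret zero_data_solution W C by unfold_locales (fact W)+
  have "W z = 0" if "z \<in> strip" for z
   using vanishes[of "fst z" "snd z"] that by (auto simp: strip_def II_def)
  with ae have "AE z in lborel. z \<in> strip --> v z = u z"
   by (auto elim!: eventually_mono)
  then show ?thesis unfolding AE_lebesgue_on[OF strip_borel] .
 qed
qed

end
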